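(* Let $\beta\in(0,1/2)$, let $(L_t)_{t\in\mathbb{R}}$ be a two-sided Lévy process with $\mathbb{E}[L_1]=0$ and $\mathbb{E}[L_1^2]=1$, and let $\eta$ be a finite signed measure on $[0,\infty)$ with $\int_{[0,\infty)}u\,|\eta|(du)<\infty$. Set $h(z)=(-z)^{1-\beta}-\int_{[0,\infty)}e^{zu}\,\eta(du)$ for $\mathrm{Re}(z)\le0$, and suppose that $h(z)\ne0$ for every $z\in\mathbb{C}$ with $\mathrm{Re}(z)\le0$. Let $g:\mathbb{R}\to\mathbb{R}$ be the function in $L^2$, vanishing on $(-\infty,0)$, with $\mathcal{F}[g](y)=(-iy)^{-\beta}/h(iy)$, and let $X_t=\int_{-\infty}^t g(t-u)\,dL_u$, $t\in\mathbb{R}$ (the unique purely non-deterministic solution to the associated stochastic fractional delay differential equation). Then, for $t\in\mathbb{R}$, the limit $$D^\beta X_t:=\frac{\beta}{\Gamma(1-\beta)}\lim_{\delta\downarrow0}\int_\delta^\infty\frac{X_t-X_{t-u}}{u^{1+\beta}}\,du$$ exists in $L^2(\mathbb{P})$, $D^\beta X_t=\int_{-\infty}^t D^\beta g(t-u)\,dL_u$, and it holds that $$\frac{1}{\Gamma(1-\beta)}\int_{-\infty}^t\big[(t-u)^{-\beta}-(s-u)_+^{-\beta}\big]\int_{[0,\infty)}X_{u-v}\,\eta(dv)\,du=\int_s^t\int_{[0,\infty)}D^\beta X_{u-v}\,\eta(dv)\,du$$ almost surely for each $s<t$.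
   Context: Complex powers: $z^\gamma=r^\gamma e^{i\gamma\theta}$ for $z=re^{i\theta}$, $r>0$, $\theta\in(-\pi,\pi]$ (principal branch). Write $x_+=\max\{x,0\}$, with $x_+^{-\beta}=0$ for $x\le 0$. The Fourier transform is $\mathcal{F}[f](y)=\int_{\mathbb{R}}e^{iyu}f(u)\,du$ for $f\in L^1$ and is extended to $L^2$ by Plancherel's theorem. Under the stated condition on $h$ such a real-valued $g$ exists and is unique in $L^2$; for a suitable representative the Marchaud fractional derivative $$D^\beta g(t)=\frac{\beta}{\Gamma(1-\beta)}\lim_{\delta\downarrow0}\int_\delta^\infty\frac{g(t)-g(t-u)}{u^{1+\beta}}\,du$$ exists for every $t>0$, and (extended by $0$ to $t\le0$) $D^\beta g\in L^1\cap L^2$ with $\mathcal{F}[D^\beta g](y)=1/h(iy)$. A two-sided Lévy process is $L_t=L^1_t$ for $t\ge0$ and $L_t=-L^2_{(-t)-}$ for $t<0$, where $(L^1_t)_{t\ge0}$ is a one-sided Lévy process and $L^2$ is an independent copy of it. For $f\in L^2$, $\int_{\mathbb{R}}f\,dL$ is the $L^2(\mathbb{P})$-limit of integrals of step functions, with $\mathbb{E}[(\int f\,dL)^2]=\mathbb{E}[L_1^2]\int f(u)^2\,du$. The stochastic fractional delay differential equation is: $X_t-X_s=\int_{-\infty}^t\frac{1}{\Gamma(1-\beta)}\big[(t-u)_+^{-\beta}-(s-u)_+^{-\beta}\big]\int_{[0,\infty)}X_{u-v}\,\eta(dv)\,du+L_t-L_s$ almost surely for each $s<t$; $(X_t)$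 is a stationary process satisfying it. *)

theory Defs
  imports "HOL-Probability.Probability"
begin

section \<open>Square-integrable functions and the Fourier transform\<close>

definition square_integrable ::
    "'a measure \<Rightarrow> ('a \<Rightarrow> 'b::{banach, second_countable_topology}) \<Rightarrow> bool" where
  "square_integrable M f \<longleftrightarrow>
     f \<in> borel_measurable M \<and> integrable M (\<lambda>x. (norm (f x))\<^sup>2)"

text \<open>The membership requirements matter: the Bochner integral of a non-integrable function
  is \<open>0\<close>, so the limit alone would not express convergence in \<open>L\<^sup>2\<close>.\<close>

definition L2_tendsto ::
    "'a measure \<Rightarrow> ('i \<Rightarrow> 'a \<Rightarrow> 'b::{banach, second_countable_topology})
       \<Rightarrow> ('a \<Rightarrow> 'b) \<Rightarrow> 'i filter \<Rightarrow> bool" where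
  "L2_tendsto M F f G \<longleftrightarrow>
     square_integrable M f \<and>
     (\<forall>\<^sub>F i in G. square_integrable M (F i)) \<and>
     ((\<lambda>i. \<integral>x. (norm (F i x - f x))\<^sup>2 \<partial>M) \<longlongrightarrow> 0) G"

definition fourier :: "(real \<Rightarrow> complex) \<Rightarrow> real \<Rightarrow> complex" where
  "fourier f y = (\<integral>u. exp (\<i> * of_real (y * u)) * f u \<partial>lborel)"

text \<open>\<open>\<phi>\<close> is a representative of the extension by continuity (Plancherel) of the Fourier transform
  from \<open>L\<^sup>1 \<inter> L\<^sup>2\<close> to \<open>L\<^sup>2\<close>, evaluated at \<open>f\<close>; it is determined up to null sets.\<close>

definition has_fourier_L2 :: "(real \<Rightarrow> complex) \<Rightarrow> (real \<Rightarrow> complex) \<Rightarrow> bool" where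
  "has_fourier_L2 f \<phi> \<longleftrightarrow>
     (\<exists>fs. (\<forall>n. integrable lborel (fs n)) \<and>
           L2_tendsto lborel fs f sequentially \<and>
           L2_tendsto lborel (\<lambda>n. fourier (fs n)) \<phi> sequentially)"


section \<open>Finite signed measures\<close>

text \<open>Only the underlying measurable space of \<open>N\<close> is used; values of \<open>\<eta>\<close> outside \<open>sets N\<close>
  are irrelevant.\<close>

definition finite_signed_measure :: "'a measure \<Rightarrow> ('a set \<Rightarrow> real) \<Rightarrow> bool" where
  "finite_signed_measure N \<eta> \<longleftrightarrow>
     \<eta> {} = 0 \<and>
     (\<forall>A :: nat \<Rightarrow> 'a set. range A \<subseteq> sets N \<longrightarrow> disjoint_family A \<longrightarrow>
        (\<lambda>i. \<eta> (A i)) sums \<eta> (\<Union>i. A i))"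

text \<open>Jordan decomposition: \<open>\<eta>\<^sup>+(A)\<close> is the supremum of \<open>\<eta>(B)\<close> over measurable \<open>B \<subseteq> A\<close>.
  Since \<open>B = {}\<close> is admitted, cutting off negative values by \<open>ennreal\<close> does no harm.
  That these are finite measures with \<open>\<eta> = \<eta>\<^sup>+ - \<eta>\<^sup>-\<close> is proved below.\<close>

definition jordan_pos :: "'a measure \<Rightarrow> ('a set \<Rightarrow> real) \<Rightarrow> 'a measure" where
  "jordan_pos N \<eta> = measure_of (space N) (sets N)
     (\<lambda>A. SUP B\<in>{B \<in> sets N. B \<subseteq> A}. ennreal (\<eta> B))"

definition jordan_neg :: "'a measure \<Rightarrow> ('a set \<Rightarrow> real) \<Rightarrow> 'a measure" where
  "jordan_neg N \<eta> = jordan_pos N (\<lambda>A. - \<eta> A)"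

definition variation :: "'a measure \<Rightarrow> ('a set \<Rightarrow> real) \<Rightarrow> 'a measure" where
  "variation N \<eta> = measure_of (space N) (sets N)
     (\<lambda>A. emeasure (jordan_pos N \<eta>) A + emeasure (jordan_neg N \<eta>) A)"

definition signed_integrable ::
    "'a measure \<Rightarrow> ('a set \<Rightarrow> real) \<Rightarrow> ('a \<Rightarrow> 'b::{banach, second_countable_topology}) \<Rightarrow> bool" where
  "signed_integrable N \<eta> f \<longleftrightarrow> integrable (jordan_pos N \<eta>) f \<and> integrable (jordan_neg N \<eta>) f"

definition signed_integral ::
    "'a measure \<Rightarrow> ('a set \<Rightarrow> real) \<Rightarrow> ('a \<Rightarrow> 'b::{banach, second_countable_topology}) \<Rightarrow> 'b" where
  "signed_integral N \<eta> f = (\<integral>x. f x \<partial>jordan_pos N \<eta>) - (\<integral>x. f x \<partial>jordan_neg N \<eta>)"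

abbreviation half_line :: "real measure" where
  "half_line \<equiv> restrict_space borel {0..}"

lemma finite_signed_measure_uminus:
  "finite_signed_measure N \<eta> \<Longrightarrow> finite_signed_measure N (\<lambda>A. - \<eta> A)"
  unfolding finite_signed_measure_def by (auto intro: sums_minus)

lemma finite_signed_measure_Un:
  assumes "finite_signed_measure N \<eta>" "A \<in> sets N" "B \<in> sets N" "A \<inter> B = {}"
  shows "\<eta> (A \<union> B) = \<eta> A + \<eta> B"
proof -
  have r: "range (binaryset A B) \<subseteq> sets N" "disjoint_family (binaryset A B)"
    using assms by (auto simp: range_binaryset_eq disjoint_family_on_def binaryset_def)
  have "(\<lambda>i. \<eta> (binaryset A B i)) sums \<eta> (\<Union>i. binaryset A B i)"
    using assms(1) r unfolding finite_signed_measure_def by blast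
  moreover have "(\<lambda>i. \<eta> (binaryset A B i)) sums (\<eta> A + \<eta> B)"
    using binaryset_sums[of \<eta> A B] assms(1) by (simp add: finite_signed_measure_def)
  ultimately show ?thesis
    by (metis sums_unique2 UN_binaryset_eq)
qed

lemma jordan_pos_sets [simp]: "sets (jordan_pos N \<eta>) = sets N"
  by (simp add: jordan_pos_def)

lemma jordan_pos_space [simp]: "space (jordan_pos N \<eta>) = space N"
  by (simp add: jordan_pos_def)

lemma emeasure_jordan_pos:
  assumes \<eta>: "finite_signed_measure N \<eta>" and E: "E \<in> sets N"
  shows "emeasure (jordan_pos N \<eta>) E = (SUP B\<in>{B \<in> sets N. B \<subseteq> E}. ennreal (\<eta> B))"
proof -
  define p where "p = (\<lambda>A. SUP B\<in>{B \<in> sets N. B \<subseteq> A}. ennreal (\<eta> B))"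
  have upper: "ennreal (\<eta> B) \<le> p A" if "B \<in> sets N" "B \<subseteq> A" for A B
    unfolding p_def using that by (intro SUP_upper) auto
  have eta0: "\<eta> {} = 0" using \<eta> by (simp add: finite_signed_measure_def)
  have mono: "p A \<le> p A'" if "A \<subseteq> A'" for A A'
    unfolding p_def using that by (intro SUP_subset_mono) auto
  have super: "p A + p A' \<le> p (A \<union> A')" if "A \<inter> A' = {}" for A A'
  proof -
    have "ennreal (\<eta> B) + ennreal (\<eta> B') \<le> p (A \<union> A')"
      if B: "B \<in> sets N" "B \<subseteq> A" "B' \<in> sets N" "B' \<subseteq> A'" for B B'
    proof -
      define C where "C = (if \<eta> B \<ge> 0 then B else {})"
      define C' where "C' = (if \<eta> B' \<ge> 0 then B' else {})"
      have CC: "C \<in> sets N" "C' \<in> sets N" "C \<subseteq> A" "C' \<subseteq> A'" "C \<inter> C' = {}"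
        using B \<open>A \<inter> A' = {}\<close> by (auto simp: C_def C'_def)
      have "ennreal (\<eta> B) + ennreal (\<eta> B') = ennreal (\<eta> C) + ennreal (\<eta> C')"
        by (auto simp: C_def C'_def eta0 ennreal_neg)
      also have "\<dots> = ennreal (\<eta> (C \<union> C'))"
        using finite_signed_measure_Un[OF \<eta> CC(1,2,5)]
        by (subst ennreal_plus[symmetric]) (auto simp: C_def C'_def eta0)
      also have "\<dots> \<le> p (A \<union> A')"
        using CC by (intro upper) auto
      finally show ?thesis .
    qed
    note le = this
    have ne: "{B \<in> sets N. B \<subseteq> A} \<noteq> {}" "{B \<in> sets N. B \<subseteq> A'} \<noteq> {}"
      by auto
    have "p A + ennreal (\<eta> B') \<le> p (A \<union> A')" if "B' \<in> sets N" "B' \<subseteq> A'" for B'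
      unfolding fun_cong[OF p_def, of A] ennreal_SUP_add_left[OF ne(1), symmetric]
      using le that by (intro SUP_least) auto
    then have "ennreal (\<eta> B') + p A \<le> p (A \<union> A')" if "B' \<in> sets N" "B' \<subseteq> A'" for B'
      using that by (simp add: add.commute)
    then have "p A' + p A \<le> p (A \<union> A')"
      unfolding fun_cong[OF p_def, of A'] ennreal_SUP_add_left[OF ne(2), symmetric]
      by (intro SUP_least) auto
    then show ?thesis by (simp add: add.commute)
  qed
  have "countably_additive (sets N) p"
  proof (rule countably_additiveI)
    fix A :: "nat \<Rightarrow> 'a set"
    assume A: "range A \<subseteq> sets N" "disjoint_family A"
    show "(\<Sum>i. p (A i)) = p (\<Union>i. A i)"
    proof (rule antisym)
      have "(\<Sum>i<n. p (A i)) \<le> p (\<Union>i<n. A i)" for n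
      proof (induction n)
        case (Suc n)
        have "A i \<inter> A n = {}" if "i < n" for i
          using disjoint_family_onD[OF A(2), of i n] that by simp
        then have "(\<Union>i<n. A i) \<inter> A n = {}"
          by blast
        then have "p (\<Union>i<n. A i) + p (A n) \<le> p ((\<Union>i<n. A i) \<union> A n)"
          by (rule super)
        also have "(\<Union>i<n. A i) \<union> A n = (\<Union>i<Suc n. A i)"
          by (auto simp: less_Suc_eq)
        finally show ?case using Suc
          by (simp, meson add_right_mono order_trans)
      qed simp
      also have "p (\<Union>i<n. A i) \<le> p (\<Union>i. A i)" for n
        by (intro mono) auto
      finally show "(\<Sum>i. p (A i)) \<le> p (\<Union>i. A i)"
        by (intro suminf_le_const) auto
    next
      show "p (\<Union>i. A i) \<le> (\<Sum>i. p (A i))"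
        unfolding fun_cong[OF p_def, of "\<Union>i. A i"]
      proof (rule SUP_least)
        fix B assume B: "B \<in> {B \<in> sets N. B \<subseteq> (\<Union>i. A i)}"
        have r: "range (\<lambda>i. B \<inter> A i) \<subseteq> sets N" "disjoint_family (\<lambda>i. B \<inter> A i)"
          using A B by (auto simp: disjoint_family_on_def)
        have "(\<lambda>i. \<eta> (B \<inter> A i)) sums \<eta> (\<Union>i. B \<inter> A i)"
          using \<eta> r unfolding finite_signed_measure_def by blast
        moreover have "(\<Union>i. B \<inter> A i) = B" using B by auto
        ultimately have s: "(\<lambda>n. \<Sum>i<n. \<eta> (B \<inter> A i)) \<longlonglongrightarrow> \<eta> B"
          by (simp add: sums_def)
        have "ennreal (\<Sum>i<n. \<eta> (B \<inter> A i)) \<le> (\<Sum>i. p (A i))" for n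
        proof -
          have "ennreal (\<Sum>i<n. \<eta> (B \<inter> A i)) \<le> ennreal (\<Sum>i<n. max 0 (\<eta> (B \<inter> A i)))"
            by (intro ennreal_leI sum_mono) auto
          also have "\<dots> = (\<Sum>i<n. ennreal (max 0 (\<eta> (B \<inter> A i))))"
            by (intro sum_ennreal[symmetric]) auto
          also have "\<dots> \<le> (\<Sum>i<n. p (A i))"
          proof (intro sum_mono)
            fix i
            have "ennreal (\<eta> (B \<inter> A i)) \<le> p (A i)" using r by (intro upper) auto
            then show "ennreal (max 0 (\<eta> (B \<inter> A i))) \<le> p (A i)"
              by (simp add: max_def)
          qed
          also have "\<dots> \<le> (\<Sum>i. p (A i))" by (intro sum_le_suminf) auto
          finally show ?thesis .
        qed
        then show "ennreal (\<eta> B) \<le> (\<Sum>i. p (A i))"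
          using tendsto_ennrealI[OF s] by (meson LIMSEQ_le_const2)
      qed
    qed
  qed
  moreover have "positive (sets N) p"
    by (auto simp: positive_def p_def eta0 bot_ennreal)
  ultimately have "emeasure (measure_of (space N) (sets N) p) E = p E"
    using E sets.sigma_algebra_axioms by (intro emeasure_measure_of_sigma)
  then show ?thesis
    by (simp add: jordan_pos_def p_def)
qed

lemma finite_measure_jordan_pos:
  assumes \<eta>: "finite_signed_measure N \<eta>"
  shows "finite_measure (jordan_pos N \<eta>)"
proof (rule finite_measureI, rule ccontr)
  let ?P = "\<lambda>E. E \<in> sets N \<and> emeasure (jordan_pos N \<eta>) E = \<infinity>"
  let ?Q = "\<lambda>E E'. E' \<subseteq> E \<and> \<bar>\<eta> (E - E')\<bar> \<ge> 1"
  assume "\<not> emeasure (jordan_pos N \<eta>) (space (jordan_pos N \<eta>)) \<noteq> \<infinity>"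
  then have base: "?P (space N)" by simp
  have step: "\<exists>E'. ?P E' \<and> ?Q E E'" if E: "?P E" for E
  proof -
    have "(SUP B\<in>{B \<in> sets N. B \<subseteq> E}. ennreal (\<eta> B)) = \<infinity>"
      using emeasure_jordan_pos[OF \<eta>] E by metis
    then have "ennreal (1 + \<bar>\<eta> E\<bar>) < (SUP B\<in>{B \<in> sets N. B \<subseteq> E}. ennreal (\<eta> B))"
      by (metis ennreal_less_top infinity_ennreal_def)
    then obtain B where B: "B \<in> sets N" "B \<subseteq> E" and lt: "ennreal (1 + \<bar>\<eta> E\<bar>) < ennreal (\<eta> B)"
      unfolding less_SUP_iff by auto
    have big: "1 + \<bar>\<eta> E\<bar> < \<eta> B"
      using lt by (subst (asm) ennreal_less_iff) auto
    have Un: "B \<union> (E - B) = E" using B by auto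
    have "\<eta> E = \<eta> B + \<eta> (E - B)"
      using finite_signed_measure_Un[OF \<eta> B(1), of "E - B"] E B Un by auto
    then have big': "\<bar>\<eta> (E - B)\<bar> \<ge> 1" "\<bar>\<eta> B\<bar> \<ge> 1" using big by auto
    have "emeasure (jordan_pos N \<eta>) B + emeasure (jordan_pos N \<eta>) (E - B) = \<infinity>"
      using plus_emeasure[of B "jordan_pos N \<eta>" "E - B"] E B Un by auto
    then consider "emeasure (jordan_pos N \<eta>) B = \<infinity>" | "emeasure (jordan_pos N \<eta>) (E - B) = \<infinity>"
      by auto
    then show ?thesis
    proof cases
      case 1
      then show ?thesis using B big' by (intro exI[of _ B]) auto
    next
      case 2
      moreover have "E - (E - B) = B" using B by auto
      ultimately show ?thesis using B E big' by (intro exI[of _ "E - B"]) auto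
    qed
  qed
  obtain f where f: "\<And>n. ?P (f n)" "\<And>n. ?Q (f n) (f (Suc n))"
    using dependent_nat_choice[of "\<lambda>_. ?P" "\<lambda>_. ?Q"] base step by metis
  define C where "C n = f n - f (Suc n)" for n
  have dec: "decseq f" using f(2) by (auto intro: decseq_SucI)
  have disj: "disjoint_family C"
    unfolding disjoint_family_on_def
  proof (intro ballI impI)
    fix m n :: nat assume "m \<noteq> n"
    then consider "Suc m \<le> n" | "Suc n \<le> m" by linarith
    then show "C m \<inter> C n = {}"
      using decseqD[OF dec] by cases (auto simp: C_def)
  qed
  have "range C \<subseteq> sets N" using f(1) by (auto simp: C_def)
  then have "(\<lambda>i. \<eta> (C i)) sums \<eta> (\<Union>i. C i)"
    using \<eta> disj unfolding finite_signed_measure_def by blast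
  then have "(\<lambda>i. \<eta> (C i)) \<longlonglongrightarrow> 0"
    by (intro summable_LIMSEQ_zero) (auto simp: sums_iff)
  then obtain n where "norm (\<eta> (C n)) < 1"
    by (auto dest!: LIMSEQ_D[of _ _ 1])
  then show False using f(2)[of n] by (simp add: C_def)
qed

lemma jordan_decomposition:
  assumes \<eta>: "finite_signed_measure N \<eta>" and A: "A \<in> sets N"
  shows "\<eta> A = measure (jordan_pos N \<eta>) A - measure (jordan_neg N \<eta>) A"
proof -
  have le: "measure (jordan_pos N \<theta>) A \<le> \<theta> A + measure (jordan_pos N (\<lambda>A. - \<theta> A)) A"
    if \<theta>: "finite_signed_measure N \<theta>" for \<theta>
  proof -
    interpret P: finite_measure "jordan_pos N \<theta>"
      using finite_measure_jordan_pos[OF \<theta>] .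
    interpret Q: finite_measure "jordan_pos N (\<lambda>A. - \<theta> A)"
      using finite_measure_jordan_pos[OF finite_signed_measure_uminus[OF \<theta>]] .
    have ub: "\<theta> B \<le> \<theta> A + measure (jordan_pos N (\<lambda>A. - \<theta> A)) A"
      if B: "B \<in> sets N" "B \<subseteq> A" for B
    proof -
      have "B \<union> (A - B) = A" using B by auto
      then have "\<theta> A = \<theta> B + \<theta> (A - B)"
        using finite_signed_measure_Un[OF \<theta> B(1), of "A - B"] A B by auto
      moreover have "ennreal (- \<theta> (A - B)) \<le> emeasure (jordan_pos N (\<lambda>A. - \<theta> A)) A"
        unfolding emeasure_jordan_pos[OF finite_signed_measure_uminus[OF \<theta>] A]
        using A B by (intro SUP_upper2[of "A - B"]) auto
      then have "- \<theta> (A - B) \<le> measure (jordan_pos N (\<lambda>A. - \<theta> A)) A"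
        by (simp add: Q.emeasure_eq_measure)
      ultimately show ?thesis by simp
    qed
    have nn: "0 \<le> \<theta> A + measure (jordan_pos N (\<lambda>A. - \<theta> A)) A"
      using ub[of "{}"] \<theta> by (simp add: finite_signed_measure_def)
    have "ennreal (measure (jordan_pos N \<theta>) A) = (SUP B\<in>{B \<in> sets N. B \<subseteq> A}. ennreal (\<theta> B))"
      using emeasure_jordan_pos[OF \<theta> A] by (simp add: P.emeasure_eq_measure)
    also have "\<dots> \<le> ennreal (\<theta> A + measure (jordan_pos N (\<lambda>A. - \<theta> A)) A)"
      using ub by (intro SUP_least ennreal_leI) auto
    finally show ?thesis using nn by simp
  qed
  from le[OF \<eta>] le[OF finite_signed_measure_uminus[OF \<eta>]] show ?thesis
    by (simp add: jordan_neg_def)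
qed

lemma emeasure_variation:
  assumes A: "A \<in> sets N"
  shows "emeasure (variation N \<eta>) A = emeasure (jordan_pos N \<eta>) A + emeasure (jordan_neg N \<eta>) A"
proof -
  let ?m = "\<lambda>A. emeasure (jordan_pos N \<eta>) A + emeasure (jordan_neg N \<eta>) A"
  have "countably_additive (sets N) ?m"
  proof (rule countably_additiveI)
    fix B :: "nat \<Rightarrow> 'a set"
    assume B: "range B \<subseteq> sets N" "disjoint_family B"
    have "(\<Sum>i. ?m (B i)) =
        (\<Sum>i. emeasure (jordan_pos N \<eta>) (B i)) + (\<Sum>i. emeasure (jordan_neg N \<eta>) (B i))"
      by (rule suminf_add[symmetric]) (rule summableI)+
    also have "\<dots> = ?m (\<Union>i. B i)"
      using suminf_emeasure[of B "jordan_pos N \<eta>"] suminf_emeasure[of B "jordan_neg N \<eta>"] B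
      by (simp add: jordan_neg_def)
    finally show "(\<Sum>i. ?m (B i)) = ?m (\<Union>i. B i)" .
  qed
  moreover have "positive (sets N) ?m" by (simp add: positive_def)
  ultimately show ?thesis
    unfolding variation_def using A sets.sigma_algebra_axioms
    by (intro emeasure_measure_of_sigma)
qed


section \<open>Two-sided Levy processes and integrals of deterministic functions\<close>

definition cadlag :: "(real \<Rightarrow> real) \<Rightarrow> bool" where
  "cadlag x \<longleftrightarrow>
     (\<forall>t\<ge>0. continuous (at_right t) x) \<and>
     (\<forall>t>0. \<exists>l. (x \<longlongrightarrow> l) (at_left t))"

text \<open>One-sided process; only the values at times \<open>t \<ge> 0\<close> are constrained.\<close>

definition levy_process :: "'w measure \<Rightarrow> (real \<Rightarrow> 'w \<Rightarrow> real) \<Rightarrow> bool" where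
  "levy_process M L \<longleftrightarrow>
     (\<forall>t\<ge>0. L t \<in> borel_measurable M) \<and>
     (AE \<omega> in M. L 0 \<omega> = 0) \<and>
     (\<forall>(ts :: nat \<Rightarrow> real) n. 0 \<le> ts 0 \<longrightarrow> mono ts \<longrightarrow>
        prob_space.indep_vars M (\<lambda>_. borel)
          (\<lambda>i \<omega>. L (ts (Suc i)) \<omega> - L (ts i) \<omega>) {..<n}) \<and>
     (\<forall>s t. 0 \<le> s \<longrightarrow> s \<le> t \<longrightarrow>
        distr M borel (\<lambda>\<omega>. L t \<omega> - L s \<omega>) = distr M borel (\<lambda>\<omega>. L (t - s) \<omega>)) \<and>
     (AE \<omega> in M. cadlag (\<lambda>t. L t \<omega>))"

definition path :: "(real \<Rightarrow> 'w \<Rightarrow> real) \<Rightarrow> 'w \<Rightarrow> real \<Rightarrow> real" where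
  "path L \<omega> = (\<lambda>t\<in>{0..}. L t \<omega>)"

text \<open>\<open>L\<^sub>t = L\<^sup>1\<^sub>t\<close> for \<open>t \<ge> 0\<close> and \<open>L\<^sub>t = - L\<^sup>2\<^bsub>(-t)-\<^esub>\<close> (a left limit) for \<open>t < 0\<close>, with \<open>L\<^sup>2\<close> an
  independent copy of \<open>L\<^sup>1\<close>.\<close>

definition two_sided_levy_process :: "'w measure \<Rightarrow> (real \<Rightarrow> 'w \<Rightarrow> real) \<Rightarrow> bool" where
  "two_sided_levy_process M L \<longleftrightarrow>
     (\<forall>t. L t \<in> borel_measurable M) \<and>
     (\<exists>L1 L2.
        levy_process M L1 \<and> levy_process M L2 \<and>
        distr M (Pi\<^sub>M {0..} (\<lambda>_. borel)) (path L1) = distr M (Pi\<^sub>M {0..} (\<lambda>_. borel)) (path L2) \<and>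
        prob_space.indep_var M
          (Pi\<^sub>M {0..} (\<lambda>_. borel)) (path L1) (Pi\<^sub>M {0..} (\<lambda>_. borel)) (path L2) \<and>
        (AE \<omega> in M.
           (\<forall>t\<ge>0. L t \<omega> = L1 t \<omega>) \<and>
           (\<forall>t<0. ((\<lambda>r. L2 r \<omega>) \<longlongrightarrow> - L t \<omega>) (at_left (- t)))))"

text \<open>A list of triples \<open>(c, a, b)\<close> with \<open>a \<le> b\<close> encodes the step function
  \<open>\<Sum> c \<cdot> 1\<^bsub>(a, b]\<^esub>\<close>.\<close>

definition step_fun :: "(real \<times> real \<times> real) list \<Rightarrow> real \<Rightarrow> real" where
  "step_fun S u = (\<Sum>(c, a, b)\<leftarrow>S. c * indicator {a<..b} u)"

definition step_integral ::
    "(real \<Rightarrow> 'w \<Rightarrow> real) \<Rightarrow> (real \<times> real \<times> real) list \<Rightarrow> 'w \<Rightarrow> real" where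
  "step_integral L S \<omega> = (\<Sum>(c, a, b)\<leftarrow>S. c * (L b \<omega> - L a \<omega>))"

text \<open>\<open>Z\<close> is a version of \<open>\<integral> f dL\<close>, which is only determined almost surely.\<close>

definition has_levy_integral ::
    "'w measure \<Rightarrow> (real \<Rightarrow> 'w \<Rightarrow> real) \<Rightarrow> (real \<Rightarrow> real) \<Rightarrow> ('w \<Rightarrow> real) \<Rightarrow> bool" where
  "has_levy_integral M L f Z \<longleftrightarrow>
     (\<exists>S :: nat \<Rightarrow> (real \<times> real \<times> real) list.
        (\<forall>n. \<forall>(c, a, b)\<in>set (S n). a \<le> b) \<and>
        L2_tendsto lborel (\<lambda>n. step_fun (S n)) f sequentially \<and>
        L2_tendsto M (\<lambda>n. step_integral L (S n)) Z sequentially)"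

definition measurable_process :: "'w measure \<Rightarrow> (real \<Rightarrow> 'w \<Rightarrow> real) \<Rightarrow> bool" where
  "measurable_process M X \<longleftrightarrow> (\<lambda>(t, \<omega>). X t \<omega>) \<in> borel_measurable (borel \<Otimes>\<^sub>M M)"


section \<open>Marchaud fractional derivatives\<close>

definition marchaud_integrand :: "real \<Rightarrow> (real \<Rightarrow> real) \<Rightarrow> real \<Rightarrow> real \<Rightarrow> real" where
  "marchaud_integrand \<beta> f t u = (f t - f (t - u)) / u powr (1 + \<beta>)"

definition marchaud_truncated :: "real \<Rightarrow> (real \<Rightarrow> real) \<Rightarrow> real \<Rightarrow> real \<Rightarrow> real" where
  "marchaud_truncated \<beta> f t \<delta> =
     \<beta> / Gamma (1 - \<beta>) * (LINT u:{\<delta><..}|lborel. marchaud_integrand \<beta> f t u)"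

definition has_marchaud_derivative :: "real \<Rightarrow> (real \<Rightarrow> real) \<Rightarrow> real \<Rightarrow> real \<Rightarrow> bool" where
  "has_marchaud_derivative \<beta> f t D \<longleftrightarrow>
     (\<forall>\<delta>>0. set_integrable lborel {\<delta><..} (marchaud_integrand \<beta> f t)) \<and>
     (marchaud_truncated \<beta> f t \<longlongrightarrow> D) (at_right 0)"

text \<open>The derivative is extended by \<open>0\<close> to \<open>t \<le> 0\<close>. The limit also depends on the value \<open>f t\<close>, so for a
  general representative of an \<open>L\<^sup>2\<close> function it may fail to exist on a null set of times \<open>t > 0\<close>,
  where the value is \<open>0\<close> as well.\<close>

definition marchaud_derivative :: "real \<Rightarrow> (real \<Rightarrow> real) \<Rightarrow> real \<Rightarrow> real" where
  "marchaud_derivative \<beta> f t =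
     (if 0 < t \<and> (\<exists>D. has_marchaud_derivative \<beta> f t D)
      then THE D. has_marchaud_derivative \<beta> f t D else 0)"

text \<open>\<open>Z\<close> is a version of \<open>D\<^sup>\<beta> X\<^sub>t\<close>: the truncated integrals are pathwise, the limit is in \<open>L\<^sup>2(P)\<close>.\<close>

definition has_marchaud_derivative_L2 ::
    "'w measure \<Rightarrow> real \<Rightarrow> (real \<Rightarrow> 'w \<Rightarrow> real) \<Rightarrow> real \<Rightarrow> ('w \<Rightarrow> real) \<Rightarrow> bool" where
  "has_marchaud_derivative_L2 M \<beta> X t Z \<longleftrightarrow>
     (\<forall>\<delta>>0. AE \<omega> in M. set_integrable lborel {\<delta><..} (marchaud_integrand \<beta> (\<lambda>s. X s \<omega>) t)) \<and>
     L2_tendsto M (\<lambda>\<delta> \<omega>. marchaud_truncated \<beta> (\<lambda>s. X s \<omega>) t \<delta>) Z (at_right 0)"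

text \<open>A process \<open>(D\<^sup>\<beta> X\<^sub>t)\<^sub>t\<close> with paths that can be integrated: every \<open>D\<^sup>\<beta> X\<^sub>t\<close> is only determined
  almost surely, and the versions have to be chosen jointly measurable.\<close>

definition is_marchaud_process ::
    "'w measure \<Rightarrow> real \<Rightarrow> (real \<Rightarrow> 'w \<Rightarrow> real) \<Rightarrow> (real \<Rightarrow> 'w \<Rightarrow> real) \<Rightarrow> bool" where
  "is_marchaud_process M \<beta> X Y \<longleftrightarrow>
     measurable_process M Y \<and> (\<forall>t. has_marchaud_derivative_L2 M \<beta> X t (Y t))"


section \<open>The characteristic function of the delay equation and its filter\<close>

text \<open>On the complex numbers \<open>powr\<close> is the principal branch with argument in \<open>(-\<pi>, \<pi>]\<close>.\<close>

definition sfdde_h :: "real \<Rightarrow> (real set \<Rightarrow> real) \<Rightarrow> complex \<Rightarrow> complex" where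
  "sfdde_h \<beta> \<eta> z =
     (- z) powr of_real (1 - \<beta>) - signed_integral half_line \<eta> (\<lambda>u. exp (z * of_real u))"

definition delay :: "(real set \<Rightarrow> real) \<Rightarrow> (real \<Rightarrow> real) \<Rightarrow> real \<Rightarrow> real" where
  "delay \<eta> x u = signed_integral half_line \<eta> (\<lambda>v. x (u - v))"

text \<open>As \<open>0 powr a = 0\<close>, the expression \<open>max x 0 powr (- \<beta>)\<close> has the value \<open>0\<close> for \<open>x \<le> 0\<close>.\<close>

definition frac_kernel :: "real \<Rightarrow> real \<Rightarrow> real \<Rightarrow> real \<Rightarrow> real" where
  "frac_kernel \<beta> s t u = (t - u) powr (- \<beta>) - (max (s - u) 0) powr (- \<beta>)"

end

theory Submission
  imports Defs
begin

text \<open>The Fourier symbol of the Marchaud operator truncated at \<open>\<delta>\<close> tends to \<open>(-iy)\<^bsup>\<beta>\<^esup>\<close> and is bounded by a multiple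
  of \<open>|y|\<^bsup>\<beta>\<^esup>\<close>, so the truncated derivatives of \<open>g\<close> converge in \<open>L\<^sup>2\<close> to the function \<open>k\<close> with Fourier transform
  \<open>1/h(iy)\<close>. Rewriting \<open>h \<cdot> (1/h) = 1\<close> as \<open>g' = \<delta>\<^sub>0 + \<eta> * k\<close> shows that \<open>g\<close> has a version on \<open>(0,\<infinity>)\<close> that is
  Hoelder continuous of order \<open>1/2\<close>; as \<open>\<beta> < 1/2\<close>, its Marchaud derivative exists pointwise, and it equals \<open>k\<close>.
  Of the Levy process only the orthogonality of its increments matters: it makes \<open>f \<mapsto> \<integral> f(t - u) dL\<^sub>u\<close> an isometry
  under which convolving the paths with a finite measure amounts to convolving the kernel. Hence \<open>D\<^sup>\<beta> X\<close> has kernel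
  \<open>k\<close>, and both sides of the claimed identity are Levy integrals of kernels that have the same Fourier transform,
  because \<open>(v\<^sub>+\<^bsup>-\<beta>\<^esup> - (v-a)\<^sub>+\<^bsup>-\<beta>\<^esup>) / \<Gamma>(1-\<beta>)\<close> is the fractional derivative of the indicator of \<open>[0,a)\<close>.\<close>

section \<open>Square-integrable functions\<close>

text \<open>The condition \<open>\<beta> < 1 / 2\<close> enters twice: \<open>1/h(iy)\<close> decays
  like \<open>|y|\<close> to the power \<open>\<beta> - 1\<close>, which is square integrable at
  infinity only then, and a Hoelder exponent 1/2 of \<open>g\<close> outweighs the singularity of
  order \<open>1 + \<beta>\<close> only then. The obstacle is that \<open>g\<close> is given as an
  L2 class through its transform, while the Marchaud derivative is a pointwise limit formed from one
  representative; identities between functions are therefore almost everywhere identities read off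
  from equal transforms. The symbol of the truncated operator leads to an integral at the points
  \<open>-iy\<close>, where scaling in \<open>y\<close> leaves one unknown constant on each
  half-axis. Moving into the half-plane of positive real part, where the integral is holomorphic and
  its value at 1 is a Gamma integral, determines both. On the probabilistic side moments are given
  at time 1 only, and the left limit in the definition of \<open>L\<close> at negative times has to
  be removed before the covariance of \<open>L\<close> can be computed.\<close>

definition L2norm :: "'a measure \<Rightarrow> ('a \<Rightarrow> 'b::{banach, second_countable_topology}) \<Rightarrow> real" where
  "L2norm M f = sqrt (\<integral>x. (norm (f x))\<^sup>2 \<partial>M)"

lemma square_integrable_measurable: "square_integrable M f \<Longrightarrow> f \<in> borel_measurable M"
  by (simp add: square_integrable_def)

lemma square_integrable_norm2: "square_integrable M f \<Longrightarrow> integrable M (\<lambda>x. (norm (f x))\<^sup>2)"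
  by (simp add: square_integrable_def)

lemma L2norm_nonneg [simp]: "0 \<le> L2norm M f"
  by (simp add: L2norm_def)

lemma L2norm_power2: "(L2norm M f)\<^sup>2 = (\<integral>x. (norm (f x))\<^sup>2 \<partial>M)"
  by (simp add: L2norm_def)

lemma L2norm_cong_AE:
  assumes "f \<in> borel_measurable M" "g \<in> borel_measurable M" "AE x in M. f x = g x"
  shows "L2norm M f = L2norm M g"
proof -
  have "(\<integral>x. (norm (f x))\<^sup>2 \<partial>M) = (\<integral>x. (norm (g x))\<^sup>2 \<partial>M)"
  proof (rule integral_cong_AE)
    show "AE x in M. (norm (f x))\<^sup>2 = (norm (g x))\<^sup>2" using assms(3) by eventually_elim simp
  qed (use assms(1,2) in measurable)
  then show ?thesis by (simp add: L2norm_def)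
qed

lemma L2norm_cong: "(\<And>x. x \<in> space M \<Longrightarrow> norm (f x) = norm (g x)) \<Longrightarrow> L2norm M f = L2norm M g"
  unfolding L2norm_def by (intro arg_cong[where f=sqrt] Bochner_Integration.integral_cong) auto

lemma L2norm_minus_commute: "L2norm M (\<lambda>x. f x - g x) = L2norm M (\<lambda>x. g x - f x)"
  by (intro L2norm_cong) (simp add: norm_minus_commute)

lemma square_integrable_bound:
  assumes "square_integrable M g" "f \<in> borel_measurable M" "AE x in M. norm (f x) \<le> norm (g x)"
  shows "square_integrable M f"
proof -
  have "integrable M (\<lambda>x. (norm (f x))\<^sup>2)"
  proof (rule Bochner_Integration.integrable_bound[OF square_integrable_norm2[OF assms(1)]])
    show "(\<lambda>x. (norm (f x))\<^sup>2) \<in> borel_measurable M" using assms(2) by measurable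
    show "AE x in M. norm ((norm (f x))\<^sup>2) \<le> norm ((norm (g x))\<^sup>2)"
      using assms(3) by eventually_elim (simp add: power_mono)
  qed
  then show ?thesis using assms(2) by (simp add: square_integrable_def)
qed

lemma square_integrable_cong_AE:
  assumes "square_integrable M g" "f \<in> borel_measurable M" "AE x in M. f x = g x"
  shows "square_integrable M f"
  by (rule square_integrable_bound[OF assms(1,2)]) (use assms(3) in eventually_elim, simp)

lemma norm_add_power2_le: "(norm (a + b))\<^sup>2 \<le> 2 * (norm a)\<^sup>2 + 2 * (norm b)\<^sup>2"
  for a b :: "'a::real_normed_vector"
proof -
  have "(norm (a + b))\<^sup>2 \<le> (norm a + norm b)\<^sup>2"
    by (intro power_mono norm_triangle_ineq) auto
  also have "\<dots> \<le> 2 * (norm a)\<^sup>2 + 2 * (norm b)\<^sup>2"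
    using sum_squares_bound[of "norm a" "norm b"] by (simp add: power2_sum)
  finally show ?thesis .
qed

lemma square_integrable_add:
  assumes "square_integrable M f" "square_integrable M g"
  shows "square_integrable M (\<lambda>x. f x + g x)"
proof -
  note [measurable] = square_integrable_measurable[OF assms(1)] square_integrable_measurable[OF assms(2)]
  have "integrable M (\<lambda>x. 2 * (norm (f x))\<^sup>2 + 2 * (norm (g x))\<^sup>2)"
    using assms by (auto simp: square_integrable_def)
  then have "integrable M (\<lambda>x. (norm (f x + g x))\<^sup>2)"
    by (rule Bochner_Integration.integrable_bound) (auto simp: norm_add_power2_le)
  then show ?thesis by (simp add: square_integrable_def)
qed

lemma square_integrable_cmult:
  fixes f :: "'a \<Rightarrow> 'b::{banach, second_countable_topology, real_normed_field}"
  shows "square_integrable M f \<Longrightarrow> square_integrable M (\<lambda>x. c * f x)"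
  by (auto simp: square_integrable_def power_mult_distrib norm_mult)

lemma square_integrable_uminus: "square_integrable M f \<Longrightarrow> square_integrable M (\<lambda>x. - f x)"
  by (auto simp: square_integrable_def)

lemma square_integrable_diff:
  assumes "square_integrable M f" "square_integrable M g"
  shows "square_integrable M (\<lambda>x. f x - g x)"
  using square_integrable_add[OF assms(1) square_integrable_uminus[OF assms(2)]] by simp

lemma square_integrable_zero [simp]: "square_integrable M (\<lambda>x. 0)"
  by (simp add: square_integrable_def)

lemma square_integrable_sum:
  "(\<And>i. i \<in> I \<Longrightarrow> square_integrable M (f i)) \<Longrightarrow> square_integrable M (\<lambda>x. \<Sum>i\<in>I. f i x)"
  by (induction I rule: infinite_finite_induct) (auto intro: square_integrable_add)

lemma L2norm_scaleR: "L2norm M (\<lambda>x. c *\<^sub>R f x) = \<bar>c\<bar> * L2norm M f"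
  by (simp add: L2norm_def power_mult_distrib real_sqrt_mult)

lemma square_integrable_norm_mult:
  assumes "square_integrable M f" "square_integrable M g"
  shows "integrable M (\<lambda>x. norm (f x) * norm (g x))"
proof -
  note [measurable] = square_integrable_measurable[OF assms(1)] square_integrable_measurable[OF assms(2)]
  have "integrable M (\<lambda>x. (norm (f x))\<^sup>2 + (norm (g x))\<^sup>2)"
    using assms by (auto simp: square_integrable_def)
  then show ?thesis
  proof (rule Bochner_Integration.integrable_bound)
    have "norm (f x) * norm (g x) \<le> (norm (f x))\<^sup>2 + (norm (g x))\<^sup>2" for x
      using sum_squares_bound[of "norm (f x)" "norm (g x)"] mult_nonneg_nonneg[OF norm_ge_zero norm_ge_zero, of "f x" "g x"]
      unfolding mult.assoc by linarith
    then show "AE x in M. norm (norm (f x) * norm (g x)) \<le> norm ((norm (f x))\<^sup>2 + (norm (g x))\<^sup>2)"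
      by simp
  qed measurable
qed

lemma square_integrable_mult:
  fixes f g :: "'a \<Rightarrow> 'b::{banach, second_countable_topology, real_normed_field}"
  assumes "square_integrable M f" "square_integrable M g"
  shows "integrable M (\<lambda>x. f x * g x)"
proof -
  note [measurable] = square_integrable_measurable[OF assms(1)] square_integrable_measurable[OF assms(2)]
  show ?thesis
    by (rule Bochner_Integration.integrable_bound[OF square_integrable_norm_mult[OF assms]])
       (auto simp: norm_mult)
qed

text \<open>The integral of \<open>(|f| - r |g|)^2\<close> is a nonnegative quadratic polynomial in
  \<open>r\<close>, so its discriminant is not positive. Passing to norms reduces Banach-valued
  functions to real ones.\<close>

lemma L2_Cauchy_Schwarz:
  assumes f: "square_integrable M f" and g: "square_integrable M g"
  shows "(\<integral>x. norm (f x) * norm (g x) \<partial>M) \<le> L2norm M f * L2norm M g"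
proof -
  define A where "A = (\<integral>x. (norm (f x))\<^sup>2 \<partial>M)"
  define B where "B = (\<integral>x. norm (f x) * norm (g x) \<partial>M)"
  define C where "C = (\<integral>x. (norm (g x))\<^sup>2 \<partial>M)"
  note i = square_integrable_norm2[OF f] square_integrable_norm2[OF g] square_integrable_norm_mult[OF f g]
  have q: "0 \<le> A - 2 * r * B + r\<^sup>2 * C" for r
  proof -
    have "0 \<le> (\<integral>x. (norm (f x) - r * norm (g x))\<^sup>2 \<partial>M)" by simp
    also have "\<dots> = (\<integral>x. (norm (f x))\<^sup>2 - (2 * r) * (norm (f x) * norm (g x)) + r\<^sup>2 * (norm (g x))\<^sup>2 \<partial>M)"
      by (simp add: power2_diff power_mult_distrib algebra_simps)
    also have "\<dots> = A - 2 * r * B + r\<^sup>2 * C"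
      using i by (simp add: A_def B_def C_def)
    finally show ?thesis .
  qed
  have nn: "A \<ge> 0" "B \<ge> 0" "C \<ge> 0" by (auto simp: A_def B_def C_def)
  have "B\<^sup>2 \<le> A * C"
  proof (cases "C = 0")
    case True
    have "B \<le> 0"
    proof (rule ccontr)
      assume "\<not> B \<le> 0"
      \<comment> \<open>With \<open>C = 0\<close> the polynomial is affine in \<open>r\<close>, and
        at this \<open>r\<close> it takes the value -1.\<close>
      then show False using q[of "(A + 1) / (2 * B)"] True by simp
    qed
    then show ?thesis using nn True by simp
  next
    case False
    \<comment> \<open>The choice \<open>r = B / C\<close> is the minimum of the parabola.\<close>
    then have "0 \<le> (A - 2 * (B / C) * B + (B / C)\<^sup>2 * C) * C"
      using q[of "B / C"] nn by (intro mult_nonneg_nonneg) auto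
    also have "\<dots> = A * C - B\<^sup>2"
      using False by (simp add: field_simps power2_eq_square)
    finally show ?thesis by simp
  qed
  then have "sqrt (B\<^sup>2) \<le> sqrt (A * C)" by (rule real_sqrt_le_mono)
  then show ?thesis using nn by (simp add: L2norm_def A_def B_def C_def real_sqrt_mult)
qed

lemma L2_inner_bound:
  fixes f g :: "'a \<Rightarrow> 'b::{banach, second_countable_topology, real_normed_field}"
  assumes f: "square_integrable M f" and g: "square_integrable M g"
  shows "norm (\<integral>x. f x * g x \<partial>M) \<le> L2norm M f * L2norm M g"
proof -
  have "norm (\<integral>x. f x * g x \<partial>M) \<le> (\<integral>x. norm (f x * g x) \<partial>M)" by (rule integral_norm_bound)
  also have "\<dots> \<le> L2norm M f * L2norm M g" using L2_Cauchy_Schwarz[OF f g] by (simp add: norm_mult)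
  finally show ?thesis .
qed

lemma L2norm_triangle:
  assumes f: "square_integrable M f" and g: "square_integrable M g"
  shows "L2norm M (\<lambda>x. f x + g x) \<le> L2norm M f + L2norm M g"
proof (rule power2_le_imp_le)
  note [measurable] = square_integrable_measurable[OF f] square_integrable_measurable[OF g]
  note i = square_integrable_norm2[OF f] square_integrable_norm2[OF g] square_integrable_norm_mult[OF f g]
  have "(L2norm M (\<lambda>x. f x + g x))\<^sup>2 = (\<integral>x. (norm (f x + g x))\<^sup>2 \<partial>M)"
    by (rule L2norm_power2)
  also have "\<dots> \<le> (\<integral>x. (norm (f x))\<^sup>2 + 2 * (norm (f x) * norm (g x)) + (norm (g x))\<^sup>2 \<partial>M)"
  proof (rule integral_mono)
    show "integrable M (\<lambda>x. (norm (f x + g x))\<^sup>2)"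
      using square_integrable_add[OF f g] by (simp add: square_integrable_def)
    show "integrable M (\<lambda>x. (norm (f x))\<^sup>2 + 2 * (norm (f x) * norm (g x)) + (norm (g x))\<^sup>2)"
      using i by auto
    fix x
    have "(norm (f x + g x))\<^sup>2 \<le> (norm (f x) + norm (g x))\<^sup>2"
      by (intro power_mono norm_triangle_ineq) auto
    then show "(norm (f x + g x))\<^sup>2 \<le> (norm (f x))\<^sup>2 + 2 * (norm (f x) * norm (g x)) + (norm (g x))\<^sup>2"
      by (simp add: power2_sum)
  qed
  also have "\<dots> = (L2norm M f)\<^sup>2 + 2 * (\<integral>x. norm (f x) * norm (g x) \<partial>M) + (L2norm M g)\<^sup>2"
    using i by (simp add: L2norm_power2)
  also have "\<dots> \<le> (L2norm M f + L2norm M g)\<^sup>2"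
    using L2_Cauchy_Schwarz[OF f g] by (simp add: power2_sum)
  finally show "(L2norm M (\<lambda>x. f x + g x))\<^sup>2 \<le> (L2norm M f + L2norm M g)\<^sup>2" .
qed simp

lemma L2norm_triangle_diff:
  assumes "square_integrable M f" "square_integrable M g" "square_integrable M h"
  shows "L2norm M (\<lambda>x. f x - h x) \<le> L2norm M (\<lambda>x. f x - g x) + L2norm M (\<lambda>x. g x - h x)"
  using L2norm_triangle[OF square_integrable_diff[OF assms(1,2)] square_integrable_diff[OF assms(2,3)]]
  by simp

lemma L2norm_diff_le:
  assumes "square_integrable M f" "square_integrable M g"
  shows "\<bar>L2norm M f - L2norm M g\<bar> \<le> L2norm M (\<lambda>x. f x - g x)"
  using L2norm_triangle[OF square_integrable_diff[OF assms(1,2)] assms(2)]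
    L2norm_triangle[OF square_integrable_diff[OF assms(2,1)] assms(1)]
    L2norm_minus_commute[of M f g] by auto

lemma L2norm_eq_0_iff:
  assumes "square_integrable M f"
  shows "L2norm M f = 0 \<longleftrightarrow> (AE x in M. f x = 0)"
  using integral_nonneg_eq_0_iff_AE[OF square_integrable_norm2[OF assms]] by (simp add: L2norm_def)

text \<open>\<open>L2_tendsto\<close> is defined by squared distances; the distances themselves obey
  the triangle inequality, so all later estimates go through this form.\<close>

lemma L2_tendsto_iff:
  "L2_tendsto M F f G \<longleftrightarrow> square_integrable M f \<and> (\<forall>\<^sub>F i in G. square_integrable M (F i)) \<and>
     ((\<lambda>i. L2norm M (\<lambda>x. F i x - f x)) \<longlongrightarrow> 0) G"
proof -
  have "((\<lambda>i. \<integral>x. (norm (F i x - f x))\<^sup>2 \<partial>M) \<longlongrightarrow> 0) G \<longleftrightarrow> ((\<lambda>i. L2norm M (\<lambda>x. F i x - f x)) \<longlongrightarrow> 0) G"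
    (is "?a \<longleftrightarrow> ?b")
  proof
    assume ?a then show ?b unfolding L2norm_def using tendsto_real_sqrt[of _ 0] by simp
  next
    assume ?b
    then have "((\<lambda>i. (L2norm M (\<lambda>x. F i x - f x))\<^sup>2) \<longlongrightarrow> 0\<^sup>2) G" by (rule tendsto_power)
    then show ?a by (simp add: L2norm_power2)
  qed
  then show ?thesis by (simp add: L2_tendsto_def)
qed

lemma L2_tendsto_sandwich:
  assumes "square_integrable M f" "\<forall>\<^sub>F i in G. square_integrable M (F i)"
    "\<forall>\<^sub>F i in G. L2norm M (\<lambda>x. F i x - f x) \<le> b i" "(b \<longlongrightarrow> 0) G"
  shows "L2_tendsto M F f G"
  unfolding L2_tendsto_iff
  by (intro conjI assms(1,2)) (rule tendsto_sandwich[OF _ assms(3) tendsto_const assms(4)], simp)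

lemma L2_tendsto_add:
  assumes "L2_tendsto M F f G" "L2_tendsto M F' f' G"
  shows "L2_tendsto M (\<lambda>i x. F i x + F' i x) (\<lambda>x. f x + f' x) G"
proof (rule L2_tendsto_sandwich)
  have s: "square_integrable M f" "square_integrable M f'"
    "\<forall>\<^sub>F i in G. square_integrable M (F i)" "\<forall>\<^sub>F i in G. square_integrable M (F' i)"
    using assms by (auto simp: L2_tendsto_iff)
  show "square_integrable M (\<lambda>x. f x + f' x)" using s by (intro square_integrable_add)
  show "\<forall>\<^sub>F i in G. square_integrable M (\<lambda>x. F i x + F' i x)"
    using s(3,4) by eventually_elim (intro square_integrable_add)
  show "\<forall>\<^sub>F i in G. L2norm M (\<lambda>x. F i x + F' i x - (f x + f' x))
      \<le> L2norm M (\<lambda>x. F i x - f x) + L2norm M (\<lambda>x. F' i x - f' x)"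
    using s(3,4)
  proof eventually_elim
    case (elim i)
    have "L2norm M (\<lambda>x. (F i x - f x) + (F' i x - f' x))
      \<le> L2norm M (\<lambda>x. F i x - f x) + L2norm M (\<lambda>x. F' i x - f' x)"
      using s elim by (intro L2norm_triangle square_integrable_diff)
    then show ?case by (simp add: algebra_simps)
  qed
  show "((\<lambda>i. L2norm M (\<lambda>x. F i x - f x) + L2norm M (\<lambda>x. F' i x - f' x)) \<longlongrightarrow> 0) G"
    using assms tendsto_add[of _ 0 G _ 0] by (auto simp: L2_tendsto_iff)
qed

lemma L2_tendsto_cmult:
  fixes f :: "'a \<Rightarrow> 'b::{banach, second_countable_topology, real_normed_field}"
  assumes "L2_tendsto M F f G"
  shows "L2_tendsto M (\<lambda>i x. c * F i x) (\<lambda>x. c * f x) G"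
proof (rule L2_tendsto_sandwich)
  show "square_integrable M (\<lambda>x. c * f x)" using assms by (auto simp: L2_tendsto_iff intro: square_integrable_cmult)
  have "\<forall>\<^sub>F i in G. square_integrable M (F i)" using assms by (auto simp: L2_tendsto_iff)
  then show "\<forall>\<^sub>F i in G. square_integrable M (\<lambda>x. c * F i x)"
    by eventually_elim (rule square_integrable_cmult)
  have "L2norm M (\<lambda>x. c * F i x - c * f x) = norm c * L2norm M (\<lambda>x. F i x - f x)" for i
    using L2norm_scaleR[of M "norm c" "\<lambda>x. F i x - f x"]
      L2norm_cong[of M "\<lambda>x. c * F i x - c * f x" "\<lambda>x. norm c *\<^sub>R (F i x - f x)"]
    by (simp add: norm_mult right_diff_distrib[symmetric])
  then show "\<forall>\<^sub>F i in G. L2norm M (\<lambda>x. c * F i x - c * f x) \<le> norm c * L2norm M (\<lambda>x. F i x - f x)"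
    by simp
  show "((\<lambda>i. norm c * L2norm M (\<lambda>x. F i x - f x)) \<longlongrightarrow> 0) G"
    using assms by (auto simp: L2_tendsto_iff intro!: tendsto_mult_right_zero)
qed

lemma L2_tendsto_diff:
  assumes "L2_tendsto M F f G" "L2_tendsto M F' f' G"
  shows "L2_tendsto M (\<lambda>i x. F i x - F' i x) (\<lambda>x. f x - f' x) G"
proof -
  have "L2_tendsto M (\<lambda>i x. - F' i x) (\<lambda>x. - f' x) G"
    using assms(2) unfolding L2_tendsto_def
    by (auto simp: norm_minus_commute square_integrable_def)
  from L2_tendsto_add[OF assms(1) this] show ?thesis by simp
qed

lemma L2_tendsto_const: "square_integrable M f \<Longrightarrow> L2_tendsto M (\<lambda>i. f) f G"
  by (simp add: L2_tendsto_def)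

lemma L2_tendsto_norm:
  assumes "L2_tendsto M F f G"
  shows "((\<lambda>i. L2norm M (F i)) \<longlongrightarrow> L2norm M f) G"
proof -
  have "((\<lambda>i. L2norm M (F i) - L2norm M f) \<longlongrightarrow> 0) G"
  proof (rule Lim_null_comparison)
    show "((\<lambda>i. L2norm M (\<lambda>x. F i x - f x)) \<longlongrightarrow> 0) G" using assms by (simp add: L2_tendsto_iff)
    have "\<forall>\<^sub>F i in G. square_integrable M (F i)" "square_integrable M f"
      using assms by (auto simp: L2_tendsto_iff)
    then show "\<forall>\<^sub>F i in G. norm (L2norm M (F i) - L2norm M f) \<le> L2norm M (\<lambda>x. F i x - f x)"
      by (auto elim!: eventually_mono simp: L2norm_diff_le)
  qed
  then show ?thesis by (rule LIM_zero_cancel)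
qed

lemma L2_tendsto_unique:
  fixes f :: "'a \<Rightarrow> 'b::{banach, second_countable_topology}"
  assumes "L2_tendsto M F f G" "L2_tendsto M F f' G" "G \<noteq> bot"
  shows "AE x in M. f x = f' x"
proof -
  have "L2_tendsto M (\<lambda>i x. 0) (\<lambda>x. f x - f' x) G" using L2_tendsto_diff[OF assms(1,2)] by simp
  then have "((\<lambda>i. L2norm M (\<lambda>x. 0 :: 'b)) \<longlongrightarrow> L2norm M (\<lambda>x. f x - f' x)) G"
    by (rule L2_tendsto_norm)
  then have "((\<lambda>i. 0) \<longlongrightarrow> L2norm M (\<lambda>x. f x - f' x)) G" by (simp add: L2norm_def)
  then have "L2norm M (\<lambda>x. f x - f' x) = 0" using assms(3) by (simp add: tendsto_const_iff)
  then show ?thesis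
    using assms by (subst (asm) L2norm_eq_0_iff) (auto simp: L2_tendsto_iff intro: square_integrable_diff)
qed

lemma L2_tendsto_cong_AE:
  assumes "L2_tendsto M F f G" "f' \<in> borel_measurable M" "AE x in M. f' x = f x"
    "\<And>i. F' i \<in> borel_measurable M" "\<And>i. AE x in M. F' i x = F i x"
  shows "L2_tendsto M F' f' G"
proof (rule L2_tendsto_sandwich)
  have s: "square_integrable M f" "\<forall>\<^sub>F i in G. square_integrable M (F i)"
    using assms by (auto simp: L2_tendsto_iff)
  show s': "square_integrable M f'" using s(1) assms(2,3) by (rule square_integrable_cong_AE)
  show "\<forall>\<^sub>F i in G. square_integrable M (F' i)"
    using s(2) by eventually_elim (rule square_integrable_cong_AE[OF _ assms(4,5)])
  show "\<forall>\<^sub>F i in G. L2norm M (\<lambda>x. F' i x - f' x) \<le> L2norm M (\<lambda>x. F i x - f x)"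
    using s(2)
  proof eventually_elim
    case (elim i)
    note [measurable] = square_integrable_measurable[OF s(1)] square_integrable_measurable[OF elim]
      assms(2) assms(4)[of i]
    have "L2norm M (\<lambda>x. F' i x - f' x) = L2norm M (\<lambda>x. F i x - f x)"
    proof (rule L2norm_cong_AE)
      show "AE x in M. F' i x - f' x = F i x - f x"
        using assms(3) assms(5)[of i] by eventually_elim simp
    qed measurable
    then show ?case by simp
  qed
  show "((\<lambda>i. L2norm M (\<lambda>x. F i x - f x)) \<longlongrightarrow> 0) G" using assms(1) by (simp add: L2_tendsto_iff)
qed

section \<open>Fatou's lemma, almost everywhere limits and completeness in L2\<close>

lemma L2_fatou:
  fixes f :: "'a \<Rightarrow> 'b::{banach, second_countable_topology}"
  assumes F: "\<And>n. square_integrable M (F n)" and f[measurable]: "f \<in> borel_measurable M"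
    and le: "\<forall>\<^sub>F n in sequentially. L2norm M (F n) \<le> c"
    and lim: "AE x in M. (\<lambda>n. F n x) \<longlonglongrightarrow> f x"
  shows "square_integrable M f" "L2norm M f \<le> c"
proof -
  note [measurable] = square_integrable_measurable[OF F]
  have c: "0 \<le> c"
    using le by (auto simp: eventually_sequentially intro: order_trans[OF L2norm_nonneg])
  have "(\<integral>\<^sup>+x. ennreal ((norm (f x))\<^sup>2) \<partial>M) = (\<integral>\<^sup>+x. liminf (\<lambda>n. ennreal ((norm (F n x))\<^sup>2)) \<partial>M)"
  proof (rule nn_integral_cong_AE, use lim in eventually_elim)
    case (elim x)
    then have "(\<lambda>n. ennreal ((norm (F n x))\<^sup>2)) \<longlonglongrightarrow> ennreal ((norm (f x))\<^sup>2)"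
      by (intro tendsto_ennrealI tendsto_power tendsto_norm)
    from lim_imp_Liminf[OF sequentially_bot this] show ?case by simp
  qed
  also have "\<dots> \<le> liminf (\<lambda>n. \<integral>\<^sup>+x. ennreal ((norm (F n x))\<^sup>2) \<partial>M)"
    by (intro nn_integral_liminf) measurable
  also have "\<dots> \<le> limsup (\<lambda>n. \<integral>\<^sup>+x. ennreal ((norm (F n x))\<^sup>2) \<partial>M)"
    by (rule Liminf_le_Limsup) simp
  also have "\<dots> \<le> ennreal (c\<^sup>2)"
  proof (rule Limsup_bounded, use le in eventually_elim)
    case (elim n)
    have "(\<integral>\<^sup>+x. ennreal ((norm (F n x))\<^sup>2) \<partial>M) = ennreal ((L2norm M (F n))\<^sup>2)"
      unfolding L2norm_power2 by (intro nn_integral_eq_integral square_integrable_norm2 F) simp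
    also have "\<dots> \<le> ennreal (c\<^sup>2)" using elim by (intro ennreal_leI power_mono) auto
    finally show ?case .
  qed
  finally have *: "(\<integral>\<^sup>+x. ennreal ((norm (f x))\<^sup>2) \<partial>M) \<le> ennreal (c\<^sup>2)" .
  then have "integrable M (\<lambda>x. (norm (f x))\<^sup>2)"
    using le_less_trans[OF * ennreal_less_top] by (intro integrableI_bounded) auto
  then show s: "square_integrable M f" by (simp add: square_integrable_def)
  have "ennreal ((L2norm M f)\<^sup>2) \<le> ennreal (c\<^sup>2)"
    using * unfolding L2norm_power2 using nn_integral_eq_integral[OF square_integrable_norm2[OF s]] by simp
  then show "L2norm M f \<le> c" by (intro power2_le_imp_le[OF _ c]) simp
qed

lemma ennreal_le_suminf: "f n \<le> (\<Sum>n. f n)" for f :: "nat \<Rightarrow> ennreal"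
  using sum_le_suminf[of f "{n}"] by simp

text \<open>Weighting the increments by \<open>2\<^sup>n\<close> makes the sum of their squares integrable, so almost everywhere
  they decay geometrically.\<close>

lemma L2_fast_Cauchy_converges_AE:
  fixes F :: "nat \<Rightarrow> 'a \<Rightarrow> 'b::{banach, second_countable_topology}"
  assumes F: "\<And>n. square_integrable M (F n)"
    and d: "\<And>n. L2norm M (\<lambda>x. F (Suc n) x - F n x) \<le> (1 / 2) ^ n"
  shows "AE x in M. convergent (\<lambda>n. F n x)"
proof -
  note [measurable] = square_integrable_measurable[OF F]
  let ?D = "\<lambda>n x. norm (F (Suc n) x - F n x)"
  have i: "(\<integral>\<^sup>+x. ennreal (2 ^ n * (?D n x)\<^sup>2) \<partial>M) \<le> ennreal ((1/2) ^ n)" for n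
  proof -
    have "(\<integral>\<^sup>+x. ennreal (2 ^ n * (?D n x)\<^sup>2) \<partial>M) = ennreal (\<integral>x. 2 ^ n * (?D n x)\<^sup>2 \<partial>M)"
      using square_integrable_norm2[OF square_integrable_diff[OF F F]]
      by (intro nn_integral_eq_integral) auto
    also have "\<dots> = ennreal (2 ^ n * (L2norm M (\<lambda>x. F (Suc n) x - F n x))\<^sup>2)"
      by (simp add: L2norm_power2)
    also have "\<dots> \<le> ennreal (2 ^ n * ((1/2) ^ n)\<^sup>2)"
      using d[of n] by (intro ennreal_leI mult_left_mono power_mono) auto
    also have "(2::real) ^ n * ((1/2) ^ n)\<^sup>2 = (1/2) ^ n"
      by (simp add: power2_eq_square power_one_over)
    finally show ?thesis .
  qed
  have "(\<integral>\<^sup>+x. (\<Sum>n. ennreal (2 ^ n * (?D n x)\<^sup>2)) \<partial>M) = (\<Sum>n. \<integral>\<^sup>+x. ennreal (2 ^ n * (?D n x)\<^sup>2) \<partial>M)"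
    by (intro nn_integral_suminf) measurable
  also have "\<dots> \<le> (\<Sum>n. ennreal ((1/2) ^ n))" by (intro suminf_le i) auto
  also have "\<dots> < \<infinity>" by (subst suminf_ennreal2) (auto intro: summable_geometric)
  finally have "AE x in M. (\<Sum>n. ennreal (2 ^ n * (?D n x)\<^sup>2)) \<noteq> \<infinity>"
    by (intro nn_integral_noteq_infinite) auto
  then show ?thesis
  proof eventually_elim
    case (elim x)
    define B where "B = enn2real (\<Sum>n. ennreal (2 ^ n * (?D n x)\<^sup>2))"
    have B: "2 ^ n * (?D n x)\<^sup>2 \<le> B" for n
    proof -
      have "ennreal (2 ^ n * (?D n x)\<^sup>2) \<le> (\<Sum>n. ennreal (2 ^ n * (?D n x)\<^sup>2))"
        by (rule ennreal_le_suminf)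
      also have "\<dots> = ennreal B" unfolding B_def using elim by (intro ennreal_enn2real[symmetric]) (simp only: less_top infinity_ennreal_def)
      finally show ?thesis by (subst (asm) ennreal_le_iff) (simp_all only: B_def enn2real_nonneg)
    qed
    have le: "?D n x \<le> sqrt B * (1 / sqrt 2) ^ n" for n
    proof -
      have "(?D n x)\<^sup>2 \<le> B / 2 ^ n" using B[of n] by (simp add: field_simps)
      then have "sqrt ((?D n x)\<^sup>2) \<le> sqrt (B / 2 ^ n)" by (rule real_sqrt_le_mono)
      then show ?thesis by (simp add: real_sqrt_divide real_sqrt_power power_divide)
    qed
    have "summable (\<lambda>n. sqrt B * (1 / sqrt 2) ^ n)"
      by (intro summable_mult summable_geometric) simp
    then have "summable (\<lambda>n. F (Suc n) x - F n x)"
      by (rule summable_comparison_test') (rule le)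
    then have "convergent (\<lambda>n. \<Sum>i<n. F (Suc i) x - F i x)" by (simp add: summable_iff_convergent)
    then have "convergent (\<lambda>n. F n x - F 0 x)" by (simp add: sum_lessThan_telescope[of "\<lambda>n. F n x"])
    from convergent_add[OF this convergent_const[of "F 0 x"]] show ?case by simp
  qed
qed

text \<open>Fatou's lemma with \<open>m\<close> fixed, applied to \<open>F m - F (r n)\<close> as
  \<open>n\<close> grows, turns the Cauchy bound into a bound on the distance to \<open>f\<close>.
  The pointwise limit is prescribed instead of merely claimed to exist, because a process defined as
  a limit of paths has to be recognised as an L2 limit at every time.\<close>

lemma L2_limit_of_AE_limit:
  fixes F :: "nat \<Rightarrow> 'a \<Rightarrow> 'b::{banach, second_countable_topology}"
  assumes F: "\<And>n. square_integrable M (F n)" and f: "f \<in> borel_measurable M"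
    and C: "\<And>e. e > 0 \<Longrightarrow> \<exists>N. \<forall>m\<ge>N. \<forall>n\<ge>N. L2norm M (\<lambda>x. F m x - F n x) \<le> e"
    and r: "strict_mono r" and lim: "AE x in M. (\<lambda>n. F (r n) x) \<longlonglongrightarrow> f x"
  shows "L2_tendsto M F f sequentially"
proof -
  note [measurable] = square_integrable_measurable[OF F] f
  have ge: "r n \<ge> n" for n using r by (rule seq_suble)
  have *: "square_integrable M (\<lambda>x. F m x - f x) \<and> L2norm M (\<lambda>x. F m x - f x) \<le> e"
    if N: "\<forall>m\<ge>N. \<forall>n\<ge>N. L2norm M (\<lambda>x. F m x - F n x) \<le> e" and m: "m \<ge> N" for e N m
  proof -
    have ev: "\<forall>\<^sub>F n in sequentially. L2norm M (\<lambda>x. F m x - F (r n) x) \<le> e"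
      unfolding eventually_sequentially
    proof (intro exI[of _ N] allI impI)
      fix n assume "N \<le> n"
      then show "L2norm M (\<lambda>x. F m x - F (r n) x) \<le> e" using N m order_trans[OF _ ge] by blast
    qed
    have l: "AE x in M. (\<lambda>n. F m x - F (r n) x) \<longlonglongrightarrow> F m x - f x"
      using lim by eventually_elim (intro tendsto_intros)
    show ?thesis
      using L2_fatou[of M "\<lambda>n x. F m x - F (r n) x", OF square_integrable_diff[OF F F] _ ev l] by auto
  qed
  obtain N where N: "\<forall>m\<ge>N. \<forall>n\<ge>N. L2norm M (\<lambda>x. F m x - F n x) \<le> 1" using C[of 1] by auto
  have "square_integrable M (\<lambda>x. F N x - (F N x - f x))"
    by (rule square_integrable_diff[OF F *[OF N order_refl, THEN conjunct1]])
  then have s: "square_integrable M f" by simp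
  have "(\<lambda>m. L2norm M (\<lambda>x. F m x - f x)) \<longlonglongrightarrow> 0"
  proof (rule LIMSEQ_I)
    fix e :: real assume "e > 0"
    then obtain N where N: "\<forall>m\<ge>N. \<forall>n\<ge>N. L2norm M (\<lambda>x. F m x - F n x) \<le> e / 2" using C[of "e/2"] by auto
    show "\<exists>N. \<forall>n\<ge>N. norm (L2norm M (\<lambda>x. F n x - f x) - 0) < e"
      using *[OF N] \<open>e > 0\<close> by (intro exI[of _ N]) force
  qed
  then show ?thesis using s F by (simp add: L2_tendsto_iff)
qed

text \<open>Formulated for an abstract distance, since the subsequence is later extracted from
  distances between kernels and then used for distances between random variables.\<close>

lemma fast_Cauchy_subsequence:
  fixes d :: "nat \<Rightarrow> nat \<Rightarrow> real"
  assumes C: "\<And>e. e > 0 \<Longrightarrow> \<exists>N. \<forall>m\<ge>N. \<forall>n\<ge>N. d m n \<le> e"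
  obtains r where "strict_mono r" "\<And>n. d (r (Suc n)) (r n) \<le> (1 / 2) ^ n"
proof -
  let ?P = "\<lambda>n N. \<forall>m\<ge>N. \<forall>k\<ge>N. d m k \<le> (1/2::real) ^ n"
  have "\<exists>r. \<forall>n. ?P n (r n) \<and> r n < r (Suc n)"
  proof (rule dependent_nat_choice)
    show "\<exists>N. ?P 0 N" using C[of 1] by simp
    fix N n assume "?P n N"
    obtain N' where "?P (Suc n) N'" using C[of "(1/2) ^ Suc n"] by auto
    then show "\<exists>N'. ?P (Suc n) N' \<and> N < N'"
      by (intro exI[of _ "max N' (Suc N)"]) auto
  qed
  then obtain r where r: "\<And>n. ?P n (r n)" "\<And>n. r n < r (Suc n)" by metis
  have "d (r (Suc n)) (r n) \<le> (1/2) ^ n" for n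
    using r(1)[of n] r(2)[of n] by (simp add: less_imp_le)
  then show ?thesis using r(2) by (intro that[of r]) (auto simp: strict_mono_Suc_iff)
qed

lemma L2_complete:
  fixes F :: "nat \<Rightarrow> 'a \<Rightarrow> 'b::{banach, second_countable_topology}"
  assumes F: "\<And>n. square_integrable M (F n)"
    and C: "\<And>e. e > 0 \<Longrightarrow> \<exists>N. \<forall>m\<ge>N. \<forall>n\<ge>N. L2norm M (\<lambda>x. F m x - F n x) \<le> e"
  obtains f where "L2_tendsto M F f sequentially"
proof -
  note [measurable] = square_integrable_measurable[OF F]
  obtain r where r: "strict_mono r" "\<And>n. L2norm M (\<lambda>x. F (r (Suc n)) x - F (r n) x) \<le> (1 / 2) ^ n"
    using fast_Cauchy_subsequence[of "\<lambda>m n. L2norm M (\<lambda>x. F m x - F n x)"] C by metis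
  have c: "AE x in M. convergent (\<lambda>n. F (r n) x)"
    by (rule L2_fast_Cauchy_converges_AE) (auto simp: r F)
  define f where "f x = lim (\<lambda>n. F (r n) x)" for x
  have "L2_tendsto M F f sequentially"
  proof (rule L2_limit_of_AE_limit[OF F _ C r(1)])
    show "f \<in> borel_measurable M" unfolding f_def by measurable
    show "AE x in M. (\<lambda>n. F (r n) x) \<longlonglongrightarrow> f x"
      using c by eventually_elim (simp add: f_def convergent_LIMSEQ_iff)
  qed
  then show ?thesis by (rule that)
qed

lemma L2_tendsto_Cauchy:
  assumes "L2_tendsto M F f sequentially" "e > 0" "\<And>n. square_integrable M (F n)"
  shows "\<exists>N. \<forall>m\<ge>N. \<forall>n\<ge>N. L2norm M (\<lambda>x. F m x - F n x) \<le> e"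
proof -
  have s: "square_integrable M f" and l: "(\<lambda>i. L2norm M (\<lambda>x. F i x - f x)) \<longlonglongrightarrow> 0"
    using assms(1) by (auto simp: L2_tendsto_iff)
  obtain N where N: "\<And>n. n \<ge> N \<Longrightarrow> L2norm M (\<lambda>x. F n x - f x) < e / 2"
    using LIMSEQ_D[OF l, of "e/2"] assms(2) by auto
  have "L2norm M (\<lambda>x. F m x - F n x) \<le> e" if "m \<ge> N" "n \<ge> N" for m n
    using L2norm_triangle_diff[OF assms(3)[of m] s assms(3)[of n]] N[OF that(1)] N[OF that(2)]
      L2norm_minus_commute[of M f "F n"] by simp
  then show ?thesis by blast
qed

section \<open>Averages, convolutions and step functions\<close>

text \<open>The limit inherits the majorant, so the squared differences are dominated by
  \<open>4 |w|^2\<close> and the dominated convergence theorem applies to them.\<close>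

lemma L2_dominated:
  fixes f :: "'a \<Rightarrow> 'b::{banach, second_countable_topology}"
  assumes f[measurable]: "f \<in> borel_measurable M" and F[measurable]: "\<And>n. F n \<in> borel_measurable M"
    and w: "square_integrable M (w :: 'a \<Rightarrow> 'c::{banach, second_countable_topology})"
    and lim: "AE x in M. (\<lambda>n. F n x) \<longlonglongrightarrow> f x"
    and le: "\<And>n. AE x in M. norm (F n x) \<le> norm (w x)"
  shows "L2_tendsto M F f sequentially"
proof -
  note [measurable] = square_integrable_measurable[OF w]
  have bnd: "square_integrable M h" if "h \<in> borel_measurable M" "AE x in M. norm (h x) \<le> norm (w x)"
    for h :: "'a \<Rightarrow> 'b"
  proof (rule square_integrable_bound[of _ "\<lambda>x. norm (w x)"])
    show "square_integrable M (\<lambda>x. norm (w x))" using w by (simp add: square_integrable_def)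
  qed (use that in auto)
  have le': "AE x in M. norm (f x) \<le> norm (w x)"
  proof -
    have "AE x in M. \<forall>n. norm (F n x) \<le> norm (w x)" using le by (simp add: AE_all_countable)
    then show ?thesis using lim
    proof eventually_elim
      case (elim x)
      show ?case by (rule LIMSEQ_le_const2[OF tendsto_norm[OF elim(2)]]) (use elim(1) in auto)
    qed
  qed
  have "(\<lambda>n. \<integral>x. (norm (F n x - f x))\<^sup>2 \<partial>M) \<longlonglongrightarrow> (\<integral>x. 0 \<partial>M)"
  proof (rule integral_dominated_convergence[where w = "\<lambda>x. 4 * (norm (w x))\<^sup>2"])
    show "integrable M (\<lambda>x. 4 * (norm (w x))\<^sup>2)" using w by (simp add: square_integrable_def)
    show "AE x in M. (\<lambda>n. (norm (F n x - f x))\<^sup>2) \<longlonglongrightarrow> 0"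
      using lim
    proof eventually_elim
      case (elim x)
      have "(\<lambda>n. (norm (F n x - f x))\<^sup>2) \<longlonglongrightarrow> (norm (f x - f x))\<^sup>2"
        by (intro tendsto_intros elim)
      then show ?case by simp
    qed
    show "AE x in M. norm ((norm (F n x - f x))\<^sup>2) \<le> 4 * (norm (w x))\<^sup>2" for n
      using le[of n] le'
    proof eventually_elim
      case (elim x)
      have "norm (F n x - f x) \<le> 2 * norm (w x)"
        using norm_triangle_ineq4[of "F n x" "f x"] elim by linarith
      then have "(norm (F n x - f x))\<^sup>2 \<le> (2 * norm (w x))\<^sup>2" by (intro power_mono) auto
      then show ?case by (simp add: power_mult_distrib)
    qed
  qed measurable
  then show ?thesis using bnd[OF f le'] bnd[OF F le] by (simp add: L2_tendsto_def)
qed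

text \<open>Cauchy-Schwarz against the constant 1; for a probability measure the second part is
  Jensen's inequality for the square.\<close>

lemma finite_measure_square_integrable:
  assumes \<nu>: "finite_measure \<nu>" and f: "square_integrable \<nu> f"
  shows "integrable \<nu> f" "(norm (\<integral>x. f x \<partial>\<nu>))\<^sup>2 \<le> measure \<nu> (space \<nu>) * (\<integral>x. (norm (f x))\<^sup>2 \<partial>\<nu>)"
proof -
  interpret finite_measure \<nu> by fact
  note [measurable] = square_integrable_measurable[OF f]
  have 1: "square_integrable \<nu> (\<lambda>_. 1 :: real)" by (simp add: square_integrable_def)
  have "integrable \<nu> (\<lambda>x. norm (f x) * norm (1::real))" by (rule square_integrable_norm_mult[OF f 1])
  then show i: "integrable \<nu> f" by (simp add: integrable_norm_iff)
  have "norm (\<integral>x. f x \<partial>\<nu>) \<le> (\<integral>x. norm (f x) \<partial>\<nu>)" by (rule integral_norm_bound)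
  also have "\<dots> = (\<integral>x. norm (f x) * norm (1::real) \<partial>\<nu>)" by simp
  also have "\<dots> \<le> L2norm \<nu> f * L2norm \<nu> (\<lambda>_. 1 :: real)" by (rule L2_Cauchy_Schwarz[OF f 1])
  finally have "(norm (\<integral>x. f x \<partial>\<nu>))\<^sup>2 \<le> (L2norm \<nu> f * L2norm \<nu> (\<lambda>_. 1 :: real))\<^sup>2"
    by (intro power_mono) auto
  then show "(norm (\<integral>x. f x \<partial>\<nu>))\<^sup>2 \<le> measure \<nu> (space \<nu>) * (\<integral>x. (norm (f x))\<^sup>2 \<partial>\<nu>)"
    by (simp add: power_mult_distrib L2norm_power2 mult.commute)
qed

section \<open>L2-valued averages over a finite measure\<close>

context
  fixes \<nu> :: "'a measure" and \<mu> :: "'c measure" and H :: "'a \<Rightarrow> 'c \<Rightarrow> 'b::{banach, second_countable_topology}"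
    and B :: real
  assumes \<nu>: "finite_measure \<nu>" and \<mu>: "sigma_finite_measure \<mu>"
    and H: "(\<lambda>(v, x). H v x) \<in> borel_measurable (\<nu> \<Otimes>\<^sub>M \<mu>)"
    and B: "\<And>v. v \<in> space \<nu> \<Longrightarrow> square_integrable \<mu> (H v)" "\<And>v. v \<in> space \<nu> \<Longrightarrow> L2norm \<mu> (H v) \<le> B" "0 \<le> B"
begin

lemma L2_average_integrable: "integrable (\<nu> \<Otimes>\<^sub>M \<mu>) (\<lambda>(v, x). (norm (H v x))\<^sup>2)"
  and L2_average_norm2_le: "(\<integral>x. (\<integral>v. (norm (H v x))\<^sup>2 \<partial>\<nu>) \<partial>\<mu>) \<le> measure \<nu> (space \<nu>) * B\<^sup>2"
proof -
  interpret N: finite_measure \<nu> by (rule \<nu>)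
  interpret P: pair_sigma_finite \<nu> \<mu>
    by (simp add: pair_sigma_finite_def N.sigma_finite_measure_axioms \<mu>)
  note [measurable] = H
  have *: "(\<integral>\<^sup>+x. ennreal ((norm (H v x))\<^sup>2) \<partial>\<mu>) \<le> ennreal (B\<^sup>2)" if "v \<in> space \<nu>" for v
  proof -
    have "(\<integral>\<^sup>+x. ennreal ((norm (H v x))\<^sup>2) \<partial>\<mu>) = ennreal ((L2norm \<mu> (H v))\<^sup>2)"
      unfolding L2norm_power2 by (intro nn_integral_eq_integral square_integrable_norm2 B that) simp
    also have "\<dots> \<le> ennreal (B\<^sup>2)" using B(2)[OF that] by (intro ennreal_leI power_mono) auto
    finally show ?thesis .
  qed
  have "(\<integral>\<^sup>+p. ennreal (norm (case p of (v, x) \<Rightarrow> (norm (H v x))\<^sup>2)) \<partial>(\<nu> \<Otimes>\<^sub>M \<mu>))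
      = (\<integral>\<^sup>+v. \<integral>\<^sup>+x. ennreal ((norm (H v x))\<^sup>2) \<partial>\<mu> \<partial>\<nu>)"
    by (subst P.M2.nn_integral_fst[symmetric]) (auto simp: split_beta')
  also have "\<dots> \<le> (\<integral>\<^sup>+v. ennreal (B\<^sup>2) \<partial>\<nu>)" by (intro nn_integral_mono *)
  also have "\<dots> < \<infinity>" using N.emeasure_finite[of "space \<nu>"] by (simp add: ennreal_mult_eq_top_iff less_top[symmetric])
  finally show i: "integrable (\<nu> \<Otimes>\<^sub>M \<mu>) (\<lambda>(v, x). (norm (H v x))\<^sup>2)"
    by (intro integrableI_bounded) measurable
  have "(\<integral>x. (\<integral>v. (norm (H v x))\<^sup>2 \<partial>\<nu>) \<partial>\<mu>) = (\<integral>v. (\<integral>x. (norm (H v x))\<^sup>2 \<partial>\<mu>) \<partial>\<nu>)"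
    by (rule P.Fubini_integral[OF i])
  also have "\<dots> \<le> (\<integral>v. B\<^sup>2 \<partial>\<nu>)"
  proof (rule integral_mono)
    show "integrable \<nu> (\<lambda>v. \<integral>x. (norm (H v x))\<^sup>2 \<partial>\<mu>)" by (rule P.integrable_fst[OF i])
    show "(\<integral>x. (norm (H v x))\<^sup>2 \<partial>\<mu>) \<le> B\<^sup>2" if "v \<in> space \<nu>" for v
      using B(2)[OF that] by (simp add: L2norm_power2[symmetric] power_mono)
  qed simp
  finally show "(\<integral>x. (\<integral>v. (norm (H v x))\<^sup>2 \<partial>\<nu>) \<partial>\<mu>) \<le> measure \<nu> (space \<nu>) * B\<^sup>2" by simp
qed

lemma L2_average_AE: "AE x in \<mu>. square_integrable \<nu> (\<lambda>v. H v x)"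
proof -
  interpret N: finite_measure \<nu> by (rule \<nu>)
  interpret P: pair_sigma_finite \<nu> \<mu>
    by (simp add: pair_sigma_finite_def N.sigma_finite_measure_axioms \<mu>)
  note [measurable] = H
  have "AE x in \<mu>. integrable \<nu> (\<lambda>v. (norm (H v x))\<^sup>2)"
    by (rule P.AE_integrable_snd[OF L2_average_integrable])
  then show ?thesis
    by (rule AE_mp) (auto simp: square_integrable_def intro!: AE_I2)
qed

lemma L2_average_AE_integrable: "AE x in \<mu>. integrable \<nu> (\<lambda>v. H v x)"
  using L2_average_AE by eventually_elim (rule finite_measure_square_integrable(1)[OF \<nu>])

lemma L2_average_measurable: "(\<lambda>x. \<integral>v. H v x \<partial>\<nu>) \<in> borel_measurable \<mu>"
proof -
  interpret N: finite_measure \<nu> by (rule \<nu>)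
  have [measurable]: "(\<lambda>p. H (snd p) (fst p)) \<in> borel_measurable (\<mu> \<Otimes>\<^sub>M \<nu>)"
    using measurable_compose[OF measurable_pair_swap' H] by (simp add: split_beta')
  show ?thesis by measurable
qed

text \<open>Minkowski's integral inequality under a uniform bound \<open>B\<close> on the slices:
  Cauchy-Schwarz in \<open>v\<close> costs one factor \<open>measure \<nu> (space \<nu>)\<close>,
  and Tonelli for the squared norms supplies the other. It is used with Lebesgue measure as
  \<open>\<mu>\<close> for kernels and with the probability measure as \<open>\<mu>\<close> for
  paths.\<close>

lemma L2_average_square_integrable: "square_integrable \<mu> (\<lambda>x. \<integral>v. H v x \<partial>\<nu>)"
  and L2_average_norm: "L2norm \<mu> (\<lambda>x. \<integral>v. H v x \<partial>\<nu>) \<le> measure \<nu> (space \<nu>) * B"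
proof -
  interpret N: finite_measure \<nu> by (rule \<nu>)
  interpret P: pair_sigma_finite \<nu> \<mu>
    by (simp add: pair_sigma_finite_def N.sigma_finite_measure_axioms \<mu>)
  note [measurable] = L2_average_measurable
  let ?c = "measure \<nu> (space \<nu>)"
  have i: "integrable \<mu> (\<lambda>x. ?c * (\<integral>v. (norm (H v x))\<^sup>2 \<partial>\<nu>))"
    using P.integrable_snd[OF L2_average_integrable] by simp
  have le: "AE x in \<mu>. (norm (\<integral>v. H v x \<partial>\<nu>))\<^sup>2 \<le> ?c * (\<integral>v. (norm (H v x))\<^sup>2 \<partial>\<nu>)"
    using L2_average_AE by eventually_elim (rule finite_measure_square_integrable(2)[OF \<nu>])
  have i2: "integrable \<mu> (\<lambda>x. (norm (\<integral>v. H v x \<partial>\<nu>))\<^sup>2)"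
  proof (rule Bochner_Integration.integrable_bound[OF i])
    show "AE x in \<mu>. norm ((norm (\<integral>v. H v x \<partial>\<nu>))\<^sup>2) \<le> norm (?c * (\<integral>v. (norm (H v x))\<^sup>2 \<partial>\<nu>))"
      using le by eventually_elim (simp add: abs_mult)
  qed measurable
  then show "square_integrable \<mu> (\<lambda>x. \<integral>v. H v x \<partial>\<nu>)" by (simp add: square_integrable_def)
  have "(L2norm \<mu> (\<lambda>x. \<integral>v. H v x \<partial>\<nu>))\<^sup>2 \<le> (\<integral>x. ?c * (\<integral>v. (norm (H v x))\<^sup>2 \<partial>\<nu>) \<partial>\<mu>)"
    unfolding L2norm_power2 by (rule integral_mono_AE[OF i2 i le])
  also have "\<dots> \<le> ?c * (?c * B\<^sup>2)"
    using L2_average_norm2_le by (simp add: mult_left_mono)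
  also have "\<dots> = (?c * B)\<^sup>2" by (simp add: power2_eq_square)
  finally show "L2norm \<mu> (\<lambda>x. \<integral>v. H v x \<partial>\<nu>) \<le> ?c * B"
    by (rule power2_le_imp_le) (simp add: B)
qed

end

text \<open>A weak form of Fubini's theorem: it gives the inner product of an average with any
  \<open>w\<close> in L2. The product is integrable jointly because \<open>|H w|\<close> is at most
  \<open>H^2 + w^2\<close>.\<close>

lemma L2_average_inner:
  fixes H :: "'a \<Rightarrow> 'c \<Rightarrow> real"
  assumes \<nu>: "finite_measure \<nu>" and \<mu>: "sigma_finite_measure \<mu>"
    and H[measurable]: "(\<lambda>(v, x). H v x) \<in> borel_measurable (\<nu> \<Otimes>\<^sub>M \<mu>)"
    and B: "\<And>v. v \<in> space \<nu> \<Longrightarrow> square_integrable \<mu> (H v)" "\<And>v. v \<in> space \<nu> \<Longrightarrow> L2norm \<mu> (H v) \<le> B" "0 \<le> B"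
    and w: "square_integrable \<mu> w"
  shows "(\<integral>x. (\<integral>v. H v x \<partial>\<nu>) * w x \<partial>\<mu>) = (\<integral>v. (\<integral>x. H v x * w x \<partial>\<mu>) \<partial>\<nu>)"
proof -
  interpret N: finite_measure \<nu> by (rule \<nu>)
  interpret P: pair_sigma_finite \<nu> \<mu>
    by (simp add: pair_sigma_finite_def N.sigma_finite_measure_axioms \<mu>)
  note [measurable] = square_integrable_measurable[OF w]
  have w2: "integrable (\<nu> \<Otimes>\<^sub>M \<mu>) (\<lambda>(v, x). (w x)\<^sup>2)"
    by (rule P.Fubini_integrable) (use square_integrable_norm2[OF w] in auto)
  have "integrable (\<nu> \<Otimes>\<^sub>M \<mu>) (\<lambda>p. (case p of (v, x) \<Rightarrow> (norm (H v x))\<^sup>2) + (case p of (v, x) \<Rightarrow> (w x)\<^sup>2))"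
    by (intro Bochner_Integration.integrable_add L2_average_integrable[OF \<nu> \<mu> H B] w2)
  then have i: "integrable (\<nu> \<Otimes>\<^sub>M \<mu>) (\<lambda>(v, x). H v x * w x)"
  proof (rule Bochner_Integration.integrable_bound)
    have "\<bar>H v x * w x\<bar> \<le> (H v x)\<^sup>2 + (w x)\<^sup>2" for v x
    proof -
      have "0 \<le> \<bar>H v x\<bar> * \<bar>w x\<bar>" by simp
      then have "\<bar>H v x\<bar> * \<bar>w x\<bar> \<le> \<bar>H v x\<bar>\<^sup>2 + \<bar>w x\<bar>\<^sup>2"
        using sum_squares_bound[of "\<bar>H v x\<bar>" "\<bar>w x\<bar>"] unfolding mult.assoc by linarith
      then show ?thesis by (simp add: abs_mult)
    qed
    then show "AE p in \<nu> \<Otimes>\<^sub>M \<mu>. norm (case p of (v, x) \<Rightarrow> H v x * w x)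
        \<le> norm ((case p of (v, x) \<Rightarrow> (norm (H v x))\<^sup>2) + (case p of (v, x) \<Rightarrow> (w x)\<^sup>2))"
      by (intro AE_I2) (simp add: split_beta')
  qed measurable
  have "(\<integral>x. (\<integral>v. H v x \<partial>\<nu>) * w x \<partial>\<mu>) = (\<integral>x. (\<integral>v. H v x * w x \<partial>\<nu>) \<partial>\<mu>)" by simp
  also have "\<dots> = (\<integral>v. (\<integral>x. H v x * w x \<partial>\<mu>) \<partial>\<nu>)" by (rule P.Fubini_integral[OF i])
  finally show ?thesis .
qed

section \<open>Convolution with finite measures on the real line\<close>

definition conv :: "real measure \<Rightarrow> (real \<Rightarrow> 'b::{banach, second_countable_topology}) \<Rightarrow> real \<Rightarrow> 'b" where
  "conv \<nu> f t = (\<integral>v. f (t - v) \<partial>\<nu>)"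

lemma square_integrable_affine:
  fixes f :: "real \<Rightarrow> 'b::{banach, second_countable_topology}"
  assumes "square_integrable lborel f" "c \<noteq> 0"
  shows "square_integrable lborel (\<lambda>t. f (a + c * t))"
proof -
  note [measurable] = square_integrable_measurable[OF assms(1), simplified]
  show ?thesis
    using lborel_integrable_real_affine[OF square_integrable_norm2[OF assms(1)] assms(2), of a]
    by (simp add: square_integrable_def)
qed

lemma square_integrable_shift:
  fixes f :: "real \<Rightarrow> 'b::{banach, second_countable_topology}"
  assumes "square_integrable lborel f"
  shows "square_integrable lborel (\<lambda>t. f (t - a))" "square_integrable lborel (\<lambda>t. f (a - t))"
  using square_integrable_affine[OF assms, of 1 "-a"] square_integrable_affine[OF assms, of "-1" a]
  by simp_all

lemma L2norm_shift:
  fixes f :: "real \<Rightarrow> 'b::{banach, second_countable_topology}"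
  shows "L2norm lborel (\<lambda>t. f (t - a)) = L2norm lborel f" "L2norm lborel (\<lambda>t. f (a - t)) = L2norm lborel f"
  using lborel_integral_real_affine[of 1 "\<lambda>t. (norm (f t))\<^sup>2" "-a"]
    lborel_integral_real_affine[of "-1" "\<lambda>t. (norm (f t))\<^sup>2" a]
  by (simp_all add: L2norm_def)

lemma L2_tendsto_shift:
  fixes f :: "real \<Rightarrow> 'b::{banach, second_countable_topology}"
  assumes "L2_tendsto lborel F f G"
  shows "L2_tendsto lborel (\<lambda>i t. F i (a - t)) (\<lambda>t. f (a - t)) G"
proof (rule L2_tendsto_sandwich)
  have s: "square_integrable lborel f" "\<forall>\<^sub>F i in G. square_integrable lborel (F i)"
    using assms by (auto simp: L2_tendsto_iff)
  show "square_integrable lborel (\<lambda>t. f (a - t))" using s by (intro square_integrable_shift)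
  show "\<forall>\<^sub>F i in G. square_integrable lborel (\<lambda>t. F i (a - t))"
    using s(2) by eventually_elim (rule square_integrable_shift)
  show "\<forall>\<^sub>F i in G. L2norm lborel (\<lambda>t. F i (a - t) - f (a - t)) \<le> L2norm lborel (\<lambda>t. F i t - f t)"
    using L2norm_shift(2)[of "\<lambda>t. F i t - f t" a for i] by simp
  show "((\<lambda>i. L2norm lborel (\<lambda>t. F i t - f t)) \<longlongrightarrow> 0) G" using assms by (simp add: L2_tendsto_iff)
qed

context
  fixes \<nu> :: "real measure"
  assumes \<nu>: "finite_measure \<nu>" and sets_\<nu>: "sets \<nu> = sets borel"
begin

lemma conv_pair_measurable:
  assumes f: "f \<in> borel_measurable borel"
  shows "(\<lambda>(v, t). f (t - v)) \<in> borel_measurable (\<nu> \<Otimes>\<^sub>M lborel)"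
proof -
  have [measurable]: "f \<in> borel_measurable borel" by fact
  have "(\<lambda>(v, t). f (t - v)) \<in> borel_measurable (borel \<Otimes>\<^sub>M borel)" by measurable
  moreover have "sets (\<nu> \<Otimes>\<^sub>M lborel) = sets (borel \<Otimes>\<^sub>M borel)"
    by (intro sets_pair_measure_cong) (auto simp: sets_\<nu>)
  ultimately show ?thesis by (subst measurable_cong_sets[OF _ refl])
qed

context
  fixes f :: "real \<Rightarrow> 'b::{banach, second_countable_topology}"
  assumes f: "square_integrable lborel f"
begin

lemma conv_AE_integrable: "AE t in lborel. integrable \<nu> (\<lambda>v. f (t - v))"
  and conv_square_integrable: "square_integrable lborel (conv \<nu> f)"
  and conv_L2norm: "L2norm lborel (conv \<nu> f) \<le> measure \<nu> UNIV * L2norm lborel f"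
proof -
  have *: "space \<nu> = UNIV" using sets_eq_imp_space_eq[OF sets_\<nu>] by simp
  have m: "(\<lambda>(v, t). f (t - v)) \<in> borel_measurable (\<nu> \<Otimes>\<^sub>M lborel)"
    using square_integrable_measurable[OF f] by (intro conv_pair_measurable) simp
  have s: "square_integrable lborel (\<lambda>t. f (t - v))" for v by (rule square_integrable_shift[OF f])
  have l: "L2norm lborel (\<lambda>t. f (t - v)) \<le> L2norm lborel f" for v by (simp add: L2norm_shift)
  note h = \<nu> lborel.sigma_finite_measure_axioms m s l L2norm_nonneg
  show "AE t in lborel. integrable \<nu> (\<lambda>v. f (t - v))" by (rule L2_average_AE_integrable[OF h])
  show "square_integrable lborel (conv \<nu> f)"
    using L2_average_square_integrable[OF h] by (simp add: conv_def[abs_def])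
  show "L2norm lborel (conv \<nu> f) \<le> measure \<nu> UNIV * L2norm lborel f"
    using L2_average_norm[OF h] by (simp add: conv_def[abs_def] *)
qed

end

text \<open>Linearity holds only almost everywhere: at the exceptional \<open>t\<close> one of the
  shifted functions may fail to be integrable, and its integral is then the default value 0.\<close>

lemma conv_diff_AE:
  fixes f g :: "real \<Rightarrow> 'b::{banach, second_countable_topology}"
  assumes "square_integrable lborel f" "square_integrable lborel g"
  shows "AE t in lborel. conv \<nu> (\<lambda>x. f x - g x) t = conv \<nu> f t - conv \<nu> g t"
  using conv_AE_integrable[OF assms(1)] conv_AE_integrable[OF assms(2)]
  by eventually_elim (simp add: conv_def)

lemma conv_L2norm_diff:
  fixes f g :: "real \<Rightarrow> 'b::{banach, second_countable_topology}"
  assumes "square_integrable lborel f" "square_integrable lborel g"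
  shows "L2norm lborel (\<lambda>t. conv \<nu> f t - conv \<nu> g t) \<le> measure \<nu> UNIV * L2norm lborel (\<lambda>t. f t - g t)"
proof -
  have "L2norm lborel (\<lambda>t. conv \<nu> f t - conv \<nu> g t) = L2norm lborel (conv \<nu> (\<lambda>x. f x - g x))"
  proof (rule L2norm_cong_AE)
    show "AE t in lborel. conv \<nu> f t - conv \<nu> g t = conv \<nu> (\<lambda>x. f x - g x) t"
      using conv_diff_AE[OF assms] by eventually_elim simp
  qed (intro square_integrable_measurable square_integrable_diff conv_square_integrable assms)+
  also have "\<dots> \<le> measure \<nu> UNIV * L2norm lborel (\<lambda>t. f t - g t)"
    by (intro conv_L2norm square_integrable_diff assms)
  finally show ?thesis .
qed

lemma L2_tendsto_conv:
  fixes f :: "real \<Rightarrow> 'b::{banach, second_countable_topology}"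
  assumes "L2_tendsto lborel F f G"
  shows "L2_tendsto lborel (\<lambda>i. conv \<nu> (F i)) (conv \<nu> f) G"
proof (rule L2_tendsto_sandwich)
  have s: "square_integrable lborel f" "\<forall>\<^sub>F i in G. square_integrable lborel (F i)"
    using assms by (auto simp: L2_tendsto_iff)
  show "square_integrable lborel (conv \<nu> f)" by (intro conv_square_integrable s)
  show "\<forall>\<^sub>F i in G. square_integrable lborel (conv \<nu> (F i))"
    using s(2) by eventually_elim (rule conv_square_integrable)
  show "\<forall>\<^sub>F i in G. L2norm lborel (\<lambda>x. conv \<nu> (F i) x - conv \<nu> f x)
      \<le> measure \<nu> UNIV * L2norm lborel (\<lambda>t. F i t - f t)"
    using s(2) by eventually_elim (rule conv_L2norm_diff[OF _ s(1)])
  show "((\<lambda>i. measure \<nu> UNIV * L2norm lborel (\<lambda>t. F i t - f t)) \<longlongrightarrow> 0) G"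
    using assms by (auto simp: L2_tendsto_iff intro!: tendsto_mult_right_zero)
qed

end

section \<open>Step functions and their density in L2\<close>

definition steps :: "(real \<times> real \<times> real) list \<Rightarrow> bool" where
  "steps S \<longleftrightarrow> (\<forall>(c, a, b)\<in>set S. a \<le> b)"

lemma step_fun_simps [simp]:
  "step_fun [] = (\<lambda>u. 0)"
  "step_fun (x # S) = (\<lambda>u. fst x * indicator {fst (snd x)<..snd (snd x)} u + step_fun S u)"
  by (auto simp: step_fun_def split_beta')

lemma step_fun_append: "step_fun (S @ T) u = step_fun S u + step_fun T u"
  by (simp add: step_fun_def)

lemma step_fun_scale: "step_fun (map (\<lambda>(c, p). (r * c, p)) S) u = r * step_fun S u"
  by (induction S) (auto simp: algebra_simps)

lemma square_integrable_indicator: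
  assumes "A \<in> sets M" "emeasure M A < \<infinity>"
  shows "square_integrable M (\<lambda>x. indicator A x :: real)"
proof -
  have "(\<lambda>x. (norm (indicator A x :: real))\<^sup>2) = (\<lambda>x. indicator A x)"
    by (auto simp: indicator_def)
  then show ?thesis using assms by (simp add: square_integrable_def)
qed

lemma emeasure_lborel_Ioc_finite: "emeasure lborel {a<..b::real} < top"
  by (cases "a \<le> b") auto

lemma square_integrable_step_fun: "square_integrable lborel (step_fun S)"
proof (induction S)
  case (Cons x S)
  have "square_integrable lborel (\<lambda>u. indicator {fst (snd x)<..snd (snd x)} u :: real)"
    by (rule square_integrable_indicator) (auto simp: emeasure_lborel_Ioc_finite)
  then show ?case using Cons by (simp add: square_integrable_add square_integrable_cmult)
qed simp

text \<open>Any class of functions that contains the half-open intervals, is linear and closed under \<open>L\<^sup>2\<close>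
  limits is all of \<open>L\<^sup>2\<close>.\<close>

lemma L2_lborel_induct [consumes 1, case_names interval add scale limit]:
  fixes f :: "real \<Rightarrow> real"
  assumes f: "square_integrable lborel f"
    and interval: "\<And>a b. a \<le> b \<Longrightarrow> P (\<lambda>x. indicator {a<..b} x)"
    and add: "\<And>f g. square_integrable lborel f \<Longrightarrow> square_integrable lborel g \<Longrightarrow> P f \<Longrightarrow> P g \<Longrightarrow> P (\<lambda>x. f x + g x)"
    and scale: "\<And>f c. square_integrable lborel f \<Longrightarrow> P f \<Longrightarrow> P (\<lambda>x. c * f x)"
    and limit: "\<And>F f. (\<And>n. square_integrable lborel (F n)) \<Longrightarrow> (\<And>n. P (F n)) \<Longrightarrow>
      L2_tendsto lborel F f sequentially \<Longrightarrow> P f"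
  shows "P f"
proof -
  let ?I = "\<lambda>n::nat. {- real n<..real n}"
  have zero: "P (\<lambda>x. 0)" using scale[OF _ interval, of 0 0 0] by (simp add: square_integrable_indicator)
  have diff: "P (\<lambda>x. f x - g x)" if "square_integrable lborel f" "square_integrable lborel g" "P f" "P g" for f g
    using add[OF that(1) square_integrable_cmult[OF that(2), of "-1"] that(3) scale[OF that(2,4), of "-1"]] by simp
  have sum: "P (\<lambda>x. \<Sum>i\<in>J. g i x)" if "finite J" "\<And>i. i \<in> J \<Longrightarrow> square_integrable lborel (g i)" "\<And>i. i \<in> J \<Longrightarrow> P (g i)"
    for J :: "'i set" and g
    using that
  proof (induction J rule: finite_induct)
    case (insert i J)
    then have "P (\<lambda>x. g i x + (\<Sum>i\<in>J. g i x))" by (intro add square_integrable_sum) auto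
    then show ?case using insert by simp
  qed (simp add: zero)
  have sqI: "square_integrable lborel (\<lambda>x. indicator (A \<inter> ?I n) x :: real)" if "A \<in> sets borel" for A n
  proof (rule square_integrable_indicator)
    have "emeasure lborel (A \<inter> ?I n) \<le> emeasure lborel (?I n)" using that by (intro emeasure_mono) auto
    also have "\<dots> < \<infinity>" by (simp add: emeasure_lborel_Ioc_finite)
    finally show "emeasure lborel (A \<inter> ?I n) < \<infinity>" .
  qed (use that in auto)
  \<comment> \<open>The window \<open>?I n\<close> keeps all measures finite. Complements taken
    inside the window are then differences of members of the class, so that Dynkin's argument for
    intersection-stable generators applies.\<close>
  have meas: "P (\<lambda>x. indicator (A \<inter> ?I n) x)" if A: "A \<in> sets borel" for A n
  proof -
    have "Int_stable (range (\<lambda>(a, b). {a<..b::real}))"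
      by (auto simp: Int_stable_def)
    moreover have "range (\<lambda>(a, b). {a<..b::real}) \<subseteq> Pow UNIV" by simp
    moreover have "A \<in> sigma_sets UNIV (range (\<lambda>(a, b). {a<..b::real}))"
      using A unfolding borel_sigma_sets_Ioc by simp
    ultimately show ?thesis
    proof (induction rule: sigma_sets_induct_disjoint[of "range (\<lambda>(a, b). {a<..b::real})" UNIV A])
      case (basic A)
      then obtain a b where "A = {a<..b}" by auto
      then have "A \<inter> ?I n = (if max a (- real n) \<le> min b (real n) then {max a (- real n)<..min b (real n)} else {})"
        by auto
      then show ?case using interval[of "max a (- real n)" "min b (real n)"] zero by auto
    next
      case empty
      then show ?case using zero by simp
    next
      case (compl A)
      have A: "A \<in> sets borel" using compl(1) unfolding borel_sigma_sets_Ioc by simp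
      have "P (\<lambda>x. indicator (UNIV \<inter> ?I n) x - indicator (A \<inter> ?I n) x)"
        using interval[of "- real n" "real n"] by (intro diff sqI A compl) auto
      moreover have "(\<lambda>x. indicator (UNIV \<inter> ?I n) x - indicator (A \<inter> ?I n) x :: real) = indicator ((UNIV - A) \<inter> ?I n)"
        by (auto simp: fun_eq_iff indicator_def)
      ultimately show ?case by simp
    next
      case (union A)
      have A: "A i \<in> sets borel" for i using union(2) unfolding borel_sigma_sets_Ioc by auto
      show ?case
      proof (rule limit[of "\<lambda>k x. \<Sum>i<k. indicator (A i \<inter> ?I n) x"])
        show "square_integrable lborel (\<lambda>x. \<Sum>i<k. indicator (A i \<inter> ?I n) x :: real)" for k
          by (intro square_integrable_sum sqI A)
        show "P (\<lambda>x. \<Sum>i<k. indicator (A i \<inter> ?I n) x)" for k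
          by (intro sum sqI A union) auto
        have eq: "(\<Sum>i<k. indicator (A i \<inter> ?I n) x :: real) = indicator ((\<Union>i<k. A i) \<inter> ?I n) x" for k x
        proof -
          have "disjoint_family_on A {..<k}" using union(1) by (rule disjoint_family_on_mono[OF subset_UNIV])
          then have "(\<Sum>i<k. indicator (A i) x :: real) = indicator (\<Union>i<k. A i) x"
            by (intro indicator_UN_disjoint[symmetric]) auto
          then show ?thesis by (simp add: indicator_inter_arith sum_distrib_right[symmetric])
        qed
        show "L2_tendsto lborel (\<lambda>k x. \<Sum>i<k. indicator (A i \<inter> ?I n) x :: real)
                (\<lambda>x. indicator (\<Union> (range A) \<inter> ?I n) x) sequentially"
          unfolding eq
        proof (rule L2_dominated[OF _ _ sqI[of UNIV n]])
          show "AE x in lborel. (\<lambda>k. indicator ((\<Union>i<k. A i) \<inter> ?I n) x :: real) \<longlonglongrightarrow> indicator (\<Union> (range A) \<inter> ?I n) x"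
          proof (rule AE_I2)
            fix x
            have "(\<lambda>k. indicator (\<Union>i<k. A i) x :: real) \<longlonglongrightarrow> indicator (\<Union> (range A)) x"
              by (rule LIMSEQ_indicator_UN)
            then show "(\<lambda>k. indicator ((\<Union>i<k. A i) \<inter> ?I n) x :: real) \<longlonglongrightarrow> indicator (\<Union> (range A) \<inter> ?I n) x"
              unfolding indicator_inter_arith by (intro tendsto_mult_right)
          qed
        qed (use A in \<open>auto simp: indicator_def\<close>)
      qed
    qed
  qed
  have fin: "P (\<lambda>x. indicator A x)" if A: "A \<in> sets borel" "emeasure lborel A < \<infinity>" for A
  proof (rule limit[of "\<lambda>n x. indicator (A \<inter> ?I n) x"])
    show "L2_tendsto lborel (\<lambda>n x. indicator (A \<inter> ?I n) x :: real) (\<lambda>x. indicator A x) sequentially"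
    proof (rule L2_dominated[OF _ _ square_integrable_indicator[of A]])
      show "AE x in lborel. (\<lambda>n. indicator (A \<inter> ?I n) x :: real) \<longlonglongrightarrow> indicator A x"
      proof (rule AE_I2)
        fix x
        have "incseq (\<lambda>n. A \<inter> ?I n)" by (auto simp: incseq_def)
        then have "(\<lambda>n. indicator (A \<inter> ?I n) x :: real) \<longlonglongrightarrow> indicator (\<Union>n. A \<inter> ?I n) x"
          by (rule LIMSEQ_indicator_incseq)
        moreover have "(\<Union>n. A \<inter> ?I n) = A" using UN_Ioc_eq_UNIV by auto
        ultimately show "(\<lambda>n. indicator (A \<inter> ?I n) x :: real) \<longlonglongrightarrow> indicator A x" by simp
      qed
    qed (use A in \<open>auto simp: indicator_def\<close>)
  qed (use A in \<open>auto intro: sqI meas\<close>)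
  have [measurable]: "f \<in> borel_measurable lborel" by (rule square_integrable_measurable[OF f])
  obtain F where F: "\<And>i. simple_function lborel (F i)" "\<And>x. (\<lambda>i. F i x) \<longlonglongrightarrow> f x"
    "\<And>i x. norm (F i x) \<le> 2 * norm (f x)"
    using borel_measurable_implies_sequence_metric[of f lborel 0] by auto
  note [measurable] = borel_measurable_simple_function[OF F(1)]
  have FP: "square_integrable lborel (F i) \<and> P (F i)" for i
  proof -
    let ?V = "F i ` UNIV - {0}"
    have V: "finite ?V" using F(1)[of i] by (simp add: simple_function_def)
    have mV: "F i -` {y} \<in> sets borel" for y
      using measurable_sets[of "F i" lborel borel "{y}"] by simp
    \<comment> \<open>Chebyshev's inequality: where the simple function has the value
      \<open>y\<close>, the bound by \<open>2 |f|\<close> gives \<open>|y| / 2 \<le> |f|\<close>,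
      whence the constant \<open>4 / y^2\<close>.\<close>
    have fV: "emeasure lborel (F i -` {y}) < \<infinity>" if y: "y \<noteq> 0" for y
    proof -
      have "emeasure lborel (F i -` {y}) = (\<integral>\<^sup>+x. indicator (F i -` {y}) x \<partial>lborel)"
        using mV by simp
      also have "\<dots> \<le> (\<integral>\<^sup>+x. ennreal (4 / y\<^sup>2 * (norm (f x))\<^sup>2) \<partial>lborel)"
      proof (rule nn_integral_mono)
        fix x
        show "indicator (F i -` {y}) x \<le> ennreal (4 / y\<^sup>2 * (norm (f x))\<^sup>2)"
        proof (cases "F i x = y")
          case True
          then have "\<bar>y\<bar>\<^sup>2 \<le> (2 * norm (f x))\<^sup>2" using F(3)[of i x] by (intro power_mono) auto
          then have "1 \<le> 4 / y\<^sup>2 * (norm (f x))\<^sup>2" using y by (simp add: field_simps)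
          then have "ennreal 1 \<le> ennreal (4 / y\<^sup>2 * (norm (f x))\<^sup>2)" by (rule ennreal_leI)
          then show ?thesis using True by simp
        qed simp
      qed
      also have "\<dots> < \<infinity>"
        using square_integrable_norm2[OF f]
        by (subst nn_integral_eq_integral) auto
      finally show ?thesis .
    qed
    have "P (\<lambda>x. \<Sum>y\<in>?V. y * indicator (F i -` {y}) x)"
      "square_integrable lborel (\<lambda>x. \<Sum>y\<in>?V. y * indicator (F i -` {y}) x)"
      using mV fV
      by (intro sum scale square_integrable_sum square_integrable_cmult square_integrable_indicator fin V; auto)+
    moreover have "(\<lambda>x. \<Sum>y\<in>?V. y * indicator (F i -` {y}) x) = F i"
    proof
      fix x
      have "(\<Sum>y\<in>?V. y * indicator (F i -` {y}) x) = (\<Sum>y\<in>?V. if y = F i x then F i x else 0)"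
        by (intro sum.cong) (auto simp: indicator_def)
      also have "\<dots> = F i x" using V by (simp add: sum.delta)
      finally show "(\<Sum>y\<in>?V. y * indicator (F i -` {y}) x) = F i x" .
    qed
    ultimately show ?thesis by simp
  qed
  show ?thesis
  proof (rule limit[of F])
    show "L2_tendsto lborel F f sequentially"
      by (rule L2_dominated[OF _ _ square_integrable_cmult[OF f, of 2]]) (use F in \<open>auto simp: abs_mult\<close>)
  qed (use FP in auto)
qed

lemma step_fun_dense:
  fixes f :: "real \<Rightarrow> real"
  assumes "square_integrable lborel f" "0 < e"
  shows "\<exists>S. steps S \<and> L2norm lborel (\<lambda>u. step_fun S u - f u) < e"
  using assms
proof (induction arbitrary: e rule: L2_lborel_induct)
  case (interval a b)
  show ?case using interval by (intro exI[of _ "[(1, a, b)]"]) (simp add: steps_def L2norm_def)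
next
  case (add f g)
  obtain S T where S: "steps S" "L2norm lborel (\<lambda>u. step_fun S u - f u) < e / 2"
    and T: "steps T" "L2norm lborel (\<lambda>u. step_fun T u - g u) < e / 2"
    using add(3)[of "e/2"] add(4)[of "e/2"] \<open>0 < e\<close> by auto
  have "L2norm lborel (\<lambda>u. (step_fun S u - f u) + (step_fun T u - g u))
      \<le> L2norm lborel (\<lambda>u. step_fun S u - f u) + L2norm lborel (\<lambda>u. step_fun T u - g u)"
    by (intro L2norm_triangle square_integrable_diff square_integrable_step_fun add)
  then have "L2norm lborel (\<lambda>u. step_fun (S @ T) u - (f u + g u)) < e"
    using S T by (simp add: step_fun_append algebra_simps)
  then show ?case using S T by (intro exI[of _ "S @ T"]) (auto simp: steps_def)
next
  case (scale f c)
  \<comment> \<open>The summand 1 in the denominator covers \<open>c = 0\<close>.\<close>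
  obtain S where S: "steps S" "L2norm lborel (\<lambda>u. step_fun S u - f u) < e / (\<bar>c\<bar> + 1)"
    using scale(2)[of "e / (\<bar>c\<bar> + 1)"] \<open>0 < e\<close> by (auto simp: divide_pos_pos add_nonneg_pos)
  have "L2norm lborel (\<lambda>u. step_fun (map (\<lambda>(r, p). (c * r, p)) S) u - c * f u)
      = \<bar>c\<bar> * L2norm lborel (\<lambda>u. step_fun S u - f u)"
    using L2norm_scaleR[of lborel c "\<lambda>u. step_fun S u - f u"] by (simp add: step_fun_scale right_diff_distrib)
  also have "\<dots> \<le> (\<bar>c\<bar> + 1) * L2norm lborel (\<lambda>u. step_fun S u - f u)"
    by (intro mult_right_mono) auto
  also have "\<dots> < e" using S(2) by (simp add: field_simps)
  finally show ?case using S(1)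
    by (intro exI[of _ "map (\<lambda>(r, p). (c * r, p)) S"]) (auto simp: steps_def)
next
  case (limit F f)
  have "(\<lambda>n. L2norm lborel (\<lambda>x. F n x - f x)) \<longlonglongrightarrow> 0" and f: "square_integrable lborel f"
    using limit.hyps(2) by (auto simp: L2_tendsto_iff)
  from LIMSEQ_D[OF this(1), of "e/2"] obtain n where n: "L2norm lborel (\<lambda>x. F n x - f x) < e / 2"
    using \<open>0 < e\<close> by auto
  obtain S where S: "steps S" "L2norm lborel (\<lambda>u. step_fun S u - F n u) < e / 2"
    using limit.IH[of "e/2" n] \<open>0 < e\<close> by auto
  have "L2norm lborel (\<lambda>u. step_fun S u - f u)
      \<le> L2norm lborel (\<lambda>u. step_fun S u - F n u) + L2norm lborel (\<lambda>u. F n u - f u)"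
    by (intro L2norm_triangle_diff square_integrable_step_fun limit.hyps f)
  then show ?case using S n by (intro exI[of _ S]) auto
qed

text \<open>For an interval the shifted indicators converge off the two endpoints; the general case
  follows by density, because translations preserve the norm. Sequences suffice, as the continuity
  is fed into dominated convergence.\<close>

lemma L2_translation_continuous:
  fixes f :: "real \<Rightarrow> real"
  assumes f: "square_integrable lborel f" and w: "w \<longlonglongrightarrow> 0"
  shows "(\<lambda>n. L2norm lborel (\<lambda>t. f (t - w n) - f t)) \<longlonglongrightarrow> 0"
  using f
proof (induction rule: L2_lborel_induct)
  case (interval a b)
  \<comment> \<open>Since \<open>K\<close> bounds all shifts, the shifted intervals stay in
    \<open>{a - K..b + K}\<close>, whose indicator is the majorant.\<close>
  obtain K where K: "\<And>n. \<bar>w n\<bar> \<le> K"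
    using convergent_imp_bounded[OF w] by (auto simp: bounded_iff)
  have "L2_tendsto lborel (\<lambda>n t. indicator {a<..b} (t - w n) :: real) (\<lambda>t. indicator {a<..b} t) sequentially"
  proof (rule L2_dominated[OF _ _ square_integrable_indicator[of "{a - K..b + K}"]])
    show "AE t in lborel. (\<lambda>n. indicator {a<..b} (t - w n) :: real) \<longlonglongrightarrow> indicator {a<..b} t"
      using AE_lborel_singleton[of a] AE_lborel_singleton[of b]
    proof eventually_elim
      case (elim t)
      have l: "(\<lambda>n. t - w n) \<longlonglongrightarrow> t - 0" by (intro tendsto_intros w)
      have "t \<in> {a<..<b} \<or> t \<in> {..<a} \<or> t \<in> {b<..}" using elim by auto
      then have "\<forall>\<^sub>F n in sequentially. indicator {a<..b} (t - w n) = (indicator {a<..b} t :: real)"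
      proof (elim disjE)
        assume t: "t \<in> {a<..<b}"
        have "\<forall>\<^sub>F n in sequentially. t - w n \<in> {a<..<b}"
          using topological_tendstoD[OF l, of "{a<..<b}"] t by auto
        then show ?thesis by eventually_elim (use t in \<open>auto simp: indicator_def\<close>)
      next
        assume t: "t \<in> {..<a}"
        have "\<forall>\<^sub>F n in sequentially. t - w n \<in> {..<a}"
          using topological_tendstoD[OF l, of "{..<a}"] t by auto
        then show ?thesis by eventually_elim (use t in \<open>auto simp: indicator_def\<close>)
      next
        assume t: "t \<in> {b<..}"
        have "\<forall>\<^sub>F n in sequentially. t - w n \<in> {b<..}"
          using topological_tendstoD[OF l, of "{b<..}"] t by auto
        then show ?thesis by eventually_elim (use t in \<open>auto simp: indicator_def\<close>)
      qed
      then show ?case by (rule tendsto_eventually)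
    qed
    show "AE t in lborel. norm (indicator {a<..b} (t - w n) :: real) \<le> norm (indicator {a - K..b + K} t :: real)" for n
    proof (rule AE_I2)
      fix t show "norm (indicator {a<..b} (t - w n) :: real) \<le> norm (indicator {a - K..b + K} t :: real)"
        using K[of n] by (auto simp: indicator_def)
    qed
  qed (auto simp: emeasure_lborel_Icc_eq)
  then show ?case by (simp add: L2_tendsto_iff)
next
  case (add f g)
  have "(\<lambda>n. L2norm lborel (\<lambda>t. f (t - w n) - f t) + L2norm lborel (\<lambda>t. g (t - w n) - g t)) \<longlonglongrightarrow> 0"
    using tendsto_add[OF add(3,4)] by simp
  then show ?case
  proof (rule tendsto_sandwich[OF _ _ tendsto_const, rotated 2])
    have "L2norm lborel (\<lambda>t. (f (t - w n) - f t) + (g (t - w n) - g t))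
      \<le> L2norm lborel (\<lambda>t. f (t - w n) - f t) + L2norm lborel (\<lambda>t. g (t - w n) - g t)" for n
      by (intro L2norm_triangle square_integrable_diff square_integrable_shift add)
    then show "\<forall>\<^sub>F n in sequentially. L2norm lborel (\<lambda>t. f (t - w n) + g (t - w n) - (f t + g t))
      \<le> L2norm lborel (\<lambda>t. f (t - w n) - f t) + L2norm lborel (\<lambda>t. g (t - w n) - g t)"
      by (simp add: algebra_simps)
  qed simp
next
  case (scale f c)
  have "L2norm lborel (\<lambda>t. c * f (t - w n) - c * f t) = \<bar>c\<bar> * L2norm lborel (\<lambda>t. f (t - w n) - f t)" for n
    using L2norm_scaleR[of lborel c "\<lambda>t. f (t - w n) - f t"] by (simp add: right_diff_distrib)
  then show ?case using scale by (auto intro!: tendsto_mult_right_zero)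
next
  case (limit F f)
  have l: "(\<lambda>n. L2norm lborel (\<lambda>x. F n x - f x)) \<longlonglongrightarrow> 0" and f: "square_integrable lborel f"
    using limit.hyps(2) by (auto simp: L2_tendsto_iff)
  show ?case
  proof (rule LIMSEQ_I)
    fix e :: real assume "0 < e"
    with LIMSEQ_D[OF l, of "e/3"] obtain k where k: "L2norm lborel (\<lambda>x. F k x - f x) < e / 3" by auto
    from LIMSEQ_D[OF limit.IH[of k], of "e/3"] \<open>0 < e\<close> obtain N where
      N: "\<And>n. n \<ge> N \<Longrightarrow> L2norm lborel (\<lambda>t. F k (t - w n) - F k t) < e / 3" by auto
    have "L2norm lborel (\<lambda>t. f (t - w n) - f t) < e" if n: "n \<ge> N" for n
    proof -
      have "L2norm lborel (\<lambda>t. f (t - w n) - f t)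
          \<le> L2norm lborel (\<lambda>t. f (t - w n) - F k (t - w n)) + L2norm lborel (\<lambda>t. F k (t - w n) - f t)"
        by (intro L2norm_triangle_diff square_integrable_shift f limit.hyps)
      also have "L2norm lborel (\<lambda>t. F k (t - w n) - f t)
          \<le> L2norm lborel (\<lambda>t. F k (t - w n) - F k t) + L2norm lborel (\<lambda>t. F k t - f t)"
        by (intro L2norm_triangle_diff square_integrable_shift f limit.hyps)
      also have "L2norm lborel (\<lambda>t. f (t - w n) - F k (t - w n)) = L2norm lborel (\<lambda>t. F k t - f t)"
        using L2norm_shift(1)[of "\<lambda>t. f t - F k t" "w n"] L2norm_minus_commute[of lborel f "F k"] by simp
      finally show ?thesis using k N[OF n] by linarith
    qed
    then show "\<exists>N. \<forall>n\<ge>N. norm (L2norm lborel (\<lambda>t. f (t - w n) - f t) - 0) < e" by auto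
  qed
qed

section \<open>Plancherel's theorem\<close>

lemma borel_measurable_cnj [measurable (raw)]:
  "f \<in> borel_measurable M \<Longrightarrow> (\<lambda>x. cnj (f x)) \<in> borel_measurable M"
  by (rule measurable_compose[OF _ borel_measurable_continuous_onI]) (auto intro: continuous_on_cnj continuous_on_id)

lemma fourier_measurable [measurable]:
  assumes [measurable]: "f \<in> borel_measurable borel"
  shows "fourier f \<in> borel_measurable borel"
  unfolding fourier_def[abs_def] by measurable

lemma norm_iexp_mult [simp]: "norm (exp (\<i> * complex_of_real x)) = 1"
  by (simp add: norm_exp_i_times)

lemma fourier_integrable:
  assumes "integrable lborel f"
  shows "integrable lborel (\<lambda>u. exp (\<i> * of_real (y * u)) * f u)"
proof -
  have [measurable]: "f \<in> borel_measurable borel" using assms by auto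
  show ?thesis
    by (rule Bochner_Integration.integrable_bound[OF assms]) (auto simp: norm_mult simp del: of_real_mult)
qed

lemma fourier_norm_le:
  assumes "integrable lborel f"
  shows "norm (fourier f y) \<le> (\<integral>u. norm (f u) \<partial>lborel)"
proof -
  have "norm (fourier f y) \<le> (\<integral>u. norm (exp (\<i> * of_real (y * u)) * f u) \<partial>lborel)"
    unfolding fourier_def by (rule integral_norm_bound)
  also have "\<dots> = (\<integral>u. norm (f u) \<partial>lborel)" by (simp add: norm_mult del: of_real_mult)
  finally show ?thesis .
qed

lemma fourier_add:
  assumes "integrable lborel f" "integrable lborel g"
  shows "fourier (\<lambda>x. f x + g x) y = fourier f y + fourier g y"
  using fourier_integrable[OF assms(1)] fourier_integrable[OF assms(2)]
  by (simp add: fourier_def ring_distribs del: of_real_mult)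

lemma fourier_cmult: "fourier (\<lambda>x. c * f x) y = c * fourier f y"
  unfolding fourier_def by (subst integral_mult_right_zero[symmetric]) (simp add: ac_simps)

lemma square_integrable_complex_of_real:
  "square_integrable M f \<Longrightarrow> square_integrable M (\<lambda>x. complex_of_real (f x))"
  by (auto simp: square_integrable_def)

lemma square_integrable_Re: "square_integrable M f \<Longrightarrow> square_integrable M (\<lambda>x. Re (f x))"
  by (rule square_integrable_bound[of M f]) (auto simp: square_integrable_def abs_Re_le_cmod)

lemma square_integrable_Im: "square_integrable M f \<Longrightarrow> square_integrable M (\<lambda>x. Im (f x))"
  by (rule square_integrable_bound[of M f]) (auto simp: square_integrable_def abs_Im_le_cmod)

lemma square_integrable_cnj: "square_integrable M f \<Longrightarrow> square_integrable M (\<lambda>x. cnj (f x))"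
  by (auto simp: square_integrable_def)

lemma L2_translation_continuous_complex:
  fixes f :: "real \<Rightarrow> complex"
  assumes f: "square_integrable lborel f" and w: "w \<longlonglongrightarrow> 0"
  shows "(\<lambda>n. L2norm lborel (\<lambda>t. f (t - w n) - f t)) \<longlonglongrightarrow> 0"
proof -
  let ?a = "\<lambda>n. L2norm lborel (\<lambda>t. Re (f (t - w n)) - Re (f t))"
  let ?b = "\<lambda>n. L2norm lborel (\<lambda>t. Im (f (t - w n)) - Im (f t))"
  have "(\<lambda>n. ?a n + ?b n) \<longlonglongrightarrow> 0 + 0"
    by (intro tendsto_add L2_translation_continuous square_integrable_Re square_integrable_Im f w)
  then have l: "(\<lambda>n. ?a n + ?b n) \<longlonglongrightarrow> 0" by simp
  have "L2norm lborel (\<lambda>t. f (t - w n) - f t) \<le> ?a n + ?b n" for n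
  proof -
    define h where "h t = f (t - w n) - f t" for t
    have h: "square_integrable lborel h"
      unfolding h_def by (intro square_integrable_diff square_integrable_shift f)
    have "L2norm lborel h = L2norm lborel (\<lambda>t. complex_of_real (Re (h t)) + \<i> * complex_of_real (Im (h t)))"
      by (intro L2norm_cong) (simp add: complex_eq[symmetric])
    also have "\<dots> \<le> L2norm lborel (\<lambda>t. complex_of_real (Re (h t))) + L2norm lborel (\<lambda>t. \<i> * complex_of_real (Im (h t)))"
      by (intro L2norm_triangle square_integrable_cmult square_integrable_complex_of_real square_integrable_Re
          square_integrable_Im h)
    also have "\<dots> = L2norm lborel (\<lambda>t. Re (h t)) + L2norm lborel (\<lambda>t. Im (h t))"
      by (intro arg_cong2[where f="(+)"] L2norm_cong) (auto simp: norm_mult)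
    finally show ?thesis by (simp add: h_def[abs_def])
  qed
  then show ?thesis
    by (intro tendsto_sandwich[OF _ _ tendsto_const l]) auto
qed

context
  fixes f :: "real \<Rightarrow> complex"
  assumes f1: "integrable lborel f" and f2: "square_integrable lborel f"
begin

private lemma f_meas [measurable]: "f \<in> borel_measurable borel"
  using f1 by auto

text \<open>The autocorrelation of \<open>f\<close>. Its Fourier transform is
  \<open>|fourier f|^2\<close> and \<open>C 0\<close> is the squared norm of \<open>f\<close>, so
  Plancherel's identity is Fourier inversion of \<open>C\<close> at the single point 0, for which
  continuity at 0 is enough.\<close>

private definition C where "C w = (\<integral>u. f u * cnj (f (u - w)) \<partial>lborel)"

private lemma C_bound: "norm (C w) \<le> (L2norm lborel f)\<^sup>2"
  using L2_inner_bound[OF f2 square_integrable_cnj[OF square_integrable_shift(1)[OF f2, of w]]]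
    L2norm_shift(1)[of f w] L2norm_cong[of lborel "\<lambda>u. cnj (f (u - w))" "\<lambda>u. f (u - w)"]
  by (simp add: C_def power2_eq_square)

private lemma C_0: "C 0 = of_real ((L2norm lborel f)\<^sup>2)"
proof -
  have "C 0 = (\<integral>u. complex_of_real ((norm (f u))\<^sup>2) \<partial>lborel)"
    unfolding C_def by (simp add: complex_norm_square[symmetric])
  then show ?thesis by (simp only: L2norm_power2 integral_complex_of_real)
qed

private lemma C_measurable [measurable]: "C \<in> borel_measurable borel"
  unfolding C_def[abs_def] by measurable

private lemma C_tendsto:
  assumes w: "w \<longlonglongrightarrow> 0"
  shows "(\<lambda>n. C (w n)) \<longlonglongrightarrow> C 0"
proof -
  have "(\<lambda>n. C (w n) - C 0) \<longlonglongrightarrow> 0"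
  proof (rule Lim_null_comparison)
    show "(\<lambda>n. L2norm lborel f * L2norm lborel (\<lambda>t. f (t - w n) - f t)) \<longlonglongrightarrow> 0"
      by (intro tendsto_mult_right_zero L2_translation_continuous_complex[OF f2 w])
    have "norm (C (w n) - C 0) \<le> L2norm lborel f * L2norm lborel (\<lambda>t. f (t - w n) - f t)" for n
    proof -
      note s = square_integrable_cnj[OF square_integrable_shift(1)[OF f2, of "w n"]] square_integrable_cnj[OF f2]
      have "C (w n) - C 0 = (\<integral>u. f u * cnj (f (u - w n)) - f u * cnj (f u) \<partial>lborel)"
        unfolding C_def using square_integrable_mult[OF f2 s(1)] square_integrable_mult[OF f2 s(2)]
        by (subst Bochner_Integration.integral_diff) auto
      also have "\<dots> = (\<integral>u. f u * (cnj (f (u - w n)) - cnj (f u)) \<partial>lborel)" by (simp add: right_diff_distrib)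
      also have "norm \<dots> \<le> L2norm lborel f * L2norm lborel (\<lambda>u. cnj (f (u - w n)) - cnj (f u))"
        by (intro L2_inner_bound f2 square_integrable_diff s)
      also have "L2norm lborel (\<lambda>u. cnj (f (u - w n)) - cnj (f u)) = L2norm lborel (\<lambda>t. f (t - w n) - f t)"
        by (intro L2norm_cong) (simp flip: complex_cnj_diff)
      finally show ?thesis .
    qed
    then show "\<forall>\<^sub>F n in sequentially. norm (C (w n) - C 0) \<le> L2norm lborel f * L2norm lborel (\<lambda>t. f (t - w n) - f t)"
      by simp
  qed
  then show ?thesis by (rule LIM_zero_cancel)
qed

private lemma fourier_abs2:
  "complex_of_real ((norm (fourier f z))\<^sup>2)
    = (\<integral>p. exp (\<i> * of_real (z * (fst p - snd p))) * (f (fst p) * cnj (f (snd p))) \<partial>(lborel \<Otimes>\<^sub>M lborel))" (is ?eq)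
  and fourier_abs2_integrable: "integrable (lborel \<Otimes>\<^sub>M lborel) (\<lambda>p. f (fst p) * cnj (f (snd p)))" (is ?int)
proof -
  show int: ?int
  proof (rule lborel_pair.Fubini_integrable)
    show "integrable lborel (\<lambda>u. \<integral>v. norm (f (fst (u, v)) * cnj (f (snd (u, v)))) \<partial>lborel)"
      using f1 by (simp add: norm_mult)
    show "AE u in lborel. integrable lborel (\<lambda>v. f (fst (u, v)) * cnj (f (snd (u, v))))"
      using f1 by simp
  qed measurable
  have int': "integrable (lborel \<Otimes>\<^sub>M lborel) (\<lambda>p. exp (\<i> * of_real (z * (fst p - snd p))) * (f (fst p) * cnj (f (snd p))))"
    by (rule Bochner_Integration.integrable_bound[OF int]) (auto simp: norm_mult simp del: of_real_mult of_real_diff)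
  have e: "exp (\<i> * of_real (z * (u - v))) * (f u * cnj (f v))
      = (exp (\<i> * of_real (z * u)) * f u) * cnj (exp (\<i> * of_real (z * v)) * f v)" for u v
  proof -
    have "exp (\<i> * of_real (z * (u - v))) = exp (\<i> * of_real (z * u)) * exp (- (\<i> * of_real (z * v)))"
      by (simp flip: exp_add add: algebra_simps)
    also have "exp (- (\<i> * of_real (z * v))) = cnj (exp (\<i> * of_real (z * v)))"
      by (simp add: exp_cnj)
    finally show ?thesis by (simp add: ac_simps)
  qed
  have c: "(\<integral>v. cnj (exp (\<i> * of_real (z * v)) * f v) \<partial>lborel) = cnj (fourier f z)"
    unfolding fourier_def by (rule Bochner_Integration.integral_cnj)
  have "(\<integral>p. exp (\<i> * of_real (z * (fst p - snd p))) * (f (fst p) * cnj (f (snd p))) \<partial>(lborel \<Otimes>\<^sub>M lborel))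
      = (\<integral>u. \<integral>v. exp (\<i> * of_real (z * (u - v))) * (f u * cnj (f v)) \<partial>lborel \<partial>lborel)"
    by (subst lborel_pair.integral_fst'[OF int', symmetric]) simp
  also have "\<dots> = (\<integral>u. (exp (\<i> * of_real (z * u)) * f u) * cnj (fourier f z) \<partial>lborel)"
    unfolding e by (simp only: integral_mult_right_zero c)
  also have "\<dots> = fourier f z * cnj (fourier f z)"
    by (simp only: integral_mult_left_zero fourier_def)
  also have "\<dots> = complex_of_real ((norm (fourier f z))\<^sup>2)"
    by (rule complex_norm_square[symmetric])
  finally show ?eq by simp
qed

text \<open>The integrability of \<open>|fourier f|^2\<close> is not yet known, so a Gaussian weight
  is inserted to justify Fubini's theorem. As the characteristic function of a Gaussian is again
  Gaussian, the weighted integral becomes a Gaussian mean of the autocorrelation at scale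
  \<open>s\<close>.\<close>

private lemma gaussian_average:
  assumes s: "0 < s"
  shows "(\<integral>y. (norm (fourier f y))\<^sup>2 * std_normal_density (s * y) \<partial>lborel)
    = Re (\<integral>w. complex_of_real (exp (- (w\<^sup>2) / 2)) * C (s * w) \<partial>lborel)"
proof -
  let ?N = "std_normal_distribution"
  let ?P = "lborel \<Otimes>\<^sub>M lborel :: (real \<times> real) measure"
  let ?G = "\<lambda>p. f (fst p) * cnj (f (snd p))"
  interpret N: prob_space ?N by (rule prob_space_normal_density) simp
  interpret NP: pair_sigma_finite ?N ?P
    by (intro pair_sigma_finite.intro N.sigma_finite_measure_axioms lborel_pair.sigma_finite_measure_axioms)
  have "(\<integral>x. complex_of_real ((norm (fourier f (x / s)))\<^sup>2) \<partial>?N)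
    = (\<integral>x. (\<integral>p. exp (\<i> * of_real (x / s * (fst p - snd p))) * ?G p \<partial>?P) \<partial>?N)"
    unfolding fourier_abs2 ..
  also have "\<dots> = (\<integral>p. (\<integral>x. exp (\<i> * of_real (x / s * (fst p - snd p))) * ?G p \<partial>?N) \<partial>?P)"
  proof (rule NP.Fubini_integral[symmetric], rule NP.Fubini_integrable)
    have "integrable ?P (\<lambda>p. exp (\<i> * of_real (x / s * (fst p - snd p))) * ?G p)" for x
      by (rule Bochner_Integration.integrable_bound[OF fourier_abs2_integrable])
         (auto simp: norm_mult simp del: of_real_mult of_real_diff of_real_divide)
    then show "AE x in ?N. integrable ?P (\<lambda>p. (case (x, p) of (x, p) \<Rightarrow> exp (\<i> * of_real (x / s * (fst p - snd p))) * ?G p))"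
      by simp
    show "integrable ?N (\<lambda>x. \<integral>p. norm (case (x, p) of (x, p) \<Rightarrow> exp (\<i> * of_real (x / s * (fst p - snd p))) * ?G p) \<partial>?P)"
      by (simp add: norm_mult del: of_real_mult of_real_diff of_real_divide)
  qed measurable
  also have "\<dots> = (\<integral>p. complex_of_real (exp (- ((fst p - snd p) / s)\<^sup>2 / 2)) * ?G p \<partial>?P)"
  proof (intro Bochner_Integration.integral_cong refl)
    fix p :: "real \<times> real"
    have "(\<integral>x. exp (\<i> * of_real (x / s * (fst p - snd p))) * ?G p \<partial>?N)
        = (\<integral>x. exp (\<i> * of_real ((fst p - snd p) / s * x)) \<partial>?N) * ?G p"
      by (subst integral_mult_left_zero[symmetric]) (simp add: mult.commute)
    also have "(\<integral>x. exp (\<i> * of_real ((fst p - snd p) / s * x)) \<partial>?N) = complex_of_real (exp (- ((fst p - snd p) / s)\<^sup>2 / 2))"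
      using fun_cong[OF char_std_normal_distribution, of "(fst p - snd p) / s"] by (simp add: char_def)
    finally show "(\<integral>x. exp (\<i> * of_real (x / s * (fst p - snd p))) * ?G p \<partial>?N)
        = complex_of_real (exp (- ((fst p - snd p) / s)\<^sup>2 / 2)) * ?G p" .
  qed
  also have "\<dots> = (\<integral>u. \<integral>v. complex_of_real (exp (- ((u - v) / s)\<^sup>2 / 2)) * (f u * cnj (f v)) \<partial>lborel \<partial>lborel)"
  proof (subst lborel_pair.integral_fst'[symmetric])
    show "integrable ?P (\<lambda>p. complex_of_real (exp (- ((fst p - snd p) / s)\<^sup>2 / 2)) * ?G p)"
      by (rule Bochner_Integration.integrable_bound[OF fourier_abs2_integrable])
         (auto simp: norm_mult mult_left_le_one_le)
  qed simp
  \<comment> \<open>The substitution \<open>v = u - s * w\<close> turns the exponent into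
    \<open>w^2 / 2\<close> and pairs \<open>f u\<close> with its shift by \<open>s * w\<close>, the
    integrand of \<open>C (s * w)\<close>.\<close>
  also have "\<dots> = (\<integral>u. s *\<^sub>R (\<integral>w. complex_of_real (exp (- (w\<^sup>2) / 2)) * (f u * cnj (f (u - s * w))) \<partial>lborel) \<partial>lborel)"
  proof (intro Bochner_Integration.integral_cong refl)
    fix u
    show "(\<integral>v. complex_of_real (exp (- ((u - v) / s)\<^sup>2 / 2)) * (f u * cnj (f v)) \<partial>lborel)
        = s *\<^sub>R (\<integral>w. complex_of_real (exp (- (w\<^sup>2) / 2)) * (f u * cnj (f (u - s * w))) \<partial>lborel)"
      using s lborel_integral_real_affine[of "- s" "\<lambda>v. complex_of_real (exp (- ((u - v) / s)\<^sup>2 / 2)) * (f u * cnj (f v))" u]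
      by simp
  qed
  also have "\<dots> = s *\<^sub>R (\<integral>u. (\<integral>w. complex_of_real (exp (- (w\<^sup>2) / 2)) * (f u * cnj (f (u - s * w))) \<partial>lborel) \<partial>lborel)"
    by simp
  also have "(\<integral>u. (\<integral>w. complex_of_real (exp (- (w\<^sup>2) / 2)) * (f u * cnj (f (u - s * w))) \<partial>lborel) \<partial>lborel)
      = (\<integral>w. (\<integral>u. complex_of_real (exp (- (w\<^sup>2) / 2)) * (f u * cnj (f (u - s * w))) \<partial>lborel) \<partial>lborel)"
  proof (rule lborel_pair.Fubini_integral, rule lborel_pair.Fubini_integrable)
    note si = square_integrable_cnj[OF square_integrable_shift(1)[OF f2]]
    have i: "integrable lborel (\<lambda>u. f u * cnj (f (u - s * w)))" for w
      by (rule square_integrable_mult[OF f2 si])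
    then show "AE w in lborel. integrable lborel (\<lambda>u. (case (w, u) of (w, u) \<Rightarrow>
        complex_of_real (exp (- (w\<^sup>2) / 2)) * (f u * cnj (f (u - s * w)))))"
      by simp
    have g: "integrable lborel (\<lambda>w. sqrt (2 * pi) * std_normal_density w * (L2norm lborel f)\<^sup>2)"
      by (intro integrable_mult_left integrable_mult_right integrable_normal_density) simp
    show "integrable lborel (\<lambda>w. \<integral>u. norm (case (w, u) of (w, u) \<Rightarrow>
        complex_of_real (exp (- (w\<^sup>2) / 2)) * (f u * cnj (f (u - s * w)))) \<partial>lborel)"
    proof (rule Bochner_Integration.integrable_bound[OF g])
      have "(\<integral>u. norm (complex_of_real (exp (- (w\<^sup>2) / 2)) * (f u * cnj (f (u - s * w)))) \<partial>lborel)
          \<le> exp (- (w\<^sup>2) / 2) * (L2norm lborel f)\<^sup>2" for w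
      proof -
        have "(\<integral>u. norm (f u) * norm (cnj (f (u - s * w))) \<partial>lborel)
          \<le> L2norm lborel f * L2norm lborel (\<lambda>u. cnj (f (u - s * w)))"
          by (rule L2_Cauchy_Schwarz[OF f2 si])
        also have "L2norm lborel (\<lambda>u. cnj (f (u - s * w))) = L2norm lborel f"
          using L2norm_shift(1)[of f "s * w"] L2norm_cong[of lborel "\<lambda>u. cnj (f (u - s * w))" "\<lambda>u. f (u - s * w)"] by simp
        finally show ?thesis by (simp add: norm_mult power2_eq_square)
      qed
      then show "AE w in lborel. norm (\<integral>u. norm (case (w, u) of (w, u) \<Rightarrow>
        complex_of_real (exp (- (w\<^sup>2) / 2)) * (f u * cnj (f (u - s * w)))) \<partial>lborel)
        \<le> norm (sqrt (2 * pi) * std_normal_density w * (L2norm lborel f)\<^sup>2)"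
        by (intro AE_I2) (simp add: std_normal_density_def)
    qed measurable
  qed measurable
  also have "\<dots> = (\<integral>w. complex_of_real (exp (- (w\<^sup>2) / 2)) * C (s * w) \<partial>lborel)"
    unfolding C_def by (intro Bochner_Integration.integral_cong refl) simp
  finally have A: "(\<integral>x. complex_of_real ((norm (fourier f (x / s)))\<^sup>2) \<partial>?N)
      = s *\<^sub>R (\<integral>w. complex_of_real (exp (- (w\<^sup>2) / 2)) * C (s * w) \<partial>lborel)" .
  have "(\<integral>x. complex_of_real ((norm (fourier f (x / s)))\<^sup>2) \<partial>?N)
      = complex_of_real (\<integral>x. (norm (fourier f (x / s)))\<^sup>2 \<partial>?N)"
    by (rule integral_complex_of_real)
  also have "(\<integral>x. (norm (fourier f (x / s)))\<^sup>2 \<partial>?N)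
      = (\<integral>x. std_normal_density x * (norm (fourier f (x / s)))\<^sup>2 \<partial>lborel)"
    by (subst integral_density) (auto simp: normal_density_nonneg)
  also have "\<dots> = s * (\<integral>y. std_normal_density (s * y) * (norm (fourier f y))\<^sup>2 \<partial>lborel)"
    using s by (subst lborel_integral_real_affine[of s _ 0]) auto
  finally have "complex_of_real (s * (\<integral>y. std_normal_density (s * y) * (norm (fourier f y))\<^sup>2 \<partial>lborel))
      = s *\<^sub>R (\<integral>w. complex_of_real (exp (- (w\<^sup>2) / 2)) * C (s * w) \<partial>lborel)"
    using A by simp
  then have "complex_of_real (\<integral>y. std_normal_density (s * y) * (norm (fourier f y))\<^sup>2 \<partial>lborel)
      = (\<integral>w. complex_of_real (exp (- (w\<^sup>2) / 2)) * C (s * w) \<partial>lborel)"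
    using s by (simp add: scaleR_conv_of_real)
  from arg_cong[OF this, of Re] show ?thesis by (simp only: Re_complex_of_real mult.commute)
qed

text \<open>As the Gaussian weights flatten, the averages of \<open>C\<close> tend to a multiple of
  \<open>C 0\<close>. Fatou's lemma first yields that \<open>fourier f\<close> is square integrable,
  which then serves as its own majorant and gives equality of the norms. The factor
  \<open>sqrt (2 * pi)\<close> reflects that \<open>fourier\<close> carries no normalising
  constant.\<close>

theorem plancherel: "square_integrable lborel (fourier f)"
  "L2norm lborel (fourier f) = sqrt (2 * pi) * L2norm lborel f"
proof -
  define s where "s n = 1 / (real n + 1)" for n
  have s: "s n > 0" for n by (simp add: s_def)
  have s0: "s \<longlonglongrightarrow> 0" unfolding s_def by real_asymp
  \<comment> \<open>The weight is split evenly between the two factors of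
    \<open>|fourier f|^2\<close>: the exponent with denominator 4 squares to that of the normal
    density. Thus Gaussian averages become squared norms of \<open>F n\<close>.\<close>
  define F where "F n y = complex_of_real (exp (- ((s n * y)\<^sup>2) / 4)) * fourier f y" for n y
  have [measurable]: "F n \<in> borel_measurable borel" for n unfolding F_def by measurable
  have e2: "(exp (- ((s n * y)\<^sup>2) / 4))\<^sup>2 = sqrt (2 * pi) * std_normal_density (s n * y)" for n y
    by (simp add: std_normal_density_def power2_eq_square flip: exp_add)
  have F2: "(norm (F n y))\<^sup>2 = sqrt (2 * pi) * ((norm (fourier f y))\<^sup>2 * std_normal_density (s n * y))" for n y
  proof -
    have "(norm (F n y))\<^sup>2 = (exp (- ((s n * y)\<^sup>2) / 4))\<^sup>2 * (norm (fourier f y))\<^sup>2"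
      unfolding F_def norm_mult power_mult_distrib[of "norm _"] by simp
    then show ?thesis unfolding e2 by simp
  qed
  have Fs: "square_integrable lborel (F n)" for n
  proof -
    have "integrable lborel (\<lambda>y. std_normal_density (0 + s n * y))"
      using s[of n] by (intro lborel_integrable_real_affine integrable_normal_density) auto
    then have i: "integrable lborel (\<lambda>y. sqrt (2 * pi) * ((\<integral>u. norm (f u) \<partial>lborel)\<^sup>2 * std_normal_density (s n * y)))"
      by simp
    have "integrable lborel (\<lambda>y. (norm (F n y))\<^sup>2)"
    proof (rule Bochner_Integration.integrable_bound[OF i])
      have "(norm (fourier f y))\<^sup>2 \<le> (\<integral>u. norm (f u) \<partial>lborel)\<^sup>2" for y
        by (intro power_mono fourier_norm_le f1) simp
      then show "AE y in lborel. norm ((norm (F n y))\<^sup>2)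
          \<le> norm (sqrt (2 * pi) * ((\<integral>u. norm (f u) \<partial>lborel)\<^sup>2 * std_normal_density (s n * y)))"
        unfolding F2 by (intro AE_I2) (simp add: abs_mult normal_density_nonneg mult_right_mono)
    qed measurable
    then show ?thesis by (simp add: square_integrable_def)
  qed
  have "(\<lambda>n. \<integral>w. complex_of_real (exp (- (w\<^sup>2) / 2)) * C (s n * w) \<partial>lborel) \<longlonglongrightarrow> (\<integral>w. complex_of_real (exp (- (w\<^sup>2) / 2)) * C 0 \<partial>lborel)"
  proof (rule integral_dominated_convergence[where w = "\<lambda>w. sqrt (2 * pi) * std_normal_density w * (L2norm lborel f)\<^sup>2"])
    show "integrable lborel (\<lambda>w. sqrt (2 * pi) * std_normal_density w * (L2norm lborel f)\<^sup>2)"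
      by (intro integrable_mult_left integrable_mult_right integrable_normal_density) simp
    show "AE w in lborel. (\<lambda>n. complex_of_real (exp (- (w\<^sup>2) / 2)) * C (s n * w)) \<longlonglongrightarrow> complex_of_real (exp (- (w\<^sup>2) / 2)) * C 0"
      by (intro AE_I2 tendsto_mult tendsto_const C_tendsto tendsto_mult_left_zero s0)
    show "AE w in lborel. norm (complex_of_real (exp (- (w\<^sup>2) / 2)) * C (s n * w))
        \<le> sqrt (2 * pi) * std_normal_density w * (L2norm lborel f)\<^sup>2" for n
      using C_bound by (intro AE_I2) (simp add: norm_mult std_normal_density_def)
  qed measurable
  also have "(\<integral>w. complex_of_real (exp (- (w\<^sup>2) / 2)) * C 0 \<partial>lborel) = complex_of_real (\<integral>w. exp (- (w\<^sup>2) / 2) \<partial>lborel) * C 0"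
    by (subst integral_mult_left_zero) (simp only: integral_complex_of_real)
  also have "(\<integral>w. exp (- (w\<^sup>2) / 2) \<partial>lborel) = (\<integral>w. sqrt (2 * pi) * std_normal_density w \<partial>lborel)"
    by (simp add: std_normal_density_def)
  also have "\<dots> = sqrt (2 * pi)" by simp
  finally have "(\<lambda>n. Re (\<integral>w. complex_of_real (exp (- (w\<^sup>2) / 2)) * C (s n * w) \<partial>lborel))
      \<longlonglongrightarrow> Re (complex_of_real (sqrt (2 * pi)) * C 0)"
    by (rule tendsto_Re)
  then have "(\<lambda>n. sqrt (2 * pi) * (\<integral>y. (norm (fourier f y))\<^sup>2 * std_normal_density (s n * y) \<partial>lborel))
      \<longlonglongrightarrow> sqrt (2 * pi) * (sqrt (2 * pi) * (L2norm lborel f)\<^sup>2)"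
    unfolding gaussian_average[OF s] by (intro tendsto_mult tendsto_const) (simp add: C_0)
  also have "sqrt (2 * pi) * (sqrt (2 * pi) * (L2norm lborel f)\<^sup>2) = (sqrt (2 * pi) * L2norm lborel f)\<^sup>2"
    by (simp add: power2_eq_square)
  also have "(\<lambda>n. sqrt (2 * pi) * (\<integral>y. (norm (fourier f y))\<^sup>2 * std_normal_density (s n * y) \<partial>lborel))
      = (\<lambda>n. (L2norm lborel (F n))\<^sup>2)"
    unfolding L2norm_power2 F2 by (simp del: real_sqrt_mult)
  finally have "(\<lambda>n. sqrt ((L2norm lborel (F n))\<^sup>2)) \<longlonglongrightarrow> sqrt ((sqrt (2 * pi) * L2norm lborel f)\<^sup>2)"
    by (rule tendsto_real_sqrt)
  then have lim: "(\<lambda>n. L2norm lborel (F n)) \<longlonglongrightarrow> sqrt (2 * pi) * L2norm lborel f"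
    by (simp only: real_sqrt_abs abs_of_nonneg L2norm_nonneg mult_nonneg_nonneg real_sqrt_ge_zero
        pi_ge_zero zero_le_mult_iff zero_le_numeral simp_thms)
  have Flim: "(\<lambda>n. F n y) \<longlonglongrightarrow> fourier f y" for y
  proof -
    have "(\<lambda>n. complex_of_real (exp (- ((s n * y)\<^sup>2) / 4)) * fourier f y)
        \<longlonglongrightarrow> complex_of_real (exp (- ((0 * y)\<^sup>2) / 4)) * fourier f y"
      by (intro tendsto_intros s0) auto
    then show ?thesis by (simp add: F_def)
  qed
  have "\<forall>\<^sub>F n in sequentially. L2norm lborel (F n) \<le> sqrt (2 * pi) * L2norm lborel f + 1"
    by (rule eventually_mono[OF order_tendstoD(2)[OF lim less_add_one]]) (rule less_imp_le)
  from L2_fatou(1)[OF Fs _ this] Flim show sq: "square_integrable lborel (fourier f)" by simp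
  have "L2_tendsto lborel F (fourier f) sequentially"
  proof (rule L2_dominated[OF _ _ sq])
    show "AE y in lborel. norm (F n y) \<le> norm (fourier f y)" for n
      by (intro AE_I2) (auto simp: F_def norm_mult mult_left_le_one_le)
  qed (use Flim in auto)
  then have "(\<lambda>n. L2norm lborel (F n)) \<longlonglongrightarrow> L2norm lborel (fourier f)" by (rule L2_tendsto_norm)
  then show "L2norm lborel (fourier f) = sqrt (2 * pi) * L2norm lborel f"
    using lim by (rule LIMSEQ_unique)
qed

end

section \<open>The Fourier transform of square-integrable functions\<close>

lemma has_fourier_L2I:
  assumes "integrable lborel f" "square_integrable lborel f"
  shows "has_fourier_L2 f (fourier f)"
  unfolding has_fourier_L2_def using assms plancherel(1)[OF assms]
  by (intro exI[of _ "\<lambda>n. f"]) (simp add: L2_tendsto_const)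

lemma has_fourier_L2_square_integrable:
  assumes "has_fourier_L2 f \<phi>"
  shows "square_integrable lborel f" "square_integrable lborel \<phi>"
  using assms by (auto simp: has_fourier_L2_def L2_tendsto_def)

lemma has_fourier_L2_norm:
  assumes "has_fourier_L2 f \<phi>"
  shows "L2norm lborel \<phi> = sqrt (2 * pi) * L2norm lborel f"
proof -
  obtain fs where fs: "\<And>n. integrable lborel (fs n)" "L2_tendsto lborel fs f sequentially"
    "L2_tendsto lborel (\<lambda>n. fourier (fs n)) \<phi> sequentially"
    using assms by (auto simp: has_fourier_L2_def)
  have ev: "\<forall>\<^sub>F n in sequentially. square_integrable lborel (fs n)"
    using fs(2) by (auto simp: L2_tendsto_def)
  have 1: "(\<lambda>n. sqrt (2 * pi) * L2norm lborel (fs n)) \<longlonglongrightarrow> sqrt (2 * pi) * L2norm lborel f"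
    by (intro tendsto_mult tendsto_const L2_tendsto_norm fs)
  have 2: "(\<lambda>n. L2norm lborel (fourier (fs n))) \<longlonglongrightarrow> L2norm lborel \<phi>"
    by (intro L2_tendsto_norm fs)
  have "\<forall>\<^sub>F n in sequentially. L2norm lborel (fourier (fs n)) = sqrt (2 * pi) * L2norm lborel (fs n)"
    using ev by eventually_elim (rule plancherel(2)[OF fs(1)])
  from tendsto_cong[OF this] 1 have "(\<lambda>n. L2norm lborel (fourier (fs n))) \<longlonglongrightarrow> sqrt (2 * pi) * L2norm lborel f"
    by (rule iffD2)
  with 2 show ?thesis by (rule LIMSEQ_unique)
qed

lemma has_fourier_L2_add:
  assumes "has_fourier_L2 f \<phi>" "has_fourier_L2 g \<psi>"
  shows "has_fourier_L2 (\<lambda>x. f x + g x) (\<lambda>y. \<phi> y + \<psi> y)"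
proof -
  obtain fs where fs: "\<And>n. integrable lborel (fs n)" "L2_tendsto lborel fs f sequentially"
    "L2_tendsto lborel (\<lambda>n. fourier (fs n)) \<phi> sequentially"
    using assms(1) by (auto simp: has_fourier_L2_def)
  obtain gs where gs: "\<And>n. integrable lborel (gs n)" "L2_tendsto lborel gs g sequentially"
    "L2_tendsto lborel (\<lambda>n. fourier (gs n)) \<psi> sequentially"
    using assms(2) by (auto simp: has_fourier_L2_def)
  have "fourier (\<lambda>x. fs n x + gs n x) = (\<lambda>y. fourier (fs n) y + fourier (gs n) y)" for n
    using fourier_add[OF fs(1) gs(1)] by auto
  then show ?thesis
    unfolding has_fourier_L2_def using fs gs
    by (intro exI[of _ "\<lambda>n x. fs n x + gs n x"]) (auto intro: L2_tendsto_add)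
qed

lemma has_fourier_L2_cmult:
  assumes "has_fourier_L2 f \<phi>"
  shows "has_fourier_L2 (\<lambda>x. c * f x) (\<lambda>y. c * \<phi> y)"
proof -
  obtain fs where fs: "\<And>n. integrable lborel (fs n)" "L2_tendsto lborel fs f sequentially"
    "L2_tendsto lborel (\<lambda>n. fourier (fs n)) \<phi> sequentially"
    using assms by (auto simp: has_fourier_L2_def)
  have "fourier (\<lambda>x. c * fs n x) = (\<lambda>y. c * fourier (fs n) y)" for n
    using fourier_cmult[of c "fs n"] by auto
  then show ?thesis
    unfolding has_fourier_L2_def using fs
    by (intro exI[of _ "\<lambda>n x. c * fs n x"]) (auto intro: L2_tendsto_cmult)
qed

lemma has_fourier_L2_diff:
  assumes "has_fourier_L2 f \<phi>" "has_fourier_L2 g \<psi>"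
  shows "has_fourier_L2 (\<lambda>x. f x - g x) (\<lambda>y. \<phi> y - \<psi> y)"
  using has_fourier_L2_add[OF assms(1) has_fourier_L2_cmult[OF assms(2), of "-1"]] by simp

lemma has_fourier_L2_norm_diff:
  assumes "has_fourier_L2 f \<phi>" "has_fourier_L2 g \<psi>"
  shows "L2norm lborel (\<lambda>x. f x - g x) = L2norm lborel (\<lambda>y. \<phi> y - \<psi> y) / sqrt (2 * pi)"
  using has_fourier_L2_norm[OF has_fourier_L2_diff[OF assms]] by simp

text \<open>Injectivity is a consequence of the norm identity. All later identities between
  functions are derived by comparing transforms through this lemma.\<close>

lemma has_fourier_L2_unique:
  assumes "has_fourier_L2 f \<phi>" "has_fourier_L2 g \<psi>" "AE y in lborel. \<phi> y = \<psi> y"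
  shows "AE x in lborel. f x = g x"
proof -
  note s = has_fourier_L2_square_integrable[OF assms(1)] has_fourier_L2_square_integrable[OF assms(2)]
  have "AE y in lborel. \<phi> y - \<psi> y = 0" using assms(3) by eventually_elim simp
  then have "L2norm lborel (\<lambda>y. \<phi> y - \<psi> y) = 0"
    by (subst L2norm_eq_0_iff) (intro square_integrable_diff s)
  then have "L2norm lborel (\<lambda>x. f x - g x) = 0"
    using has_fourier_L2_norm_diff[OF assms(1,2)] by simp
  then have "AE x in lborel. f x - g x = 0"
    by (subst (asm) L2norm_eq_0_iff) (intro square_integrable_diff s)
  then show ?thesis by eventually_elim simp
qed

lemma has_fourier_L2_cong_AE:
  assumes "has_fourier_L2 f \<phi>" "g \<in> borel_measurable borel" "AE x in lborel. g x = f x"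
    "\<psi> \<in> borel_measurable borel" "AE y in lborel. \<psi> y = \<phi> y"
  shows "has_fourier_L2 g \<psi>"
proof -
  obtain fs where fs: "\<And>n. integrable lborel (fs n)" "L2_tendsto lborel fs f sequentially"
    "L2_tendsto lborel (\<lambda>n. fourier (fs n)) \<phi> sequentially"
    using assms(1) by (auto simp: has_fourier_L2_def)
  have [measurable]: "fs n \<in> borel_measurable borel" for n using fs(1)[of n] by auto
  have "L2_tendsto lborel fs g sequentially"
    by (rule L2_tendsto_cong_AE[OF fs(2)]) (use assms in auto)
  moreover have "L2_tendsto lborel (\<lambda>n. fourier (fs n)) \<psi> sequentially"
    by (rule L2_tendsto_cong_AE[OF fs(3)]) (use assms in auto)
  ultimately show ?thesis using fs(1) by (auto simp: has_fourier_L2_def)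
qed

text \<open>Each \<open>F n\<close> comes with its own approximating sequence. A diagonal choice
  picks one integrable \<open>h n\<close> that is close to \<open>F n\<close> and whose transform is
  simultaneously close to \<open>\<Phi> n\<close>.\<close>

lemma has_fourier_L2_limit:
  assumes F: "\<And>n. has_fourier_L2 (F n) (\<Phi> n)"
    and f: "L2_tendsto lborel F f sequentially" and \<phi>: "L2_tendsto lborel \<Phi> \<phi> sequentially"
  shows "has_fourier_L2 f \<phi>"
proof -
  let ?near = "\<lambda>n h. integrable lborel h \<and> square_integrable lborel h \<and> square_integrable lborel (fourier h) \<and>
    L2norm lborel (\<lambda>x. h x - F n x) < 1 / (real n + 1) \<and> L2norm lborel (\<lambda>y. fourier h y - \<Phi> n y) < 1 / (real n + 1)"
  have "\<exists>h. ?near n h" for n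
  proof -
    obtain fs where fs: "\<And>n. integrable lborel (fs n)" "L2_tendsto lborel fs (F n) sequentially"
      "L2_tendsto lborel (\<lambda>n. fourier (fs n)) (\<Phi> n) sequentially"
      using F[of n] by (auto simp: has_fourier_L2_def)
    have "\<forall>\<^sub>F k in sequentially. ?near n (fs k)"
    proof -
      have a: "\<forall>\<^sub>F k in sequentially. square_integrable lborel (fs k)"
        "\<forall>\<^sub>F k in sequentially. square_integrable lborel (fourier (fs k))"
        "(\<lambda>k. L2norm lborel (\<lambda>x. fs k x - F n x)) \<longlonglongrightarrow> 0"
        "(\<lambda>k. L2norm lborel (\<lambda>y. fourier (fs k) y - \<Phi> n y)) \<longlonglongrightarrow> 0"
        using fs by (auto simp: L2_tendsto_iff)
      have p: "0 < 1 / (real n + 1)" by simp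
      show ?thesis
        using a(1,2) order_tendstoD(2)[OF a(3) p] order_tendstoD(2)[OF a(4) p]
        by eventually_elim (use fs(1) in auto)
    qed
    then show ?thesis by (auto simp: eventually_sequentially)
  qed
  then obtain h where h: "\<And>n. ?near n (h n)" by metis
  have l: "(\<lambda>n. 1 / (real n + 1)) \<longlonglongrightarrow> 0" by real_asymp
  have s: "square_integrable lborel (F n)" "square_integrable lborel (\<Phi> n)" for n
    using has_fourier_L2_square_integrable[OF F] by auto
  have sf: "square_integrable lborel f" "square_integrable lborel \<phi>"
    "(\<lambda>n. L2norm lborel (\<lambda>x. F n x - f x)) \<longlonglongrightarrow> 0" "(\<lambda>n. L2norm lborel (\<lambda>x. \<Phi> n x - \<phi> x)) \<longlonglongrightarrow> 0"
    using f \<phi> by (auto simp: L2_tendsto_iff)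
  have "L2_tendsto lborel h f sequentially"
  proof (rule L2_tendsto_sandwich)
    have "L2norm lborel (\<lambda>x. h n x - f x) \<le> 1 / (real n + 1) + L2norm lborel (\<lambda>x. F n x - f x)" for n
      using L2norm_triangle_diff[of lborel "h n" "F n" f] h[of n] s sf(1) by auto
    then show "\<forall>\<^sub>F n in sequentially. L2norm lborel (\<lambda>x. h n x - f x) \<le> 1 / (real n + 1) + L2norm lborel (\<lambda>x. F n x - f x)"
      by simp
    show "(\<lambda>n. 1 / (real n + 1) + L2norm lborel (\<lambda>x. F n x - f x)) \<longlonglongrightarrow> 0"
      using tendsto_add[OF l sf(3)] by simp
  qed (use h sf in auto)
  moreover have "L2_tendsto lborel (\<lambda>n. fourier (h n)) \<phi> sequentially"
  proof (rule L2_tendsto_sandwich)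
    have "L2norm lborel (\<lambda>x. fourier (h n) x - \<phi> x) \<le> 1 / (real n + 1) + L2norm lborel (\<lambda>x. \<Phi> n x - \<phi> x)" for n
      using L2norm_triangle_diff[of lborel "fourier (h n)" "\<Phi> n" \<phi>] h[of n] s sf(2) by auto
    then show "\<forall>\<^sub>F n in sequentially. L2norm lborel (\<lambda>x. fourier (h n) x - \<phi> x) \<le> 1 / (real n + 1) + L2norm lborel (\<lambda>x. \<Phi> n x - \<phi> x)"
      by simp
    show "(\<lambda>n. 1 / (real n + 1) + L2norm lborel (\<lambda>x. \<Phi> n x - \<phi> x)) \<longlonglongrightarrow> 0"
      using tendsto_add[OF l sf(4)] by simp
  qed (use h sf in auto)
  ultimately show ?thesis using h by (auto simp: has_fourier_L2_def)
qed

lemma L2_tendsto_mult_bounded: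
  fixes f m :: "'a \<Rightarrow> complex"
  assumes "L2_tendsto M F f G" "m \<in> borel_measurable M" "\<And>x. norm (m x) \<le> c"
  shows "L2_tendsto M (\<lambda>i x. m x * F i x) (\<lambda>x. m x * f x) G"
proof -
  have sq: "square_integrable M (\<lambda>x. m x * h x)" and nm: "L2norm M (\<lambda>x. m x * h x) \<le> \<bar>c\<bar> * L2norm M h"
    if h: "square_integrable M h" for h :: "'a \<Rightarrow> complex"
  proof -
    note [measurable] = assms(2) square_integrable_measurable[OF h]
    have le: "norm (m x * h x) \<le> norm (complex_of_real c * h x)" for x
      using assms(3)[of x] by (auto simp: norm_mult intro!: mult_right_mono)
    show s: "square_integrable M (\<lambda>x. m x * h x)"
      by (rule square_integrable_bound[OF square_integrable_cmult[OF h, of "complex_of_real c"]])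
         (use le in auto)
    have "(L2norm M (\<lambda>x. m x * h x))\<^sup>2 \<le> (\<integral>x. c\<^sup>2 * (norm (h x))\<^sup>2 \<partial>M)"
      unfolding L2norm_power2
    proof (rule integral_mono)
      show "(norm (m x * h x))\<^sup>2 \<le> c\<^sup>2 * (norm (h x))\<^sup>2" for x
        using power_mono[OF le[of x], of 2] by (simp add: norm_mult power_mult_distrib)
    qed (use s h in \<open>auto simp: square_integrable_def\<close>)
    also have "\<dots> = (\<bar>c\<bar> * L2norm M h)\<^sup>2" by (simp add: power_mult_distrib L2norm_power2)
    finally show "L2norm M (\<lambda>x. m x * h x) \<le> \<bar>c\<bar> * L2norm M h" by (rule power2_le_imp_le) simp
  qed
  have s: "square_integrable M f" "\<forall>\<^sub>F i in G. square_integrable M (F i)"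
    "((\<lambda>i. L2norm M (\<lambda>x. F i x - f x)) \<longlongrightarrow> 0) G"
    using assms(1) by (auto simp: L2_tendsto_iff)
  show ?thesis
  proof (rule L2_tendsto_sandwich[OF sq[OF s(1)]])
    show "\<forall>\<^sub>F i in G. square_integrable M (\<lambda>x. m x * F i x)" using s(2) by eventually_elim (rule sq)
    show "\<forall>\<^sub>F i in G. L2norm M (\<lambda>x. m x * F i x - m x * f x) \<le> \<bar>c\<bar> * L2norm M (\<lambda>x. F i x - f x)"
      using s(2) by eventually_elim (use nm[OF square_integrable_diff] s(1) in \<open>simp add: right_diff_distrib\<close>)
    show "((\<lambda>i. \<bar>c\<bar> * L2norm M (\<lambda>x. F i x - f x)) \<longlongrightarrow> 0) G"
      by (intro tendsto_mult_right_zero s)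
  qed
qed

context
  fixes \<nu> :: "real measure"
  assumes \<nu>: "finite_measure \<nu>" and sets_\<nu>: "sets \<nu> = sets borel"
begin

lemma space_borel_measure: "space \<nu> = UNIV"
  using sets_eq_imp_space_eq[OF sets_\<nu>] by simp

lemma char_norm_le: "norm (char \<nu> y) \<le> measure \<nu> UNIV"
proof -
  interpret finite_measure \<nu> by (rule \<nu>)
  have "norm (char \<nu> y) \<le> (\<integral>v. norm (exp (\<i> * of_real (y * v))) \<partial>\<nu>)"
    unfolding char_def by (rule integral_norm_bound)
  also have "\<dots> = measure \<nu> UNIV" by (simp add: space_borel_measure del: of_real_mult)
  finally show ?thesis .
qed

lemma char_borel_measurable: "char \<nu> \<in> borel_measurable borel"
proof -
  interpret finite_measure \<nu> by (rule \<nu>)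
  have "(\<lambda>p. exp (\<i> * of_real (fst p * snd p))) \<in> borel_measurable (borel \<Otimes>\<^sub>M (borel :: real measure))" by measurable
  then have [measurable]: "(\<lambda>p. exp (\<i> * of_real (fst p * snd p))) \<in> borel_measurable (borel \<Otimes>\<^sub>M \<nu>)"
    by (subst measurable_cong_sets[OF sets_pair_measure_cong[OF refl sets_\<nu>] refl])
  show ?thesis unfolding char_def[abs_def] by measurable
qed

lemma conv_integrable_fourier:
  fixes f :: "real \<Rightarrow> complex"
  assumes f: "integrable lborel f"
  shows "integrable lborel (conv \<nu> f)" "fourier (conv \<nu> f) y = char \<nu> y * fourier f y"
proof -
  interpret finite_measure \<nu> by (rule \<nu>)
  interpret P: pair_sigma_finite \<nu> lborel
    by (intro pair_sigma_finite.intro sigma_finite_measure_axioms lborel.sigma_finite_measure_axioms)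
  have [measurable]: "f \<in> borel_measurable borel" using f by auto
  have m[measurable]: "(\<lambda>(v, t). f (t - v)) \<in> borel_measurable (\<nu> \<Otimes>\<^sub>M lborel)"
    by (rule conv_pair_measurable[OF \<nu> sets_\<nu>]) simp
  have sh: "integrable lborel (\<lambda>t. f (t - v))" "(\<integral>t. norm (f (t - v)) \<partial>lborel) = (\<integral>t. norm (f t) \<partial>lborel)" for v
    using lborel_integrable_real_affine[OF f, of 1 "-v"] lborel_integral_real_affine[of 1 "\<lambda>t. norm (f t)" "-v"]
    by simp_all
  have i: "integrable (\<nu> \<Otimes>\<^sub>M lborel) (\<lambda>(v, t). f (t - v))"
    by (rule P.Fubini_integrable) (auto simp: sh)
  show "integrable lborel (conv \<nu> f)"
    using P.integrable_snd[OF i] by (simp add: conv_def[abs_def])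
  have i2: "integrable (\<nu> \<Otimes>\<^sub>M lborel) (\<lambda>(v, t). exp (\<i> * of_real (y * t)) * f (t - v))"
    by (intro Bochner_Integration.integrable_bound[OF i])
       (simp_all add: norm_mult split_beta' del: of_real_mult)
  have "fourier (conv \<nu> f) y = (\<integral>t. (\<integral>v. exp (\<i> * of_real (y * t)) * f (t - v) \<partial>\<nu>) \<partial>lborel)"
    unfolding fourier_def conv_def by (simp only: integral_mult_right_zero)
  also have "\<dots> = (\<integral>v. (\<integral>t. exp (\<i> * of_real (y * t)) * f (t - v) \<partial>lborel) \<partial>\<nu>)"
    by (rule P.Fubini_integral[OF i2])
  also have "\<dots> = (\<integral>v. exp (\<i> * of_real (y * v)) * fourier f y \<partial>\<nu>)"
  proof (intro Bochner_Integration.integral_cong refl)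
    fix v
    have "(\<integral>t. exp (\<i> * of_real (y * t)) * f (t - v) \<partial>lborel)
        = (\<integral>t. exp (\<i> * of_real (y * v)) * (exp (\<i> * of_real (y * t)) * f t) \<partial>lborel)"
      using lborel_integral_real_affine[of 1 "\<lambda>t. exp (\<i> * of_real (y * t)) * f (t - v)" v]
      by (simp add: ring_distribs exp_add mult.assoc)
    then show "(\<integral>t. exp (\<i> * of_real (y * t)) * f (t - v) \<partial>lborel) = exp (\<i> * of_real (y * v)) * fourier f y"
      by (simp only: integral_mult_right_zero fourier_def)
  qed
  also have "\<dots> = char \<nu> y * fourier f y" by (simp only: integral_mult_left_zero char_def)
  finally show "fourier (conv \<nu> f) y = char \<nu> y * fourier f y" .
qed

text \<open>For integrable functions this is Fubini's theorem. It passes to L2 limits because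
  convolution with a finite measure and multiplication by the bounded function
  \<open>char \<nu>\<close> are both continuous there.\<close>

lemma has_fourier_L2_conv:
  assumes "has_fourier_L2 f \<phi>"
  shows "has_fourier_L2 (conv \<nu> f) (\<lambda>y. char \<nu> y * \<phi> y)"
proof -
  obtain fs where fs: "\<And>n. integrable lborel (fs n)" "L2_tendsto lborel fs f sequentially"
    "L2_tendsto lborel (\<lambda>n. fourier (fs n)) \<phi> sequentially"
    using assms by (auto simp: has_fourier_L2_def)
  have "L2_tendsto lborel (\<lambda>n. conv \<nu> (fs n)) (conv \<nu> f) sequentially"
    by (rule L2_tendsto_conv[OF \<nu> sets_\<nu> fs(2)])
  moreover have "L2_tendsto lborel (\<lambda>n y. char \<nu> y * fourier (fs n) y) (\<lambda>y. char \<nu> y * \<phi> y) sequentially"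
    by (rule L2_tendsto_mult_bounded[OF fs(3) _ char_norm_le]) (simp add: char_borel_measurable)
  then have "L2_tendsto lborel (\<lambda>n. fourier (conv \<nu> (fs n))) (\<lambda>y. char \<nu> y * \<phi> y) sequentially"
    unfolding conv_integrable_fourier(2)[OF fs(1), abs_def, symmetric] .
  ultimately show ?thesis
    unfolding has_fourier_L2_def using conv_integrable_fourier(1)[OF fs(1)]
    by (intro exI[of _ "\<lambda>n. conv \<nu> (fs n)"]) simp
qed

end

section \<open>The symbol of the fractional derivative\<close>

lemma has_integral_imp_lborel:
  fixes f :: "real \<Rightarrow> real"
  assumes [measurable]: "f \<in> borel_measurable borel" "S \<in> sets borel"
    and nonneg: "\<And>x. x \<in> S \<Longrightarrow> 0 \<le> f x" and I: "(f has_integral I) S"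
  shows "integrable lborel (\<lambda>x. indicator S x * f x)" "(\<integral>x. indicator S x * f x \<partial>lborel) = I"
proof -
  have "has_bochner_integral lborel (\<lambda>x. indicator S x * f x) I"
  proof (rule has_bochner_integral_nn_integral)
    show "(\<integral>\<^sup>+x. ennreal (indicator S x * f x) \<partial>lborel) = ennreal I"
      using nn_integral_has_integral_lebesgue[OF nonneg I] by simp
    show "0 \<le> I" by (rule has_integral_nonneg[OF I nonneg])
    show "AE x in lborel. 0 \<le> indicator S x * f x" using nonneg by (auto simp: indicator_def)
  qed measurable
  then show "integrable lborel (\<lambda>x. indicator S x * f x)" "(\<integral>x. indicator S x * f x \<partial>lborel) = I"
    by (auto simp: has_bochner_integral_iff)
qed

lemma powr_tail_integral:
  fixes a \<beta> :: real
  assumes a: "0 < a" and \<beta>: "0 < \<beta>"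
  shows "integrable lborel (\<lambda>u. indicator {a<..} u * u powr (-(1 + \<beta>)))"
    "(\<integral>u. indicator {a<..} u * u powr (-(1 + \<beta>)) \<partial>lborel) = a powr (-\<beta>) / \<beta>"
proof -
  have "(\<integral>\<^sup>+u. ennreal (u powr (-(1 + \<beta>))) * indicator {a..} u \<partial>lborel) = ennreal (0 - (- (a powr (-\<beta>) / \<beta>)))"
  proof (rule nn_integral_FTC_atLeast)
    show "((\<lambda>u. - (u powr (-\<beta>) / \<beta>)) has_real_derivative u powr (-(1 + \<beta>))) (at u)" if "a \<le> u" for u
    proof -
      have e: "-(1 + \<beta>) = -\<beta> - 1" by simp
      show ?thesis unfolding e using that a \<beta> by (auto intro!: derivative_eq_intros)
    qed
    show "((\<lambda>u. - (u powr (-\<beta>) / \<beta>)) \<longlongrightarrow> 0) at_top"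
      using \<beta> by real_asymp
  qed auto
  also have "(\<integral>\<^sup>+u. ennreal (u powr (-(1 + \<beta>))) * indicator {a..} u \<partial>lborel)
      = (\<integral>\<^sup>+u. ennreal (indicator {a<..} u * u powr (-(1 + \<beta>))) \<partial>lborel)"
    by (intro nn_integral_cong_AE eventually_mono[OF AE_lborel_singleton[of a]]) (auto simp: indicator_def)
  finally have "has_bochner_integral lborel (\<lambda>u. indicator {a<..} u * u powr (-(1 + \<beta>))) (a powr (-\<beta>) / \<beta>)"
    using \<beta> by (intro has_bochner_integral_nn_integral) auto
  then show "integrable lborel (\<lambda>u. indicator {a<..} u * u powr (-(1 + \<beta>)))"
    "(\<integral>u. indicator {a<..} u * u powr (-(1 + \<beta>)) \<partial>lborel) = a powr (-\<beta>) / \<beta>"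
    by (auto simp: has_bochner_integral_iff)
qed

lemma powr_head_integral:
  fixes a \<beta> :: real
  assumes a: "0 \<le> a" and \<beta>: "\<beta> < 1"
  shows "integrable lborel (\<lambda>u. indicator {0..a} u * u powr (-\<beta>))"
proof -
  have "((\<lambda>u. u powr (-\<beta>)) has_integral (a powr (-\<beta> + 1) / (-\<beta> + 1))) {0..a}"
    using a \<beta> by (intro has_integral_powr_from_0) auto
  then show ?thesis by (intro has_integral_imp_lborel(1)) auto
qed

text \<open>The majorant for everything built from \<open>1 - exp (- z u)\<close>: that factor is
  linear near 0, where \<open>\<beta> < 1\<close> makes the singularity integrable, and bounded at
  infinity, where \<open>0 < \<beta>\<close> does.\<close>

lemma powr_min_integrable:
  fixes A B \<beta> :: real
  assumes \<beta>: "0 < \<beta>" "\<beta> < 1" and AB: "0 \<le> A" "0 \<le> B"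
  shows "integrable lborel (\<lambda>u. indicator {0<..} u * u powr (-(1 + \<beta>)) * min A (B * u))"
proof -
  have i: "integrable lborel (\<lambda>u. B * (indicator {0..1} u * u powr (-\<beta>)) + A * (indicator {1<..} u * u powr (-(1 + \<beta>))))"
    using powr_head_integral[of 1 \<beta>] powr_tail_integral(1)[of 1 \<beta>] \<beta> by auto
  show ?thesis
  proof (rule Bochner_Integration.integrable_bound[OF i])
    have "\<bar>indicator {0<..} u * u powr (-(1 + \<beta>)) * min A (B * u)\<bar>
      \<le> \<bar>B * (indicator {0..1} u * u powr (-\<beta>)) + A * (indicator {1<..} u * u powr (-(1 + \<beta>)))\<bar>" for u
    proof (cases "u \<le> 0")
      case False
      then have p: "u powr (-\<beta>) = u * u powr (-(1 + \<beta>))"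
        by (simp add: powr_mult_base)
      have m: "0 \<le> min A (B * u)" "min A (B * u) \<le> B * u" "min A (B * u) \<le> A"
        using False AB by auto
      show ?thesis
      proof (cases "u \<le> 1")
        case True
        have "u powr (-(1 + \<beta>)) * min A (B * u) \<le> u powr (-(1 + \<beta>)) * (B * u)"
          using m by (intro mult_left_mono) auto
        then show ?thesis using True False p m AB by (simp add: ac_simps)
      next
        case False
        then show ?thesis using m AB by (simp add: mult_right_mono mult.commute)
      qed
    qed simp
    then show "AE u in lborel. norm (indicator {0<..} u * u powr (-(1 + \<beta>)) * min A (B * u))
      \<le> norm (B * (indicator {0..1} u * u powr (-\<beta>)) + A * (indicator {1<..} u * u powr (-(1 + \<beta>))))"
      by simp
  qed measurable
qed

lemma norm_exp_minus_diff_le: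
  assumes "r \<le> Re w" "r \<le> Re z" "0 \<le> u"
  shows "norm (exp (- (w * complex_of_real u)) - exp (- (z * complex_of_real u))) \<le> u * exp (- r * u) * norm (w - z)"
proof (rule field_differentiable_bound[of "{z. r \<le> Re z}"])
  show "convex {z. r \<le> Re z}" by (rule convex_halfspace_Re_ge)
  show "((\<lambda>z. exp (- (z * complex_of_real u))) has_field_derivative (- complex_of_real u * exp (- (z * complex_of_real u)))) (at z within {z. r \<le> Re z})" for z
    by (auto intro!: derivative_eq_intros)
  show "norm (- complex_of_real u * exp (- (z * complex_of_real u))) \<le> u * exp (- r * u)" if "z \<in> {z. r \<le> Re z}" for z
    using that assms by (auto simp: norm_mult intro!: mult_left_mono mult_right_mono)
qed (use assms in auto)

lemma norm_one_minus_exp_le: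
  assumes "0 \<le> Re z" "0 \<le> u"
  shows "norm (1 - exp (- (z * complex_of_real u))) \<le> min 2 (norm z * u)"
proof -
  have "norm (1 - exp (- (z * complex_of_real u))) \<le> norm (1::complex) + norm (exp (- (z * complex_of_real u)))"
    by (rule norm_triangle_ineq4)
  also have "\<dots> \<le> 2" using assms by simp
  finally show ?thesis
    using norm_exp_minus_diff_le[of 0 0 z u] assms by (simp add: mult.commute)
qed

text \<open>Up to a constant this is the Levy-Khintchine representation of the Laplace exponent of a
  \<open>\<beta>\<close>-stable subordinator. At \<open>z = -iy\<close> it is the symbol of the
  Marchaud derivative without its normalising factor.\<close>

definition frac_int :: "real \<Rightarrow> complex \<Rightarrow> complex" where
  "frac_int \<beta> z = (\<integral>u. (indicator {0<..} u * u powr (-(1 + \<beta>))) *\<^sub>R (1 - exp (- (z * complex_of_real u))) \<partial>lborel)"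

context
  fixes \<beta> :: real
  assumes \<beta>: "0 < \<beta>" "\<beta> < 1"
begin

private abbreviation "k u \<equiv> indicator {0<..} u * u powr (-(1 + \<beta>))"

lemma frac_integrand_bound:
  assumes "0 \<le> Re z" "norm z \<le> B"
  shows "norm (k u *\<^sub>R (1 - exp (- (z * complex_of_real u)))) \<le> k u * min 2 (B * u)"
proof (cases "u \<le> 0")
  case False
  have "norm (1 - exp (- (z * complex_of_real u))) \<le> min 2 (norm z * u)"
    using False assms by (intro norm_one_minus_exp_le) auto
  also have "\<dots> \<le> min 2 (B * u)" using assms False by (intro min.mono mult_right_mono) auto
  finally show ?thesis by (auto intro!: mult_left_mono)
qed simp

lemma frac_integrable:
  assumes "0 \<le> Re z"
  shows "integrable lborel (\<lambda>u. k u *\<^sub>R (1 - exp (- (z * complex_of_real u))))"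
  using powr_min_integrable[OF \<beta>, of 2 "norm z"] frac_integrand_bound[OF assms order_refl]
  by (intro Bochner_Integration.integrable_bound[OF powr_min_integrable[OF \<beta>, of 2 "norm z"]])
     (auto intro: order_trans[OF _ abs_ge_self])

text \<open>Continuity up to the imaginary axis, from where the formula found in the open half-plane
  is carried to the points \<open>-iy\<close>.\<close>

lemma frac_int_tendsto:
  assumes z: "\<And>n. 0 \<le> Re (z n)" and l: "z \<longlonglongrightarrow> l"
  shows "(\<lambda>n. frac_int \<beta> (z n)) \<longlonglongrightarrow> frac_int \<beta> l"
proof -
  obtain B where B: "\<And>n. norm (z n) \<le> B"
    using convergent_imp_bounded[OF l] by (auto simp: bounded_iff)
  then have "0 \<le> B" using norm_ge_zero order_trans by blast
  show ?thesis
    unfolding frac_int_def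
  proof (rule integral_dominated_convergence[where w = "\<lambda>u. k u * min 2 (B * u)"])
    show "integrable lborel (\<lambda>u. k u * min 2 (B * u))"
      by (rule powr_min_integrable[OF \<beta>]) (use \<open>0 \<le> B\<close> in auto)
    show "AE u in lborel. (\<lambda>n. k u *\<^sub>R (1 - exp (- (z n * complex_of_real u))))
        \<longlonglongrightarrow> k u *\<^sub>R (1 - exp (- (l * complex_of_real u)))"
      by (intro AE_I2 tendsto_intros l)
    show "AE u in lborel. norm (k u *\<^sub>R (1 - exp (- (z n * complex_of_real u)))) \<le> k u * min 2 (B * u)" for n
      by (intro AE_I2 frac_integrand_bound z B)
  qed measurable
qed

text \<open>Substituting \<open>c * u\<close> for \<open>u\<close> in the integral. Only positive
  factors are admissible, so homogeneity alone determines the function on each ray up to a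
  constant.\<close>

lemma frac_int_scale:
  assumes c: "0 < c"
  shows "frac_int \<beta> (of_real c * z) = complex_of_real (c powr \<beta>) * frac_int \<beta> z"
proof -
  let ?h = "\<lambda>u. k u *\<^sub>R (1 - exp (- (z * complex_of_real u)))"
  have e: "?h (0 + c * u) = (c powr (-(1 + \<beta>))) *\<^sub>R (k u *\<^sub>R (1 - exp (- (of_real c * z * complex_of_real u))))" for u
    using c by (simp add: indicator_def zero_less_mult_iff powr_mult mult_ac)
  have "frac_int \<beta> z = \<bar>c\<bar> *\<^sub>R (\<integral>u. ?h (0 + c * u) \<partial>lborel)"
    unfolding frac_int_def using c by (intro lborel_integral_real_affine) auto
  also have "(\<integral>u. ?h (0 + c * u) \<partial>lborel) = (c powr (-(1 + \<beta>))) *\<^sub>R frac_int \<beta> (of_real c * z)"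
    unfolding e frac_int_def by (rule Bochner_Integration.integral_scaleR_right)
  also have "\<bar>c\<bar> *\<^sub>R (c powr (-(1 + \<beta>))) *\<^sub>R frac_int \<beta> (of_real c * z) = (c powr (-\<beta>)) *\<^sub>R frac_int \<beta> (of_real c * z)"
    using c by (simp add: powr_mult_base)
  finally have "(c powr \<beta>) *\<^sub>R frac_int \<beta> z = (c powr \<beta> * c powr (-\<beta>)) *\<^sub>R frac_int \<beta> (of_real c * z)" by simp
  also have "c powr \<beta> * c powr (-\<beta>) = 1" using c by (simp flip: powr_add)
  finally show ?thesis by (simp add: scaleR_conv_of_real)
qed

text \<open>Differentiation under the integral sign. The value of the derivative is left open
  because Euler's equation will determine it.\<close>

lemma frac_int_differentiable:
  assumes z: "0 < Re z"
  obtains D where "(frac_int \<beta> has_field_derivative D) (at z)"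
proof -
  \<comment> \<open>On the half-plane of points with real part above \<open>r\<close> the difference
    quotients are bounded by \<open>u * exp (- r * u)\<close>. This is at most \<open>1 / r\<close>
    and at most \<open>u\<close>, hence within the scope of
    \<open>powr_min_integrable\<close>.\<close>
  define r where "r = Re z / 2"
  have r: "0 < r" "r < Re z" using z by (auto simp: r_def)
  let ?d = "\<lambda>u. k u *\<^sub>R (complex_of_real u * exp (- (z * complex_of_real u)))"
  have kb: "k u * (u * exp (- r * u)) \<le> k u * min (1 / r) (1 * u)" for u
  proof (cases "u \<le> 0")
    case False
    have "r * u \<le> exp (r * u)" using exp_ge_add_one_self[of "r * u"] by linarith
    then have "u * exp (- r * u) \<le> 1 / r" using r by (simp add: exp_minus field_simps)
    moreover have "u * exp (- r * u) \<le> u" using False r by (simp add: mult_le_cancel_left2)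
    ultimately show ?thesis by (intro mult_left_mono) auto
  qed simp
  have "((\<lambda>w. (frac_int \<beta> w - frac_int \<beta> z) / (w - z)) \<longlongrightarrow> (\<integral>u. ?d u \<partial>lborel)) (at z within {w. r < Re w})"
    unfolding tendsto_at_iff_sequentially
  proof (intro allI impI)
    fix X assume X: "\<forall>i. X i \<in> {w. r < Re w} - {z}" "X \<longlonglongrightarrow> z"
    have eq: "(frac_int \<beta> (X i) - frac_int \<beta> z) / (X i - z)
      = (\<integral>u. k u *\<^sub>R ((exp (- (z * complex_of_real u)) - exp (- (X i * complex_of_real u))) / (X i - z)) \<partial>lborel)" for i
    proof -
      have "0 \<le> Re (X i)" "0 \<le> Re z" using X r less_trans[of 0 r "Re (X i)"] by auto
      then have "frac_int \<beta> (X i) - frac_int \<beta> z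
        = (\<integral>u. k u *\<^sub>R (1 - exp (- (X i * complex_of_real u))) - k u *\<^sub>R (1 - exp (- (z * complex_of_real u))) \<partial>lborel)"
        unfolding frac_int_def by (intro Bochner_Integration.integral_diff[symmetric] frac_integrable)
      then have "(frac_int \<beta> (X i) - frac_int \<beta> z) / (X i - z)
        = (\<integral>u. (k u *\<^sub>R (1 - exp (- (X i * complex_of_real u))) - k u *\<^sub>R (1 - exp (- (z * complex_of_real u)))) / (X i - z) \<partial>lborel)"
        by simp
      also have "\<dots> = (\<integral>u. k u *\<^sub>R ((exp (- (z * complex_of_real u)) - exp (- (X i * complex_of_real u))) / (X i - z)) \<partial>lborel)"
        by (intro Bochner_Integration.integral_cong refl) (simp add: scaleR_conv_of_real algebra_simps diff_divide_distrib)
      finally show ?thesis .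
    qed
    show "((\<lambda>w. (frac_int \<beta> w - frac_int \<beta> z) / (w - z)) \<circ> X) \<longlonglongrightarrow> (\<integral>u. ?d u \<partial>lborel)"
      unfolding comp_def eq
    proof (rule integral_dominated_convergence[where w = "\<lambda>u. k u * min (1 / r) (1 * u)"])
      show "integrable lborel (\<lambda>u. k u * min (1 / r) (1 * u))"
        by (rule powr_min_integrable[OF \<beta>]) (use r in auto)
      show "AE u in lborel. (\<lambda>i. k u *\<^sub>R ((exp (- (z * complex_of_real u)) - exp (- (X i * complex_of_real u))) / (X i - z)))
          \<longlonglongrightarrow> ?d u"
      proof (intro AE_I2 tendsto_scaleR tendsto_const)
        fix u
        have "((\<lambda>w. - exp (- (w * complex_of_real u))) has_field_derivative (complex_of_real u * exp (- (z * complex_of_real u)))) (at z)"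
          by (auto intro!: derivative_eq_intros)
        then have "((\<lambda>w. (- exp (- (w * complex_of_real u)) - - exp (- (z * complex_of_real u))) / (w - z))
          \<longlongrightarrow> complex_of_real u * exp (- (z * complex_of_real u))) (at z within UNIV)"
          unfolding has_field_derivative_iff by simp
        from this[unfolded tendsto_at_iff_sequentially, rule_format, of X] X
        show "(\<lambda>i. (exp (- (z * complex_of_real u)) - exp (- (X i * complex_of_real u))) / (X i - z))
            \<longlonglongrightarrow> complex_of_real u * exp (- (z * complex_of_real u))"
          by (simp add: comp_def)
      qed
      show "AE u in lborel. norm (k u *\<^sub>R ((exp (- (z * complex_of_real u)) - exp (- (X i * complex_of_real u))) / (X i - z)))
          \<le> k u * min (1 / r) (1 * u)" for i
      proof (rule AE_I2)
        fix u
        show "norm (k u *\<^sub>R ((exp (- (z * complex_of_real u)) - exp (- (X i * complex_of_real u))) / (X i - z)))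
          \<le> k u * min (1 / r) (1 * u)"
        proof (cases "u \<le> 0")
          case False
          have Xi: "r \<le> Re (X i)" "X i \<noteq> z" using X(1) by (auto intro: less_imp_le)
          have "norm (exp (- (z * complex_of_real u)) - exp (- (X i * complex_of_real u))) \<le> u * exp (- r * u) * norm (z - X i)"
            using Xi r False by (intro norm_exp_minus_diff_le) auto
          then have "norm ((exp (- (z * complex_of_real u)) - exp (- (X i * complex_of_real u))) / (X i - z)) \<le> u * exp (- r * u)"
            using Xi(2) by (simp add: norm_divide norm_minus_commute[of z] divide_le_eq)
          then have "norm (k u *\<^sub>R ((exp (- (z * complex_of_real u)) - exp (- (X i * complex_of_real u))) / (X i - z)))
              \<le> k u * (u * exp (- r * u))"
            by (auto intro: mult_left_mono)
          also note kb
          finally show ?thesis .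
        qed simp
      qed
    qed measurable
  qed
  moreover have "at z within {w. r < Re w} = at z"
    using r by (intro at_within_open open_halfspace_Re_gt) auto
  ultimately show ?thesis by (intro that) (simp add: has_field_derivative_iff)
qed

text \<open>Write \<open>1 - exp (- u)\<close> as the integral of \<open>exp (- r)\<close> over
  \<open>0 \<le> r \<le> u\<close> and exchange the integrals: the tail of the power weight beyond
  \<open>r\<close> is \<open>r powr (-\<beta>) / \<beta>\<close>, which leaves the Gamma integral at
  \<open>1 - \<beta>\<close>.\<close>

lemma frac_int_1: "frac_int \<beta> 1 = complex_of_real (Gamma (1 - \<beta>) / \<beta>)"
proof -
  have G: "0 < Gamma (1 - \<beta>)" using \<beta> by (intro Gamma_real_pos) auto
  have "(\<integral>\<^sup>+u. ennreal (k u * (1 - exp (- u))) \<partial>lborel)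
    = (\<integral>\<^sup>+u. \<integral>\<^sup>+r. ennreal (k u) * (ennreal (exp (- r)) * indicator {0..u} r) \<partial>lborel \<partial>lborel)"
  proof (intro nn_integral_cong)
    fix u :: real
    show "ennreal (k u * (1 - exp (- u))) = (\<integral>\<^sup>+r. ennreal (k u) * (ennreal (exp (- r)) * indicator {0..u} r) \<partial>lborel)"
    proof (cases "u \<le> 0")
      case False
      have "(\<integral>\<^sup>+r. ennreal (exp (- r)) * indicator {0..u} r \<partial>lborel) = ennreal (- exp (- u) - (- exp (- 0)))"
        by (rule nn_integral_FTC_Icc) (use False in \<open>auto intro!: derivative_eq_intros\<close>)
      moreover have "ennreal (k u * (1 - exp (- u))) = ennreal (k u) * ennreal (1 - exp (- u))"
        by (rule ennreal_mult) (use False in auto)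
      moreover have "(\<integral>\<^sup>+r. ennreal (k u) * (ennreal (exp (- r)) * indicator {0..u} r) \<partial>lborel)
          = ennreal (k u) * (\<integral>\<^sup>+r. ennreal (exp (- r)) * indicator {0..u} r \<partial>lborel)"
        by (rule nn_integral_cmult) measurable
      ultimately show ?thesis by (simp only: minus_zero exp_zero diff_minus_eq_add uminus_add_conv_diff)
    qed simp
  qed
  also have "\<dots> = (\<integral>\<^sup>+r. \<integral>\<^sup>+u. ennreal (k u) * (ennreal (exp (- r)) * indicator {0..u} r) \<partial>lborel \<partial>lborel)"
    by (rule lborel_pair.Fubini', unfold indicator_def atLeastAtMost_iff greaterThan_iff) measurable
  also have "\<dots> = (\<integral>\<^sup>+r. ennreal (1 / \<beta>) * ennreal (indicator {0..} r * r powr ((1 - \<beta>) - 1) / exp r) \<partial>lborel)"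
  proof (intro nn_integral_cong_AE eventually_mono[OF AE_lborel_singleton[of 0]])
    fix r :: real assume r: "r \<noteq> 0"
    show "(\<integral>\<^sup>+u. ennreal (k u) * (ennreal (exp (- r)) * indicator {0..u} r) \<partial>lborel)
        = ennreal (1 / \<beta>) * ennreal (indicator {0..} r * r powr ((1 - \<beta>) - 1) / exp r)"
    proof (cases "r < 0")
      case True
      then have "indicator {0..u} r = (0::ennreal)" for u by (simp add: indicator_def)
      then show ?thesis using True by simp
    next
      case False
      have "(\<integral>\<^sup>+u. ennreal (k u) * (ennreal (exp (- r)) * indicator {0..u} r) \<partial>lborel)
          = (\<integral>\<^sup>+u. ennreal (exp (- r)) * ennreal (indicator {r<..} u * u powr (-(1 + \<beta>))) \<partial>lborel)"
        by (intro nn_integral_cong_AE eventually_mono[OF AE_lborel_singleton[of r]])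
           (use False r in \<open>auto simp: indicator_def mult.commute\<close>)
      also have "\<dots> = ennreal (exp (- r)) * ennreal (r powr (-\<beta>) / \<beta>)"
      proof (subst nn_integral_cmult)
        show "ennreal (exp (- r)) * (\<integral>\<^sup>+u. ennreal (indicator {r<..} u * u powr (-(1 + \<beta>))) \<partial>lborel)
            = ennreal (exp (- r)) * ennreal (r powr (-\<beta>) / \<beta>)"
          using nn_integral_eq_integral[OF powr_tail_integral(1)[of r \<beta>]] powr_tail_integral(2)[of r \<beta>] False r \<beta> by simp
      qed measurable
      also have "\<dots> = ennreal (1 / \<beta>) * ennreal (indicator {0..} r * r powr ((1 - \<beta>) - 1) / exp r)"
        using False \<beta> by (simp flip: ennreal_mult add: exp_minus field_simps)
      finally show ?thesis .
    qed
  qed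
  also have "\<dots> = ennreal (1 / \<beta>) * (\<integral>\<^sup>+r. ennreal (indicator {0..} r * r powr ((1 - \<beta>) - 1) / exp r) \<partial>lborel)"
    by (rule nn_integral_cmult) measurable
  also have "\<dots> = ennreal (Gamma (1 - \<beta>) / \<beta>)"
    using G \<beta> by (subst Gamma_conv_nn_integral_real[symmetric]) (simp_all flip: ennreal_mult)
  finally have "has_bochner_integral lborel (\<lambda>u. k u * (1 - exp (- u))) (Gamma (1 - \<beta>) / \<beta>)"
    using G \<beta> by (intro has_bochner_integral_nn_integral) (auto simp: indicator_def)
  then have "(\<integral>u. k u * (1 - exp (- u)) \<partial>lborel) = Gamma (1 - \<beta>) / \<beta>" by (simp add: has_bochner_integral_iff)
  moreover have "frac_int \<beta> 1 = (\<integral>u. complex_of_real (k u * (1 - exp (- u))) \<partial>lborel)"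
    unfolding frac_int_def
    by (intro Bochner_Integration.integral_cong refl) (simp add: scaleR_conv_of_real flip: exp_of_real)
  ultimately show ?thesis by (simp only: integral_complex_of_real)
qed

text \<open>For \<open>J = frac_int \<beta>\<close>, homogeneity turns into Euler's equation \<open>z J'(z) = \<beta> J(z)\<close>, which makes
  \<open>J(z) z\<^bsup>-\<beta>\<^esup>\<close> constant on the open half-plane.\<close>

lemma frac_int_eq_open:
  assumes z: "0 < Re z"
  shows "frac_int \<beta> z = complex_of_real (Gamma (1 - \<beta>) / \<beta>) * z powr (of_real \<beta>)"
proof -
  let ?S = "{z. 0 < Re z}"
  let ?K = "\<lambda>z. frac_int \<beta> z * z powr (- of_real \<beta>)"
  have nz: "z \<notin> \<real>\<^sub>\<le>\<^sub>0" "z \<noteq> 0" if "z \<in> ?S" for z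
    using that by (auto simp: complex_nonpos_Reals_iff)
  have "\<exists>c. \<forall>z\<in>?S. ?K z = c"
  proof (rule has_field_derivative_zero_constant)
    show "convex ?S" by (rule convex_halfspace_Re_gt)
    fix z assume z: "z \<in> ?S"
    obtain D where D: "(frac_int \<beta> has_field_derivative D) (at z)"
      using frac_int_differentiable z by auto
    have "((\<lambda>c. frac_int \<beta> (of_real c * z)) has_vector_derivative D * z) (at 1)"
    proof -
      have "((\<lambda>c. complex_of_real c * z) has_vector_derivative z) (at 1)"
        by (auto intro!: derivative_eq_intros simp: has_vector_derivative_def scaleR_conv_of_real)
      then have "((frac_int \<beta> \<circ> (\<lambda>c. complex_of_real c * z)) has_vector_derivative z * D) (at 1)"
        by (rule field_vector_diff_chain_at) (use D in simp)
      then show ?thesis by (simp add: comp_def mult.commute)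
    qed
    moreover have "((\<lambda>c. frac_int \<beta> (of_real c * z)) has_vector_derivative of_real \<beta> * frac_int \<beta> z) (at 1)"
    proof -
      have "((\<lambda>c. c powr \<beta>) has_real_derivative \<beta> * 1 powr (\<beta> - 1)) (at 1)"
        by (rule has_real_derivative_powr) simp
      then have "((\<lambda>c. complex_of_real (c powr \<beta>)) has_vector_derivative complex_of_real \<beta>) (at 1)"
        by (intro has_vector_derivative_of_real) (simp add: has_real_derivative_iff_has_vector_derivative)
      then have "((\<lambda>c. complex_of_real (c powr \<beta>) * frac_int \<beta> z) has_vector_derivative of_real \<beta> * frac_int \<beta> z) (at 1)"
        by (rule has_vector_derivative_mult_left)
      then show ?thesis
      proof (rule has_vector_derivative_transform_within_open[where S = "{0<..}"])
        show "complex_of_real (c powr \<beta>) * frac_int \<beta> z = frac_int \<beta> (of_real c * z)" if "c \<in> {0<..}" for c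
          using frac_int_scale[of c z] that by simp
      qed auto
    qed
    ultimately have euler: "D * z = of_real \<beta> * frac_int \<beta> z"
      by (rule vector_derivative_unique_at)
    have "(?K has_field_derivative frac_int \<beta> z * (- of_real \<beta> * z powr (- of_real \<beta> - 1)) + D * z powr (- of_real \<beta>)) (at z)"
      using DERIV_mult[OF D has_field_derivative_powr[OF nz(1)[OF z], of "- of_real \<beta>"]] by (simp add: algebra_simps)
    moreover have "frac_int \<beta> z * (- of_real \<beta> * z powr (- of_real \<beta> - 1)) + D * z powr (- of_real \<beta>) = 0"
    proof -
      have "z powr (- of_real \<beta>) = z * z powr (- of_real \<beta> - 1)"
        using nz(2)[OF z] by (simp add: powr_diff)
      then show ?thesis using euler by (simp add: algebra_simps)
    qed
    ultimately show "(?K has_field_derivative 0) (at z within ?S)" by (metis has_field_derivative_at_within)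
  qed
  then obtain c where c: "\<And>z. 0 < Re z \<Longrightarrow> ?K z = c" by blast
  have "?K z = ?K 1" using c[OF z] c[of 1] by simp
  then have "?K z * z powr (of_real \<beta>) = complex_of_real (Gamma (1 - \<beta>) / \<beta>) * z powr (of_real \<beta>)"
    by (simp add: frac_int_1)
  moreover have "z powr (- of_real \<beta>) * z powr (of_real \<beta>) = 1"
    using nz(2)[of z] z by (simp flip: powr_add)
  ultimately show ?thesis by (simp add: mult.assoc)
qed

text \<open>A boundary point is approached from the right by \<open>w n\<close>. Apart from 0, where
  both sides vanish, the closed right half-plane does not meet the branch cut, so the complex power
  is continuous there.\<close>

theorem frac_int_eq:
  assumes z: "0 \<le> Re z"
  shows "frac_int \<beta> z = complex_of_real (Gamma (1 - \<beta>) / \<beta>) * z powr (of_real \<beta>)"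
proof (cases "z = 0")
  case True
  then show ?thesis by (simp add: frac_int_def)
next
  case False
  define w where "w n = z + of_real (1 / (real n + 1))" for n
  have wpos: "0 < Re (w n)" for n using z by (simp add: w_def add_nonneg_pos)
  have "(\<lambda>n. 1 / (real n + 1)) \<longlonglongrightarrow> 0" by real_asymp
  then have "w \<longlonglongrightarrow> z + of_real 0" unfolding w_def by (intro tendsto_intros)
  then have w: "w \<longlonglongrightarrow> z" by simp
  have "z \<notin> \<real>\<^sub>\<le>\<^sub>0" using False z by (auto simp: complex_nonpos_Reals_iff complex_eq_iff)
  then have "(\<lambda>n. complex_of_real (Gamma (1 - \<beta>) / \<beta>) * w n powr (of_real \<beta>))
      \<longlonglongrightarrow> complex_of_real (Gamma (1 - \<beta>) / \<beta>) * z powr (of_real \<beta>)"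
    by (intro tendsto_mult tendsto_const tendsto_powr_complex w)
  moreover have "(\<lambda>n. frac_int \<beta> (w n)) \<longlonglongrightarrow> frac_int \<beta> z"
    by (rule frac_int_tendsto[OF less_imp_le[OF wpos] w])
  ultimately show ?thesis
    unfolding frac_int_eq_open[OF wpos] by (intro LIMSEQ_unique)
qed

end

section \<open>Truncated fractional derivatives\<close>

text \<open>Integral kernels are treated as finite measures, so that the results on
  \<open>conv\<close> and \<open>char\<close> apply to them as well as to delay measures and point
  masses.\<close>

definition dens :: "(real \<Rightarrow> real) \<Rightarrow> real measure" where
  "dens w = density lborel (\<lambda>x. ennreal (w x))"

lemma sets_dens [simp]: "sets (dens w) = sets borel"
  and space_dens [simp]: "space (dens w) = UNIV"
  by (simp_all add: dens_def)

context
  fixes w :: "real \<Rightarrow> real"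
  assumes w: "integrable lborel w" and w_nonneg: "\<And>x. 0 \<le> w x"
begin

lemma finite_measure_dens: "finite_measure (dens w)"
proof (rule finite_measureI)
  have [measurable]: "w \<in> borel_measurable borel" using w by auto
  have "emeasure (dens w) UNIV = (\<integral>\<^sup>+x. ennreal (w x) \<partial>lborel)"
    unfolding dens_def by (subst emeasure_density) auto
  also have "\<dots> = ennreal (\<integral>x. w x \<partial>lborel)" using w w_nonneg by (intro nn_integral_eq_integral) auto
  finally show "emeasure (dens w) (space (dens w)) \<noteq> \<infinity>" by simp
qed

lemma integral_dens:
  fixes f :: "real \<Rightarrow> 'b::{banach, second_countable_topology}"
  assumes "f \<in> borel_measurable borel"
  shows "(\<integral>x. f x \<partial>dens w) = (\<integral>x. w x *\<^sub>R f x \<partial>lborel)"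
  unfolding dens_def using w w_nonneg assms by (intro integral_density) auto

lemma integrable_dens:
  fixes f :: "real \<Rightarrow> 'b::{banach, second_countable_topology}"
  assumes "f \<in> borel_measurable borel"
  shows "integrable (dens w) f \<longleftrightarrow> integrable lborel (\<lambda>x. w x *\<^sub>R f x)"
  unfolding dens_def using w w_nonneg assms by (intro integrable_density) auto

lemma conv_dens:
  fixes f :: "real \<Rightarrow> 'b::{banach, second_countable_topology}"
  assumes [measurable]: "f \<in> borel_measurable borel"
  shows "conv (dens w) f t = (\<integral>v. w v *\<^sub>R f (t - v) \<partial>lborel)"
  unfolding conv_def by (rule integral_dens) measurable

lemma char_dens: "char (dens w) y = (\<integral>u. w u *\<^sub>R exp (\<i> * of_real (y * u)) \<partial>lborel)"
  unfolding char_def by (rule integral_dens) measurable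

end

section \<open>The two Jordan parts of the delay measure, transported to the real line\<close>

definition jplus :: "(real set \<Rightarrow> real) \<Rightarrow> real measure" where
  "jplus \<eta> = distr (jordan_pos half_line \<eta>) borel (\<lambda>x. x)"

definition jminus :: "(real set \<Rightarrow> real) \<Rightarrow> real measure" where
  "jminus \<eta> = distr (jordan_neg half_line \<eta>) borel (\<lambda>x. x)"

lemma jordan_neg_sets [simp]: "sets (jordan_neg N \<eta>) = sets N"
  by (simp add: jordan_neg_def)

lemma sets_jordan_measures [simp]: "sets (jplus \<eta>) = sets borel" "sets (jminus \<eta>) = sets borel"
  by (simp_all add: jplus_def jminus_def)

lemma id_measurable_jordan:
  "(\<lambda>x. x) \<in> measurable (jordan_pos half_line \<eta>) borel" "(\<lambda>x. x) \<in> measurable (jordan_neg half_line \<eta>) borel"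
proof -
  have *: "(\<lambda>x. x) \<in> measurable half_line (borel :: real measure)" by (rule measurable_restrict_space1) simp
  show "(\<lambda>x. x) \<in> measurable (jordan_pos half_line \<eta>) borel"
    by (subst measurable_cong_sets[OF jordan_pos_sets refl]) (rule *)
  show "(\<lambda>x. x) \<in> measurable (jordan_neg half_line \<eta>) borel"
    by (subst measurable_cong_sets[OF jordan_neg_sets refl]) (rule *)
qed

lemma finite_measure_jordan:
  assumes "finite_signed_measure half_line \<eta>"
  shows "finite_measure (jplus \<eta>)" "finite_measure (jminus \<eta>)"
  unfolding jplus_def jminus_def jordan_neg_def
  using finite_measure_jordan_pos[OF assms] finite_measure_jordan_pos[OF finite_signed_measure_uminus[OF assms]]
    id_measurable_jordan[of \<eta>]
  by (auto intro!: finite_measure.finite_measure_distr simp: jordan_neg_def)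

lemma AE_jordan_nonneg: "AE v in jplus \<eta>. 0 \<le> v" "AE v in jminus \<eta>. 0 \<le> v"
  unfolding jplus_def jminus_def
  by (subst AE_distr_iff; auto simp: jordan_neg_def space_restrict_space id_measurable_jordan[unfolded jordan_neg_def] intro!: AE_I2)+

lemma signed_integral_jordan:
  fixes f :: "real \<Rightarrow> 'b::{banach, second_countable_topology}"
  assumes "f \<in> borel_measurable borel"
  shows "signed_integral half_line \<eta> f = (\<integral>v. f v \<partial>jplus \<eta>) - (\<integral>v. f v \<partial>jminus \<eta>)"
  unfolding signed_integral_def jplus_def jminus_def
  using assms id_measurable_jordan by (simp add: integral_distr)

lemma signed_integrable_jordan:
  fixes f :: "real \<Rightarrow> 'b::{banach, second_countable_topology}"
  assumes "f \<in> borel_measurable borel"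
  shows "signed_integrable half_line \<eta> f \<longleftrightarrow> integrable (jplus \<eta>) f \<and> integrable (jminus \<eta>) f"
  unfolding signed_integrable_def jplus_def jminus_def
  using assms id_measurable_jordan by (simp add: integrable_distr_eq)

definition sconv :: "(real set \<Rightarrow> real) \<Rightarrow> (real \<Rightarrow> 'b::{banach, second_countable_topology}) \<Rightarrow> real \<Rightarrow> 'b" where
  "sconv \<eta> f t = conv (jplus \<eta>) f t - conv (jminus \<eta>) f t"

lemma delay_eq_sconv:
  assumes [measurable]: "x \<in> borel_measurable borel"
  shows "delay \<eta> x u = sconv \<eta> x u"
  unfolding delay_def sconv_def conv_def by (rule signed_integral_jordan) measurable

context
  fixes \<eta> :: "real set \<Rightarrow> real"
  assumes \<eta>: "finite_signed_measure half_line \<eta>"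
begin

lemmas jordan_finite = finite_measure_jordan[OF \<eta>]

lemma square_integrable_sconv:
  fixes f :: "real \<Rightarrow> 'b::{banach, second_countable_topology}"
  assumes "square_integrable lborel f"
  shows "square_integrable lborel (sconv \<eta> f)"
  unfolding sconv_def[abs_def]
  using assms by (intro square_integrable_diff conv_square_integrable jordan_finite) auto

lemma has_fourier_L2_sconv:
  assumes "has_fourier_L2 f \<phi>"
  shows "has_fourier_L2 (sconv \<eta> f) (\<lambda>y. (char (jplus \<eta>) y - char (jminus \<eta>) y) * \<phi> y)"
  unfolding sconv_def[abs_def] left_diff_distrib
  using assms by (intro has_fourier_L2_diff has_fourier_L2_conv jordan_finite) auto

lemma sconv_of_real: "sconv \<eta> (\<lambda>x. complex_of_real (f x)) t = complex_of_real (sconv \<eta> f t)"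
  by (simp add: sconv_def conv_def)

text \<open>Both Jordan parts are carried by the half-line, so the delay operator looks only into
  the past and preserves causality.\<close>

lemma sconv_eq_0:
  assumes "\<And>t. t < 0 \<Longrightarrow> f t = 0" "t < 0"
  shows "sconv \<eta> f t = 0"
proof -
  have "conv (jplus \<eta>) f t = 0"
    unfolding conv_def by (rule integral_eq_zero_AE, rule eventually_mono[OF AE_jordan_nonneg(1)]) (use assms in simp)
  moreover have "conv (jminus \<eta>) f t = 0"
    unfolding conv_def by (rule integral_eq_zero_AE, rule eventually_mono[OF AE_jordan_nonneg(2)]) (use assms in simp)
  ultimately show ?thesis by (simp add: sconv_def)
qed

lemma sfdde_h_imaginary:
  "sfdde_h \<beta> \<eta> (\<i> * of_real y) = (- (\<i> * of_real y)) powr of_real (1 - \<beta>) - (char (jplus \<eta>) y - char (jminus \<eta>) y)"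
proof -
  have "signed_integral half_line \<eta> (\<lambda>u. exp (\<i> * of_real y * of_real u)) = char (jplus \<eta>) y - char (jminus \<eta>) y"
    by (subst signed_integral_jordan) (simp_all add: char_def mult.assoc)
  then show ?thesis by (simp add: sfdde_h_def)
qed

end

section \<open>The truncated Marchaud operator and its Fourier multiplier\<close>

definition frac_dens :: "real \<Rightarrow> real \<Rightarrow> real measure" where
  "frac_dens \<beta> \<delta> = dens (\<lambda>u. indicator {\<delta><..} u * u powr (-(1 + \<beta>)))"

text \<open>The truncated Marchaud derivative with the difference pulled apart, which is possible as
  long as \<open>\<delta>\<close> is positive: \<open>\<delta> powr (-\<beta>) / \<beta>\<close> is
  the total mass of \<open>frac_dens \<beta> \<delta>\<close>. In this form it is a multiple of the
  identity minus a convolution, so the convolution theorem yields the multiplier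
  \<open>frac_mult\<close>.\<close>

definition frac_diff :: "real \<Rightarrow> real \<Rightarrow> (real \<Rightarrow> real) \<Rightarrow> real \<Rightarrow> real" where
  "frac_diff \<beta> \<delta> f t = \<beta> / Gamma (1 - \<beta>) * (\<delta> powr (-\<beta>) / \<beta> * f t - conv (frac_dens \<beta> \<delta>) f t)"

definition frac_mult :: "real \<Rightarrow> real \<Rightarrow> real \<Rightarrow> complex" where
  "frac_mult \<beta> \<delta> y = of_real (\<beta> / Gamma (1 - \<beta>)) * (of_real (\<delta> powr (-\<beta>) / \<beta>) - char (frac_dens \<beta> \<delta>) y)"

lemma sets_frac_dens [simp]: "sets (frac_dens \<beta> \<delta>) = sets borel"
  by (simp add: frac_dens_def)

lemma norm_powr_of_real: "norm (z powr complex_of_real b) = norm z powr b"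
  by (simp add: powr_def)

context
  fixes \<beta> :: real
  assumes \<beta>: "0 < \<beta>" "\<beta> < 1"
begin

lemma finite_measure_frac_dens: "0 < \<delta> \<Longrightarrow> finite_measure (frac_dens \<beta> \<delta>)"
  unfolding frac_dens_def using powr_tail_integral(1)[of \<delta> \<beta>] \<beta> by (intro finite_measure_dens) auto

lemma marchaud_truncated_eq:
  assumes \<delta>: "0 < \<delta>" and [measurable]: "f \<in> borel_measurable borel"
    and i: "integrable (frac_dens \<beta> \<delta>) (\<lambda>u. f (t - u))"
  shows "set_integrable lborel {\<delta><..} (marchaud_integrand \<beta> f t)"
    "marchaud_truncated \<beta> f t \<delta> = frac_diff \<beta> \<delta> f t"
proof -
  let ?w = "\<lambda>u. indicator {\<delta><..} u * u powr (-(1 + \<beta>))"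
  have w: "integrable lborel ?w" "(\<integral>u. ?w u \<partial>lborel) = \<delta> powr (-\<beta>) / \<beta>" using powr_tail_integral[OF \<delta> \<beta>(1)] by auto
  have wn: "0 \<le> ?w u" for u by simp
  have i2: "integrable lborel (\<lambda>u. ?w u *\<^sub>R f (t - u))"
    using i unfolding frac_dens_def by (subst (asm) integrable_dens[OF w(1) wn]) auto
  have e: "indicator {\<delta><..} u *\<^sub>R marchaud_integrand \<beta> f t u = ?w u * f t - ?w u *\<^sub>R f (t - u)" for u
  proof -
    have "x / u powr (1 + \<beta>) = x * u powr (-(1 + \<beta>))" for x by (simp only: powr_minus divide_inverse)
    then show ?thesis unfolding marchaud_integrand_def by (simp add: algebra_simps split: split_indicator)
  qed
  show "set_integrable lborel {\<delta><..} (marchaud_integrand \<beta> f t)"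
    unfolding set_integrable_def e using w(1) i2 by auto
  have "(LINT u:{\<delta><..}|lborel. marchaud_integrand \<beta> f t u) = \<delta> powr (-\<beta>) / \<beta> * f t - conv (frac_dens \<beta> \<delta>) f t"
    unfolding set_lebesgue_integral_def e frac_dens_def conv_dens[OF w(1) wn assms(2)]
    using w i2 by (subst Bochner_Integration.integral_diff) auto
  then show "marchaud_truncated \<beta> f t \<delta> = frac_diff \<beta> \<delta> f t"
    by (simp add: marchaud_truncated_def frac_diff_def)
qed

lemma square_integrable_frac_diff:
  assumes "0 < \<delta>" "square_integrable lborel f"
  shows "square_integrable lborel (frac_diff \<beta> \<delta> f)"
  unfolding frac_diff_def[abs_def]
  using assms by (intro square_integrable_cmult square_integrable_diff conv_square_integrable finite_measure_frac_dens) auto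

lemma has_fourier_L2_frac_diff:
  assumes \<delta>: "0 < \<delta>" and f: "has_fourier_L2 (\<lambda>t. complex_of_real (f t)) \<phi>"
  shows "has_fourier_L2 (\<lambda>t. complex_of_real (frac_diff \<beta> \<delta> f t)) (\<lambda>y. frac_mult \<beta> \<delta> y * \<phi> y)"
proof -
  have e: "complex_of_real (frac_diff \<beta> \<delta> f t) = of_real (\<beta> / Gamma (1 - \<beta>)) *
    (of_real (\<delta> powr (-\<beta>) / \<beta>) * of_real (f t) - conv (frac_dens \<beta> \<delta>) (\<lambda>t. complex_of_real (f t)) t)" for t
    by (simp add: frac_diff_def conv_def)
  have e2: "frac_mult \<beta> \<delta> y * \<phi> y = of_real (\<beta> / Gamma (1 - \<beta>)) *
    (of_real (\<delta> powr (-\<beta>) / \<beta>) * \<phi> y - char (frac_dens \<beta> \<delta>) y * \<phi> y)" for y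
    by (simp add: frac_mult_def left_diff_distrib mult.assoc)
  show ?thesis
    unfolding e e2
    by (intro has_fourier_L2_cmult has_fourier_L2_diff has_fourier_L2_conv f finite_measure_frac_dens[OF \<delta>]) simp
qed

text \<open>The two terms of \<open>frac_mult\<close> diverge separately as \<open>\<delta>\<close>
  decreases to 0. Recombined under one integral they contain the factor
  \<open>1 - exp (i y u)\<close>, which stays integrable against the untruncated weight.\<close>

lemma frac_mult_eq:
  assumes \<delta>: "0 < \<delta>"
  shows "frac_mult \<beta> \<delta> y = of_real (\<beta> / Gamma (1 - \<beta>)) *
    (\<integral>u. (indicator {\<delta><..} u * u powr (-(1 + \<beta>))) *\<^sub>R (1 - exp (- (- (\<i> * of_real y) * complex_of_real u))) \<partial>lborel)"
proof -
  let ?w = "\<lambda>u. indicator {\<delta><..} u * u powr (-(1 + \<beta>))"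
  have w: "integrable lborel ?w" "(\<integral>u. ?w u \<partial>lborel) = \<delta> powr (-\<beta>) / \<beta>" using powr_tail_integral[OF \<delta> \<beta>(1)] by auto
  have wn: "0 \<le> ?w u" for u by simp
  have e: "exp (- (- (\<i> * of_real y) * complex_of_real u)) = exp (\<i> * of_real (y * u))" for u
    by (simp add: mult.assoc)
  have i2: "integrable lborel (\<lambda>u. ?w u *\<^sub>R exp (\<i> * of_real (y * u)))"
    by (rule Bochner_Integration.integrable_bound[OF w(1)]) (auto simp del: of_real_mult)
  have i1: "integrable lborel (\<lambda>u. ?w u *\<^sub>R (1::complex))" by (rule integrable_scaleR_left) (rule w(1))
  have "(\<integral>u. ?w u *\<^sub>R (1 - exp (- (- (\<i> * of_real y) * complex_of_real u))) \<partial>lborel)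
      = (\<integral>u. ?w u *\<^sub>R (1::complex) - ?w u *\<^sub>R exp (\<i> * of_real (y * u)) \<partial>lborel)"
    unfolding e by (simp only: scaleR_diff_right)
  also have "\<dots> = (\<integral>u. ?w u *\<^sub>R (1::complex) \<partial>lborel) - (\<integral>u. ?w u *\<^sub>R exp (\<i> * of_real (y * u)) \<partial>lborel)"
    by (rule Bochner_Integration.integral_diff[OF i1 i2])
  also have "(\<integral>u. ?w u *\<^sub>R (1::complex) \<partial>lborel) = (\<integral>u. ?w u \<partial>lborel) *\<^sub>R 1"
    by (rule integral_scaleR_left) (rule w(1))
  also have "\<dots> = of_real (\<delta> powr (-\<beta>) / \<beta>)" unfolding w(2) by (rule scaleR_conv_of_real[THEN trans]) simp
  finally show ?thesis
    unfolding frac_mult_def frac_dens_def char_dens[OF w(1) wn] by simp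
qed

lemma frac_integrand_imaginary_bound:
  "norm ((indicator {0<..} u * u powr (-(1 + \<beta>))) *\<^sub>R (1 - exp (- (- (\<i> * of_real y) * complex_of_real u))))
    \<le> indicator {0<..} u * u powr (-(1 + \<beta>)) * min 2 (\<bar>y\<bar> * u)"
  by (rule frac_integrand_bound[OF \<beta>]) (simp_all add: norm_mult)

lemma frac_mult_tendsto:
  assumes \<delta>: "\<And>n. 0 < \<delta> n" "\<delta> \<longlonglongrightarrow> 0"
  shows "(\<lambda>n. frac_mult \<beta> (\<delta> n) y) \<longlonglongrightarrow> (- (\<i> * of_real y)) powr of_real \<beta>"
proof -
  have "(\<lambda>n. frac_mult \<beta> (\<delta> n) y) \<longlonglongrightarrow> of_real (\<beta> / Gamma (1 - \<beta>)) * frac_int \<beta> (- (\<i> * of_real y))"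
    unfolding frac_mult_eq[OF \<delta>(1)] frac_int_def
  proof (intro tendsto_mult tendsto_const integral_dominated_convergence)
    show "integrable lborel (\<lambda>u. indicator {0<..} u * u powr (-(1 + \<beta>)) * min 2 (\<bar>y\<bar> * u))"
      by (rule powr_min_integrable[OF \<beta>]) auto
    show "AE u in lborel. (\<lambda>n. (indicator {\<delta> n<..} u * u powr (-(1 + \<beta>))) *\<^sub>R (1 - exp (- (- (\<i> * of_real y) * complex_of_real u))))
        \<longlonglongrightarrow> (indicator {0<..} u * u powr (-(1 + \<beta>))) *\<^sub>R (1 - exp (- (- (\<i> * of_real y) * complex_of_real u)))"
    proof (intro AE_I2 tendsto_scaleR tendsto_mult tendsto_const)
      fix u :: real
      show "(\<lambda>n. indicator {\<delta> n<..} u :: real) \<longlonglongrightarrow> indicator {0<..} u"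
      proof (cases "0 < u")
        case True
        have "\<forall>\<^sub>F n in sequentially. \<delta> n < u" by (rule order_tendstoD(2)[OF \<delta>(2) True])
        then show ?thesis using True by (intro tendsto_eventually) (auto elim!: eventually_mono)
      next
        case False
        then have "indicator {\<delta> n<..} u = (0::real)" for n using \<delta>(1)[of n] by (auto simp: indicator_def)
        then show ?thesis using False by simp
      qed
    qed
    show "AE u in lborel. norm ((indicator {\<delta> n<..} u * u powr (-(1 + \<beta>))) *\<^sub>R (1 - exp (- (- (\<i> * of_real y) * complex_of_real u))))
        \<le> indicator {0<..} u * u powr (-(1 + \<beta>)) * min 2 (\<bar>y\<bar> * u)" for n
    proof (rule AE_I2)
      fix u
      have "norm ((indicator {\<delta> n<..} u * u powr (-(1 + \<beta>))) *\<^sub>R (1 - exp (- (- (\<i> * of_real y) * complex_of_real u))))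
        \<le> norm ((indicator {0<..} u * u powr (-(1 + \<beta>))) *\<^sub>R (1 - exp (- (- (\<i> * of_real y) * complex_of_real u))))"
        using \<delta>(1)[of n] by (auto simp: indicator_def)
      also note frac_integrand_imaginary_bound
      finally show "norm ((indicator {\<delta> n<..} u * u powr (-(1 + \<beta>))) *\<^sub>R (1 - exp (- (- (\<i> * of_real y) * complex_of_real u))))
        \<le> indicator {0<..} u * u powr (-(1 + \<beta>)) * min 2 (\<bar>y\<bar> * u)" .
    qed
  qed measurable
  moreover have "of_real (\<beta> / Gamma (1 - \<beta>)) * frac_int \<beta> (- (\<i> * of_real y)) = (- (\<i> * of_real y)) powr of_real \<beta>"
  proof -
    have c: "\<beta> / c * (c / \<beta>) = 1" if "0 < c" for c using that \<beta> by simp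
    have 1: "\<beta> / Gamma (1 - \<beta>) * (Gamma (1 - \<beta>) / \<beta>) = 1" by (rule c, rule Gamma_real_pos) (use \<beta> in simp)
    have "0 \<le> Re (- (\<i> * of_real y))" by simp
    from frac_int_eq[OF \<beta> this] show ?thesis
      unfolding mult.assoc[symmetric] of_real_mult[symmetric] 1 by (simp only: 1 mult.assoc[symmetric] of_real_mult[symmetric] of_real_1 mult_1)
  qed
  ultimately show ?thesis by simp
qed

text \<open>Dropping the truncation gives a majorant that does not depend on
  \<open>\<delta>\<close>; rescaling the variable by \<open>1 / |y|\<close> reduces it to its value
  at \<open>y = 1\<close>, which is \<open>B\<close>.\<close>

lemma frac_mult_bound:
  obtains K where "0 \<le> K" "\<And>\<delta> y. 0 < \<delta> \<Longrightarrow> norm (frac_mult \<beta> \<delta> y) \<le> K * \<bar>y\<bar> powr \<beta>"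
proof
  let ?k = "\<lambda>u. indicator {0<..} u * u powr (-(1 + \<beta>)) :: real"
  define B where "B = (\<integral>u. ?k u * min 2 (1 * u) \<partial>lborel)"
  have iB: "integrable lborel (\<lambda>u. ?k u * min 2 (c * u))" if "0 \<le> c" for c
    using that by (intro powr_min_integrable[OF \<beta>]) auto
  have B0: "0 \<le> B" unfolding B_def by (intro Bochner_Integration.integral_nonneg) (auto simp: indicator_def)
  have G: "0 < Gamma (1 - \<beta>)" using Gamma_real_pos[of "1 - \<beta>"] \<beta> by simp
  show "0 \<le> \<beta> / Gamma (1 - \<beta>) * B" using B0 G \<beta> by simp
  fix \<delta> y :: real assume \<delta>: "0 < \<delta>"
  have scale: "(\<integral>u. ?k u * min 2 (\<bar>y\<bar> * u) \<partial>lborel) = \<bar>y\<bar> powr \<beta> * B"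
  proof (cases "y = 0")
    case True
    have "?k u * min 2 (\<bar>y\<bar> * u) = 0" for u using True by simp
    then show ?thesis using True by simp
  next
    case False
    define c where "c = 1 / \<bar>y\<bar>"
    have c: "0 < c" using False by (simp add: c_def)
    have "(\<integral>u. ?k u * min 2 (\<bar>y\<bar> * u) \<partial>lborel) = \<bar>c\<bar> *\<^sub>R (\<integral>u. ?k (0 + c * u) * min 2 (\<bar>y\<bar> * (0 + c * u)) \<partial>lborel)"
      using c by (intro lborel_integral_real_affine) auto
    also have "(\<lambda>u. ?k (0 + c * u) * min 2 (\<bar>y\<bar> * (0 + c * u))) = (\<lambda>u. c powr (-(1 + \<beta>)) * (?k u * min 2 (1 * u)))"
    proof
      fix u
      have "?k (0 + c * u) = c powr (-(1 + \<beta>)) * ?k u" using c by (simp add: indicator_def zero_less_mult_iff powr_mult)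
      moreover have "\<bar>y\<bar> * (0 + c * u) = 1 * u" using False by (simp add: c_def)
      ultimately show "?k (0 + c * u) * min 2 (\<bar>y\<bar> * (0 + c * u)) = c powr (-(1 + \<beta>)) * (?k u * min 2 (1 * u))"
        by (simp only: mult.assoc)
    qed
    also have "\<bar>c\<bar> *\<^sub>R (\<integral>u. c powr (-(1 + \<beta>)) * (?k u * min 2 (1 * u)) \<partial>lborel) = (c * c powr (-(1 + \<beta>))) * B"
      using c by (simp add: B_def)
    also have "c * c powr (-(1 + \<beta>)) = \<bar>y\<bar> powr \<beta>"
      using False c by (simp add: powr_mult_base) (simp add: c_def powr_minus powr_divide)
    finally show ?thesis .
  qed
  have "norm (\<integral>u. (indicator {\<delta><..} u * u powr (-(1 + \<beta>))) *\<^sub>R (1 - exp (- (- (\<i> * of_real y) * complex_of_real u))) \<partial>lborel)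
      \<le> (\<integral>u. ?k u * min 2 (\<bar>y\<bar> * u) \<partial>lborel)"
  proof (rule Bochner_Integration.integral_norm_bound_integral)
    fix u
    have "norm ((indicator {\<delta><..} u * u powr (-(1 + \<beta>))) *\<^sub>R (1 - exp (- (- (\<i> * of_real y) * complex_of_real u))))
      \<le> norm (?k u *\<^sub>R (1 - exp (- (- (\<i> * of_real y) * complex_of_real u))))"
      using \<delta> by (auto simp: indicator_def)
    also note frac_integrand_imaginary_bound
    finally show le: "norm ((indicator {\<delta><..} u * u powr (-(1 + \<beta>))) *\<^sub>R (1 - exp (- (- (\<i> * of_real y) * complex_of_real u))))
      \<le> ?k u * min 2 (\<bar>y\<bar> * u)" .
  next
    show "integrable lborel (\<lambda>u. (indicator {\<delta><..} u * u powr (-(1 + \<beta>))) *\<^sub>R (1 - exp (- (- (\<i> * of_real y) * complex_of_real u))))"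
    proof (rule Bochner_Integration.integrable_bound[OF frac_integrable[OF \<beta>, of "- (\<i> * of_real y)"]])
      show "AE u in lborel. norm ((indicator {\<delta><..} u * u powr (-(1 + \<beta>))) *\<^sub>R (1 - exp (- (- (\<i> * of_real y) * complex_of_real u))))
        \<le> norm (?k u *\<^sub>R (1 - exp (- (- (\<i> * of_real y) * complex_of_real u))))"
        using \<delta> by (intro AE_I2) (auto simp: indicator_def)
    qed auto
  qed (rule iB, simp)
  also note scale
  finally have le: "norm (\<integral>u. (indicator {\<delta><..} u * u powr (-(1 + \<beta>))) *\<^sub>R (1 - exp (- (- (\<i> * of_real y) * complex_of_real u))) \<partial>lborel)
      \<le> \<bar>y\<bar> powr \<beta> * B" .
  have nn: "0 \<le> \<beta> / Gamma (1 - \<beta>)" using G \<beta> by simp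
  have n: "norm (complex_of_real (\<beta> / Gamma (1 - \<beta>))) = \<beta> / Gamma (1 - \<beta>)"
    by (simp only: norm_of_real abs_of_nonneg[OF nn])
  from mult_left_mono[OF le nn]
  show "norm (frac_mult \<beta> \<delta> y) \<le> \<beta> / Gamma (1 - \<beta>) * B * \<bar>y\<bar> powr \<beta>"
    unfolding frac_mult_eq[OF \<delta>] norm_mult n by (simp only: ac_simps)
qed

end

section \<open>The filter of the delay equation\<close>

lemma L2norm_complex_of_real: "L2norm M (\<lambda>x. complex_of_real (f x)) = L2norm M f"
  by (rule L2norm_cong) simp

text \<open>The complex power is not continuous on the whole plane, so measurability is read off
  from the explicit logarithm on the imaginary axis: \<open>Ln (-iy)\<close> has real part
  \<open>ln |y|\<close> and imaginary part \<open>- sgn y * pi / 2\<close>.\<close>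

lemma powr_imaginary_measurable [measurable]: "(\<lambda>y. (- (\<i> * of_real y)) powr complex_of_real b) \<in> borel_measurable borel"
proof -
  have "(\<lambda>y. if y = 0 then 0 else exp (complex_of_real b * (of_real (ln \<bar>y\<bar>) + \<i> * of_real (- sgn y * pi / 2)))) \<in> borel_measurable borel"
    by measurable
  also have "(\<lambda>y. if y = 0 then 0 else exp (complex_of_real b * (of_real (ln \<bar>y\<bar>) + \<i> * of_real (- sgn y * pi / 2))))
      = (\<lambda>y. (- (\<i> * of_real y)) powr complex_of_real b)"
  proof
    fix y :: real
    show "(if y = 0 then 0 else exp (complex_of_real b * (of_real (ln \<bar>y\<bar>) + \<i> * of_real (- sgn y * pi / 2))))
      = (- (\<i> * of_real y)) powr complex_of_real b"
    proof (cases "y = 0")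
      case False
      have "Ln (- (\<i> * of_real y)) = of_real (ln \<bar>y\<bar>) + \<i> * of_real (- sgn y * pi / 2)"
      proof (rule Ln_unique)
        have e: "exp (\<i> * of_real (- sgn y * pi / 2)) = - \<i> * of_real (sgn y)"
          using False by (cases "y > 0") (auto simp: exp_eq_polar cis_conv_exp[symmetric] complex_eq_iff)
        have "exp (of_real (ln \<bar>y\<bar>) + \<i> * of_real (- sgn y * pi / 2)) = of_real \<bar>y\<bar> * (- \<i> * of_real (sgn y))"
        proof -
          have "exp (complex_of_real (ln \<bar>y\<bar>)) = of_real \<bar>y\<bar>" using False by (simp add: exp_of_real)
          with e show ?thesis by (simp only: exp_add)
        qed
        also have "\<dots> = - (\<i> * of_real y)" 
        proof -
          have "complex_of_real \<bar>y\<bar> * of_real (sgn y) = of_real y" by (simp only: of_real_mult[symmetric] abs_mult_sgn)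
          then show ?thesis by (simp only: mult_minus_left mult_minus_right mult.left_commute)
        qed
        finally show "exp (of_real (ln \<bar>y\<bar>) + \<i> * of_real (- sgn y * pi / 2)) = - (\<i> * of_real y)" .
        show "- pi < Im (of_real (ln \<bar>y\<bar>) + \<i> * of_real (- sgn y * pi / 2))"
          "Im (of_real (ln \<bar>y\<bar>) + \<i> * of_real (- sgn y * pi / 2)) \<le> pi"
        proof -
          have "- pi < - sgn y * pi / 2 \<and> - sgn y * pi / 2 \<le> pi"
          proof (cases "y > 0")
            case True
            then have s: "sgn y = 1" by simp
            show ?thesis unfolding s using pi_gt_zero by linarith
          next
            case n: False
            then have s: "sgn y = -1" using False by simp
            show ?thesis unfolding s using pi_gt_zero by linarith
          qed
          then show "- pi < Im (of_real (ln \<bar>y\<bar>) + \<i> * of_real (- sgn y * pi / 2))"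
            "Im (of_real (ln \<bar>y\<bar>) + \<i> * of_real (- sgn y * pi / 2)) \<le> pi"
            by simp_all
        qed
      qed
      then show ?thesis using False by (simp add: powr_def)
    qed simp
  qed
  finally show ?thesis .
qed

locale sfdde_filter =
  fixes \<beta> :: real and \<eta> :: "real set \<Rightarrow> real" and g :: "real \<Rightarrow> real"
  assumes \<beta>: "0 < \<beta>" "\<beta> < 1 / 2"
    and \<eta>: "finite_signed_measure half_line \<eta>"
    and h_nonzero: "\<And>z. Re z \<le> 0 \<Longrightarrow> sfdde_h \<beta> \<eta> z \<noteq> 0"
    and g: "square_integrable lborel g"
    and g_neg: "\<And>t. t < 0 \<Longrightarrow> g t = 0"
    and g_fourier: "has_fourier_L2 (\<lambda>t. complex_of_real (g t))
           (\<lambda>y. (- (\<i> * of_real y)) powr of_real (- \<beta>) / sfdde_h \<beta> \<eta> (\<i> * of_real y))"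
begin

lemma \<beta>1: "\<beta> < 1"
  using \<beta> by simp

definition g_hat :: "real \<Rightarrow> complex" where
  "g_hat y = (- (\<i> * of_real y)) powr of_real (- \<beta>) / sfdde_h \<beta> \<eta> (\<i> * of_real y)"

definition \<eta>_hat :: "real \<Rightarrow> complex" where
  "\<eta>_hat y = char (jplus \<eta>) y - char (jminus \<eta>) y"

text \<open>The transform \<open>1/h(iy)\<close> of the fractional derivative of \<open>g\<close>,
  except at \<open>y = 0\<close>, where the product is 0. Written as a product it is the limit of
  the truncated multipliers times \<open>g_hat\<close> at every \<open>y\<close>.\<close>

definition k_hat :: "real \<Rightarrow> complex" where
  "k_hat y = (- (\<i> * of_real y)) powr of_real \<beta> * g_hat y"

lemma g_fourier': "has_fourier_L2 (\<lambda>t. complex_of_real (g t)) g_hat"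
  using g_fourier by (simp add: g_hat_def[abs_def])

lemma g_measurable [measurable]: "g \<in> borel_measurable borel"
  using square_integrable_measurable[OF g] by simp

lemma square_integrable_g_hat: "square_integrable lborel g_hat"
  using has_fourier_L2_square_integrable[OF g_fourier'] by simp

lemma g_hat_measurable [measurable]: "g_hat \<in> borel_measurable borel"
  using square_integrable_measurable[OF square_integrable_g_hat] by simp

lemma k_hat_measurable [measurable]: "k_hat \<in> borel_measurable borel"
  unfolding k_hat_def[abs_def] by measurable

lemma sfdde_h_nonzero: "sfdde_h \<beta> \<eta> (\<i> * of_real y) \<noteq> 0"
  by (rule h_nonzero) simp

lemma h_eq: "sfdde_h \<beta> \<eta> (\<i> * of_real y) = (- (\<i> * of_real y)) powr of_real (1 - \<beta>) - \<eta>_hat y"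
  unfolding \<eta>_hat_def by (rule sfdde_h_imaginary[OF \<eta>])

lemma k_hat_eq:
  assumes "y \<noteq> 0"
  shows "k_hat y = 1 / sfdde_h \<beta> \<eta> (\<i> * of_real y)"
proof -
  have "(- (\<i> * of_real y)) powr of_real \<beta> * (- (\<i> * of_real y)) powr of_real (- \<beta>) = (1::complex)"
    using assms by (simp flip: powr_add)
  then show ?thesis by (simp add: k_hat_def g_hat_def)
qed

lemma norm_k_hat: "norm (k_hat y) = \<bar>y\<bar> powr \<beta> * norm (g_hat y)"
  by (simp add: k_hat_def norm_mult norm_powr_of_real)

definition \<eta>_mass :: real where
  "\<eta>_mass = measure (jplus \<eta>) UNIV + measure (jminus \<eta>) UNIV"

lemma \<eta>_mass_nonneg: "0 \<le> \<eta>_mass"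
  by (simp add: \<eta>_mass_def)

lemma norm_\<eta>_hat: "norm (\<eta>_hat y) \<le> \<eta>_mass"
  unfolding \<eta>_hat_def \<eta>_mass_def
  by (intro order_trans[OF norm_triangle_ineq4] add_mono char_norm_le jordan_finite \<eta>) auto

text \<open>Low frequencies are controlled by \<open>g_hat\<close> being in \<open>L\<^sup>2\<close>, high frequencies by \<open>|1/h(iy)| = O(|y|\<^bsup>\<beta>-1\<^esup>)\<close>
  and \<open>2(1-\<beta>) > 1\<close>.\<close>

lemma square_integrable_k_hat: "square_integrable lborel k_hat"
proof -
  \<comment> \<open>Beyond \<open>R\<close> the power \<open>|y| powr (1 - \<beta>)\<close> exceeds
    \<open>2 * \<eta>_mass\<close>, so at least half of it survives the subtraction of
    \<open>\<eta>_hat\<close>; the summand 1 keeps \<open>R\<close> positive when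
    \<open>\<eta>_mass\<close> is 0. The exponent \<open>2 - 2 * \<beta>\<close> appears as
    \<open>1 + (1 - 2 * \<beta>)\<close> to fit \<open>powr_tail_integral\<close>.\<close>
  define R where "R = (2 * \<eta>_mass + 1) powr (1 / (1 - \<beta>))"
  have Rp: "0 < R" unfolding R_def using \<eta>_mass_nonneg by simp
  have R1: "R powr (1 - \<beta>) = 2 * \<eta>_mass + 1" unfolding R_def using \<beta> \<eta>_mass_nonneg by (simp add: powr_powr)
  let ?t = "\<lambda>y. indicator {R<..} y * y powr (-(1 + (1 - 2 * \<beta>)))"
  have t: "integrable lborel ?t" by (rule powr_tail_integral(1)) (use Rp \<beta> in auto)
  have t': "integrable lborel (\<lambda>y. ?t (0 + (-1) * y))" by (rule lborel_integrable_real_affine[OF t]) simp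
  have i: "integrable lborel (\<lambda>y. (R powr \<beta>)\<^sup>2 * (norm (g_hat y))\<^sup>2 + 4 * (?t y + ?t (0 + (-1) * y)))"
    using square_integrable_norm2[OF square_integrable_g_hat] t t' by (intro Bochner_Integration.integrable_add integrable_mult_right) auto
  have "integrable lborel (\<lambda>y. (norm (k_hat y))\<^sup>2)"
  proof (rule Bochner_Integration.integrable_bound[OF i])
    have le: "(norm (k_hat y))\<^sup>2 \<le> (R powr \<beta>)\<^sup>2 * (norm (g_hat y))\<^sup>2 + 4 * (?t y + ?t (0 + (-1) * y))" for y
    proof (cases "\<bar>y\<bar> \<le> R")
      case True
      have "\<bar>y\<bar> powr \<beta> \<le> R powr \<beta>" using True \<beta> by (intro powr_mono2) auto
      then have "(norm (k_hat y))\<^sup>2 \<le> (R powr \<beta> * norm (g_hat y))\<^sup>2"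
        unfolding norm_k_hat by (intro power_mono mult_right_mono) auto
      moreover have "0 \<le> ?t y + ?t (0 + (-1) * y)" by simp
      moreover have "a \<le> b \<Longrightarrow> 0 \<le> c \<Longrightarrow> a \<le> b + 4 * c" for a b c :: real by linarith
      ultimately show ?thesis unfolding power_mult_distrib by blast
    next
      case False
      have "y \<noteq> 0" using False Rp by auto
      have "R powr (1 - \<beta>) \<le> \<bar>y\<bar> powr (1 - \<beta>)" using False Rp \<beta> by (intro powr_mono2) auto
      then have h1: "2 * \<eta>_mass + 1 \<le> \<bar>y\<bar> powr (1 - \<beta>)" using R1 by simp
      have "\<bar>y\<bar> powr (1 - \<beta>) - \<eta>_mass \<le> norm (sfdde_h \<beta> \<eta> (\<i> * of_real y))"
        unfolding h_eq using norm_triangle_ineq2[of "(- (\<i> * of_real y)) powr of_real (1 - \<beta>)" "\<eta>_hat y"] norm_\<eta>_hat[of y]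
        by (simp only: norm_powr_of_real) (simp add: norm_mult)
      then have "\<bar>y\<bar> powr (1 - \<beta>) / 2 \<le> norm (sfdde_h \<beta> \<eta> (\<i> * of_real y))"
        using h1 \<eta>_mass_nonneg by linarith
      moreover have p: "0 < \<bar>y\<bar> powr (1 - \<beta>)" using \<open>y \<noteq> 0\<close> by simp
      ultimately have "norm (k_hat y) \<le> 1 / (\<bar>y\<bar> powr (1 - \<beta>) / 2)"
        unfolding k_hat_eq[OF \<open>y \<noteq> 0\<close>] norm_divide norm_one by (intro divide_left_mono mult_pos_pos) (auto simp: sfdde_h_nonzero)
      then have "(norm (k_hat y))\<^sup>2 \<le> (2 / \<bar>y\<bar> powr (1 - \<beta>))\<^sup>2" by (intro power_mono) auto
      also have "\<dots> = 4 * \<bar>y\<bar> powr (-(1 + (1 - 2 * \<beta>)))"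
      proof -
        have "(\<bar>y\<bar> powr (1 - \<beta>))\<^sup>2 = \<bar>y\<bar> powr (1 + (1 - 2 * \<beta>))"
          by (simp add: power2_eq_square flip: powr_add)
        then show ?thesis by (simp only: power_divide powr_minus) (simp add: divide_inverse)
      qed
      also have "\<dots> = 4 * (?t y + ?t (0 + (-1) * y))"
        using False Rp by (cases "y > 0") (auto simp: indicator_def)
      also have "\<dots> \<le> (R powr \<beta>)\<^sup>2 * (norm (g_hat y))\<^sup>2 + 4 * (?t y + ?t (0 + (-1) * y))" by simp
      finally show ?thesis .
    qed
    then show "AE y in lborel. norm ((norm (k_hat y))\<^sup>2)
        \<le> norm ((R powr \<beta>)\<^sup>2 * (norm (g_hat y))\<^sup>2 + 4 * (?t y + ?t (0 + (-1) * y)))"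
      by (intro AE_I2) (simp only: real_norm_def, rule order_trans[OF _ abs_ge_self], simp)
  qed measurable
  then show ?thesis by (simp add: square_integrable_def)
qed

lemma frac_mult_measurable: "0 < \<delta> \<Longrightarrow> frac_mult \<beta> \<delta> \<in> borel_measurable borel"
  unfolding frac_mult_def[abs_def]
  by (intro borel_measurable_times borel_measurable_diff borel_measurable_const char_borel_measurable
      finite_measure_frac_dens[OF \<beta>(1) \<beta>1]) simp_all

text \<open>The uniform bound on the multipliers has exactly the modulus of the limiting symbol, so
  a constant times \<open>k_hat\<close> is the majorant.\<close>

lemma frac_mult_g_hat_tendsto:
  assumes \<delta>: "\<And>n. 0 < \<delta> n" "\<delta> \<longlonglongrightarrow> 0"
  shows "L2_tendsto lborel (\<lambda>n y. frac_mult \<beta> (\<delta> n) y * g_hat y) k_hat sequentially"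
proof -
  obtain K where K: "0 \<le> K" "\<And>\<delta> y. 0 < \<delta> \<Longrightarrow> norm (frac_mult \<beta> \<delta> y) \<le> K * \<bar>y\<bar> powr \<beta>"
    using frac_mult_bound[OF \<beta>(1) \<beta>1] by metis
  note [measurable] = frac_mult_measurable[OF \<delta>(1)]
  show ?thesis
  proof (rule L2_dominated[OF _ _ square_integrable_cmult[OF square_integrable_k_hat, of "of_real K"]])
    show "AE y in lborel. (\<lambda>n. frac_mult \<beta> (\<delta> n) y * g_hat y) \<longlonglongrightarrow> k_hat y"
      unfolding k_hat_def
      by (intro AE_I2 tendsto_mult tendsto_const frac_mult_tendsto \<beta>(1) \<beta>1 \<delta>)
    show "AE y in lborel. norm (frac_mult \<beta> (\<delta> n) y * g_hat y) \<le> norm (of_real K * k_hat y)" for n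
    proof (rule AE_I2)
      fix y
      have "norm (frac_mult \<beta> (\<delta> n) y) * norm (g_hat y) \<le> (K * \<bar>y\<bar> powr \<beta>) * norm (g_hat y)"
        by (intro mult_right_mono K \<delta>) simp
      then show "norm (frac_mult \<beta> (\<delta> n) y * g_hat y) \<le> norm (of_real K * k_hat y)"
        using K(1) by (simp add: norm_mult norm_k_hat mult.assoc)
    qed
  qed measurable
qed

lemma frac_diff_fourier:
  "0 < \<delta> \<Longrightarrow> has_fourier_L2 (\<lambda>t. complex_of_real (frac_diff \<beta> \<delta> g t)) (\<lambda>y. frac_mult \<beta> \<delta> y * g_hat y)"
  by (rule has_fourier_L2_frac_diff[OF \<beta>(1) \<beta>1 _ g_fourier'])

text \<open>The truncated operator uses present and past values only, so causality of
  \<open>g\<close> is inherited.\<close>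

lemma frac_diff_neg:
  assumes "0 < \<delta>" "t < 0"
  shows "frac_diff \<beta> \<delta> g t = 0"
proof -
  let ?w = "\<lambda>u. indicator {\<delta><..} u * u powr (-(1 + \<beta>))"
  have w: "integrable lborel ?w" "\<And>u. 0 \<le> ?w u" using powr_tail_integral(1)[OF assms(1) \<beta>(1)] by auto
  have "?w v *\<^sub>R g (t - v) = 0" for v using g_neg[of "t - v"] assms by (auto simp: indicator_def)
  then have "conv (frac_dens \<beta> \<delta>) g t = 0"
    unfolding frac_dens_def conv_dens[OF w g_measurable] by (simp only:) simp
  then show ?thesis using g_neg assms by (simp add: frac_diff_def)
qed

definition kern :: "real \<Rightarrow> real" where
  "kern = (SOME k. (\<forall>t<0. k t = 0) \<and> has_fourier_L2 (\<lambda>t. complex_of_real (k t)) k_hat)"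

text \<open>The inverse transform of \<open>k_hat\<close> is obtained without inverting anything:
  the truncated derivatives of \<open>g\<close> are real and causal, Plancherel's identity makes
  them a Cauchy sequence, and their limit inherits both properties.\<close>

lemma kern_exists: "\<exists>k :: real \<Rightarrow> real. (\<forall>t<0. k t = 0) \<and> has_fourier_L2 (\<lambda>t. complex_of_real (k t)) k_hat"
proof -
  define \<delta> where "\<delta> n = 1 / (real n + 1)" for n
  have \<delta>: "\<And>n. 0 < \<delta> n" by (simp add: \<delta>_def)
  have \<delta>0: "\<delta> \<longlonglongrightarrow> 0" unfolding \<delta>_def by real_asymp
  let ?F = "\<lambda>n. frac_diff \<beta> (\<delta> n) g"
  let ?\<Phi> = "\<lambda>n y. frac_mult \<beta> (\<delta> n) y * g_hat y"
  note Fl = frac_mult_g_hat_tendsto[OF \<delta> \<delta>0]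
  note Ff = frac_diff_fourier[OF \<delta>]
  have sF: "square_integrable lborel (?F n)" for n
    by (rule square_integrable_frac_diff[OF \<beta>(1) \<beta>1 \<delta> g])
  have sP: "square_integrable lborel (?\<Phi> n)" for n using has_fourier_L2_square_integrable[OF Ff] by simp
  have d: "L2norm lborel (\<lambda>t. ?F m t - ?F n t) = L2norm lborel (\<lambda>y. ?\<Phi> m y - ?\<Phi> n y) / sqrt (2 * pi)" for m n
    using has_fourier_L2_norm_diff[OF Ff[of m] Ff[of n]] L2norm_complex_of_real[of lborel "\<lambda>t. ?F m t - ?F n t"]
    by simp
  obtain k0 where k0: "L2_tendsto lborel ?F k0 sequentially"
  proof (rule L2_complete[OF sF])
    fix e :: real assume e: "0 < e"
    obtain N where N: "\<forall>m\<ge>N. \<forall>n\<ge>N. L2norm lborel (\<lambda>y. ?\<Phi> m y - ?\<Phi> n y) \<le> e"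
      using L2_tendsto_Cauchy[OF Fl e sP] by auto
    \<comment> \<open>Since this factor is at least 1, the Cauchy bound for the transforms can be
      reused without adjusting \<open>e\<close>.\<close>
    have "1 \<le> sqrt (2 * pi)" using pi_gt3 by (simp add: real_le_rsqrt)
    then have le: "L2norm lborel (\<lambda>t. ?F m t - ?F n t) \<le> L2norm lborel (\<lambda>y. ?\<Phi> m y - ?\<Phi> n y)" for m n
      unfolding d using divide_left_mono[of 1 "sqrt (2 * pi)" "L2norm lborel (\<lambda>y. ?\<Phi> m y - ?\<Phi> n y)"] by simp
    show "\<exists>N. \<forall>m\<ge>N. \<forall>n\<ge>N. L2norm lborel (\<lambda>t. ?F m t - ?F n t) \<le> e"
    proof (intro exI[of _ N] allI impI)
      fix m n assume "N \<le> m" "N \<le> n"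
      with N have "L2norm lborel (\<lambda>y. ?\<Phi> m y - ?\<Phi> n y) \<le> e" by blast
      then show "L2norm lborel (\<lambda>t. ?F m t - ?F n t) \<le> e" by (rule order_trans[OF le])
    qed
  qed
  \<comment> \<open>An L2 limit vanishes on the negative axis only almost everywhere. Setting it to
    0 there cannot increase its distance to the truncated derivatives, which vanish there
    themselves.\<close>
  define k where "k t = indicator {0..} t * k0 t" for t
  have sk0: "square_integrable lborel k0" using k0 by (simp add: L2_tendsto_iff)
  note [measurable] = square_integrable_measurable[OF sk0, simplified] square_integrable_measurable[OF sF, simplified]
  have sk: "square_integrable lborel k"
  proof (rule square_integrable_bound[OF sk0])
    show "k \<in> borel_measurable lborel" unfolding k_def[abs_def] by measurable
  qed (auto simp: k_def indicator_def)
  have kl: "L2_tendsto lborel ?F k sequentially"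
  proof (rule L2_tendsto_sandwich[OF sk])
    have "L2norm lborel (\<lambda>t. ?F n t - k t) \<le> L2norm lborel (\<lambda>t. ?F n t - k0 t)" for n
    proof -
      have "(L2norm lborel (\<lambda>t. ?F n t - k t))\<^sup>2 \<le> (L2norm lborel (\<lambda>t. ?F n t - k0 t))\<^sup>2"
        unfolding L2norm_power2
      proof (rule integral_mono)
        show "(norm (?F n t - k t))\<^sup>2 \<le> (norm (?F n t - k0 t))\<^sup>2" for t
          using frac_diff_neg[OF \<delta>, of t n] by (auto simp: k_def indicator_def not_le)
      qed (intro square_integrable_norm2 square_integrable_diff sF sk sk0)+
      then show ?thesis by (rule power2_le_imp_le) simp
    qed
    then show "\<forall>\<^sub>F n in sequentially. L2norm lborel (\<lambda>t. ?F n t - k t) \<le> L2norm lborel (\<lambda>t. ?F n t - k0 t)"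
      by simp
    show "(\<lambda>n. L2norm lborel (\<lambda>t. ?F n t - k0 t)) \<longlonglongrightarrow> 0" using k0 by (simp add: L2_tendsto_iff)
  qed (simp add: sF)
  have "L2_tendsto lborel (\<lambda>n t. complex_of_real (?F n t)) (\<lambda>t. complex_of_real (k t)) sequentially"
    using kl L2norm_complex_of_real[of lborel "\<lambda>t. ?F n t - k t" for n]
    by (simp add: L2_tendsto_iff square_integrable_complex_of_real sF)
  from has_fourier_L2_limit[OF Ff this Fl] show ?thesis by (intro exI[of _ k]) (auto simp: k_def)
qed

lemma kern_neg: "t < 0 \<Longrightarrow> kern t = 0"
  and kern_fourier: "has_fourier_L2 (\<lambda>t. complex_of_real (kern t)) k_hat"
  using someI_ex[OF kern_exists] unfolding kern_def by auto

lemma kern: "square_integrable lborel kern"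
  using square_integrable_Re[OF has_fourier_L2_square_integrable(1)[OF kern_fourier]] by simp

lemma kern_measurable [measurable]: "kern \<in> borel_measurable borel"
  using square_integrable_measurable[OF kern] by simp

lemma frac_diff_tendsto_kern_seq:
  assumes \<delta>: "\<And>n. 0 < \<delta> n" "\<delta> \<longlonglongrightarrow> 0"
  shows "(\<lambda>n. L2norm lborel (\<lambda>t. frac_diff \<beta> (\<delta> n) g t - kern t)) \<longlonglongrightarrow> 0"
proof -
  have "L2norm lborel (\<lambda>t. frac_diff \<beta> (\<delta> n) g t - kern t)
      = L2norm lborel (\<lambda>y. frac_mult \<beta> (\<delta> n) y * g_hat y - k_hat y) / sqrt (2 * pi)" for n
    using has_fourier_L2_norm_diff[OF frac_diff_fourier[OF \<delta>(1)] kern_fourier]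
      L2norm_complex_of_real[of lborel "\<lambda>t. frac_diff \<beta> (\<delta> n) g t - kern t"] by simp
  moreover have "(\<lambda>n. L2norm lborel (\<lambda>y. frac_mult \<beta> (\<delta> n) y * g_hat y - k_hat y) / sqrt (2 * pi)) \<longlonglongrightarrow> 0 / sqrt (2 * pi)"
    using frac_mult_g_hat_tendsto[OF \<delta>] by (intro tendsto_divide tendsto_const) (auto simp: L2_tendsto_iff)
  ultimately show ?thesis by simp
qed

lemma frac_diff_tendsto_kern:
  "((\<lambda>\<delta>. L2norm lborel (\<lambda>t. frac_diff \<beta> \<delta> g t - kern t)) \<longlongrightarrow> 0) (at_right 0)"
  unfolding tendsto_at_iff_sequentially comp_def
  by (auto intro: frac_diff_tendsto_kern_seq)

end

section \<open>Pointwise Marchaud derivative of the filter\<close>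

definition ind_dens :: "real \<Rightarrow> real measure" where
  "ind_dens a = dens (\<lambda>x. indicator {0..a} x)"

lemma integrable_indicator_Icc: "integrable lborel (\<lambda>x. indicator {a..b::real} x :: real)"
  by (cases "a \<le> b") (auto simp: emeasure_lborel_Icc_eq)

lemma finite_measure_ind_dens: "finite_measure (ind_dens a)"
  unfolding ind_dens_def by (rule finite_measure_dens[OF integrable_indicator_Icc]) simp

lemma sets_ind_dens [simp]: "sets (ind_dens a) = sets borel"
  by (simp add: ind_dens_def)

text \<open>The fundamental theorem of calculus in Fourier form: taking increments over a step
  \<open>a\<close> is differentiation followed by convolution with the indicator of
  \<open>[0,a]\<close>. Multiplying by \<open>-iy\<close> instead of dividing includes
  \<open>y = 0\<close>.\<close>

lemma char_ind_dens_eq: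
  assumes a: "0 \<le> a"
  shows "- (\<i> * of_real y) * char (ind_dens a) y = 1 - exp (\<i> * of_real (y * a))"
proof (cases "y = 0")
  case True
  then show ?thesis by simp
next
  case False
  let ?F = "\<lambda>u. exp (\<i> * of_real (y * u)) / (\<i> * of_real y)"
  have "char (ind_dens a) y = (\<integral>u. indicator {0..a} u *\<^sub>R exp (\<i> * of_real (y * u)) \<partial>lborel)"
    unfolding ind_dens_def by (rule char_dens[OF integrable_indicator_Icc]) simp
  also have "\<dots> = ?F a - ?F 0"
  proof (rule integral_FTC_Icc[OF a])
    fix u
    have "((\<lambda>z. exp (\<i> * (of_real y * z)) / (\<i> * of_real y)) has_field_derivative exp (\<i> * of_real (y * u))) (at (of_real u))"
    proof -
      have ii: "- (\<i> * (z * \<i>)) = z" for z by (simp add: complex_eq_iff)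
      show ?thesis using False by (auto intro!: derivative_eq_intros simp: field_simps ii)
    qed
    then show "(?F has_vector_derivative exp (\<i> * of_real (y * u))) (at u within {0..a})"
      using has_vector_derivative_real_field[of "\<lambda>z. exp (\<i> * (of_real y * z)) / (\<i> * of_real y)"
          "exp (\<i> * of_real (y * u))" u "{0..a}"] by simp
  qed (intro continuous_intros)
  finally show ?thesis using False by (simp add: field_simps)
qed

lemma has_fourier_L2_indicator: "has_fourier_L2 (\<lambda>t. complex_of_real (indicator {0..a} t)) (char (ind_dens a))"
proof -
  have "fourier (\<lambda>t. complex_of_real (indicator {0..a} t)) y = char (ind_dens a) y" for y
    unfolding ind_dens_def by (subst char_dens[OF integrable_indicator_Icc])
      (auto simp: fourier_def scaleR_conv_of_real mult.commute intro!: Bochner_Integration.integral_cong)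
  then have e: "char (ind_dens a) = fourier (\<lambda>t. complex_of_real (indicator {0..a} t))" by auto
  show ?thesis
    unfolding e
  proof (rule has_fourier_L2I)
    show "integrable lborel (\<lambda>t. complex_of_real (indicator {0..a} t))"
      by (intro integrable_of_real integrable_indicator_Icc)
    show "square_integrable lborel (\<lambda>t. complex_of_real (indicator {0..a} t))"
      by (intro square_integrable_complex_of_real square_integrable_indicator) (auto simp: emeasure_lborel_Icc_eq)
  qed
qed

text \<open>A translation is the convolution with a point mass at \<open>a\<close>.\<close>

lemma has_fourier_L2_translate:
  assumes "has_fourier_L2 f \<phi>"
  shows "has_fourier_L2 (\<lambda>t. f (t - a)) (\<lambda>y. exp (\<i> * of_real (y * a)) * \<phi> y)"
proof -
  have [measurable]: "f \<in> borel_measurable borel"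
    using square_integrable_measurable[OF has_fourier_L2_square_integrable(1)[OF assms]] by simp
  interpret prob_space "return borel a" by (rule prob_space_return) simp
  have "has_fourier_L2 (conv (return borel a) f) (\<lambda>y. char (return borel a) y * \<phi> y)"
    by (rule has_fourier_L2_conv[OF finite_measure_axioms _ assms]) simp
  moreover have "conv (return borel a) f = (\<lambda>t. f (t - a))"
    unfolding conv_def by (rule ext, rule integral_return) simp_all
  moreover have "char (return borel a) y = exp (\<i> * of_real (y * a))" for y
    unfolding char_def by (rule integral_return) simp_all
  ultimately show ?thesis by simp
qed

text \<open>For every \<open>t\<close>, not merely almost every one: away from 0 the weight is
  itself square integrable, so Cauchy-Schwarz applies at each point.\<close>

lemma frac_dens_integrable:
  assumes \<beta>: "0 < \<beta>" and \<delta>: "0 < \<delta>" and f: "square_integrable lborel (f :: real \<Rightarrow> real)"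
  shows "integrable (frac_dens \<beta> \<delta>) (\<lambda>u. f (t - u))"
    "integrable lborel (\<lambda>u. indicator {\<delta><..} u * u powr (-(1 + \<beta>)) * f (t - u))"
proof -
  let ?w = "\<lambda>u. indicator {\<delta><..} u * u powr (-(1 + \<beta>))"
  have [measurable]: "f \<in> borel_measurable borel" using square_integrable_measurable[OF f] by simp
  have w: "integrable lborel ?w" "\<And>u. 0 \<le> ?w u" using powr_tail_integral(1)[OF \<delta> \<beta>] by auto
  have "integrable lborel (\<lambda>u. indicator {\<delta><..} u * u powr (-(1 + (1 + 2 * \<beta>))))"
    by (rule powr_tail_integral(1)) (use \<delta> \<beta> in auto)
  moreover have "(norm (?w u))\<^sup>2 = indicator {\<delta><..} u * u powr (-(1 + (1 + 2 * \<beta>)))" for u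
    using \<delta> by (simp add: power_mult_distrib power2_eq_square indicator_def flip: powr_add)
  ultimately have "square_integrable lborel ?w" by (simp add: square_integrable_def)
  from square_integrable_mult[OF this square_integrable_shift(2)[OF f]]
  show i: "integrable lborel (\<lambda>u. ?w u * f (t - u))" by simp
  then show "integrable (frac_dens \<beta> \<delta>) (\<lambda>u. f (t - u))"
    unfolding frac_dens_def by (subst integrable_dens[OF w]) auto
qed

text \<open>Near \<open>\<delta>\<close> all truncation points lie beyond
  \<open>\<delta> / 2\<close>, so the integrand truncated there is a majorant. Continuity allows
  restricting to rational truncation points when measurability of the limit is shown.\<close>

lemma frac_diff_isCont:
  assumes \<beta>: "0 < \<beta>" and \<delta>: "0 < \<delta>" and f: "square_integrable lborel f"
  shows "isCont (\<lambda>\<delta>. frac_diff \<beta> \<delta> f t) \<delta>"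
proof -
  let ?w = "\<lambda>\<delta> u. indicator {\<delta><..} u * u powr (-(1 + \<beta>)) :: real"
  have [measurable]: "f \<in> borel_measurable borel" using square_integrable_measurable[OF f] by simp
  have c: "conv (frac_dens \<beta> d) f t = (\<integral>u. ?w d u * f (t - u) \<partial>lborel)" if "0 < d" for d
    using powr_tail_integral(1)[OF that \<beta>] unfolding frac_dens_def by (subst conv_dens) auto
  have "((\<lambda>d. conv (frac_dens \<beta> d) f t) \<longlongrightarrow> conv (frac_dens \<beta> \<delta>) f t) (at \<delta> within {\<delta> / 2<..})"
    unfolding tendsto_at_iff_sequentially comp_def
  proof (intro allI impI)
    fix X assume X: "\<forall>i. X i \<in> {\<delta> / 2<..} - {\<delta>}" "X \<longlonglongrightarrow> \<delta>"
    have Xp: "\<delta> / 2 < X i" for i using X(1) by auto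
    then have Xp': "0 < X i" for i using \<delta> by (meson half_gt_zero less_trans)
    have "(\<lambda>i. \<integral>u. ?w (X i) u * f (t - u) \<partial>lborel) \<longlonglongrightarrow> (\<integral>u. ?w \<delta> u * f (t - u) \<partial>lborel)"
    proof (rule integral_dominated_convergence[where w = "\<lambda>u. norm (?w (\<delta> / 2) u * f (t - u))"])
      show "integrable lborel (\<lambda>u. norm (?w (\<delta> / 2) u * f (t - u)))"
        by (intro integrable_norm frac_dens_integrable(2) \<beta> f) (use \<delta> in simp)
      show "AE u in lborel. (\<lambda>i. ?w (X i) u * f (t - u)) \<longlonglongrightarrow> ?w \<delta> u * f (t - u)"
      proof (rule eventually_mono[OF AE_lborel_singleton[of \<delta>]])
        fix u assume "u \<noteq> \<delta>"
        have "\<forall>\<^sub>F i in sequentially. indicator {X i<..} u = (indicator {\<delta><..} u :: real)"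
        proof (cases "\<delta> < u")
          case True
          then show ?thesis using True by (intro eventually_mono[OF order_tendstoD(2)[OF X(2) True]]) simp
        next
          case False
          then have "u < \<delta>" using \<open>u \<noteq> \<delta>\<close> by simp
          then show ?thesis by (intro eventually_mono[OF order_tendstoD(1)[OF X(2)]]) (auto simp: indicator_def)
        qed
        then show "(\<lambda>i. ?w (X i) u * f (t - u)) \<longlonglongrightarrow> ?w \<delta> u * f (t - u)"
          by (intro tendsto_mult tendsto_const tendsto_eventually)
      qed
      show "AE u in lborel. norm (?w (X i) u * f (t - u)) \<le> norm (?w (\<delta> / 2) u * f (t - u))" for i
        using Xp[of i] by (intro AE_I2) (auto simp: indicator_def)
    qed measurable
    then show "(\<lambda>i. conv (frac_dens \<beta> (X i)) f t) \<longlonglongrightarrow> conv (frac_dens \<beta> \<delta>) f t"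
      using c[OF Xp'] c[OF \<delta>] by simp
  qed
  moreover have "at \<delta> within {\<delta> / 2<..} = at \<delta>" using \<delta> by (intro at_within_open) auto
  ultimately have "isCont (\<lambda>d. conv (frac_dens \<beta> d) f t) \<delta>" by (simp add: isCont_def)
  then show ?thesis unfolding frac_diff_def using \<delta> \<beta> by (intro continuous_intros) auto
qed

lemma marchaud_truncated_L2:
  assumes \<beta>: "0 < \<beta>" "\<beta> < 1" and \<delta>: "0 < \<delta>" and f: "square_integrable lborel f"
  shows "set_integrable lborel {\<delta><..} (marchaud_integrand \<beta> f t)"
    "marchaud_truncated \<beta> f t \<delta> = frac_diff \<beta> \<delta> f t"
  using marchaud_truncated_eq[OF \<beta> \<delta> _ frac_dens_integrable(1)[OF \<beta>(1) \<delta> f]] square_integrable_measurable[OF f]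
  by auto

lemma has_marchaud_derivative_L2_iff:
  assumes \<beta>: "0 < \<beta>" "\<beta> < 1" and f: "square_integrable lborel f"
  shows "has_marchaud_derivative \<beta> f t D \<longleftrightarrow> ((\<lambda>\<delta>. frac_diff \<beta> \<delta> f t) \<longlongrightarrow> D) (at_right 0)"
proof -
  have "\<forall>\<^sub>F \<delta> in at_right 0. marchaud_truncated \<beta> f t \<delta> = frac_diff \<beta> \<delta> f t"
    using eventually_at_right_less[of 0] by eventually_elim (rule marchaud_truncated_L2(2)[OF \<beta> _ f])
  then have "(marchaud_truncated \<beta> f t \<longlongrightarrow> D) (at_right 0) \<longleftrightarrow> ((\<lambda>\<delta>. frac_diff \<beta> \<delta> f t) \<longlongrightarrow> D) (at_right 0)"
    by (rule tendsto_cong)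
  then show ?thesis
    unfolding has_marchaud_derivative_def using marchaud_truncated_L2(1)[OF \<beta> _ f] by auto
qed

text \<open>By continuity in \<open>\<delta>\<close> the Cauchy criterion for the limit \<open>\<delta> \<down> 0\<close> can be tested on rational \<open>\<delta>\<close>, which
  makes its domain a Borel set.\<close>

lemma at_right_limit_iff_rational_Cauchy:
  fixes T :: "real \<Rightarrow> real"
  assumes cont: "\<And>\<delta>. 0 < \<delta> \<Longrightarrow> isCont T \<delta>"
  shows "(\<exists>D. (T \<longlongrightarrow> D) (at_right 0)) \<longleftrightarrow>
    (\<forall>k::nat. \<exists>n::nat. \<forall>p q :: rat. 0 < p \<and> real_of_rat p < 1 / (real n + 1) \<and> 0 < q \<and> real_of_rat q < 1 / (real n + 1)
      \<longrightarrow> \<bar>T (real_of_rat p) - T (real_of_rat q)\<bar> \<le> 1 / (real k + 1))" (is "?L \<longleftrightarrow> ?R")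
proof
  assume ?L
  then obtain D where D: "(T \<longlongrightarrow> D) (at_right 0)" by blast
  show ?R
  proof
    fix k :: nat
    define e where "e = 1 / (real k + 1) / 2"
    have "0 < e" by (simp add: e_def)
    from tendstoD[OF D this] obtain b where b: "0 < b" "\<And>x. 0 < x \<Longrightarrow> x < b \<Longrightarrow> dist (T x) D < e"
      unfolding eventually_at_right[OF zero_less_one] by blast
    obtain n :: nat where n: "1 / (real n + 1) < b"
      using reals_Archimedean[OF b(1)] by (auto simp: inverse_eq_divide add.commute)
    have "\<bar>T x - T y\<bar> \<le> 1 / (real k + 1)" if "0 < x" "x < 1 / (real n + 1)" "0 < y" "y < 1 / (real n + 1)" for x y
    proof -
      have "x = 2 * (x / 2)" for x :: real by simp
      then have "1 / (real k + 1) = 2 * e" unfolding e_def .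
      moreover have "\<bar>T x - D\<bar> < e" "\<bar>T y - D\<bar> < e"
        using b(2)[of x] b(2)[of y] that less_trans[OF that(2) n] less_trans[OF that(4) n] by (auto simp: dist_real_def)
      ultimately show ?thesis by linarith
    qed
    then show "\<exists>n::nat. \<forall>p q :: rat. 0 < p \<and> real_of_rat p < 1 / (real n + 1) \<and> 0 < q \<and> real_of_rat q < 1 / (real n + 1)
      \<longrightarrow> \<bar>T (real_of_rat p) - T (real_of_rat q)\<bar> \<le> 1 / (real k + 1)"
      by (intro exI[of _ n]) auto
  qed
next
  assume R: ?R
  have R': "\<exists>b>0. \<forall>x y. 0 < x \<and> x < b \<and> 0 < y \<and> y < b \<longrightarrow> \<bar>T x - T y\<bar> \<le> e" if e: "0 < e" for e
  proof -
    obtain k :: nat where k: "1 / (real k + 1) < e"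
      using reals_Archimedean[OF e] by (auto simp: inverse_eq_divide add.commute)
    obtain n :: nat where n: "\<forall>p q :: rat. 0 < p \<and> real_of_rat p < 1 / (real n + 1) \<and> 0 < q \<and> real_of_rat q < 1 / (real n + 1)
      \<longrightarrow> \<bar>T (real_of_rat p) - T (real_of_rat q)\<bar> \<le> 1 / (real k + 1)" using R by blast
    have approx: "\<exists>p :: nat \<Rightarrow> rat. (\<forall>i. 0 < p i \<and> real_of_rat (p i) < 1 / (real n + 1)) \<and> (\<lambda>i. T (real_of_rat (p i))) \<longlonglongrightarrow> T x"
      if x: "0 < x" "x < 1 / (real n + 1)" for x
    proof -
      have "\<exists>r :: rat. max 0 (x - 1 / (real i + 1)) < real_of_rat r \<and> real_of_rat r < x" for i :: nat
        using x by (intro of_rat_dense) auto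
      then obtain p :: "nat \<Rightarrow> rat" where p: "\<And>i. max 0 (x - 1 / (real i + 1)) < real_of_rat (p i)" "\<And>i. real_of_rat (p i) < x"
        by metis
      have l: "(\<lambda>i. x - 1 / (real i + 1)) \<longlonglongrightarrow> x" by real_asymp
      have "(\<lambda>i. real_of_rat (p i)) \<longlonglongrightarrow> x"
        by (rule tendsto_sandwich[OF _ _ l tendsto_const]) (use p in \<open>auto intro!: always_eventually less_imp_le\<close>)
      then have "(\<lambda>i. T (real_of_rat (p i))) \<longlonglongrightarrow> T x"
        by (rule isCont_tendsto_compose[OF cont[OF x(1)]])
      moreover have "0 < p i \<and> real_of_rat (p i) < 1 / (real n + 1)" for i
        using p(1)[of i] p(2)[of i] x by auto
      ultimately show ?thesis by (intro exI[of _ p]) auto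
    qed
    have "\<bar>T x - T y\<bar> \<le> e" if xy: "0 < x" "x < 1 / (real n + 1)" "0 < y" "y < 1 / (real n + 1)" for x y
    proof -
      obtain p q :: "nat \<Rightarrow> rat" where p: "\<And>i. 0 < p i" "\<And>i. real_of_rat (p i) < 1 / (real n + 1)" "(\<lambda>i. T (real_of_rat (p i))) \<longlonglongrightarrow> T x"
        and q: "\<And>i. 0 < q i" "\<And>i. real_of_rat (q i) < 1 / (real n + 1)" "(\<lambda>i. T (real_of_rat (q i))) \<longlonglongrightarrow> T y"
        using approx[OF xy(1,2)] approx[OF xy(3,4)] by metis
      have "(\<lambda>i. \<bar>T (real_of_rat (p i)) - T (real_of_rat (q i))\<bar>) \<longlonglongrightarrow> \<bar>T x - T y\<bar>"
        by (intro tendsto_intros p q)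
      moreover have "\<bar>T (real_of_rat (p i)) - T (real_of_rat (q i))\<bar> \<le> e" for i
        using n p(1,2)[of i] q(1,2)[of i] k by (meson less_imp_le order_trans)
      ultimately show ?thesis by (intro LIMSEQ_le_const2) auto
    qed
    then show ?thesis by (intro exI[of _ "1 / (real n + 1)"]) auto
  qed
  have "Cauchy (\<lambda>m. T (1 / (real m + 1)))"
  proof (rule metric_CauchyI)
    fix e :: real assume "0 < e"
    then obtain b where b: "0 < b" "\<And>x y. 0 < x \<Longrightarrow> x < b \<Longrightarrow> 0 < y \<Longrightarrow> y < b \<Longrightarrow> \<bar>T x - T y\<bar> \<le> e / 2"
      using R'[of "e / 2"] by auto
    have "(\<lambda>m. 1 / (real m + 1)) \<longlonglongrightarrow> 0" by real_asymp
    from order_tendstoD(2)[OF this b(1)] obtain N where N: "\<And>m. m \<ge> N \<Longrightarrow> 1 / (real m + 1) < b"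
      by (auto simp: eventually_sequentially)
    have "dist (T (1 / (real m + 1))) (T (1 / (real n + 1))) < e" if "m \<ge> N" "n \<ge> N" for m n
      using b(2)[of "1 / (real m + 1)" "1 / (real n + 1)"] N[OF that(1)] N[OF that(2)] \<open>0 < e\<close> by (simp add: dist_real_def)
    then show "\<exists>M. \<forall>m\<ge>M. \<forall>n\<ge>M. dist (T (1 / (real m + 1))) (T (1 / (real n + 1))) < e" by blast
  qed
  then obtain D where D: "(\<lambda>m. T (1 / (real m + 1))) \<longlonglongrightarrow> D"
    using Cauchy_convergent convergent_def by blast
  have "(T \<longlongrightarrow> D) (at_right 0)"
  proof (rule tendstoI)
    fix e :: real assume "0 < e"
    then obtain b where b: "0 < b" "\<And>x y. 0 < x \<Longrightarrow> x < b \<Longrightarrow> 0 < y \<Longrightarrow> y < b \<Longrightarrow> \<bar>T x - T y\<bar> \<le> e / 2"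
      using R'[of "e / 2"] by auto
    have l: "(\<lambda>m. 1 / (real m + 1)) \<longlonglongrightarrow> 0" by real_asymp
    have "dist (T x) D < e" if x: "0 < x" "x < b" for x
    proof -
      have "(\<lambda>m. \<bar>T x - T (1 / (real m + 1))\<bar>) \<longlonglongrightarrow> \<bar>T x - D\<bar>" by (intro tendsto_intros D)
      moreover have "\<forall>\<^sub>F m in sequentially. \<bar>T x - T (1 / (real m + 1))\<bar> \<le> e / 2"
        using order_tendstoD(2)[OF l b(1)] by eventually_elim (use x in \<open>intro b(2); simp\<close>)
      ultimately have "\<bar>T x - D\<bar> \<le> e / 2" by (rule tendsto_upperbound) simp
      then show ?thesis using \<open>0 < e\<close> by (simp add: dist_real_def)
    qed
    then show "\<forall>\<^sub>F x in at_right 0. dist (T x) D < e"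
      unfolding eventually_at_right[OF zero_less_one] using b(1) by auto
  qed
  then show ?L by blast
qed

text \<open>The derivative is defined by a definite description on the set where the limit exists.
  That set is Borel by the rational Cauchy criterion, and on it the limit may be taken along
  \<open>1 / (m + 1)\<close>.\<close>

lemma marchaud_derivative_measurable:
  assumes \<beta>: "0 < \<beta>" "\<beta> < 1" and f: "square_integrable lborel f"
  shows "marchaud_derivative \<beta> f \<in> borel_measurable borel"
proof -
  let ?T = "\<lambda>\<delta> t. frac_diff \<beta> \<delta> f t"
  let ?E = "\<lambda>t. \<exists>D. (( \<lambda>\<delta>. ?T \<delta> t) \<longlongrightarrow> D) (at_right 0)"
  have m: "?T \<delta> \<in> borel_measurable borel" if "0 < \<delta>" for \<delta>
    using square_integrable_measurable[OF square_integrable_frac_diff[OF \<beta> that f]] by simp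
  have E: "?E t \<longleftrightarrow> (\<forall>k::nat. \<exists>n::nat. \<forall>p q :: rat. 0 < p \<and> real_of_rat p < 1 / (real n + 1) \<and> 0 < q \<and> real_of_rat q < 1 / (real n + 1)
      \<longrightarrow> \<bar>?T (real_of_rat p) t - ?T (real_of_rat q) t\<bar> \<le> 1 / (real k + 1))" for t
    by (rule at_right_limit_iff_rational_Cauchy) (rule frac_diff_isCont[OF \<beta>(1) _ f])
  have mE: "Measurable.pred borel ?E"
    unfolding E
  proof (intro pred_intros_countable)
    fix k n :: nat and p q :: rat
    show "Measurable.pred borel (\<lambda>t. 0 < p \<and> real_of_rat p < 1 / (real n + 1) \<and> 0 < q \<and> real_of_rat q < 1 / (real n + 1)
      \<longrightarrow> \<bar>?T (real_of_rat p) t - ?T (real_of_rat q) t\<bar> \<le> 1 / (real k + 1))"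
    \<comment> \<open>Measurability of \<open>?T \<delta>\<close> is available for positive \<delta>
      only; for other \<open>p\<close> or \<open>q\<close> the implication is vacuous.\<close>
    proof (cases "0 < p \<and> 0 < q")
      case True
      then have [measurable]: "?T (real_of_rat p) \<in> borel_measurable borel" "?T (real_of_rat q) \<in> borel_measurable borel"
        by (auto intro!: m)
      show ?thesis by measurable
    next
      case False
      then have "(\<lambda>t. 0 < p \<and> real_of_rat p < 1 / (real n + 1) \<and> 0 < q \<and> real_of_rat q < 1 / (real n + 1)
        \<longrightarrow> \<bar>?T (real_of_rat p) t - ?T (real_of_rat q) t\<bar> \<le> 1 / (real k + 1)) = (\<lambda>t. True)" by auto
      then show ?thesis by simp
    qed
  qed
  have "marchaud_derivative \<beta> f t = (if 0 < t \<and> ?E t then lim (\<lambda>m. ?T (1 / (real m + 1)) t) else 0)" for t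
  proof (cases "0 < t \<and> ?E t")
    case True
    then obtain D where D: "((\<lambda>\<delta>. ?T \<delta> t) \<longlongrightarrow> D) (at_right 0)" by blast
    have "filterlim (\<lambda>m. 1 / (real m + 1)) (at_right 0) sequentially" by real_asymp
    then have "(\<lambda>m. ?T (1 / (real m + 1)) t) \<longlonglongrightarrow> D" by (rule filterlim_compose[OF D])
    then have "lim (\<lambda>m. ?T (1 / (real m + 1)) t) = D" by (rule limI)
    moreover have "(THE D. has_marchaud_derivative \<beta> f t D) = D"
      unfolding has_marchaud_derivative_L2_iff[OF \<beta> f]
      by (rule the_equality, rule D) (rule tendsto_unique[OF trivial_limit_at_right_real _ D])
    moreover have "has_marchaud_derivative \<beta> f t D"
      using D by (simp add: has_marchaud_derivative_L2_iff[OF \<beta> f])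
    ultimately show ?thesis
      using True by (auto simp: marchaud_derivative_def)
  next
    case False
    then show ?thesis by (auto simp: marchaud_derivative_def has_marchaud_derivative_L2_iff[OF \<beta> f])
  qed
  then have e: "marchaud_derivative \<beta> f = (\<lambda>t. if 0 < t \<and> ?E t then lim (\<lambda>m. ?T (1 / (real m + 1)) t) else 0)" by auto
  have [measurable]: "?T (1 / (real m + 1)) \<in> borel_measurable borel" for m by (rule m) simp
  note [measurable] = mE
  show ?thesis unfolding e by measurable
qed

section \<open>The increments of the filter and its Hoelder continuous version\<close>

context sfdde_filter
begin

text \<open>The absolutely continuous part of the derivative of \<open>g\<close>, that is
  \<open>\<eta> * k\<close>.\<close>

definition drift :: "real \<Rightarrow> real" where
  "drift = sconv \<eta> kern"

lemma drift: "square_integrable lborel drift"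
  unfolding drift_def by (rule square_integrable_sconv[OF \<eta> kern])

lemma drift_measurable [measurable]: "drift \<in> borel_measurable borel"
  using square_integrable_measurable[OF drift] by simp

lemma drift_neg: "t < 0 \<Longrightarrow> drift t = 0"
  unfolding drift_def using kern_neg by (intro sconv_eq_0[OF \<eta>]) auto

lemma drift_fourier: "has_fourier_L2 (\<lambda>t. complex_of_real (drift t)) (\<lambda>y. \<eta>_hat y * k_hat y)"
  using has_fourier_L2_sconv[OF \<eta> kern_fourier] unfolding drift_def \<eta>_hat_def sconv_of_real[OF \<eta>, abs_def] by simp

text \<open>In Fourier space \<open>h k_hat = 1\<close> reads \<open>(-iy) g_hat = 1 + \<eta>_hat k_hat\<close>, that is \<open>g' = \<delta>\<^sub>0 + \<eta> * k\<close>; working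
  with increments of \<open>g\<close> avoids distributions.\<close>

lemma g_increment_AE:
  assumes a: "0 < a"
  shows "AE t in lborel. g t - g (t - a) = indicator {0..a} t + conv (ind_dens a) drift t"
proof -
  let ?E = "\<lambda>y. exp (\<i> * of_real (y * a))"
  have L: "has_fourier_L2 (\<lambda>t. complex_of_real (g t) - complex_of_real (g (t - a))) (\<lambda>y. g_hat y - ?E y * g_hat y)"
    by (rule has_fourier_L2_diff[OF g_fourier' has_fourier_L2_translate[OF g_fourier']])
  have R: "has_fourier_L2 (\<lambda>t. complex_of_real (indicator {0..a} t) + conv (ind_dens a) (\<lambda>t. complex_of_real (drift t)) t)
      (\<lambda>y. char (ind_dens a) y + char (ind_dens a) y * (\<eta>_hat y * k_hat y))"
    by (intro has_fourier_L2_add has_fourier_L2_indicator has_fourier_L2_conv drift_fourier finite_measure_ind_dens sets_ind_dens)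
  have eq: "g_hat y - ?E y * g_hat y = char (ind_dens a) y + char (ind_dens a) y * (\<eta>_hat y * k_hat y)" if y: "y \<noteq> 0" for y
  proof -
    define w where "w = - (\<i> * complex_of_real y)"
    have w: "w \<noteq> 0" using y by (simp add: w_def)
    have "(w powr of_real (1 - \<beta>) - \<eta>_hat y) * k_hat y = 1"
      using sfdde_h_nonzero[of y] unfolding k_hat_eq[OF y] h_eq w_def by simp
    then have "1 + \<eta>_hat y * k_hat y = w powr of_real (1 - \<beta>) * k_hat y" by (simp add: left_diff_distrib) (simp add: algebra_simps)
    also have "\<dots> = (w powr of_real (1 - \<beta>) * w powr of_real \<beta>) * g_hat y"
      by (simp add: k_hat_def w_def mult.assoc)
    also have "w powr of_real (1 - \<beta>) * w powr of_real \<beta> = w"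
      using w by (simp flip: powr_add of_real_add)
    finally have 1: "1 + \<eta>_hat y * k_hat y = w * g_hat y" .
    have "w * char (ind_dens a) y = 1 - ?E y" unfolding w_def by (rule char_ind_dens_eq) (use a in simp)
    from arg_cong[OF this, of "\<lambda>z. z * g_hat y"]
    have "g_hat y - ?E y * g_hat y = char (ind_dens a) y * (w * g_hat y)"
      by (simp only: left_diff_distrib right_diff_distrib mult_1 mult_1_right ac_simps)
    then show ?thesis unfolding 1[symmetric] by (simp add: distrib_left)
  qed
  have "AE t in lborel. complex_of_real (g t) - complex_of_real (g (t - a))
      = complex_of_real (indicator {0..a} t) + conv (ind_dens a) (\<lambda>t. complex_of_real (drift t)) t"
    by (rule has_fourier_L2_unique[OF L R]) (use eq in \<open>intro eventually_mono[OF AE_lborel_singleton[of 0]]\<close>)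
  then show ?thesis
  proof (rule eventually_mono)
    fix t
    assume "complex_of_real (g t) - complex_of_real (g (t - a))
      = complex_of_real (indicator {0..a} t) + conv (ind_dens a) (\<lambda>t. complex_of_real (drift t)) t"
    then have "complex_of_real (g t - g (t - a)) = complex_of_real (indicator {0..a} t + conv (ind_dens a) drift t)"
      by (simp add: conv_def)
    then show "g t - g (t - a) = indicator {0..a} t + conv (ind_dens a) drift t" by (simp only: of_real_eq_iff)
  qed
qed

text \<open>The continuous version of \<open>g\<close> on the positive axis. The constant 1 is the
  jump that the Dirac mass at 0 contributes to the derivative of \<open>g\<close>.\<close>

definition G :: "real \<Rightarrow> real" where
  "G t = 1 + (\<integral>u. indicator {0..t} u * drift u \<partial>lborel)"

lemma G_measurable [measurable]: "G \<in> borel_measurable borel"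
proof -
  have "G t = 1 + (\<integral>u. (if 0 \<le> u \<and> u \<le> t then drift u else 0) \<partial>lborel)" for t
    unfolding G_def by (intro arg_cong[where f="(+) 1"] Bochner_Integration.integral_cong) (auto simp: indicator_def)
  then have e: "G = (\<lambda>t. 1 + (\<integral>u. (if 0 \<le> u \<and> u \<le> t then drift u else 0) \<partial>lborel))" by auto
  show ?thesis unfolding e by measurable
qed

text \<open>For \<open>0 < t < n\<close> the increment of \<open>g\<close> over a step of length
  \<open>n\<close> reaches back to where \<open>g\<close> vanishes, so the increment formula gives
  \<open>g t\<close> itself. Countably many \<open>n\<close> exhaust the positive axis.\<close>

lemma g_eq_G: "AE t in lborel. 0 < t \<longrightarrow> g t = G t"
proof -
  have "AE t in lborel. 0 < t \<and> t < real n \<longrightarrow> g t = G t" if n: "0 < n" for n :: nat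
  proof (rule eventually_mono[OF g_increment_AE[of "real n"]])
    fix t assume e: "g t - g (t - real n) = indicator {0..real n} t + conv (ind_dens (real n)) drift t"
    show "0 < t \<and> t < real n \<longrightarrow> g t = G t"
    proof
      assume t: "0 < t \<and> t < real n"
      have "conv (ind_dens (real n)) drift t = (\<integral>v. indicator {0..real n} v * drift (t - v) \<partial>lborel)"
        unfolding ind_dens_def by (subst conv_dens[OF integrable_indicator_Icc]) auto
      also have "\<dots> = (\<integral>u. indicator {0..real n} (t - u) * drift u \<partial>lborel)"
        by (subst lborel_integral_real_affine[of "-1" _ t]) simp_all
      also have "\<dots> = (\<integral>u. indicator {0..t} u * drift u \<partial>lborel)"
        using t drift_neg by (intro Bochner_Integration.integral_cong) (auto simp: indicator_def)
      finally have "conv (ind_dens (real n)) drift t = (\<integral>u. indicator {0..t} u * drift u \<partial>lborel)" .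
      then show "g t = G t" using e t g_neg[of "t - real n"] by (simp add: G_def)
    qed
  qed (use n in simp)
  then have "AE t in lborel. \<forall>n::nat. 0 < n \<longrightarrow> 0 < t \<and> t < real n \<longrightarrow> g t = G t"
    by (simp add: AE_all_countable)
  then show ?thesis
  proof (rule eventually_mono)
    fix t assume *: "\<forall>n::nat. 0 < n \<longrightarrow> 0 < t \<and> t < real n \<longrightarrow> g t = G t"
    obtain n :: nat where "t < real n" using reals_Archimedean2 by blast
    then show "0 < t \<longrightarrow> g t = G t" using *[rule_format, of n] by (cases n) auto
  qed
qed

text \<open>Cauchy-Schwarz over an interval of length \<open>u\<close>: all that is known of
  \<open>drift\<close> is its L2 norm, which accounts for the exponent 1/2.\<close>

lemma G_Hoelder:
  assumes "0 < u" "u < t"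
  shows "\<bar>G t - G (t - u)\<bar> \<le> L2norm lborel drift * sqrt u"
proof -
  have sI: "square_integrable lborel (\<lambda>x. indicator A x :: real)" if "A \<in> sets borel" "emeasure lborel A < \<infinity>" for A
    using that by (intro square_integrable_indicator) auto
  have i: "integrable lborel (\<lambda>x. indicator {0..s} x * drift x)" for s
    by (intro square_integrable_mult drift sI) (auto simp: emeasure_lborel_Icc_eq)
  have "G t - G (t - u) = (\<integral>x. indicator {0..t} x * drift x - indicator {0..t - u} x * drift x \<partial>lborel)"
    unfolding G_def using i by simp
  also have "\<dots> = (\<integral>x. indicator {t - u<..t} x * drift x \<partial>lborel)"
    using assms by (intro Bochner_Integration.integral_cong) (auto simp: indicator_def)
  also have "norm \<dots> \<le> L2norm lborel (\<lambda>x. indicator {t - u<..t} x :: real) * L2norm lborel drift"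
    using assms by (intro L2_inner_bound drift sI) auto
  also have "L2norm lborel (\<lambda>x. indicator {t - u<..t} x :: real) = sqrt u"
  proof -
    have "(\<lambda>x. (norm (indicator {t - u<..t} x :: real))\<^sup>2) = (\<lambda>x. indicator {t - u<..t} x)"
      by (auto simp: indicator_def)
    then show ?thesis using assms by (simp add: L2norm_def)
  qed
  finally show ?thesis by (simp add: mult.commute)
qed

text \<open>Near \<open>u = 0\<close> the Hoelder bound leaves a singularity of order
  \<open>\<beta> + 1 / 2 < 1\<close>; for \<open>u > t\<close> the value \<open>g (t - u)\<close> is
  0 and the weight is integrable. Hence the untruncated integral converges absolutely at every
  positive \<open>t\<close> where \<open>g\<close> agrees with \<open>G\<close>.\<close>

lemma marchaud_g_exists: "AE t in lborel. 0 < t \<longrightarrow> (\<exists>D. has_marchaud_derivative \<beta> g t D)"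
proof (rule eventually_mono[OF g_eq_G])
  fix t assume gt: "0 < t \<longrightarrow> g t = G t"
  show "0 < t \<longrightarrow> (\<exists>D. has_marchaud_derivative \<beta> g t D)"
  proof
    assume t: "0 < t"
    let ?K = "\<lambda>u. indicator {0<..} u * marchaud_integrand \<beta> g t u"
    let ?B = "\<lambda>u. L2norm lborel drift * (indicator {0..t} u * u powr (-(\<beta> + 1 / 2)))
      + \<bar>g t\<bar> * (indicator {t<..} u * u powr (-(1 + \<beta>)))"
    have B: "integrable lborel ?B"
      using powr_head_integral[of t "\<beta> + 1 / 2"] powr_tail_integral(1)[of t \<beta>] t \<beta>
      by (intro Bochner_Integration.integrable_add integrable_mult_right) auto
    \<comment> \<open>With \<open>t\<close> fixed, agreement of \<open>g\<close> and
      \<open>G\<close> is needed at \<open>t - u\<close> for almost every \<open>u\<close>;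
      reflection and translation preserve null sets.\<close>
    have "AE s in lborel. 0 < t + -1 * s \<longrightarrow> g (t + -1 * s) = G (t + -1 * s)"
      by (rule AE_borel_affine[OF _ _ g_eq_G]) auto
    then have ae: "AE u in lborel. 0 < t - u \<longrightarrow> g (t - u) = G (t - u)" by simp
    have K: "norm (?K u) = \<bar>g t - g (t - u)\<bar> * u powr (-(1 + \<beta>))" if "0 < u" for u
    proof -
      have "x / u powr (1 + \<beta>) = x * u powr (-(1 + \<beta>))" for x by (simp only: powr_minus divide_inverse)
      then show ?thesis using that unfolding marchaud_integrand_def by (simp add: abs_mult)
    qed
    have bound: "AE u in lborel. norm (?K u) \<le> ?B u"
      using ae AE_lborel_singleton[of t]
    proof eventually_elim
      case (elim u)
      consider "u \<le> 0" | "0 < u" "u < t" | "t < u" using elim(2) by linarith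
      then show ?case
      proof cases
        case 1
        then show ?thesis by (simp add: indicator_def)
      next
        case 2
        have "\<bar>g t - g (t - u)\<bar> \<le> L2norm lborel drift * sqrt u"
          using G_Hoelder[OF 2] gt t elim(1) 2 by simp
        then have "\<bar>g t - g (t - u)\<bar> * u powr (-(1 + \<beta>)) \<le> L2norm lborel drift * sqrt u * u powr (-(1 + \<beta>))"
          by (intro mult_right_mono) auto
        also have "\<dots> = L2norm lborel drift * u powr (-(\<beta> + 1 / 2))"
        proof -
          have "sqrt u * u powr (-(1 + \<beta>)) = u powr (1 / 2 + -(1 + \<beta>))"
            using 2 by (simp only: powr_half_sqrt[symmetric] powr_add less_imp_le)
          also have "1 / 2 + -(1 + \<beta>) = -(\<beta> + 1 / 2)" by simp
          finally show ?thesis by (simp only: mult.assoc)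
        qed
        finally have "norm (?K u) \<le> L2norm lborel drift * u powr (-(\<beta> + 1 / 2))" unfolding K[OF 2(1)] .
        then show ?thesis using 2 by simp
      next
        case 3
        then have "g (t - u) = 0" by (intro g_neg) simp
        have "0 < u" using 3 t by simp
        show ?thesis unfolding K[OF \<open>0 < u\<close>] \<open>g (t - u) = 0\<close> using 3 t by simp
      qed
    qed
    have [measurable]: "marchaud_integrand \<beta> g t \<in> borel_measurable borel"
      unfolding marchaud_integrand_def[abs_def] by measurable
    have "(marchaud_truncated \<beta> g t \<longlongrightarrow> \<beta> / Gamma (1 - \<beta>) * (\<integral>u. ?K u \<partial>lborel)) (at_right 0)"
      unfolding tendsto_at_iff_sequentially comp_def marchaud_truncated_def set_lebesgue_integral_def
    proof (intro allI impI tendsto_mult tendsto_const)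
      fix X assume X: "\<forall>i. X i \<in> {0<..} - {0::real}" "X \<longlonglongrightarrow> 0"
      show "(\<lambda>i. \<integral>u. indicator {X i<..} u *\<^sub>R marchaud_integrand \<beta> g t u \<partial>lborel) \<longlonglongrightarrow> (\<integral>u. ?K u \<partial>lborel)"
      proof (rule integral_dominated_convergence[OF _ _ B])
        show "AE u in lborel. (\<lambda>i. indicator {X i<..} u *\<^sub>R marchaud_integrand \<beta> g t u) \<longlonglongrightarrow> ?K u"
        proof (rule AE_I2)
          fix u :: real
          have "\<forall>\<^sub>F i in sequentially. indicator {X i<..} u = (indicator {0<..} u :: real)"
          proof (cases "0 < u")
            case True
            then show ?thesis by (intro eventually_mono[OF order_tendstoD(2)[OF X(2) True]]) simp
          next
            case False
            have "0 < X i" for i using X(1) by auto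
            then have "\<not> X i < u" for i using False by (meson less_trans)
            then show ?thesis using False by (intro always_eventually) (simp add: indicator_def)
          qed
          then show "(\<lambda>i. indicator {X i<..} u *\<^sub>R marchaud_integrand \<beta> g t u) \<longlonglongrightarrow> ?K u"
            unfolding real_scaleR_def by (intro tendsto_mult tendsto_const tendsto_eventually)
        qed
        show "AE u in lborel. norm (indicator {X i<..} u *\<^sub>R marchaud_integrand \<beta> g t u) \<le> ?B u" for i
          using bound
        proof eventually_elim
          case (elim u)
          have "0 < X i" using X(1) by auto
          then have "norm (indicator {X i<..} u *\<^sub>R marchaud_integrand \<beta> g t u) \<le> norm (?K u)"
            by (auto simp: indicator_def)
          then show ?case using elim by linarith
        qed
      qed measurable
    qed
    then show "\<exists>D. has_marchaud_derivative \<beta> g t D"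
      unfolding has_marchaud_derivative_def using marchaud_truncated_L2(1)[OF \<beta>(1) \<beta>1 _ g] by blast
  qed
qed

abbreviation "mderiv \<equiv> marchaud_derivative \<beta> g"

lemma mderiv_measurable [measurable]: "mderiv \<in> borel_measurable borel"
  by (rule marchaud_derivative_measurable[OF \<beta>(1) \<beta>1 g])

text \<open>The truncated derivatives converge pointwise almost everywhere to \<open>mderiv\<close>
  and in L2 to \<open>kern\<close>. Fatou's lemma bounds the distance between the two limits by
  every positive \<open>e\<close>.\<close>

lemma mderiv_eq_kern: "AE t in lborel. mderiv t = kern t"
proof -
  define \<delta> where "\<delta> m = 1 / (real m + 1)" for m
  have \<delta>: "\<And>m. 0 < \<delta> m" by (simp add: \<delta>_def)
  have \<delta>0: "\<delta> \<longlonglongrightarrow> 0" unfolding \<delta>_def by real_asymp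
  have \<delta>r: "filterlim \<delta> (at_right 0) sequentially" unfolding \<delta>_def by real_asymp
  have s: "square_integrable lborel (frac_diff \<beta> (\<delta> m) g)" for m
    by (rule square_integrable_frac_diff[OF \<beta>(1) \<beta>1 \<delta> g])
  have lim: "AE t in lborel. (\<lambda>m. frac_diff \<beta> (\<delta> m) g t - kern t) \<longlonglongrightarrow> mderiv t - kern t"
    using marchaud_g_exists AE_lborel_singleton[of 0]
  proof eventually_elim
    case (elim t)
    show ?case
    proof (cases "0 < t")
      case True
      then obtain D where D: "has_marchaud_derivative \<beta> g t D" using elim by blast
      have D': "((\<lambda>\<delta>. frac_diff \<beta> \<delta> g t) \<longlongrightarrow> D) (at_right 0)"
        using D by (simp add: has_marchaud_derivative_L2_iff[OF \<beta>(1) \<beta>1 g])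
      have "(THE D. has_marchaud_derivative \<beta> g t D) = D"
        unfolding has_marchaud_derivative_L2_iff[OF \<beta>(1) \<beta>1 g]
        by (rule the_equality, rule D') (rule tendsto_unique[OF trivial_limit_at_right_real _ D'])
      then have "mderiv t = D" using True D by (auto simp: marchaud_derivative_def)
      then show ?thesis using filterlim_compose[OF D' \<delta>r] by (intro tendsto_intros) simp
    next
      case False
      then have "t < 0" using elim by simp
      then show ?thesis using frac_diff_neg[OF \<delta>] False by (simp add: marchaud_derivative_def)
    qed
  qed
  have sd: "square_integrable lborel (\<lambda>t. frac_diff \<beta> (\<delta> m) g t - kern t)" for m
    by (intro square_integrable_diff s kern)
  have le: "square_integrable lborel (\<lambda>t. mderiv t - kern t) \<and> L2norm lborel (\<lambda>t. mderiv t - kern t) \<le> e" if e: "0 < e" for e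
  proof -
    have "\<forall>\<^sub>F m in sequentially. L2norm lborel (\<lambda>t. frac_diff \<beta> (\<delta> m) g t - kern t) \<le> e"
      by (rule eventually_mono[OF order_tendstoD(2)[OF frac_diff_tendsto_kern_seq[OF \<delta> \<delta>0] e]]) simp
    from L2_fatou[OF sd _ this lim] show ?thesis by simp
  qed
  have "L2norm lborel (\<lambda>t. mderiv t - kern t) = 0"
  proof (rule antisym[OF _ L2norm_nonneg], rule field_le_epsilon)
    fix e :: real assume "0 < e"
    then show "L2norm lborel (\<lambda>t. mderiv t - kern t) \<le> 0 + e" using le[of e] by linarith
  qed
  then have "AE t in lborel. mderiv t - kern t = 0"
    using L2norm_eq_0_iff[of lborel "\<lambda>t. mderiv t - kern t"] le[of 1] by simp
  then show ?thesis by (rule eventually_mono) simp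
qed

lemma mderiv: "square_integrable lborel mderiv"
  by (rule square_integrable_cong_AE[OF kern _ mderiv_eq_kern]) simp

lemma mderiv_fourier: "has_fourier_L2 (\<lambda>t. complex_of_real (mderiv t)) k_hat"
  by (rule has_fourier_L2_cong_AE[OF kern_fourier]) (use mderiv_eq_kern in auto)

lemma frac_diff_tendsto_mderiv:
  "((\<lambda>\<delta>. L2norm lborel (\<lambda>t. frac_diff \<beta> \<delta> g t - mderiv t)) \<longlongrightarrow> 0) (at_right 0)"
proof -
  have "L2norm lborel (\<lambda>t. frac_diff \<beta> \<delta> g t - mderiv t) = L2norm lborel (\<lambda>t. frac_diff \<beta> \<delta> g t - kern t)" if "0 < \<delta>" for \<delta>
  proof (rule L2norm_cong_AE)
    have "frac_diff \<beta> \<delta> g \<in> borel_measurable lborel"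
      by (rule square_integrable_measurable[OF square_integrable_frac_diff[OF \<beta>(1) \<beta>1 that g]])
    then show "(\<lambda>t. frac_diff \<beta> \<delta> g t - mderiv t) \<in> borel_measurable lborel"
      "(\<lambda>t. frac_diff \<beta> \<delta> g t - kern t) \<in> borel_measurable lborel" by auto
    show "AE t in lborel. frac_diff \<beta> \<delta> g t - mderiv t = frac_diff \<beta> \<delta> g t - kern t"
      using mderiv_eq_kern by (rule eventually_mono) simp
  qed
  then have "\<forall>\<^sub>F \<delta> in at_right 0. L2norm lborel (\<lambda>t. frac_diff \<beta> \<delta> g t - mderiv t) = L2norm lborel (\<lambda>t. frac_diff \<beta> \<delta> g t - kern t)"
    by (rule eventually_mono[OF eventually_at_right_less])
  then show ?thesis using frac_diff_tendsto_kern by (subst tendsto_cong)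
qed

end

section \<open>The fractional derivative of an indicator\<close>

text \<open>The kernel \<open>frac_kernel \<beta> s t u\<close> for \<open>u \<le> t\<close>,
  written in the variable \<open>v = t - u\<close> with \<open>a = t - s\<close>, so that it acts as
  a convolution kernel.\<close>

definition frac_step :: "real \<Rightarrow> real \<Rightarrow> real \<Rightarrow> real" where
  "frac_step \<beta> a v = (max v 0) powr (-\<beta>) - (max (v - a) 0) powr (-\<beta>)"

lemma frac_step_measurable [measurable]: "frac_step \<beta> a \<in> borel_measurable borel"
  unfolding frac_step_def[abs_def] by measurable

context
  fixes \<beta> a :: real
  assumes \<beta>: "0 < \<beta>" "\<beta> < 1" and a: "0 < a"
begin

private abbreviation "kk u \<equiv> indicator {0<..} u * u powr (-(1 + \<beta>))"
private abbreviation "I \<equiv> \<lambda>v. indicator {0..a} v :: real"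

text \<open>For \<open>v\<close> inside the interval only \<open>u > v\<close> leaves it, which
  gives one tail of the weight. For \<open>v\<close> beyond it only \<open>u\<close> between
  \<open>v - a\<close> and \<open>v\<close> hit the interval, with negative sign, which gives a
  difference of two tails.\<close>

private lemma frac_step_eq:
  assumes v: "v \<noteq> 0" "v \<noteq> a"
  shows "(\<integral>u. kk u * (I v - I (v - u)) \<partial>lborel) = frac_step \<beta> a v / \<beta>"
proof -
  let ?t = "\<lambda>s u. indicator {s<..} u * u powr (-(1 + \<beta>)) :: real"
  note tail = powr_tail_integral[OF _ \<beta>(1)]
  consider "v < 0" | "0 < v" "v < a" | "a < v" using v by linarith
  then show ?thesis
  proof cases
    case 1
    have "kk u * (I v - I (v - u)) = 0" for u using 1 by (auto simp: indicator_def)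
    then have "(\<integral>u. kk u * (I v - I (v - u)) \<partial>lborel) = 0" by (simp only: integral_zero)
    then show ?thesis using 1 a by (simp add: frac_step_def)
  next
    case 2
    have "kk u * (I v - I (v - u)) = ?t v u" for u using 2 by (auto simp: indicator_def)
    then have "(\<integral>u. kk u * (I v - I (v - u)) \<partial>lborel) = v powr (-\<beta>) / \<beta>" by (simp only: tail(2)[OF 2(1)])
    then show ?thesis using 2 by (simp add: frac_step_def)
  next
    case 3
    have "(\<integral>u. kk u * (I v - I (v - u)) \<partial>lborel) = (\<integral>u. ?t v u - ?t (v - a) u \<partial>lborel)"
    proof (rule integral_cong_AE)
      show "AE u in lborel. kk u * (I v - I (v - u)) = ?t v u - ?t (v - a) u"
        using AE_lborel_singleton[of "v - a"] by (rule eventually_mono) (use 3 a in \<open>auto simp: indicator_def\<close>)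
    qed measurable
    also have "\<dots> = (v powr (-\<beta>) - (v - a) powr (-\<beta>)) / \<beta>"
      using tail[of v] tail[of "v - a"] 3 a by (simp add: diff_divide_distrib)
    finally show ?thesis using 3 a by (simp add: frac_step_def)
  qed
qed

private lemma frac_step_eq':
  assumes "v \<noteq> 0" "v \<noteq> a"
  shows "\<beta> * (\<integral>u. kk u * (I v - I (v - u)) \<partial>lborel) = frac_step \<beta> a v"
  unfolding frac_step_eq[OF assms] using \<beta> by simp

text \<open>The interval and its translate differ by at most their total length \<open>2 * a\<close>
  and by at most two pieces of length \<open>u\<close>. The minimum of both bounds is what
  \<open>powr_min_integrable\<close> requires.\<close>

private lemma increment_bound: "(\<integral>v. \<bar>I v - I (v - u)\<bar> \<partial>lborel) \<le> min (2 * a) (2 * u)" (is ?le)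
  and increment_integrable: "integrable lborel (\<lambda>v. I v - I (v - u))" (is ?int)
  if u: "0 < u" for u
proof -
  have e: "I (v - u) = indicator {u..a + u} v" for v by (auto simp: indicator_def)
  show i: ?int unfolding e by (intro Bochner_Integration.integrable_diff integrable_indicator_Icc)
  have 1: "(\<integral>v. \<bar>I v - I (v - u)\<bar> \<partial>lborel) \<le> (\<integral>v. I v + indicator {u..a + u} v \<partial>lborel)"
    using i unfolding e
    by (intro integral_mono integrable_abs Bochner_Integration.integrable_add integrable_indicator_Icc) (auto simp: indicator_def)
  have 2: "(\<integral>v. \<bar>I v - I (v - u)\<bar> \<partial>lborel) \<le> (\<integral>v. indicator {0..u} v + indicator {a..a + u} v \<partial>lborel)"
    using i u unfolding e
    by (intro integral_mono integrable_abs Bochner_Integration.integrable_add integrable_indicator_Icc) (auto simp: indicator_def)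
  show ?le using 1 2 u a by (simp add: integrable_indicator_Icc)
qed

private lemma frac_step_pair: "integrable (lborel \<Otimes>\<^sub>M lborel) (\<lambda>(u, v). kk u * (I v - I (v - u)))"
proof (rule lborel_pair.Fubini_integrable)
  show "AE u in lborel. integrable lborel (\<lambda>v. case (u, v) of (u, v) \<Rightarrow> kk u * (I v - I (v - u)))"
  proof (rule AE_I2)
    fix u show "integrable lborel (\<lambda>v. case (u, v) of (u, v) \<Rightarrow> kk u * (I v - I (v - u)))"
      using increment_integrable[of u] by (cases "0 < u") auto
  qed
  show "integrable lborel (\<lambda>u. \<integral>v. norm (case (u, v) of (u, v) \<Rightarrow> kk u * (I v - I (v - u))) \<partial>lborel)"
  proof (rule Bochner_Integration.integrable_bound[OF powr_min_integrable[OF \<beta>, of "2 * a" 2]])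
    show "AE u in lborel. norm (\<integral>v. norm (case (u, v) of (u, v) \<Rightarrow> kk u * (I v - I (v - u))) \<partial>lborel)
        \<le> norm (kk u * min (2 * a) (2 * u))"
    proof (rule AE_I2)
      fix u
      show "norm (\<integral>v. norm (case (u, v) of (u, v) \<Rightarrow> kk u * (I v - I (v - u))) \<partial>lborel)
        \<le> norm (kk u * min (2 * a) (2 * u))"
      proof (cases "0 < u")
        case True
        have "(\<integral>v. norm (kk u * (I v - I (v - u))) \<partial>lborel) = kk u * (\<integral>v. \<bar>I v - I (v - u)\<bar> \<partial>lborel)"
          by (simp add: abs_mult)
        also have "\<dots> \<le> kk u * min (2 * a) (2 * u)" using increment_bound[OF True] by (intro mult_left_mono) auto
        moreover have "\<bar>min (2 * a) (2 * u)\<bar> = min (2 * a) (2 * u)" using True a by simp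
        ultimately show ?thesis by (simp add: abs_mult)
      qed simp
    qed
  qed (use a in auto)
qed measurable

text \<open>Neither power is integrable at infinity; the cancellation between them comes for free
  from Fubini's theorem, as the function is a marginal of a jointly integrable one.\<close>

lemma frac_step_integrable: "integrable lborel (frac_step \<beta> a)"
proof -
  have "integrable lborel (\<lambda>v. \<beta> * (\<integral>u. kk u * (I v - I (v - u)) \<partial>lborel))"
    using lborel_pair.integrable_snd[OF frac_step_pair] by simp
  moreover have "AE v in lborel. \<beta> * (\<integral>u. kk u * (I v - I (v - u)) \<partial>lborel) = frac_step \<beta> a v"
    using AE_lborel_singleton[of 0] AE_lborel_singleton[of a]
    by eventually_elim (rule frac_step_eq')
  ultimately show ?thesis by (subst (asm) integrable_cong_AE) auto
qed

text \<open>After exchanging the integrals, the shift by \<open>u\<close> inside becomes the factor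
  \<open>1 - exp (i y u)\<close>, and the outer integral is \<open>frac_int\<close> at
  \<open>-iy\<close>.\<close>

lemma frac_step_char:
  "(\<integral>v. frac_step \<beta> a v *\<^sub>R exp (\<i> * of_real (y * v)) \<partial>lborel)
    = of_real (Gamma (1 - \<beta>)) * (- (\<i> * of_real y)) powr of_real \<beta> * char (ind_dens a) y"
proof -
  let ?e = "\<lambda>v. exp (\<i> * of_real (y * v))"
  let ?H = "\<lambda>u v. (kk u * (I v - I (v - u))) *\<^sub>R ?e v"
  have i: "integrable (lborel \<Otimes>\<^sub>M lborel) (\<lambda>(u, v). ?H u v)"
    by (rule Bochner_Integration.integrable_bound[OF frac_step_pair]) (auto simp: split_beta' simp del: of_real_mult)
  have J: "(\<integral>v. I v *\<^sub>R ?e v \<partial>lborel) = char (ind_dens a) y"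
    unfolding ind_dens_def by (subst char_dens[OF integrable_indicator_Icc]) auto
  have iJ: "integrable lborel (\<lambda>v. I v *\<^sub>R ?e v)"
    by (rule Bochner_Integration.integrable_bound[OF integrable_indicator_Icc[of 0 a]]) (auto simp del: of_real_mult)
  have sh: "(\<integral>v. I (v - u) *\<^sub>R ?e v \<partial>lborel) = ?e u * char (ind_dens a) y" for u
  proof -
    have "(\<integral>v. I (v - u) *\<^sub>R ?e v \<partial>lborel) = (\<integral>v. ?e u * (I v *\<^sub>R ?e v) \<partial>lborel)"
      by (subst lborel_integral_real_affine[of 1 _ u]) (simp_all add: ring_distribs exp_add)
    then show ?thesis by (simp only: integral_mult_right_zero J)
  qed
  have iJ': "integrable lborel (\<lambda>v. I (v - u) *\<^sub>R ?e v)" for u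
  proof (rule Bochner_Integration.integrable_bound)
    show "integrable lborel (\<lambda>v. indicator {u..a + u} v :: real)" by (rule integrable_indicator_Icc)
    show "AE v in lborel. norm (I (v - u) *\<^sub>R ?e v) \<le> norm (indicator {u..a + u} v :: real)"
      by (auto simp: indicator_def simp del: of_real_mult)
  qed measurable
  have "(\<integral>v. frac_step \<beta> a v *\<^sub>R ?e v \<partial>lborel) = (\<integral>v. \<beta> *\<^sub>R (\<integral>u. ?H u v \<partial>lborel) \<partial>lborel)"
  proof (rule integral_cong_AE)
    have H: "AE v in lborel. (\<integral>u. ?H u v \<partial>lborel) = (\<integral>u. kk u * (I v - I (v - u)) \<partial>lborel) *\<^sub>R ?e v"
      using lborel_pair.AE_integrable_snd[OF frac_step_pair]
      by eventually_elim (rule integral_scaleR_left)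
    show "AE v in lborel. frac_step \<beta> a v *\<^sub>R ?e v = \<beta> *\<^sub>R (\<integral>u. ?H u v \<partial>lborel)"
      using H AE_lborel_singleton[of 0] AE_lborel_singleton[of a]
    proof eventually_elim
      case (elim v)
      show ?case unfolding elim(1) frac_step_eq'[OF elim(2,3), symmetric] by (simp only: scaleR_scaleR)
    qed
  qed measurable
  also have "\<dots> = \<beta> *\<^sub>R (\<integral>v. (\<integral>u. ?H u v \<partial>lborel) \<partial>lborel)" by (rule Bochner_Integration.integral_scaleR_right)
  also have "(\<integral>v. (\<integral>u. ?H u v \<partial>lborel) \<partial>lborel) = (\<integral>u. (\<integral>v. ?H u v \<partial>lborel) \<partial>lborel)"
    by (rule lborel_pair.Fubini_integral[OF i])
  also have "\<dots> = (\<integral>u. (kk u *\<^sub>R (1 - exp (- (- (\<i> * of_real y) * complex_of_real u)))) * char (ind_dens a) y \<partial>lborel)"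
  proof (intro Bochner_Integration.integral_cong refl)
    fix u
    have "(\<integral>v. ?H u v \<partial>lborel) = (\<integral>v. kk u *\<^sub>R (I v *\<^sub>R ?e v - I (v - u) *\<^sub>R ?e v) \<partial>lborel)"
      by (simp only: scaleR_scaleR[symmetric] scaleR_diff_left)
    also have "\<dots> = kk u *\<^sub>R (\<integral>v. I v *\<^sub>R ?e v - I (v - u) *\<^sub>R ?e v \<partial>lborel)"
      by (rule Bochner_Integration.integral_scaleR_right)
    also have "(\<integral>v. I v *\<^sub>R ?e v - I (v - u) *\<^sub>R ?e v \<partial>lborel) = char (ind_dens a) y - ?e u * char (ind_dens a) y"
      by (simp only: Bochner_Integration.integral_diff[OF iJ iJ'] J sh)
    also have "\<dots> = (1 - exp (- (- (\<i> * of_real y) * complex_of_real u))) * char (ind_dens a) y"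
      by (simp add: left_diff_distrib mult.assoc)
    finally show "(\<integral>v. ?H u v \<partial>lborel) = (kk u *\<^sub>R (1 - exp (- (- (\<i> * of_real y) * complex_of_real u)))) * char (ind_dens a) y"
      by (simp only: mult_scaleR_left)
  qed
  also have "\<dots> = frac_int \<beta> (- (\<i> * of_real y)) * char (ind_dens a) y"
    unfolding frac_int_def by (rule integral_mult_left_zero)
  also have "frac_int \<beta> (- (\<i> * of_real y)) = complex_of_real (Gamma (1 - \<beta>) / \<beta>) * (- (\<i> * of_real y)) powr (of_real \<beta>)"
    by (rule frac_int_eq[OF \<beta>]) simp
  finally show ?thesis using \<beta> by (simp add: scaleR_conv_of_real)
qed

text \<open>The kernel changes sign at \<open>a\<close>, whereas \<open>conv\<close> is set up for
  positive measures; hence the split into positive and negative part.\<close>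

lemma has_fourier_L2_frac_step:
  assumes f: "has_fourier_L2 f \<phi>"
  shows "has_fourier_L2 (\<lambda>t. conv (dens (\<lambda>v. max 0 (frac_step \<beta> a v))) f t - conv (dens (\<lambda>v. max 0 (- frac_step \<beta> a v))) f t)
    (\<lambda>y. of_real (Gamma (1 - \<beta>)) * (- (\<i> * of_real y)) powr of_real \<beta> * char (ind_dens a) y * \<phi> y)"
proof -
  let ?p = "\<lambda>v. max 0 (frac_step \<beta> a v)" and ?n = "\<lambda>v. max 0 (- frac_step \<beta> a v)"
  have i: "integrable lborel ?p" "integrable lborel ?n" using frac_step_integrable by auto
  have nn: "0 \<le> ?p v" "0 \<le> ?n v" for v by auto
  have ie: "integrable lborel (\<lambda>v. w v *\<^sub>R exp (\<i> * of_real (y * v)))" if "integrable lborel w" for w :: "real \<Rightarrow> real" and y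
    by (rule Bochner_Integration.integrable_bound[OF that]) (use that in \<open>auto simp del: of_real_mult\<close>)
  have "char (dens ?p) y - char (dens ?n) y = (\<integral>v. frac_step \<beta> a v *\<^sub>R exp (\<i> * of_real (y * v)) \<partial>lborel)" for y
    unfolding char_dens[OF i(1) nn(1)] char_dens[OF i(2) nn(2)]
    by (subst Bochner_Integration.integral_diff[OF ie ie, symmetric])
       (use i in \<open>auto simp: scaleR_diff_left[symmetric] max_def intro!: Bochner_Integration.integral_cong\<close>)
  then have c: "char (dens ?p) y * \<phi> y - char (dens ?n) y * \<phi> y
      = of_real (Gamma (1 - \<beta>)) * (- (\<i> * of_real y)) powr of_real \<beta> * char (ind_dens a) y * \<phi> y" for y
    by (simp only: left_diff_distrib[symmetric] frac_step_char)
  have "has_fourier_L2 (\<lambda>t. conv (dens ?p) f t - conv (dens ?n) f t) (\<lambda>y. char (dens ?p) y * \<phi> y - char (dens ?n) y * \<phi> y)"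
    by (intro has_fourier_L2_diff has_fourier_L2_conv f finite_measure_dens i nn) simp_all
  then show ?thesis unfolding c .
qed

end

text \<open>On the left the symbol of the fractional derivative belongs to the indicator, on the
  right to \<open>g\<close>. Products of transforms do not distinguish the two.\<close>

lemma (in sfdde_filter) kernel_identity:
  assumes a: "0 < a"
  shows "AE t in lborel. conv (dens (\<lambda>v. max 0 (frac_step \<beta> a v))) (sconv \<eta> g) t - conv (dens (\<lambda>v. max 0 (- frac_step \<beta> a v))) (sconv \<eta> g) t
    = Gamma (1 - \<beta>) * conv (ind_dens a) (sconv \<eta> mderiv) t"
proof -
  let ?p = "dens (\<lambda>v. max 0 (frac_step \<beta> a v))" and ?n = "dens (\<lambda>v. max 0 (- frac_step \<beta> a v))"
  have sg: "has_fourier_L2 (\<lambda>t. complex_of_real (sconv \<eta> g t)) (\<lambda>y. \<eta>_hat y * g_hat y)"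
    using has_fourier_L2_sconv[OF \<eta> g_fourier'] unfolding \<eta>_hat_def sconv_of_real[OF \<eta>, abs_def] by simp
  have sm: "has_fourier_L2 (\<lambda>t. complex_of_real (sconv \<eta> mderiv t)) (\<lambda>y. \<eta>_hat y * k_hat y)"
    using has_fourier_L2_sconv[OF \<eta> mderiv_fourier] unfolding \<eta>_hat_def sconv_of_real[OF \<eta>, abs_def] by simp
  have L: "has_fourier_L2 (\<lambda>t. complex_of_real (conv ?p (sconv \<eta> g) t - conv ?n (sconv \<eta> g) t))
    (\<lambda>y. of_real (Gamma (1 - \<beta>)) * (- (\<i> * of_real y)) powr of_real \<beta> * char (ind_dens a) y * (\<eta>_hat y * g_hat y))"
    using has_fourier_L2_frac_step[OF \<beta>(1) \<beta>1 a sg] by (simp add: conv_def)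
  have R: "has_fourier_L2 (\<lambda>t. complex_of_real (Gamma (1 - \<beta>) * conv (ind_dens a) (sconv \<eta> mderiv) t))
    (\<lambda>y. of_real (Gamma (1 - \<beta>)) * (char (ind_dens a) y * (\<eta>_hat y * k_hat y)))"
    using has_fourier_L2_cmult[OF has_fourier_L2_conv[OF finite_measure_ind_dens[of a] sets_ind_dens sm], of "of_real (Gamma (1 - \<beta>))"]
    by (simp add: conv_def)
  have "AE t in lborel. complex_of_real (conv ?p (sconv \<eta> g) t - conv ?n (sconv \<eta> g) t)
      = complex_of_real (Gamma (1 - \<beta>) * conv (ind_dens a) (sconv \<eta> mderiv) t)"
    by (rule has_fourier_L2_unique[OF L R]) (simp add: k_hat_def ac_simps)
  then show ?thesis by (rule eventually_mono) (simp only: of_real_eq_iff)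
qed

section \<open>Levy processes with finite second moment\<close>

text \<open>Cauchy's functional equation: nonnegativity makes \<open>f\<close> monotone, and
  squeezing \<open>real n * t\<close> between consecutive integers leaves an error of at most
  \<open>f 1 / n\<close>.\<close>

lemma additive_nonneg_linear:
  fixes f :: "real \<Rightarrow> real"
  assumes add: "\<And>s t. 0 \<le> s \<Longrightarrow> 0 \<le> t \<Longrightarrow> f (s + t) = f s + f t"
    and nonneg: "\<And>t. 0 \<le> t \<Longrightarrow> 0 \<le> f t" and t: "0 \<le> t"
  shows "f t = t * f 1"
proof -
  have f0: "f 0 = 0" using add[of 0 0] by simp
  have mult: "f (real n * s) = real n * f s" if "0 \<le> s" for n s
  proof (induction n)
    case (Suc n)
    then show ?case using add[of "real n * s" s] that by (simp add: algebra_simps)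
  qed (simp add: f0)
  have mono: "f s \<le> f u" if "0 \<le> s" "s \<le> u" for s u
    using add[of s "u - s"] nonneg[of "u - s"] that by simp
  have le: "real n * \<bar>f t - t * f 1\<bar> \<le> f 1" for n
  proof -
    define k where "k = nat \<lfloor>real n * t\<rfloor>"
    have nt: "0 \<le> real n * t" using t by simp
    have k: "real k \<le> real n * t" "real n * t \<le> real k + 1"
      unfolding k_def using nt by linarith+
    have "f (real k * 1) \<le> f (real n * t)" using k by (intro mono) auto
    moreover have "f (real n * t) \<le> f (real (Suc k) * 1)" using k nt by (intro mono) auto
    ultimately have 1: "real k * f 1 \<le> real n * f t" "real n * f t \<le> real k * f 1 + f 1"
      using mult[of 1 k] mult[of 1 "Suc k"] mult[OF t, of n] by (auto simp: algebra_simps)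
    have 2: "real k * f 1 \<le> real n * t * f 1" "real n * t * f 1 \<le> (real k + 1) * f 1"
      using k nonneg[of 1] by (intro mult_right_mono; simp)+
    have "real n * \<bar>f t - t * f 1\<bar> = \<bar>real n * f t - real n * t * f 1\<bar>"
      by (simp add: abs_mult right_diff_distrib[symmetric] mult.assoc)
    then show ?thesis using 1 2 by (simp add: algebra_simps abs_le_iff)
  qed
  show ?thesis
  proof (rule ccontr)
    assume "f t \<noteq> t * f 1"
    then have "0 < \<bar>f t - t * f 1\<bar>" by simp
    then obtain n :: nat where "f 1 < real n * \<bar>f t - t * f 1\<bar>" using reals_Archimedean3 by blast
    then show False using le[of n] by simp
  qed
qed

context prob_space
begin

lemma distr_moments:
  fixes U V :: "'a \<Rightarrow> real"
  assumes d: "distr M borel U = distr M borel V" and U: "square_integrable M U" and [measurable]: "V \<in> borel_measurable M"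
  shows "square_integrable M V" "expectation V = expectation U" "expectation (\<lambda>\<omega>. (V \<omega>)\<^sup>2) = expectation (\<lambda>\<omega>. (U \<omega>)\<^sup>2)"
proof -
  have [measurable]: "U \<in> borel_measurable M" using U by (rule square_integrable_measurable)
  have "integrable (distr M borel U) (\<lambda>x. x\<^sup>2)"
    using U by (subst integrable_distr_eq) (auto simp: square_integrable_def)
  then have "integrable M (\<lambda>\<omega>. (V \<omega>)\<^sup>2)" unfolding d by (subst (asm) integrable_distr_eq) auto
  then show "square_integrable M V" by (simp add: square_integrable_def)
  have e: "expectation (\<lambda>\<omega>. h (V \<omega>)) = expectation (\<lambda>\<omega>. h (U \<omega>))"
    if h: "h \<in> borel_measurable borel" for h :: "real \<Rightarrow> real"
  proof -
    have "expectation (\<lambda>\<omega>. h (V \<omega>)) = integral\<^sup>L (distr M borel V) h"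
      by (rule integral_distr[symmetric]) (simp_all add: h)
    also have "\<dots> = expectation (\<lambda>\<omega>. h (U \<omega>))"
      unfolding d[symmetric] by (rule integral_distr) (simp_all add: h)
    finally show ?thesis .
  qed
  show "expectation V = expectation U" by (rule e) simp
  show "expectation (\<lambda>\<omega>. (V \<omega>)\<^sup>2) = expectation (\<lambda>\<omega>. (U \<omega>)\<^sup>2)" by (rule e) simp
qed

text \<open>By Fubini's theorem for the product law, \<open>(U + y)^2\<close> is integrable for
  almost every value \<open>y\<close> of \<open>V\<close>, and one such value suffices. In this way
  second moments at time 1 pass to earlier times.\<close>

lemma indep_sum_square_integrable:
  fixes U V :: "'a \<Rightarrow> real"
  assumes i: "indep_var borel U borel V" and s: "square_integrable M (\<lambda>\<omega>. U \<omega> + V \<omega>)"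
  shows "square_integrable M U"
proof -
  have [measurable]: "U \<in> borel_measurable M" "V \<in> borel_measurable M"
    using i by (auto dest: indep_var_rv1 indep_var_rv2)
  let ?P = "distr M borel U" and ?Q = "distr M borel V"
  interpret P: prob_space ?P by (rule prob_space_distr) simp
  interpret Q: prob_space ?Q by (rule prob_space_distr) simp
  interpret PQ: pair_sigma_finite ?P ?Q ..
  have e: "?P \<Otimes>\<^sub>M ?Q = distr M (borel \<Otimes>\<^sub>M borel) (\<lambda>x. (U x, V x))"
    using i by (simp add: indep_var_distribution_eq)
  have "integrable (distr M (borel \<Otimes>\<^sub>M borel) (\<lambda>x. (U x, V x))) (\<lambda>(x, y). (x + y)\<^sup>2)"
    using s by (subst integrable_distr_eq) (auto simp: square_integrable_def)
  then have "integrable (?P \<Otimes>\<^sub>M ?Q) (\<lambda>(x, y). (x + y)\<^sup>2)" unfolding e .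
  then have "AE y in ?Q. integrable ?P (\<lambda>x. (x + y)\<^sup>2)" by (rule PQ.AE_integrable_snd)
  then obtain y where "integrable ?P (\<lambda>x. (x + y)\<^sup>2)"
    using eventually_happens'[OF Q.ae_filter_bot] by blast
  then have "integrable M (\<lambda>\<omega>. (U \<omega> + y)\<^sup>2)" by (subst (asm) integrable_distr_eq) auto
  then have "square_integrable M (\<lambda>\<omega>. (U \<omega> + y) - y)"
    by (intro square_integrable_diff) (auto simp: square_integrable_def)
  then show ?thesis by simp
qed

lemma expectation_power2_le:
  assumes "square_integrable M U"
  shows "(expectation U)\<^sup>2 \<le> expectation (\<lambda>\<omega>. (U \<omega> :: real)\<^sup>2)"
  using finite_measure_square_integrable(2)[OF finite_measure_axioms assms] by (simp add: prob_space)

end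

section \<open>Moments of a one-sided Levy process\<close>

lemma levy_indep_increment:
  assumes "prob_space M" "levy_process M X" "0 \<le> s" "s \<le> t"
  shows "prob_space.indep_var M borel (\<lambda>\<omega>. X s \<omega> - X 0 \<omega>) borel (\<lambda>\<omega>. X t \<omega> - X s \<omega>)"
proof -
  interpret prob_space M by fact
  \<comment> \<open>The partition 0, \<open>s\<close>, \<open>t\<close>. As \<open>X 0\<close> is 0
    only almost surely, independence is stated for \<open>X s - X 0\<close> in place of
    \<open>X s\<close>.\<close>
  define ts where "ts i = (if i = 0 then 0 else if i = 1 then s else t)" for i :: nat
  have t0: "0 \<le> ts 0" by (simp add: ts_def)
  have "mono ts" using assms by (auto simp: ts_def mono_def)
  then have "indep_vars (\<lambda>_. borel) (\<lambda>i \<omega>. X (ts (Suc i)) \<omega> - X (ts i) \<omega>) {..<2}"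
    using assms(2)[unfolded levy_process_def] t0 by blast
  moreover have "{..<2} = insert 0 {1::nat}" by auto
  ultimately have "indep_vars (\<lambda>_. borel) (\<lambda>i \<omega>. X (ts (Suc i)) \<omega> - X (ts i) \<omega>) (insert 0 {1})" by simp
  from indep_vars_sum[OF _ _ this] show ?thesis by (simp add: ts_def)
qed

locale square_integrable_levy = prob_space M for M :: "'w measure" +
  fixes X :: "real \<Rightarrow> 'w \<Rightarrow> real"
  assumes levy: "levy_process M X"
    and sq1: "square_integrable M (X 1)" and mean1: "expectation (X 1) = 0"
    and var1: "expectation (\<lambda>\<omega>. (X 1 \<omega>)\<^sup>2) = 1"
begin

lemma X_measurable: "0 \<le> t \<Longrightarrow> X t \<in> borel_measurable M"
  using levy by (simp add: levy_process_def)

lemma X_0: "AE \<omega> in M. X 0 \<omega> = 0"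
  using levy by (simp add: levy_process_def)

lemma increment_distr: "0 \<le> s \<Longrightarrow> s \<le> t \<Longrightarrow> distr M borel (X (t - s)) = distr M borel (\<lambda>\<omega>. X t \<omega> - X s \<omega>)"
  using levy by (simp add: levy_process_def)

lemma square_integrable_small:
  assumes "0 \<le> s" "s \<le> 1"
  shows "square_integrable M (X s)"
proof -
  note [measurable] = X_measurable[of 0] X_measurable[OF assms(1)]
  have "square_integrable M (\<lambda>\<omega>. (X s \<omega> - X 0 \<omega>) + (X 1 \<omega> - X s \<omega>))"
    by (rule square_integrable_cong_AE[OF sq1]) (use X_0 X_measurable assms in auto)
  then have "square_integrable M (\<lambda>\<omega>. X s \<omega> - X 0 \<omega>)"
    by (rule indep_sum_square_integrable[OF levy_indep_increment[OF prob_space_axioms levy assms]])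
  then show ?thesis by (rule square_integrable_cong_AE) (use X_0 X_measurable assms in auto)
qed

lemma increment_moments:
  assumes "0 \<le> s" "s \<le> t" "square_integrable M (X (t - s))"
  shows "square_integrable M (\<lambda>\<omega>. X t \<omega> - X s \<omega>)" "expectation (\<lambda>\<omega>. X t \<omega> - X s \<omega>) = expectation (X (t - s))"
    "expectation (\<lambda>\<omega>. (X t \<omega> - X s \<omega>)\<^sup>2) = expectation (\<lambda>\<omega>. (X (t - s) \<omega>)\<^sup>2)"
  by (rule distr_moments[OF increment_distr[OF assms(1,2)] assms(3)]; use X_measurable assms in auto)+

lemma square_integrable_X:
  assumes "0 \<le> t"
  shows "square_integrable M (X t)"
proof -
  obtain n :: nat where n: "t < real n" using reals_Archimedean2 by blast
  have n0: "0 < real n" using n assms by linarith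
  \<comment> \<open>Cutting \<open>[0,t]\<close> into pieces of length at most 1 makes each
    increment distributed like some \<open>X r\<close> with \<open>r \<le> 1\<close>, which is
    already known to be square integrable.\<close>
  define r where "r = t / real n"
  have r: "0 \<le> r" "r \<le> 1" using assms n n0 by (auto simp: r_def)
  have "square_integrable M (X (real k * r))" for k
  proof (induction k)
    case (Suc k)
    have "square_integrable M (\<lambda>\<omega>. X (real (Suc k) * r) \<omega> - X (real k * r) \<omega>)"
      using r by (intro increment_moments) (auto simp: algebra_simps intro: square_integrable_small)
    from square_integrable_add[OF this Suc] show ?case by simp
  qed (use square_integrable_small[of 0] in simp)
  from this[of n] show ?thesis using n0 by (simp add: r_def)
qed

definition mean :: "real \<Rightarrow> real" where "mean t = expectation (X t)"
text \<open>The variance is used because, in contrast to the second moment, it is additive before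
  the mean is known to vanish: the cross term \<open>2 * mean s * mean r\<close> is absorbed by the
  square of the mean.\<close>

definition var :: "real \<Rightarrow> real" where "var t = expectation (\<lambda>\<omega>. (X t \<omega>)\<^sup>2) - (mean t)\<^sup>2"

lemma integrable_X: "0 \<le> t \<Longrightarrow> integrable M (X t)"
  by (rule finite_measure_square_integrable(1)[OF finite_measure_axioms square_integrable_X])

lemma integrable_X2: "0 \<le> t \<Longrightarrow> integrable M (\<lambda>\<omega>. (X t \<omega>)\<^sup>2)"
  using square_integrable_norm2[OF square_integrable_X] by simp

lemma expectation_increment_mult:
  assumes "0 \<le> s" "s \<le> t"
  shows "expectation (\<lambda>\<omega>. X s \<omega> * (X t \<omega> - X s \<omega>)) = mean s * mean (t - s)"
proof -
  note m[measurable] = X_measurable[of 0] X_measurable[OF assms(1)] X_measurable[OF order_trans[OF assms]]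
  have t: "0 \<le> t" using assms by simp
  have "expectation (\<lambda>\<omega>. (X s \<omega> - X 0 \<omega>) * (X t \<omega> - X s \<omega>))
      = expectation (\<lambda>\<omega>. X s \<omega> - X 0 \<omega>) * expectation (\<lambda>\<omega>. X t \<omega> - X s \<omega>)"
    by (rule indep_var_lebesgue_integral[OF levy_indep_increment[OF prob_space_axioms levy assms]])
       (use integrable_X assms t in auto)
  also have "expectation (\<lambda>\<omega>. (X s \<omega> - X 0 \<omega>) * (X t \<omega> - X s \<omega>)) = expectation (\<lambda>\<omega>. X s \<omega> * (X t \<omega> - X s \<omega>))"
    by (rule integral_cong_AE) (use X_0 in \<open>auto\<close>)
  also have "expectation (\<lambda>\<omega>. X s \<omega> - X 0 \<omega>) = mean s"
    unfolding mean_def by (rule integral_cong_AE) (use X_0 in \<open>auto\<close>)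
  also have "expectation (\<lambda>\<omega>. X t \<omega> - X s \<omega>) = mean (t - s)"
    unfolding mean_def using assms by (intro increment_moments square_integrable_X) auto
  finally show ?thesis .
qed

lemma mean_add:
  assumes "0 \<le> s" "0 \<le> r"
  shows "mean (s + r) = mean s + mean r"
proof -
  have "expectation (\<lambda>\<omega>. X (s + r) \<omega> - X s \<omega>) = mean r"
    using increment_moments(2)[of s "s + r"] square_integrable_X assms by (simp add: mean_def)
  moreover have "expectation (\<lambda>\<omega>. X (s + r) \<omega> - X s \<omega>) = mean (s + r) - mean s"
    unfolding mean_def using integrable_X assms by (intro Bochner_Integration.integral_diff) auto
  ultimately show ?thesis by simp
qed

lemma var_add:
  assumes "0 \<le> s" "0 \<le> r"
  shows "var (s + r) = var s + var r"
proof -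
  have sr: "0 \<le> s + r" "s \<le> s + r" using assms by auto
  have d: "square_integrable M (\<lambda>\<omega>. X (s + r) \<omega> - X s \<omega>)"
    using square_integrable_diff[OF square_integrable_X[OF sr(1)] square_integrable_X[OF assms(1)]] .
  note i = integrable_X2[OF assms(1)] square_integrable_mult[OF square_integrable_X[OF assms(1)] d] square_integrable_norm2[OF d]
  have "expectation (\<lambda>\<omega>. (X (s + r) \<omega>)\<^sup>2)
      = expectation (\<lambda>\<omega>. (X s \<omega>)\<^sup>2 + 2 * (X s \<omega> * (X (s + r) \<omega> - X s \<omega>)) + (norm (X (s + r) \<omega> - X s \<omega>))\<^sup>2)"
    by (intro Bochner_Integration.integral_cong refl) (simp add: power2_eq_square algebra_simps)
  also have "\<dots> = expectation (\<lambda>\<omega>. (X s \<omega>)\<^sup>2) + 2 * expectation (\<lambda>\<omega>. X s \<omega> * (X (s + r) \<omega> - X s \<omega>))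
      + expectation (\<lambda>\<omega>. (norm (X (s + r) \<omega> - X s \<omega>))\<^sup>2)"
    using i by simp
  also have "expectation (\<lambda>\<omega>. X s \<omega> * (X (s + r) \<omega> - X s \<omega>)) = mean s * mean r"
    using expectation_increment_mult[OF assms(1) sr(2)] by simp
  also have "expectation (\<lambda>\<omega>. (norm (X (s + r) \<omega> - X s \<omega>))\<^sup>2) = expectation (\<lambda>\<omega>. (X r \<omega>)\<^sup>2)"
    using increment_moments(3)[OF assms(1) sr(2)] square_integrable_X[OF assms(2)] by simp
  finally show ?thesis
    unfolding var_def mean_add[OF assms] by (simp add: power2_sum)
qed

lemma var_eq: "0 \<le> t \<Longrightarrow> var t = t"
  using additive_nonneg_linear[of var t] var_add expectation_power2_le[OF square_integrable_X] var1 mean1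
  by (simp add: var_def mean_def)

text \<open>The mean has no sign, so additivity alone does not make it linear and some continuity is
  required. Right-continuous paths make \<open>X (u n)\<close> small in probability, and the
  variance \<open>u n\<close> keeps it close to its mean.\<close>

lemma mean_tendsto_0:
  assumes u: "\<And>n. 0 < u n" "u \<longlonglongrightarrow> 0"
  shows "(\<lambda>n. mean (u n)) \<longlonglongrightarrow> 0"
proof -
  have up: "0 \<le> u n" for n using u(1)[of n] by simp
  note [measurable] = X_measurable[OF up]
  have lim: "AE \<omega> in M. (\<lambda>n. X (u n) \<omega>) \<longlonglongrightarrow> 0"
  proof -
    have "AE \<omega> in M. cadlag (\<lambda>t. X t \<omega>)" using levy by (simp add: levy_process_def)
    then show ?thesis using X_0
    proof eventually_elim
      case (elim \<omega>)
      have "continuous (at_right 0) (\<lambda>t. X t \<omega>)" using elim(1) unfolding cadlag_def by blast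
      then have "((\<lambda>t. X t \<omega>) \<longlongrightarrow> 0) (at_right 0)" using elim(2) by (simp add: continuous_within)
      then show ?case using u unfolding tendsto_at_iff_sequentially comp_def by auto
    qed
  qed
  have "(\<lambda>n. expectation (\<lambda>\<omega>. min 1 \<bar>X (u n) \<omega>\<bar>)) \<longlonglongrightarrow> expectation (\<lambda>\<omega>. 0)"
  proof (rule integral_dominated_convergence[where w = "\<lambda>_. 1"])
    show "AE \<omega> in M. (\<lambda>n. min 1 \<bar>X (u n) \<omega>\<bar>) \<longlonglongrightarrow> 0"
      using lim
    proof eventually_elim
      case (elim \<omega>)
      have "(\<lambda>n. min 1 \<bar>X (u n) \<omega>\<bar>) \<longlonglongrightarrow> min 1 \<bar>0\<bar>" by (intro tendsto_intros elim)
      then show ?case by simp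
    qed
  qed auto
  then have 1: "(\<lambda>n. expectation (\<lambda>\<omega>. min 1 \<bar>X (u n) \<omega>\<bar>)) \<longlonglongrightarrow> 0" by simp
  have 2: "(\<lambda>n. sqrt (u n)) \<longlonglongrightarrow> 0" using tendsto_real_sqrt[OF u(2)] by simp
  \<comment> \<open>Truncation at 1 replaces a majorant for \<open>X (u n)\<close>; the distance to
    the mean is controlled in expectation by the standard deviation
    \<open>sqrt (u n)\<close>.\<close>
  have "min 1 \<bar>mean (u n)\<bar> \<le> expectation (\<lambda>\<omega>. min 1 \<bar>X (u n) \<omega>\<bar>) + sqrt (u n)" for n
  proof -
    note s = square_integrable_X[OF up[of n]]
    have d: "square_integrable M (\<lambda>\<omega>. X (u n) \<omega> - mean (u n))"
      by (intro square_integrable_diff s) (simp add: square_integrable_def)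
    have "(expectation (\<lambda>\<omega>. \<bar>X (u n) \<omega> - mean (u n)\<bar>))\<^sup>2 \<le> expectation (\<lambda>\<omega>. \<bar>X (u n) \<omega> - mean (u n)\<bar>\<^sup>2)"
      by (rule expectation_power2_le) (use d in \<open>simp add: square_integrable_def\<close>)
    also have "\<dots> = expectation (\<lambda>\<omega>. (X (u n) \<omega>)\<^sup>2 - 2 * mean (u n) * X (u n) \<omega> + (mean (u n))\<^sup>2)"
      by (intro Bochner_Integration.integral_cong refl) (simp add: power2_diff)
    also have "\<dots> = var (u n)"
      using integrable_X[OF up[of n]] integrable_X2[OF up[of n]] by (simp add: var_def mean_def prob_space power2_eq_square)
    finally have e: "expectation (\<lambda>\<omega>. \<bar>X (u n) \<omega> - mean (u n)\<bar>) \<le> sqrt (u n)"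
      using var_eq[OF up[of n]] by (intro real_le_rsqrt) simp
    have di: "integrable M (\<lambda>\<omega>. \<bar>X (u n) \<omega> - mean (u n)\<bar>)" using integrable_X[OF up[of n]] by auto
    have mi: "integrable M (\<lambda>\<omega>. min 1 \<bar>X (u n) \<omega>\<bar>)"
      by (rule Bochner_Integration.integrable_bound[of _ "\<lambda>_. 1::real"]) auto
    have "min 1 \<bar>mean (u n)\<bar> = expectation (\<lambda>\<omega>. min 1 \<bar>mean (u n)\<bar>)" by (simp add: prob_space)
    also have "\<dots> \<le> expectation (\<lambda>\<omega>. min 1 \<bar>X (u n) \<omega>\<bar> + \<bar>X (u n) \<omega> - mean (u n)\<bar>)"
      using di mi by (intro integral_mono) auto
    also have "\<dots> \<le> expectation (\<lambda>\<omega>. min 1 \<bar>X (u n) \<omega>\<bar>) + sqrt (u n)" using di mi e by simp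
    finally show ?thesis .
  qed
  note le = this
  have "(\<lambda>n. expectation (\<lambda>\<omega>. min 1 \<bar>X (u n) \<omega>\<bar>) + sqrt (u n)) \<longlonglongrightarrow> 0"
    using tendsto_add[OF 1 2] by simp
  from tendsto_sandwich[OF _ _ tendsto_const this] have l: "(\<lambda>n. min 1 \<bar>mean (u n)\<bar>) \<longlonglongrightarrow> 0"
    using le by (auto intro!: always_eventually)
  have "\<forall>\<^sub>F n in sequentially. min 1 \<bar>mean (u n)\<bar> = \<bar>mean (u n)\<bar>"
    using order_tendstoD(2)[OF l zero_less_one] by (rule eventually_mono) linarith
  then have "(\<lambda>n. \<bar>mean (u n)\<bar>) \<longlonglongrightarrow> 0" using l by (subst (asm) tendsto_cong)
  then show ?thesis by (rule tendsto_rabs_zero_cancel)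
qed

text \<open>The mean is additive, vanishes at the integers and tends to \<open>0\<close> at \<open>0\<close>, hence is zero.\<close>

lemma mean_eq_0:
  assumes t: "0 \<le> t"
  shows "mean t = 0"
proof -
  have mult: "mean (real n * s) = real n * mean s" if "0 \<le> s" for n s
  proof (induction n)
    case 0
    show ?case using mean_add[of 0 0] by simp
  next
    case (Suc n)
    then show ?case using mean_add[of "real n * s" s] that by (simp add: algebra_simps)
  qed
  have m1: "mean 1 = 0" by (simp add: mean_def mean1)
  \<comment> \<open>The fractional part of \<open>n t\<close>: its mean is
    \<open>n * mean t\<close>, since the mean vanishes at integers. Adding 1 and dividing by
    \<open>n + 1\<close> yields positive times tending to 0 whose mean is
    \<open>n / (n + 1) * mean t\<close>.\<close>
  define r where "r n = real n * t - real (nat \<lfloor>real n * t\<rfloor>)" for n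
  have r: "0 \<le> r n" "r n \<le> 1" for n unfolding r_def using t by (auto simp: of_nat_nat) linarith+
  have mr: "mean (r n) = real n * mean t" for n
  proof -
    have "mean (real n * t) = mean (real (nat \<lfloor>real n * t\<rfloor>) * 1 + r n)" by (simp add: r_def)
    also have "\<dots> = mean (r n)" using r[of n] mult[of 1] m1 by (subst mean_add) auto
    finally show ?thesis using mult[OF t, of n] by simp
  qed
  have "(\<lambda>n. mean ((r n + 1) / (real n + 1))) \<longlonglongrightarrow> 0"
  proof (rule mean_tendsto_0)
    show "0 < (r n + 1) / (real n + 1)" for n using r(1)[of n] by (simp add: add_nonneg_pos)
    have l: "(\<lambda>n. 2 / (real n + 1)) \<longlonglongrightarrow> 0" by real_asymp
    show "(\<lambda>n. (r n + 1) / (real n + 1)) \<longlonglongrightarrow> 0"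
      by (rule tendsto_sandwich[OF _ _ tendsto_const l])
         (use r in \<open>auto intro!: always_eventually divide_right_mono simp: add_nonneg_pos\<close>)
  qed
  moreover have "mean ((r n + 1) / (real n + 1)) = real n / (real n + 1) * mean t" for n
  proof -
    have p: "0 \<le> (r n + 1) / (real n + 1)" using r(1)[of n] by simp
    have "real (Suc n) * mean ((r n + 1) / (real n + 1)) = mean (real (Suc n) * ((r n + 1) / (real n + 1)))"
      by (rule mult[OF p, symmetric])
    also have "real (Suc n) * ((r n + 1) / (real n + 1)) = r n + 1" by (simp add: add.commute)
    also have "mean (r n + 1) = real n * mean t" using mean_add[of "r n" 1] r(1) m1 mr by simp
    finally show ?thesis by (simp add: field_simps)
  qed
  ultimately have A: "(\<lambda>n. real n / (real n + 1) * mean t) \<longlonglongrightarrow> 0" by simp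
  have "(\<lambda>n. real n / (real n + 1)) \<longlonglongrightarrow> 1" by real_asymp
  then have "(\<lambda>n. real n / (real n + 1) * mean t) \<longlonglongrightarrow> 1 * mean t" by (intro tendsto_mult tendsto_const)
  from LIMSEQ_unique[OF this A] show ?thesis by simp
qed

lemma expectation_X: "0 \<le> t \<Longrightarrow> expectation (X t) = 0"
  using mean_eq_0 by (simp add: mean_def)

lemma expectation_X2: "0 \<le> t \<Longrightarrow> expectation (\<lambda>\<omega>. (X t \<omega>)\<^sup>2) = t"
  using var_eq[of t] mean_eq_0[of t] by (simp add: var_def)

lemma expectation_X_X:
  assumes "0 \<le> s" "s \<le> t"
  shows "expectation (\<lambda>\<omega>. X s \<omega> * X t \<omega>) = s"
proof -
  have t: "0 \<le> t" using assms by simp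
  note s = square_integrable_X[OF assms(1)] square_integrable_X[OF t]
  have "expectation (\<lambda>\<omega>. X s \<omega> * X t \<omega>) = expectation (\<lambda>\<omega>. X s \<omega> * X s \<omega> + X s \<omega> * (X t \<omega> - X s \<omega>))"
    by (simp add: algebra_simps)
  also have "\<dots> = expectation (\<lambda>\<omega>. X s \<omega> * X s \<omega>) + expectation (\<lambda>\<omega>. X s \<omega> * (X t \<omega> - X s \<omega>))"
    by (intro Bochner_Integration.integral_add square_integrable_mult square_integrable_diff s)
  finally show ?thesis
    using expectation_increment_mult[OF assms] mean_eq_0[OF assms(1)] expectation_X2[OF assms(1)]
    by (simp add: power2_eq_square)
qed

lemma increment_norm:
  assumes "0 \<le> s" "s \<le> t"
  shows "L2norm M (\<lambda>\<omega>. X t \<omega> - X s \<omega>) = sqrt (t - s)"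
  using increment_moments(3)[OF assms] square_integrable_X[of "t - s"] expectation_X2[of "t - s"] assms
  by (simp add: L2norm_def)

end

section \<open>Integrals with respect to orthogonal increments\<close>

text \<open>The signed indicator whose Levy integral is \<open>L t\<close>, up to a null set. With
  it the covariance of \<open>L\<close> is an inner product in L2 for all signs of the times at
  once.\<close>

definition sgn_ind :: "real \<Rightarrow> real \<Rightarrow> real" where
  "sgn_ind t u = indicator {0<..t} u - indicator {t<..0} u"

lemma indicator_Ioc_eq_sgn_ind: "a \<le> b \<Longrightarrow> indicator {a<..b} u = sgn_ind b u - sgn_ind a u"
  by (auto simp: sgn_ind_def indicator_def)

lemma square_integrable_sgn_ind: "square_integrable lborel (sgn_ind t)"
  unfolding sgn_ind_def[abs_def]
  by (intro square_integrable_diff square_integrable_indicator) (auto simp: emeasure_lborel_Ioc_finite)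

lemma integral_sgn_ind_mult:
  "(\<integral>u. sgn_ind s u * sgn_ind t u \<partial>lborel) =
    (if 0 \<le> s \<and> 0 \<le> t then min s t else if s < 0 \<and> t < 0 then min (- s) (- t) else 0)"
proof -
  consider "0 \<le> s" "0 \<le> t" | "s < 0" "t < 0" | "0 \<le> s" "t < 0" | "s < 0" "0 \<le> t" by linarith
  then show ?thesis
  proof cases
    case 1
    have "sgn_ind s u * sgn_ind t u = indicator {0<..min s t} u" for u
      using 1 by (auto simp: sgn_ind_def indicator_def)
    then show ?thesis using 1 by simp
  next
    case 2
    have "sgn_ind s u * sgn_ind t u = indicator {max s t<..0} u" for u
      using 2 by (auto simp: sgn_ind_def indicator_def)
    then show ?thesis using 2 by (auto simp: min_def max_def)
  next
    case 3
    have "sgn_ind s u * sgn_ind t u = 0" for u using 3 by (auto simp: sgn_ind_def indicator_def)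
    then have "(\<integral>u. sgn_ind s u * sgn_ind t u \<partial>lborel) = 0" by (simp only: integral_zero)
    then show ?thesis using 3 by simp
  next
    case 4
    have "sgn_ind s u * sgn_ind t u = 0" for u using 4 by (auto simp: sgn_ind_def indicator_def)
    then have "(\<integral>u. sgn_ind s u * sgn_ind t u \<partial>lborel) = 0" by (simp only: integral_zero)
    then show ?thesis using 4 by simp
  qed
qed

locale orthogonal_increments = prob_space M for M :: "'w measure" +
  fixes L :: "real \<Rightarrow> 'w \<Rightarrow> real"
  assumes square_integrable_L: "square_integrable M (L t)"
    and covariance_L: "expectation (\<lambda>\<omega>. L s \<omega> * L t \<omega>) = (\<integral>u. sgn_ind s u * sgn_ind t u \<partial>lborel)"

lemma two_sided_levy_orthogonal_increments:
  assumes "prob_space M" and L: "two_sided_levy_process M L"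
    and sq: "integrable M (L 1)" "integrable M (\<lambda>\<omega>. (L 1 \<omega>)\<^sup>2)"
    and mean: "(\<integral>\<omega>. L 1 \<omega> \<partial>M) = 0" and var: "(\<integral>\<omega>. (L 1 \<omega>)\<^sup>2 \<partial>M) = 1"
  shows "orthogonal_increments M L"
proof -
  interpret prob_space M by fact
  let ?P = "Pi\<^sub>M {0..} (\<lambda>_. borel) :: (real \<Rightarrow> real) measure"
  have mL[measurable]: "L t \<in> borel_measurable M" for t using L by (simp add: two_sided_levy_process_def)
  obtain L1 L2 where L1: "levy_process M L1" and L2: "levy_process M L2"
    and eq: "distr M ?P (path L1) = distr M ?P (path L2)"
    and ind: "indep_var ?P (path L1) ?P (path L2)"
    and ae: "AE \<omega> in M. (\<forall>t\<ge>0. L t \<omega> = L1 t \<omega>) \<and> (\<forall>t<0. ((\<lambda>r. L2 r \<omega>) \<longlongrightarrow> - L t \<omega>) (at_left (- t)))"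
    using L unfolding two_sided_levy_process_def by blast
  have m1[measurable]: "L1 t \<in> borel_measurable M" and m2[measurable]: "L2 t \<in> borel_measurable M" if "0 \<le> t" for t
    using that L1 L2 by (auto simp: levy_process_def)
  have p: "path L1 \<in> measurable M ?P" "path L2 \<in> measurable M ?P"
    using ind by (auto dest: indep_var_rv1 indep_var_rv2)
  have L1L: "AE \<omega> in M. L1 t \<omega> = L t \<omega>" if "0 \<le> t" for t
    using ae by eventually_elim (use that in simp)
  have c: "(\<lambda>f. f t) \<in> measurable ?P borel" if "0 \<le> t" for t :: real
    using that by (intro measurable_component_singleton) simp
  have proj: "(\<lambda>f. f t) \<circ> path K = K t" if "0 \<le> t" for t and K :: "real \<Rightarrow> 'a \<Rightarrow> real"
    using that by (auto simp: path_def)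
  \<comment> \<open>Only the laws of the paths are given as equal; the coordinate map at time 1
    transfers the moments of \<open>L1 1\<close> to \<open>L2 1\<close>.\<close>
  have d12: "distr M borel (L1 1) = distr M borel (L2 1)"
  proof -
    have "distr M borel (L1 1) = distr (distr M ?P (path L1)) borel (\<lambda>f. f 1)"
      by (subst distr_distr[OF c[OF zero_le_one] p(1)]) (rule arg_cong[OF proj[OF zero_le_one, symmetric]])
    also have "\<dots> = distr (distr M ?P (path L2)) borel (\<lambda>f. f 1)" unfolding eq ..
    also have "\<dots> = distr M borel (L2 1)"
      by (subst distr_distr[OF c[OF zero_le_one] p(2)]) (rule arg_cong[OF proj[OF zero_le_one]])
    finally show ?thesis .
  qed
  have sq1: "square_integrable M (L1 1)"
    by (rule square_integrable_cong_AE[of M "L 1"]) (use sq L1L[of 1] in \<open>auto simp: square_integrable_def\<close>)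
  have L11: "AE \<omega> in M. L1 1 \<omega> = L 1 \<omega>" by (rule L1L) simp
  have "expectation (L1 1) = expectation (L 1)"
    by (rule integral_cong_AE[OF m1[OF zero_le_one] mL L11])
  then have e1: "expectation (L1 1) = 0" using mean by (rule trans)
  have "expectation (\<lambda>\<omega>. (L1 1 \<omega>)\<^sup>2) = expectation (\<lambda>\<omega>. (L 1 \<omega>)\<^sup>2)"
  proof (rule integral_cong_AE)
    show "AE \<omega> in M. (L1 1 \<omega>)\<^sup>2 = (L 1 \<omega>)\<^sup>2" using L11 by (rule eventually_mono) simp
  qed (use m1[OF zero_le_one] in measurable)
  then have v1: "expectation (\<lambda>\<omega>. (L1 1 \<omega>)\<^sup>2) = 1" using var by (rule trans)
  interpret A: square_integrable_levy M L1
    by unfold_locales (rule L1 sq1 e1 v1)+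
  note dm = distr_moments[OF d12 sq1 m2[OF zero_le_one]]
  interpret B: square_integrable_levy M L2
    by unfold_locales (rule L2 dm(1) trans[OF dm(2) e1] trans[OF dm(3) v1])+
  \<comment> \<open>At a fixed time the left limit that defines \<open>L t\<close> equals the value
    of \<open>L2\<close> almost surely: the increment of \<open>L2\<close> from \<open>r n\<close>
    to \<open>s\<close> has norm \<open>sqrt (s - r n)\<close>, which tends to 0, so by Fatou's
    lemma the jump at \<open>s\<close> has norm 0.\<close>
  have neg: "AE \<omega> in M. L2 (- t) \<omega> = - L t \<omega>" if t: "t < 0" for t
  proof -
    define s where "s = - t"
    have s: "0 < s" using t by (simp add: s_def)
    define r where "r n = s - s / (real n + 1)" for n
    have r: "0 \<le> r n" "r n < s" for n using s by (auto simp: r_def field_simps)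
    have rl: "r \<longlonglongrightarrow> s"
    proof -
      have "(\<lambda>n. s - s / (real n + 1)) \<longlonglongrightarrow> s" by real_asymp
      then show ?thesis by (simp add: r_def[abs_def])
    qed
    note [measurable] = m2[OF less_imp_le[OF s]] m2[OF r(1)]
    have sd: "square_integrable M (\<lambda>\<omega>. L2 s \<omega> - L2 (r n) \<omega>)" for n
      using s r(1)[of n] by (intro square_integrable_diff B.square_integrable_X) auto
    have lim: "AE \<omega> in M. (\<lambda>n. L2 s \<omega> - L2 (r n) \<omega>) \<longlonglongrightarrow> L2 s \<omega> - (- L t \<omega>)"
      using ae
    proof eventually_elim
      case (elim \<omega>)
      then have "((\<lambda>r. L2 r \<omega>) \<longlongrightarrow> - L t \<omega>) (at_left s)" using t by (simp add: s_def)
      then have "(\<lambda>n. L2 (r n) \<omega>) \<longlonglongrightarrow> - L t \<omega>"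
        using r rl unfolding tendsto_at_iff_sequentially comp_def by (auto simp: less_le)
      then show ?case by (intro tendsto_diff tendsto_const)
    qed
    have nrm: "L2norm M (\<lambda>\<omega>. L2 s \<omega> - L2 (r n) \<omega>) = sqrt (s - r n)" for n
      using r(1)[of n] r(2)[of n] by (intro B.increment_norm) auto
    have "(\<lambda>n. sqrt (s - r n)) \<longlonglongrightarrow> sqrt (s - s)" by (intro tendsto_intros rl)
    then have nl: "(\<lambda>n. sqrt (s - r n)) \<longlonglongrightarrow> 0" by simp
    have le: "square_integrable M (\<lambda>\<omega>. L2 s \<omega> - (- L t \<omega>)) \<and> L2norm M (\<lambda>\<omega>. L2 s \<omega> - (- L t \<omega>)) \<le> e" if e: "0 < e" for e
    proof -
      have "\<forall>\<^sub>F n in sequentially. L2norm M (\<lambda>\<omega>. L2 s \<omega> - L2 (r n) \<omega>) \<le> e"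
        unfolding nrm using order_tendstoD(2)[OF nl e] by (rule eventually_mono) simp
      from L2_fatou[OF sd _ this lim] show ?thesis by simp
    qed
    have "L2norm M (\<lambda>\<omega>. L2 s \<omega> - (- L t \<omega>)) = 0"
    proof (rule antisym[OF _ L2norm_nonneg], rule field_le_epsilon)
      fix e :: real assume "0 < e"
      then show "L2norm M (\<lambda>\<omega>. L2 s \<omega> - (- L t \<omega>)) \<le> 0 + e" using le[of e] by linarith
    qed
    then have "AE \<omega> in M. L2 s \<omega> - (- L t \<omega>) = 0"
      using L2norm_eq_0_iff[of M "\<lambda>\<omega>. L2 s \<omega> - (- L t \<omega>)"] le[of 1] by simp
    then show ?thesis unfolding s_def by (rule eventually_mono) simp
  qed
  \<comment> \<open>Independence of the two copies removes the covariance across time 0, matching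
    the disjoint supports of \<open>sgn_ind\<close> for times of opposite sign.\<close>
  have indep: "expectation (\<lambda>\<omega>. L1 s \<omega> * L2 t \<omega>) = 0" if "0 \<le> s" "0 \<le> t" for s t
  proof -
    have "indep_var borel ((\<lambda>f. f s) \<circ> path L1) borel ((\<lambda>f. f t) \<circ> path L2)"
      by (rule indep_var_compose[OF ind c[OF that(1)] c[OF that(2)]])
    then have "indep_var borel (L1 s) borel (L2 t)" using that by (simp add: proj)
    then have "expectation (\<lambda>\<omega>. L1 s \<omega> * L2 t \<omega>) = expectation (L1 s) * expectation (L2 t)"
      by (rule indep_var_lebesgue_integral) (use that A.integrable_X B.integrable_X in auto)
    then show ?thesis using A.expectation_X that by simp
  qed
  have sL: "square_integrable M (L t)" for t
  proof (cases "0 \<le> t")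
    case True
    show ?thesis by (rule square_integrable_cong_AE[OF A.square_integrable_X[OF True]]) (use L1L[OF True] in auto)
  next
    case False
    have "square_integrable M (\<lambda>\<omega>. - L2 (- t) \<omega>)" using False by (intro square_integrable_uminus B.square_integrable_X) simp
    then show ?thesis by (rule square_integrable_cong_AE) (use neg[of t] False in auto)
  qed
  have cov: "expectation (\<lambda>\<omega>. L s \<omega> * L t \<omega>) = (\<integral>u. sgn_ind s u * sgn_ind t u \<partial>lborel)" if "s \<le> t" for s t
  proof -
    consider "0 \<le> s" "0 \<le> t" | "s < 0" "t < 0" | "s < 0" "0 \<le> t" using \<open>s \<le> t\<close> by linarith
    then show ?thesis
    proof cases
      case 1
      note [measurable] = m1[OF 1(1)] m1[OF 1(2)]
      have "expectation (\<lambda>\<omega>. L s \<omega> * L t \<omega>) = expectation (\<lambda>\<omega>. L1 s \<omega> * L1 t \<omega>)"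
      proof (rule integral_cong_AE)
        show "AE \<omega> in M. L s \<omega> * L t \<omega> = L1 s \<omega> * L1 t \<omega>"
          using L1L[OF 1(1)] L1L[OF 1(2)] by eventually_elim simp
      qed measurable
      then show ?thesis using A.expectation_X_X[of s t] 1 that by (simp add: integral_sgn_ind_mult)
    next
      case 2
      have n: "0 \<le> - s" "0 \<le> - t" "- t \<le> - s" using 2 that by auto
      note [measurable] = m2[OF n(1)] m2[OF n(2)]
      have "expectation (\<lambda>\<omega>. L s \<omega> * L t \<omega>) = expectation (\<lambda>\<omega>. L2 (- t) \<omega> * L2 (- s) \<omega>)"
      proof (rule integral_cong_AE)
        show "AE \<omega> in M. L s \<omega> * L t \<omega> = L2 (- t) \<omega> * L2 (- s) \<omega>"
          using neg[OF 2(1)] neg[OF 2(2)] by eventually_elim simp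
      qed measurable
      then show ?thesis using B.expectation_X_X[OF n(2,3)] 2 that by (simp add: integral_sgn_ind_mult)
    next
      case 3
      have n: "0 \<le> - s" using 3 by auto
      note [measurable] = m2[OF n] m1[OF 3(2)]
      have "expectation (\<lambda>\<omega>. L s \<omega> * L t \<omega>) = expectation (\<lambda>\<omega>. - (L1 t \<omega> * L2 (- s) \<omega>))"
      proof (rule integral_cong_AE)
        show "AE \<omega> in M. L s \<omega> * L t \<omega> = - (L1 t \<omega> * L2 (- s) \<omega>)"
          using neg[OF 3(1)] L1L[OF 3(2)] by eventually_elim simp
      qed measurable
      then show ?thesis using indep[OF 3(2) n] 3 by (simp add: integral_sgn_ind_mult)
    qed
  qed
  show ?thesis
  proof
    show "square_integrable M (L t)" for t by (rule sL)
    show "expectation (\<lambda>\<omega>. L s \<omega> * L t \<omega>) = (\<integral>u. sgn_ind s u * sgn_ind t u \<partial>lborel)" for s t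
      using cov[of s t] cov[of t s] by (cases "s \<le> t") (auto simp: mult.commute)
  qed
qed

section \<open>The isometry between kernels and Levy integrals\<close>

context orthogonal_increments
begin

lemma step_integral_simps [simp]:
  "step_integral L [] = (\<lambda>\<omega>. 0)"
  "step_integral L (x # S) = (\<lambda>\<omega>. fst x * (L (snd (snd x)) \<omega> - L (fst (snd x)) \<omega>) + step_integral L S \<omega>)"
  by (auto simp: step_integral_def split_beta')

lemma step_integral_append: "step_integral L (S @ T) \<omega> = step_integral L S \<omega> + step_integral L T \<omega>"
  by (simp add: step_integral_def)

lemma step_integral_scale: "step_integral L (map (\<lambda>(c, p). (r * c, p)) S) \<omega> = r * step_integral L S \<omega>"
  by (induction S) (auto simp: algebra_simps)

lemma square_integrable_step_integral: "square_integrable M (step_integral L S)"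
  by (induction S) (auto intro!: square_integrable_add square_integrable_cmult square_integrable_diff square_integrable_L)

lemma increment_inner:
  assumes "a \<le> b" "c \<le> d"
  shows "expectation (\<lambda>\<omega>. (L b \<omega> - L a \<omega>) * (L d \<omega> - L c \<omega>)) = (\<integral>u. indicator {a<..b} u * indicator {c<..d} u \<partial>lborel)"
proof -
  note i = square_integrable_mult[OF square_integrable_L square_integrable_L]
  note j = square_integrable_mult[OF square_integrable_sgn_ind square_integrable_sgn_ind]
  have "expectation (\<lambda>\<omega>. (L b \<omega> - L a \<omega>) * (L d \<omega> - L c \<omega>))
      = expectation (\<lambda>\<omega>. L b \<omega> * L d \<omega> - L b \<omega> * L c \<omega> - (L a \<omega> * L d \<omega> - L a \<omega> * L c \<omega>))"
    by (simp add: algebra_simps)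
  also have "\<dots> = expectation (\<lambda>\<omega>. L b \<omega> * L d \<omega>) - expectation (\<lambda>\<omega>. L b \<omega> * L c \<omega>)
      - (expectation (\<lambda>\<omega>. L a \<omega> * L d \<omega>) - expectation (\<lambda>\<omega>. L a \<omega> * L c \<omega>))"
    using i by simp
  also have "\<dots> = (\<integral>u. sgn_ind b u * sgn_ind d u - sgn_ind b u * sgn_ind c u
      - (sgn_ind a u * sgn_ind d u - sgn_ind a u * sgn_ind c u) \<partial>lborel)"
    unfolding covariance_L using j by simp
  also have "\<dots> = (\<integral>u. indicator {a<..b} u * indicator {c<..d} u \<partial>lborel)"
    unfolding indicator_Ioc_eq_sgn_ind[OF assms(1)] indicator_Ioc_eq_sgn_ind[OF assms(2)]
    by (simp add: algebra_simps)
  finally show ?thesis .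
qed

text \<open>Bilinearity reduces this to two increments. The condition \<open>a \<le> b\<close> in
  \<open>steps\<close> matters: for \<open>b < a\<close> the step function would vanish while the
  integral would still count an increment.\<close>

lemma step_integral_inner:
  assumes "steps S" "steps T"
  shows "expectation (\<lambda>\<omega>. step_integral L S \<omega> * step_integral L T \<omega>) = (\<integral>u. step_fun S u * step_fun T u \<partial>lborel)"
proof -
  have sI: "square_integrable lborel (\<lambda>u. indicator {a<..b} u :: real)" for a b :: real
    by (rule square_integrable_indicator) (auto simp: emeasure_lborel_Ioc_finite)
  have sD: "square_integrable M (\<lambda>\<omega>. L b \<omega> - L a \<omega>)" for a b
    by (intro square_integrable_diff square_integrable_L)
  have *: "expectation (\<lambda>\<omega>. (L b \<omega> - L a \<omega>) * step_integral L T \<omega>) = (\<integral>u. indicator {a<..b} u * step_fun T u \<partial>lborel)"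
    if "a \<le> b" "steps T" for a b T
    using that(2)
  proof (induction T)
    case (Cons x T)
    obtain r c d where x: "x = (r, c, d)" by (cases x)
    have cd: "c \<le> d" and T: "steps T" using Cons(2) by (auto simp: steps_def x)
    have "expectation (\<lambda>\<omega>. (L b \<omega> - L a \<omega>) * step_integral L (x # T) \<omega>)
      = expectation (\<lambda>\<omega>. r * ((L b \<omega> - L a \<omega>) * (L d \<omega> - L c \<omega>)) + (L b \<omega> - L a \<omega>) * step_integral L T \<omega>)"
      by (simp add: x algebra_simps)
    also have "\<dots> = r * expectation (\<lambda>\<omega>. (L b \<omega> - L a \<omega>) * (L d \<omega> - L c \<omega>)) + expectation (\<lambda>\<omega>. (L b \<omega> - L a \<omega>) * step_integral L T \<omega>)"
      using square_integrable_mult[OF sD sD] square_integrable_mult[OF sD square_integrable_step_integral] by simp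
    also have "\<dots> = (\<integral>u. r * (indicator {a<..b} u * indicator {c<..d} u) + indicator {a<..b} u * step_fun T u \<partial>lborel)"
      unfolding increment_inner[OF that(1) cd] Cons(1)[OF T]
      using square_integrable_mult[OF sI sI] square_integrable_mult[OF sI square_integrable_step_fun] by simp
    also have "\<dots> = (\<integral>u. indicator {a<..b} u * step_fun (x # T) u \<partial>lborel)"
      by (simp add: x algebra_simps)
    finally show ?case .
  qed simp
  show ?thesis
    using assms(1)
  proof (induction S)
    case (Cons x S)
    obtain r a b where x: "x = (r, a, b)" by (cases x)
    have ab: "a \<le> b" and S: "steps S" using Cons(2) by (auto simp: steps_def x)
    have "expectation (\<lambda>\<omega>. step_integral L (x # S) \<omega> * step_integral L T \<omega>)
      = expectation (\<lambda>\<omega>. r * ((L b \<omega> - L a \<omega>) * step_integral L T \<omega>) + step_integral L S \<omega> * step_integral L T \<omega>)"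
      by (simp add: x algebra_simps)
    also have "\<dots> = r * expectation (\<lambda>\<omega>. (L b \<omega> - L a \<omega>) * step_integral L T \<omega>) + expectation (\<lambda>\<omega>. step_integral L S \<omega> * step_integral L T \<omega>)"
      using square_integrable_mult[OF sD square_integrable_step_integral]
        square_integrable_mult[OF square_integrable_step_integral square_integrable_step_integral] by simp
    also have "\<dots> = (\<integral>u. r * (indicator {a<..b} u * step_fun T u) + step_fun S u * step_fun T u \<partial>lborel)"
      unfolding *[OF ab assms(2)] Cons(1)[OF S]
      using square_integrable_mult[OF sI square_integrable_step_fun]
        square_integrable_mult[OF square_integrable_step_fun square_integrable_step_fun] by simp
    also have "\<dots> = (\<integral>u. step_fun (x # S) u * step_fun T u \<partial>lborel)"
      by (simp add: x algebra_simps)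
    finally show ?case .
  qed simp
qed

lemma step_integral_norm:
  assumes "steps S"
  shows "L2norm M (step_integral L S) = L2norm lborel (step_fun S)"
  using step_integral_inner[OF assms assms] by (simp add: L2norm_def power2_eq_square)

lemma steps_append: "steps S \<Longrightarrow> steps T \<Longrightarrow> steps (S @ T)"
  and steps_scale: "steps S \<Longrightarrow> steps (map (\<lambda>(c, p). (r * c, p)) S)"
  by (auto simp: steps_def)

lemma has_levy_integral_iff:
  "has_levy_integral M L f Z \<longleftrightarrow> (\<exists>S. (\<forall>n. steps (S n)) \<and> L2_tendsto lborel (\<lambda>n. step_fun (S n)) f sequentially \<and>
        L2_tendsto M (\<lambda>n. step_integral L (S n)) Z sequentially)"
  by (simp add: has_levy_integral_def steps_def)

lemma has_levy_integral_square_integrable: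
  assumes "has_levy_integral M L f Z"
  shows "square_integrable lborel f" "square_integrable M Z"
  using assms by (auto simp: has_levy_integral_iff L2_tendsto_def)

lemma has_levy_integral_norm:
  assumes "has_levy_integral M L f Z"
  shows "L2norm M Z = L2norm lborel f"
proof -
  obtain S where S: "\<And>n. steps (S n)" "L2_tendsto lborel (\<lambda>n. step_fun (S n)) f sequentially"
    "L2_tendsto M (\<lambda>n. step_integral L (S n)) Z sequentially"
    using assms by (auto simp: has_levy_integral_iff)
  have "(\<lambda>n. L2norm M (step_integral L (S n))) \<longlonglongrightarrow> L2norm lborel f"
    unfolding step_integral_norm[OF S(1)] by (rule L2_tendsto_norm[OF S(2)])
  with L2_tendsto_norm[OF S(3)] show ?thesis by (rule LIMSEQ_unique)
qed

lemma has_levy_integral_add: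
  assumes "has_levy_integral M L f Z" "has_levy_integral M L g W"
  shows "has_levy_integral M L (\<lambda>u. f u + g u) (\<lambda>\<omega>. Z \<omega> + W \<omega>)"
proof -
  obtain S where S: "\<And>n. steps (S n)" "L2_tendsto lborel (\<lambda>n. step_fun (S n)) f sequentially"
    "L2_tendsto M (\<lambda>n. step_integral L (S n)) Z sequentially"
    using assms(1) by (auto simp: has_levy_integral_iff)
  obtain T where T: "\<And>n. steps (T n)" "L2_tendsto lborel (\<lambda>n. step_fun (T n)) g sequentially"
    "L2_tendsto M (\<lambda>n. step_integral L (T n)) W sequentially"
    using assms(2) by (auto simp: has_levy_integral_iff)
  have "step_fun (S n @ T n) = (\<lambda>u. step_fun (S n) u + step_fun (T n) u)"
    "step_integral L (S n @ T n) = (\<lambda>u. step_integral L (S n) u + step_integral L (T n) u)" for n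
    by (auto simp: step_fun_append step_integral_append)
  then show ?thesis
    unfolding has_levy_integral_iff using S T
    by (intro exI[of _ "\<lambda>n. S n @ T n"]) (simp add: steps_append L2_tendsto_add)
qed

lemma has_levy_integral_cmult:
  assumes "has_levy_integral M L f Z"
  shows "has_levy_integral M L (\<lambda>u. c * f u) (\<lambda>\<omega>. c * Z \<omega>)"
proof -
  obtain S where S: "\<And>n. steps (S n)" "L2_tendsto lborel (\<lambda>n. step_fun (S n)) f sequentially"
    "L2_tendsto M (\<lambda>n. step_integral L (S n)) Z sequentially"
    using assms(1) by (auto simp: has_levy_integral_iff)
  have "step_fun (map (\<lambda>(r, p). (c * r, p)) (S n)) = (\<lambda>u. c * step_fun (S n) u)"
    "step_integral L (map (\<lambda>(r, p). (c * r, p)) (S n)) = (\<lambda>u. c * step_integral L (S n) u)" for n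
    by (auto simp: step_fun_scale step_integral_scale)
  then show ?thesis
    unfolding has_levy_integral_iff using S
    by (intro exI[of _ "\<lambda>n. map (\<lambda>(r, p). (c * r, p)) (S n)"]) (simp add: steps_scale L2_tendsto_cmult)
qed

lemma has_levy_integral_diff:
  assumes "has_levy_integral M L f Z" "has_levy_integral M L g W"
  shows "has_levy_integral M L (\<lambda>u. f u - g u) (\<lambda>\<omega>. Z \<omega> - W \<omega>)"
  using has_levy_integral_add[OF assms(1) has_levy_integral_cmult[OF assms(2), of "-1"]] by simp

lemma has_levy_integral_cong_AE:
  assumes "has_levy_integral M L f Z" "g \<in> borel_measurable borel" "AE u in lborel. g u = f u"
    "W \<in> borel_measurable M" "AE \<omega> in M. W \<omega> = Z \<omega>"
  shows "has_levy_integral M L g W"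
proof -
  obtain S where S: "\<And>n. steps (S n)" "L2_tendsto lborel (\<lambda>n. step_fun (S n)) f sequentially"
    "L2_tendsto M (\<lambda>n. step_integral L (S n)) Z sequentially"
    using assms(1) by (auto simp: has_levy_integral_iff)
  have "L2_tendsto lborel (\<lambda>n. step_fun (S n)) g sequentially"
    by (rule L2_tendsto_cong_AE[OF S(2)])
       (use assms square_integrable_measurable[OF square_integrable_step_fun] in auto)
  moreover have "L2_tendsto M (\<lambda>n. step_integral L (S n)) W sequentially"
    by (rule L2_tendsto_cong_AE[OF S(3)])
       (use assms square_integrable_measurable[OF square_integrable_step_integral] in auto)
  ultimately show ?thesis using S(1) by (auto simp: has_levy_integral_iff)
qed

lemma has_levy_integral_unique:
  assumes "has_levy_integral M L f Z" "has_levy_integral M L g W" "AE u in lborel. f u = g u"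
  shows "AE \<omega> in M. Z \<omega> = W \<omega>"
proof -
  note s = has_levy_integral_square_integrable[OF assms(1)] has_levy_integral_square_integrable[OF assms(2)]
  have "AE u in lborel. f u - g u = 0" using assms(3) by (rule eventually_mono) simp
  then have "L2norm lborel (\<lambda>u. f u - g u) = 0" by (subst L2norm_eq_0_iff) (intro square_integrable_diff s)
  then have "L2norm M (\<lambda>\<omega>. Z \<omega> - W \<omega>) = 0"
    using has_levy_integral_norm[OF has_levy_integral_diff[OF assms(1,2)]] by simp
  then have "AE \<omega> in M. Z \<omega> - W \<omega> = 0" by (subst (asm) L2norm_eq_0_iff) (intro square_integrable_diff s)
  then show ?thesis by (rule eventually_mono) simp
qed

text \<open>Polarisation of the isometry, which avoids a second approximation argument for
  products.\<close>

lemma has_levy_integral_inner: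
  assumes "has_levy_integral M L f Z" "has_levy_integral M L g W"
  shows "expectation (\<lambda>\<omega>. Z \<omega> * W \<omega>) = (\<integral>u. f u * g u \<partial>lborel)"
proof -
  note s = has_levy_integral_square_integrable[OF assms(1)] has_levy_integral_square_integrable[OF assms(2)]
  have polar: "4 * (\<integral>x. p x * q x \<partial>N) = (L2norm N (\<lambda>x. p x + q x))\<^sup>2 - (L2norm N (\<lambda>x. p x - q x))\<^sup>2"
    if "square_integrable N p" "square_integrable N q" for N :: "'z measure" and p q :: "'z \<Rightarrow> real"
  proof -
    have "(L2norm N (\<lambda>x. p x + q x))\<^sup>2 - (L2norm N (\<lambda>x. p x - q x))\<^sup>2
      = (\<integral>x. (norm (p x + q x))\<^sup>2 - (norm (p x - q x))\<^sup>2 \<partial>N)"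
      unfolding L2norm_power2 using that
      by (intro Bochner_Integration.integral_diff[symmetric] square_integrable_norm2 square_integrable_add square_integrable_diff)
    also have "\<dots> = (\<integral>x. 4 * (p x * q x) \<partial>N)"
      by (intro Bochner_Integration.integral_cong refl) (simp add: power2_eq_square algebra_simps)
    finally show ?thesis by simp
  qed
  have "4 * expectation (\<lambda>\<omega>. Z \<omega> * W \<omega>) = 4 * (\<integral>u. f u * g u \<partial>lborel)"
    unfolding polar[OF s(2,4)] polar[OF s(1,3)]
    by (simp add: has_levy_integral_norm[OF has_levy_integral_diff[OF assms]] has_levy_integral_norm[OF has_levy_integral_add[OF assms]])
  then show ?thesis by simp
qed

lemma has_levy_integral_exists:
  assumes f: "square_integrable lborel f"
  obtains Z where "has_levy_integral M L f Z"
proof -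
  have "\<exists>S. steps S \<and> L2norm lborel (\<lambda>u. step_fun S u - f u) < 1 / (real n + 1)" for n
    using step_fun_dense[OF f] by simp
  then obtain S where S: "\<And>n. steps (S n)" "\<And>n. L2norm lborel (\<lambda>u. step_fun (S n) u - f u) < 1 / (real n + 1)"
    by metis
  have l: "(\<lambda>n. 1 / (real n + 1)) \<longlonglongrightarrow> 0" by real_asymp
  have Sf: "L2_tendsto lborel (\<lambda>n. step_fun (S n)) f sequentially"
    by (rule L2_tendsto_sandwich[OF f _ _ l])
       (use S(2) in \<open>auto intro!: always_eventually square_integrable_step_fun less_imp_le\<close>)
  have d: "L2norm M (\<lambda>\<omega>. step_integral L (S m) \<omega> - step_integral L (S n) \<omega>)
      = L2norm lborel (\<lambda>u. step_fun (S m) u - step_fun (S n) u)" for m n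
  proof -
    \<comment> \<open>A difference of step functions is again one, encoded by appending the second
      list with negated coefficients, so the isometry also covers distances.\<close>
    let ?T = "S m @ map (\<lambda>(c, p). (- 1 * c, p)) (S n)"
    have "step_integral L ?T = (\<lambda>\<omega>. step_integral L (S m) \<omega> - step_integral L (S n) \<omega>)"
      "step_fun ?T = (\<lambda>u. step_fun (S m) u - step_fun (S n) u)"
      unfolding fun_eq_iff step_integral_append step_integral_scale step_fun_append step_fun_scale by simp_all
    then show ?thesis
      using step_integral_norm[OF steps_append[OF S(1)[of m] steps_scale[OF S(1)[of n], of "-1"]]] by (simp only:)
  qed
  obtain Z where "L2_tendsto M (\<lambda>n. step_integral L (S n)) Z sequentially"
  proof (rule L2_complete[OF square_integrable_step_integral])
    fix e :: real assume "0 < e"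
    from L2_tendsto_Cauchy[OF Sf this square_integrable_step_fun]
    show "\<exists>N. \<forall>m\<ge>N. \<forall>n\<ge>N. L2norm M (\<lambda>\<omega>. step_integral L (S m) \<omega> - step_integral L (S n) \<omega>) \<le> e"
      unfolding d .
  qed
  then show ?thesis using S(1) Sf by (intro that[of Z]) (auto simp: has_levy_integral_iff)
qed

text \<open>By the isometry, \<open>Y\<close> also converges to a Levy integral of \<open>f\<close>,
  and L2 limits are unique up to null sets. This avoids a diagonal choice of step functions.\<close>

lemma has_levy_integral_limit:
  assumes F: "\<And>n. has_levy_integral M L (F n) (Y n)"
    and f: "L2_tendsto lborel F f sequentially" and Z: "L2_tendsto M Y Z sequentially"
  shows "has_levy_integral M L f Z"
proof -
  have sf: "square_integrable lborel f" and sZ: "square_integrable M Z" using f Z by (auto simp: L2_tendsto_def)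
  obtain W where W: "has_levy_integral M L f W" using has_levy_integral_exists[OF sf] .
  note sW = has_levy_integral_square_integrable(2)[OF W]
  have "L2_tendsto M Y W sequentially"
  proof (rule L2_tendsto_sandwich[OF sW])
    show "\<forall>\<^sub>F n in sequentially. L2norm M (\<lambda>\<omega>. Y n \<omega> - W \<omega>) \<le> L2norm lborel (\<lambda>u. F n u - f u)"
      using has_levy_integral_norm[OF has_levy_integral_diff[OF F W]] by simp
    show "(\<lambda>n. L2norm lborel (\<lambda>u. F n u - f u)) \<longlonglongrightarrow> 0" using f by (simp add: L2_tendsto_iff)
  qed (use has_levy_integral_square_integrable(2)[OF F] in simp)
  then have "AE \<omega> in M. Z \<omega> = W \<omega>" by (rule L2_tendsto_unique[OF Z]) simp
  then show ?thesis
    by (intro has_levy_integral_cong_AE[OF W]) (use square_integrable_measurable[OF sZ] square_integrable_measurable[OF sf] in auto)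
qed

end

section \<open>Moving averages\<close>

lemma AE_lborel_reflect:
  assumes "AE u in lborel. P (u :: real)" "Measurable.pred borel P"
  shows "AE u in lborel. P (t - u)"
  using AE_borel_affine[OF _ assms(2,1), of "-1" t] by simp

lemma measurable_process_reflect:
  assumes X: "measurable_process M X" and \<nu>: "sets \<nu> = sets borel"
  shows "(\<lambda>(v, \<omega>). X (t - v) \<omega>) \<in> borel_measurable (\<nu> \<Otimes>\<^sub>M M)"
    "(\<lambda>(\<omega>, v). X (t - v) \<omega>) \<in> borel_measurable (M \<Otimes>\<^sub>M \<nu>)"
    "(\<lambda>(p, v). X (fst p - v) (snd p)) \<in> borel_measurable ((borel \<Otimes>\<^sub>M M) \<Otimes>\<^sub>M \<nu>)"
proof -
  have X': "(\<lambda>p. X (fst p) (snd p)) \<in> borel_measurable (borel \<Otimes>\<^sub>M M)"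
    using X by (simp add: measurable_process_def split_beta')
  have id[measurable]: "(\<lambda>v. v) \<in> measurable \<nu> borel"
    by (subst measurable_cong_sets[OF \<nu> refl]) simp
  have [measurable]: "fst \<in> measurable (\<nu> \<Otimes>\<^sub>M M) borel" "snd \<in> measurable (M \<Otimes>\<^sub>M \<nu>) borel"
    "snd \<in> measurable ((borel \<Otimes>\<^sub>M M) \<Otimes>\<^sub>M \<nu>) (borel :: real measure)"
    using measurable_compose[OF measurable_fst id] measurable_compose[OF measurable_snd id] by auto
  have "(\<lambda>p. (t - fst p, snd p)) \<in> measurable (\<nu> \<Otimes>\<^sub>M M) (borel \<Otimes>\<^sub>M M)" by measurable
  from measurable_compose[OF this X'] show "(\<lambda>(v, \<omega>). X (t - v) \<omega>) \<in> borel_measurable (\<nu> \<Otimes>\<^sub>M M)"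
    by (simp add: split_beta')
  have "(\<lambda>p. (t - snd p, fst p)) \<in> measurable (M \<Otimes>\<^sub>M \<nu>) (borel \<Otimes>\<^sub>M M)" by measurable
  from measurable_compose[OF this X'] show "(\<lambda>(\<omega>, v). X (t - v) \<omega>) \<in> borel_measurable (M \<Otimes>\<^sub>M \<nu>)"
    by (simp add: split_beta')
  have "(\<lambda>p. (fst (fst p) - snd p, snd (fst p))) \<in> measurable ((borel \<Otimes>\<^sub>M M) \<Otimes>\<^sub>M \<nu>) (borel \<Otimes>\<^sub>M M)" by measurable
  from measurable_compose[OF this X'] show "(\<lambda>(p, v). X (fst p - v) (snd p)) \<in> borel_measurable ((borel \<Otimes>\<^sub>M M) \<Otimes>\<^sub>M \<nu>)"
    by (simp add: split_beta')
qed

lemma measurable_process_path: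
  assumes "measurable_process M X" "\<omega> \<in> space M"
  shows "(\<lambda>t. X t \<omega>) \<in> borel_measurable borel"
  using measurable_compose[OF measurable_Pair2'[OF assms(2)] assms(1)[unfolded measurable_process_def]] by simp

lemma measurable_process_time:
  assumes "measurable_process M X"
  shows "X t \<in> borel_measurable M"
  using measurable_compose[OF measurable_Pair1' assms[unfolded measurable_process_def], of t] by simp

lemma measurable_process_conv:
  assumes X: "measurable_process M X" and \<nu>: "finite_measure \<nu>" "sets \<nu> = sets borel"
  shows "measurable_process M (\<lambda>t \<omega>. conv \<nu> (\<lambda>s. X s \<omega>) t)"
proof -
  interpret finite_measure \<nu> by fact
  note [measurable] = measurable_process_reflect(3)[OF X \<nu>(2)]
  have "(\<lambda>p. \<integral>v. X (fst p - v) (snd p) \<partial>\<nu>) \<in> borel_measurable (borel \<Otimes>\<^sub>M M)" by measurable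
  then show ?thesis by (simp add: measurable_process_def conv_def split_beta')
qed

lemma measurable_process_diff:
  "measurable_process M X \<Longrightarrow> measurable_process M Y \<Longrightarrow> measurable_process M (\<lambda>t \<omega>. X t \<omega> - Y t \<omega>)"
  unfolding measurable_process_def split_beta' by measurable

lemma measurable_process_cmult:
  "measurable_process M X \<Longrightarrow> measurable_process M (\<lambda>t \<omega>. c * X t \<omega>)"
  unfolding measurable_process_def split_beta' by measurable

context orthogonal_increments
begin

text \<open>The Levy integrals fix each \<open>X t\<close> only up to a null set depending on
  \<open>t\<close>. Joint measurability is therefore part of the notion: without it integrals along
  paths would not be accessible.\<close>

definition moving_average :: "(real \<Rightarrow> real) \<Rightarrow> (real \<Rightarrow> 'w \<Rightarrow> real) \<Rightarrow> bool" where
  "moving_average f X \<longleftrightarrow> measurable_process M X \<and> square_integrable lborel f \<and>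
     (\<forall>t. has_levy_integral M L (\<lambda>u. f (t - u)) (X t))"

lemma moving_averageD:
  assumes "moving_average f X"
  shows "measurable_process M X" "square_integrable lborel f" "has_levy_integral M L (\<lambda>u. f (t - u)) (X t)"
    "square_integrable M (X t)" "L2norm M (X t) = L2norm lborel f"
proof -
  show 1: "measurable_process M X" "square_integrable lborel f" "has_levy_integral M L (\<lambda>u. f (t - u)) (X t)"
    using assms by (auto simp: moving_average_def)
  show "square_integrable M (X t)" by (rule has_levy_integral_square_integrable(2)[OF 1(3)])
  show "L2norm M (X t) = L2norm lborel f" using has_levy_integral_norm[OF 1(3)] by (simp add: L2norm_shift)
qed

lemma moving_average_diff:
  "moving_average f X \<Longrightarrow> moving_average g Y \<Longrightarrow> moving_average (\<lambda>t. f t - g t) (\<lambda>t \<omega>. X t \<omega> - Y t \<omega>)"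
  by (simp add: moving_average_def measurable_process_diff square_integrable_diff has_levy_integral_diff)

lemma moving_average_cmult:
  "moving_average f X \<Longrightarrow> moving_average (\<lambda>t. c * f t) (\<lambda>t \<omega>. c * X t \<omega>)"
  by (simp add: moving_average_def measurable_process_cmult square_integrable_cmult has_levy_integral_cmult)

lemma moving_average_unique:
  assumes f: "moving_average f X" and g: "moving_average g Y" and eq: "AE t in lborel. f t = g t"
  shows "AE \<omega> in M. X t \<omega> = Y t \<omega>"
proof (rule has_levy_integral_unique[OF moving_averageD(3)[OF f] moving_averageD(3)[OF g]])
  note [measurable] = square_integrable_measurable[OF moving_averageD(2)[OF f], simplified]
    square_integrable_measurable[OF moving_averageD(2)[OF g], simplified]
  show "AE u in lborel. f (t - u) = g (t - u)" by (rule AE_lborel_reflect[OF eq]) measurable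
qed

text \<open>Stochastic Fubini. Instead of interchanging integrals directly, the pathwise convolution is compared with the
  Levy integral of the convolved kernel: their difference is orthogonal to all Levy integrals, hence to both.\<close>

lemma moving_average_conv:
  assumes X: "moving_average f X" and \<nu>: "finite_measure \<nu>" "sets \<nu> = sets borel"
  shows "moving_average (conv \<nu> f) (\<lambda>t \<omega>. conv \<nu> (\<lambda>s. X s \<omega>) t)"
    "AE \<omega> in M. integrable \<nu> (\<lambda>v. X (t - v) \<omega>)"
proof -
  note f = moving_averageD(2)[OF X]
  have sf: "square_integrable lborel (conv \<nu> f)" by (rule conv_square_integrable[OF \<nu> f])
  have H: "finite_measure \<nu>" "sigma_finite_measure M" "(\<lambda>(v, \<omega>). X (t - v) \<omega>) \<in> borel_measurable (\<nu> \<Otimes>\<^sub>M M)"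
    "\<And>v. v \<in> space \<nu> \<Longrightarrow> square_integrable M (X (t - v))" "\<And>v. v \<in> space \<nu> \<Longrightarrow> L2norm M (X (t - v)) \<le> L2norm lborel f"
    "0 \<le> L2norm lborel f" for t
    using \<nu> sigma_finite_measure_axioms measurable_process_reflect(1)[OF moving_averageD(1)[OF X] \<nu>(2)] moving_averageD[OF X]
    by auto
  show "AE \<omega> in M. integrable \<nu> (\<lambda>v. X (t - v) \<omega>)"
    by (rule L2_average_AE_integrable[OF H])
  have "has_levy_integral M L (\<lambda>u. conv \<nu> f (t - u)) (\<lambda>\<omega>. conv \<nu> (\<lambda>s. X s \<omega>) t)" for t
  proof -
    define Z where "Z \<omega> = (\<integral>v. X (t - v) \<omega> \<partial>\<nu>)" for \<omega>
    have Z: "square_integrable M Z" unfolding Z_def by (rule L2_average_square_integrable[OF H])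
    obtain W where W: "has_levy_integral M L (\<lambda>u. conv \<nu> f (t - u)) W"
      using has_levy_integral_exists[OF square_integrable_shift(2)[OF sf]] .
    note sW = has_levy_integral_square_integrable(2)[OF W]
    have sD: "square_integrable M (\<lambda>\<omega>. Z \<omega> - W \<omega>)" by (intro square_integrable_diff Z sW)
    have fm: "f \<in> borel_measurable borel" using square_integrable_measurable[OF f] by simp
    have K: "(\<lambda>(v, u). f (t - u - v)) \<in> borel_measurable (\<nu> \<Otimes>\<^sub>M lborel)"
    proof -
      have "(\<lambda>(v, u). f (t - u - v)) \<in> borel_measurable (borel \<Otimes>\<^sub>M borel)" using fm by measurable
      moreover have "sets (\<nu> \<Otimes>\<^sub>M lborel) = sets (borel \<Otimes>\<^sub>M borel)"
        by (intro sets_pair_measure_cong) (auto simp: \<nu>)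
      ultimately show ?thesis by (subst measurable_cong_sets[OF _ refl])
    qed
    have sh: "(\<lambda>u. f (t - u - v)) = (\<lambda>u. f (t - v - u))" for v by (simp add: algebra_simps)
    have orth: "expectation (\<lambda>\<omega>. (Z \<omega> - W \<omega>) * V \<omega>) = 0" if V: "has_levy_integral M L h V" for h V
    proof -
      note s = has_levy_integral_square_integrable[OF V]
      have "expectation (\<lambda>\<omega>. Z \<omega> * V \<omega>) = (\<integral>v. expectation (\<lambda>\<omega>. X (t - v) \<omega> * V \<omega>) \<partial>\<nu>)"
        unfolding Z_def by (rule L2_average_inner[OF H s(2)])
      also have "\<dots> = (\<integral>v. (\<integral>u. f (t - u - v) * h u \<partial>lborel) \<partial>\<nu>)"
        using has_levy_integral_inner[OF moving_averageD(3)[OF X] V]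
        by (intro Bochner_Integration.integral_cong refl) (simp add: algebra_simps)
      also have "\<dots> = (\<integral>u. (\<integral>v. f (t - u - v) \<partial>\<nu>) * h u \<partial>lborel)"
      proof (rule L2_average_inner[OF \<nu>(1) lborel.sigma_finite_measure_axioms K _ _ L2norm_nonneg[of lborel f] s(1), symmetric])
        show "square_integrable lborel (\<lambda>u. f (t - u - v))" for v
          unfolding sh by (rule square_integrable_shift(2)[OF f])
        show "L2norm lborel (\<lambda>u. f (t - u - v)) \<le> L2norm lborel f" for v
          unfolding sh L2norm_shift(2) ..
      qed
      also have "\<dots> = expectation (\<lambda>\<omega>. W \<omega> * V \<omega>)"
        using has_levy_integral_inner[OF W V] by (simp add: conv_def)
      finally show ?thesis
        using square_integrable_mult[OF Z s(2)] square_integrable_mult[OF sW s(2)] by (simp add: left_diff_distrib)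
    qed
    \<comment> \<open>\<open>Z\<close> is not yet known to be a Levy integral, but it is an average
      of the Levy integrals \<open>X (t - v)\<close>, each of which is orthogonal to the
      difference.\<close>
    have "expectation (\<lambda>\<omega>. Z \<omega> * (Z \<omega> - W \<omega>)) = (\<integral>v. expectation (\<lambda>\<omega>. X (t - v) \<omega> * (Z \<omega> - W \<omega>)) \<partial>\<nu>)"
      unfolding Z_def by (rule L2_average_inner[OF H sD[unfolded Z_def]])
    also have "\<dots> = 0"
    proof -
      have "expectation (\<lambda>\<omega>. X (t - v) \<omega> * (Z \<omega> - W \<omega>)) = 0" for v
        using orth[OF moving_averageD(3)[OF X, of "t - v"]] by (simp only: mult.commute)
      then show ?thesis by simp
    qed
    finally have 1: "expectation (\<lambda>\<omega>. Z \<omega> * (Z \<omega> - W \<omega>)) = 0" .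
    have 2: "expectation (\<lambda>\<omega>. W \<omega> * (Z \<omega> - W \<omega>)) = 0" using orth[OF W] by (simp add: mult.commute)
    have "(L2norm M (\<lambda>\<omega>. Z \<omega> - W \<omega>))\<^sup>2 = expectation (\<lambda>\<omega>. Z \<omega> * (Z \<omega> - W \<omega>) - W \<omega> * (Z \<omega> - W \<omega>))"
      unfolding L2norm_power2 by (intro Bochner_Integration.integral_cong refl) (simp add: power2_eq_square algebra_simps)
    also have "\<dots> = 0"
      using square_integrable_mult[OF Z sD] square_integrable_mult[OF sW sD] 1 2
      by (subst Bochner_Integration.integral_diff) auto
    finally have "L2norm M (\<lambda>\<omega>. Z \<omega> - W \<omega>) = 0" by simp
    then have "AE \<omega> in M. Z \<omega> - W \<omega> = 0" by (subst (asm) L2norm_eq_0_iff[OF sD])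
    then have "AE \<omega> in M. Z \<omega> = W \<omega>" by (rule eventually_mono) simp
    then have "has_levy_integral M L (\<lambda>u. conv \<nu> f (t - u)) Z"
      using square_integrable_measurable[OF Z] square_integrable_measurable[OF square_integrable_shift(2)[OF sf]]
      by (intro has_levy_integral_cong_AE[OF W]) auto
    then show ?thesis by (simp add: Z_def[abs_def] conv_def)
  qed
  then show "moving_average (conv \<nu> f) (\<lambda>t \<omega>. conv \<nu> (\<lambda>s. X s \<omega>) t)"
    using measurable_process_conv[OF moving_averageD(1)[OF X] \<nu>] sf by (simp add: moving_average_def)
qed

text \<open>Integrability is known at each time outside a null set depending on that time. Tonelli's
  theorem exchanges the quantifiers; expressing integrability as a finite nonnegative integral makes
  the exceptional set of pairs measurable.\<close>

lemma moving_average_AE_AE_integrable: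
  assumes X: "moving_average f X" and \<nu>: "finite_measure \<nu>" "sets \<nu> = sets borel"
  shows "AE \<omega> in M. AE u in lborel. integrable \<nu> (\<lambda>v. X (u - v) \<omega>)"
proof -
  interpret N: finite_measure \<nu> by (rule \<nu>)
  interpret P: pair_sigma_finite M lborel
    by (intro pair_sigma_finite.intro sigma_finite_measure_axioms lborel.sigma_finite_measure_axioms)
  let ?I = "\<lambda>\<omega> u. (\<integral>\<^sup>+v. ennreal (norm (X (u - v) \<omega>)) \<partial>\<nu>)"
  have "(\<lambda>(p, v). X (fst p - v) (snd p)) \<in> borel_measurable ((borel \<Otimes>\<^sub>M M) \<Otimes>\<^sub>M \<nu>)"
    by (rule measurable_process_reflect(3)[OF moving_averageD(1)[OF X] \<nu>(2)])
  then have [measurable]: "(\<lambda>p. X (fst (fst p) - snd p) (snd (fst p))) \<in> borel_measurable ((borel \<Otimes>\<^sub>M M) \<Otimes>\<^sub>M \<nu>)"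
    by (simp add: split_beta')
  have m1: "(\<lambda>p. ?I (snd p) (fst p)) \<in> borel_measurable (borel \<Otimes>\<^sub>M M)" by measurable
  have sw: "(\<lambda>p. (snd p, fst p)) \<in> measurable (M \<Otimes>\<^sub>M lborel) (borel \<Otimes>\<^sub>M M)" by measurable
  have [measurable]: "(\<lambda>p. ?I (fst p) (snd p)) \<in> borel_measurable (M \<Otimes>\<^sub>M lborel)"
    using measurable_compose[OF sw m1] by simp
  have "{p \<in> space (M \<Otimes>\<^sub>M lborel). ?I (fst p) (snd p) < \<infinity>} \<in> sets (M \<Otimes>\<^sub>M lborel)" by measurable
  note com = P.AE_commute[OF this]
  have "AE u in lborel. AE \<omega> in M. ?I \<omega> u < \<infinity>"
  proof (rule AE_I2)
    fix u show "AE \<omega> in M. ?I \<omega> u < \<infinity>"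
      using moving_average_conv(2)[OF X \<nu>, of u] by (rule eventually_mono) (simp add: integrable_iff_bounded)
  qed
  then have "AE \<omega> in M. AE u in lborel. ?I \<omega> u < \<infinity>" using com by simp
  then show ?thesis using AE_space
  proof eventually_elim
    case (elim \<omega>)
    have "(\<lambda>t. X t \<omega>) \<in> borel_measurable borel"
      by (rule measurable_process_path[OF moving_averageD(1)[OF X] elim(2)])
    then have "(\<lambda>v. X (u - v) \<omega>) \<in> borel_measurable borel" for u by measurable
    then have m: "(\<lambda>v. X (u - v) \<omega>) \<in> borel_measurable \<nu>" for u by (subst measurable_cong_sets[OF \<nu>(2) refl])
    show ?case using elim(1) by (rule eventually_mono) (simp add: integrable_iff_bounded m)
  qed
qed

lemma moving_average_sconv:
  assumes "moving_average f X" "finite_signed_measure half_line \<eta>"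
  shows "moving_average (sconv \<eta> f) (\<lambda>t \<omega>. sconv \<eta> (\<lambda>s. X s \<omega>) t)"
  unfolding sconv_def[abs_def]
  by (intro moving_average_diff moving_average_conv(1)[OF assms(1)] finite_measure_jordan[OF assms(2)]) simp_all

lemma moving_average_frac_diff:
  assumes "moving_average f X" "0 < \<beta>" "\<beta> < 1" "0 < \<delta>"
  shows "moving_average (frac_diff \<beta> \<delta> f) (\<lambda>t \<omega>. frac_diff \<beta> \<delta> (\<lambda>s. X s \<omega>) t)"
  unfolding frac_diff_def[abs_def]
  by (intro moving_average_cmult moving_average_diff moving_average_conv(1)[OF assms(1)] finite_measure_frac_dens assms) simp_all

end

section \<open>The fractional derivative of the moving average\<close>

locale sfdde_solution = orthogonal_increments M L + sfdde_filter \<beta> \<eta> g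
  for M :: "'w measure" and L :: "real \<Rightarrow> 'w \<Rightarrow> real" and \<beta> \<eta> g +
  fixes X :: "real \<Rightarrow> 'w \<Rightarrow> real"
  assumes X: "moving_average g X"
begin

abbreviation "fX \<delta> t \<omega> \<equiv> frac_diff \<beta> \<delta> (\<lambda>s. X s \<omega>) t"
abbreviation "trX \<delta> t \<omega> \<equiv> marchaud_truncated \<beta> (\<lambda>s. X s \<omega>) t \<delta>"

lemma fX: "0 < \<delta> \<Longrightarrow> moving_average (frac_diff \<beta> \<delta> g) (fX \<delta>)"
  by (rule moving_average_frac_diff[OF X \<beta>(1) \<beta>1])

lemma truncated_AE:
  assumes \<delta>: "0 < \<delta>"
  shows "AE \<omega> in M. set_integrable lborel {\<delta><..} (marchaud_integrand \<beta> (\<lambda>s. X s \<omega>) t) \<and> trX \<delta> t \<omega> = fX \<delta> t \<omega>"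
  using moving_average_conv(2)[OF X finite_measure_frac_dens[OF \<beta>(1) \<beta>1 \<delta>] sets_frac_dens, of t] AE_space
proof eventually_elim
  case (elim \<omega>)
  show ?case
    using marchaud_truncated_eq[OF \<beta>(1) \<beta>1 \<delta> measurable_process_path[OF moving_averageD(1)[OF X] elim(2)] elim(1)] by simp
qed

text \<open>The pathwise integrals coincide with \<open>fX \<delta> t\<close> only almost surely, so
  their measurability, which L2 convergence presupposes, needs its own argument.\<close>

lemma truncated_measurable: "trX \<delta> t \<in> borel_measurable M"
proof -
  have "(\<lambda>(\<omega>, v). X (t - v) \<omega>) \<in> borel_measurable (M \<Otimes>\<^sub>M lborel)"
    by (rule measurable_process_reflect(2)[OF moving_averageD(1)[OF X]]) simp
  then have [measurable]: "(\<lambda>p. X (t - snd p) (fst p)) \<in> borel_measurable (M \<Otimes>\<^sub>M lborel)" by (simp add: split_beta')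
  note [measurable] = square_integrable_measurable[OF moving_averageD(4)[OF X]]
  show ?thesis
    unfolding marchaud_truncated_def set_lebesgue_integral_def marchaud_integrand_def by measurable
qed

text \<open>The null set on which pathwise truncation and \<open>fX\<close> differ depends on
  \<open>\<delta>\<close>. This is harmless, because the limit is taken in L2 and involves norms
  only.\<close>

lemma has_marchaud_derivative_L2_iff:
  "has_marchaud_derivative_L2 M \<beta> X t Z \<longleftrightarrow> L2_tendsto M (\<lambda>\<delta>. fX \<delta> t) Z (at_right 0)"
proof -
  have pos: "\<forall>\<^sub>F \<delta> in at_right 0. 0 < (\<delta>::real)" by (rule eventually_at_right_less)
  have m: "fX \<delta> t \<in> borel_measurable M" if "0 < \<delta>" for \<delta>
    by (rule square_integrable_measurable[OF moving_averageD(4)[OF fX[OF that]]])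
  have ae: "AE \<omega> in M. trX \<delta> t \<omega> = fX \<delta> t \<omega>" if "0 < \<delta>" for \<delta>
    using truncated_AE[OF that, of t] by (rule eventually_mono) simp
  have sq: "square_integrable M (trX \<delta> t)" "square_integrable M (fX \<delta> t)" if "0 < \<delta>" for \<delta>
    using moving_averageD(4)[OF fX[OF that], of t] square_integrable_cong_AE[OF _ truncated_measurable ae[OF that]] by auto
  have nrm: "L2norm M (\<lambda>\<omega>. trX \<delta> t \<omega> - Z \<omega>) = L2norm M (\<lambda>\<omega>. fX \<delta> t \<omega> - Z \<omega>)"
    if "0 < \<delta>" "square_integrable M Z" for \<delta>
  proof (rule L2norm_cong_AE)
    note [measurable] = truncated_measurable m[OF that(1)] square_integrable_measurable[OF that(2)]
    show "(\<lambda>\<omega>. trX \<delta> t \<omega> - Z \<omega>) \<in> borel_measurable M" "(\<lambda>\<omega>. fX \<delta> t \<omega> - Z \<omega>) \<in> borel_measurable M" by measurable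
    show "AE \<omega> in M. trX \<delta> t \<omega> - Z \<omega> = fX \<delta> t \<omega> - Z \<omega>" using ae[OF that(1)] by (rule eventually_mono) simp
  qed
  have sqi: "\<forall>\<^sub>F \<delta> in at_right 0. square_integrable M (trX \<delta> t)" "\<forall>\<^sub>F \<delta> in at_right 0. square_integrable M (fX \<delta> t)"
    by (rule eventually_mono[OF pos], rule sq, assumption)+
  have "((\<lambda>\<delta>. L2norm M (\<lambda>\<omega>. trX \<delta> t \<omega> - Z \<omega>)) \<longlongrightarrow> 0) (at_right 0) \<longleftrightarrow> ((\<lambda>\<delta>. L2norm M (\<lambda>\<omega>. fX \<delta> t \<omega> - Z \<omega>)) \<longlongrightarrow> 0) (at_right 0)"
    if "square_integrable M Z"
    by (rule tendsto_cong, rule eventually_mono[OF pos], rule nrm[OF _ that])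
  moreover have "\<forall>\<delta>>0. AE \<omega> in M. set_integrable lborel {\<delta><..} (marchaud_integrand \<beta> (\<lambda>s. X s \<omega>) t)"
    using truncated_AE[of _ t] by (auto elim!: eventually_mono)
  ultimately show ?thesis
    unfolding has_marchaud_derivative_L2_def L2_tendsto_iff using sqi by blast
qed

text \<open>By the isometry the distance of \<open>fX \<delta> t\<close> to a moving average with
  kernel \<open>mderiv\<close> is the distance of the truncated derivative of \<open>g\<close> to
  \<open>mderiv\<close>, whatever \<open>t\<close> is. In the other direction Levy integrals are
  stable under simultaneous limits of kernel and value. Thus every admissible version of the
  derivative is a moving average with kernel \<open>mderiv\<close>.\<close>

lemma marchaud_process_iff:
  assumes "measurable_process M Y"
  shows "is_marchaud_process M \<beta> X Y \<longleftrightarrow> moving_average mderiv Y"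
proof
  assume "is_marchaud_process M \<beta> X Y"
  then have lim: "L2_tendsto M (\<lambda>\<delta>. fX \<delta> t) (Y t) (at_right 0)" for t
    by (simp add: is_marchaud_process_def has_marchaud_derivative_L2_iff)
  define \<delta> where "\<delta> n = 1 / (real n + 1)" for n
  have \<delta>: "0 < \<delta> n" for n by (simp add: \<delta>_def)
  have \<delta>r: "filterlim \<delta> (at_right 0) sequentially" unfolding \<delta>_def by real_asymp
  have "has_levy_integral M L (\<lambda>u. mderiv (t - u)) (Y t)" for t
  proof (rule has_levy_integral_limit)
    show "has_levy_integral M L (\<lambda>u. frac_diff \<beta> (\<delta> n) g (t - u)) (fX (\<delta> n) t)" for n
      by (rule moving_averageD(3)[OF fX[OF \<delta>]])
    have s: "square_integrable lborel (frac_diff \<beta> (\<delta> n) g)" for n by (rule moving_averageD(2)[OF fX[OF \<delta>]])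
    have "L2_tendsto lborel (\<lambda>n. frac_diff \<beta> (\<delta> n) g) mderiv sequentially"
      unfolding L2_tendsto_iff using s mderiv filterlim_compose[OF frac_diff_tendsto_mderiv \<delta>r] by simp
    then show "L2_tendsto lborel (\<lambda>n u. frac_diff \<beta> (\<delta> n) g (t - u)) (\<lambda>u. mderiv (t - u)) sequentially"
      by (rule L2_tendsto_shift)
    show "L2_tendsto M (\<lambda>n. fX (\<delta> n) t) (Y t) sequentially"
      using lim[of t] moving_averageD(4)[OF fX[OF \<delta>]] filterlim_compose[OF _ \<delta>r, of "\<lambda>\<delta>. L2norm M (\<lambda>\<omega>. fX \<delta> t \<omega> - Y t \<omega>)"]
      unfolding L2_tendsto_iff by auto
  qed
  then show "moving_average mderiv Y" using assms mderiv by (simp add: moving_average_def)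
next
  assume Y: "moving_average mderiv Y"
  have "L2_tendsto M (\<lambda>\<delta>. fX \<delta> t) (Y t) (at_right 0)" for t
    unfolding L2_tendsto_iff
  proof (intro conjI)
    have pos: "\<forall>\<^sub>F \<delta> in at_right 0. 0 < (\<delta>::real)" by (rule eventually_at_right_less)
    show "square_integrable M (Y t)" by (rule moving_averageD(4)[OF Y])
    show "\<forall>\<^sub>F \<delta> in at_right 0. square_integrable M (fX \<delta> t)"
      using pos by (rule eventually_mono) (rule moving_averageD(4)[OF fX])
    have "\<forall>\<^sub>F \<delta> in at_right 0. L2norm M (\<lambda>\<omega>. fX \<delta> t \<omega> - Y t \<omega>) = L2norm lborel (\<lambda>u. frac_diff \<beta> \<delta> g u - mderiv u)"
      using pos by (rule eventually_mono) (rule moving_averageD(5)[OF moving_average_diff[OF fX Y]])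
    then show "((\<lambda>\<delta>. L2norm M (\<lambda>\<omega>. fX \<delta> t \<omega> - Y t \<omega>)) \<longlongrightarrow> 0) (at_right 0)"
      using frac_diff_tendsto_mderiv by (subst tendsto_cong)
  qed
  then show "is_marchaud_process M \<beta> X Y"
    using assms by (simp add: is_marchaud_process_def has_marchaud_derivative_L2_iff)
qed

text \<open>A jointly measurable version arises as the pathwise limit along one fast sequence \<open>\<delta>\<close> that works for all \<open>t\<close>, as
  the \<open>L\<^sup>2\<close> distances do not depend on \<open>t\<close>.\<close>

lemma marchaud_process_exists: "\<exists>Y. is_marchaud_process M \<beta> X Y"
proof -
  define \<delta> where "\<delta> n = 1 / (real n + 1)" for n
  have \<delta>: "0 < \<delta> n" for n by (simp add: \<delta>_def)
  have \<delta>r: "filterlim \<delta> (at_right 0) sequentially" unfolding \<delta>_def by real_asymp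
  have s: "square_integrable lborel (frac_diff \<beta> (\<delta> n) g)" for n by (rule moving_averageD(2)[OF fX[OF \<delta>]])
  have gl: "L2_tendsto lborel (\<lambda>n. frac_diff \<beta> (\<delta> n) g) mderiv sequentially"
    unfolding L2_tendsto_iff using s mderiv filterlim_compose[OF frac_diff_tendsto_mderiv \<delta>r] by simp
  note C = L2_tendsto_Cauchy[OF gl _ s]
  obtain r where r: "strict_mono r"
    "\<And>n. L2norm lborel (\<lambda>t. frac_diff \<beta> (\<delta> (r (Suc n))) g t - frac_diff \<beta> (\<delta> (r n)) g t) \<le> (1 / 2) ^ n"
    using fast_Cauchy_subsequence[of "\<lambda>m n. L2norm lborel (\<lambda>t. frac_diff \<beta> (\<delta> m) g t - frac_diff \<beta> (\<delta> n) g t)", OF C] by blast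
  have d: "L2norm M (\<lambda>\<omega>. fX (\<delta> m) t \<omega> - fX (\<delta> n) t \<omega>)
      = L2norm lborel (\<lambda>t. frac_diff \<beta> (\<delta> m) g t - frac_diff \<beta> (\<delta> n) g t)" for m n t
    by (rule moving_averageD(5)[OF moving_average_diff[OF fX[OF \<delta>] fX[OF \<delta>]]])
  note sX = moving_averageD(4)[OF fX[OF \<delta>]]
  define Y where "Y t \<omega> = lim (\<lambda>n. fX (\<delta> (r n)) t \<omega>)" for t \<omega>
  have mY: "measurable_process M Y"
  proof -
    have [measurable]: "(\<lambda>p. fX (\<delta> n) (fst p) (snd p)) \<in> borel_measurable (borel \<Otimes>\<^sub>M M)" for n
      using moving_averageD(1)[OF fX[OF \<delta>[of n]]] by (simp add: measurable_process_def split_beta')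
    show ?thesis unfolding measurable_process_def Y_def split_beta' by measurable
  qed
  have "moving_average mderiv Y"
  proof -
    have "has_levy_integral M L (\<lambda>u. mderiv (t - u)) (Y t)" for t
    proof (rule has_levy_integral_limit)
      show "has_levy_integral M L (\<lambda>u. frac_diff \<beta> (\<delta> n) g (t - u)) (fX (\<delta> n) t)" for n
        by (rule moving_averageD(3)[OF fX[OF \<delta>]])
      show "L2_tendsto lborel (\<lambda>n u. frac_diff \<beta> (\<delta> n) g (t - u)) (\<lambda>u. mderiv (t - u)) sequentially"
        by (rule L2_tendsto_shift[OF gl])
      show "L2_tendsto M (\<lambda>n. fX (\<delta> n) t) (Y t) sequentially"
      proof (rule L2_limit_of_AE_limit[OF sX _ _ r(1)])
        show "Y t \<in> borel_measurable M" by (rule measurable_process_time[OF mY])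
        have "AE \<omega> in M. convergent (\<lambda>n. fX (\<delta> (r n)) t \<omega>)"
          by (rule L2_fast_Cauchy_converges_AE) (use sX r(2) in \<open>simp_all add: d\<close>)
        then show "AE \<omega> in M. (\<lambda>n. fX (\<delta> (r n)) t \<omega>) \<longlonglongrightarrow> Y t \<omega>"
          by (rule eventually_mono) (simp add: Y_def convergent_LIMSEQ_iff)
        show "\<exists>N. \<forall>m\<ge>N. \<forall>n\<ge>N. L2norm M (\<lambda>\<omega>. fX (\<delta> m) t \<omega> - fX (\<delta> n) t \<omega>) \<le> e" if "0 < e" for e
          unfolding d by (rule C[OF that])
      qed
    qed
    then show ?thesis using mY mderiv by (simp add: moving_average_def)
  qed
  then show ?thesis using marchaud_process_iff[OF mY] by blast
qed

text \<open>At the fixed time \<open>t\<close> both sides are values of moving averages: the kernel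
  on the left convolves the delayed \<open>X\<close> with \<open>frac_step\<close>, that on the
  right the delayed \<open>Y\<close> with the indicator of \<open>[0,a]\<close>.
  \<open>kernel_identity\<close> makes the two kernels equal, and the rest is the substitution
  \<open>v = t - u\<close> along each path.\<close>

lemma marchaud_process_identity:
  assumes Y: "moving_average mderiv Y" and st: "s < t"
  shows "AE \<omega> in M.
    (AE u in lborel. signed_integrable half_line \<eta> (\<lambda>v. X (u - v) \<omega>)) \<and>
    (AE u in lborel. signed_integrable half_line \<eta> (\<lambda>v. Y (u - v) \<omega>)) \<and>
    set_integrable lborel {..t} (\<lambda>u. frac_kernel \<beta> s t u * delay \<eta> (\<lambda>r. X r \<omega>) u) \<and>
    set_integrable lborel {s..t} (delay \<eta> (\<lambda>r. Y r \<omega>)) \<and>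
    1 / Gamma (1 - \<beta>) * (LINT u:{..t}|lborel. frac_kernel \<beta> s t u * delay \<eta> (\<lambda>r. X r \<omega>) u)
      = (LINT u:{s..t}|lborel. delay \<eta> (\<lambda>r. Y r \<omega>) u)"
proof -
  define a where "a = t - s"
  have a: "0 < a" using st by (simp add: a_def)
  let ?c = "frac_step \<beta> a"
  let ?wp = "\<lambda>v. max 0 (?c v)" and ?wn = "\<lambda>v. max 0 (- ?c v)"
  have wi: "integrable lborel ?wp" "integrable lborel ?wn" using frac_step_integrable[OF \<beta>(1) \<beta>1 a] by auto
  have wn: "0 \<le> ?wp v" "0 \<le> ?wn v" for v by auto
  note fp = finite_measure_dens[OF wi(1) wn(1)] and fn = finite_measure_dens[OF wi(2) wn(2)]
  note fi = finite_measure_ind_dens[of a]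
  have SX: "moving_average (sconv \<eta> g) (\<lambda>t \<omega>. sconv \<eta> (\<lambda>s. X s \<omega>) t)" by (rule moving_average_sconv[OF X \<eta>])
  have SY: "moving_average (sconv \<eta> mderiv) (\<lambda>t \<omega>. sconv \<eta> (\<lambda>s. Y s \<omega>) t)" by (rule moving_average_sconv[OF Y \<eta>])
  have eq: "AE \<omega> in M. conv (dens ?wp) (sconv \<eta> (\<lambda>s. X s \<omega>)) t - conv (dens ?wn) (sconv \<eta> (\<lambda>s. X s \<omega>)) t
      = Gamma (1 - \<beta>) * conv (ind_dens a) (sconv \<eta> (\<lambda>s. Y s \<omega>)) t"
    by (rule moving_average_unique[OF
          moving_average_diff[OF moving_average_conv(1)[OF SX fp sets_dens] moving_average_conv(1)[OF SX fn sets_dens]]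
          moving_average_cmult[OF moving_average_conv(1)[OF SY fi sets_ind_dens]] kernel_identity[OF a]])
  note jf = finite_measure_jordan[OF \<eta>]
  show ?thesis
    using eq moving_average_conv(2)[OF SX fp sets_dens, of t] moving_average_conv(2)[OF SX fn sets_dens, of t]
      moving_average_conv(2)[OF SY fi sets_ind_dens, of t]
      moving_average_AE_AE_integrable[OF X jf(1) sets_jordan_measures(1)] moving_average_AE_AE_integrable[OF X jf(2) sets_jordan_measures(2)]
      moving_average_AE_AE_integrable[OF Y jf(1) sets_jordan_measures(1)] moving_average_AE_AE_integrable[OF Y jf(2) sets_jordan_measures(2)]
      AE_space
  proof eventually_elim
    case (elim \<omega>)
    have xm[measurable]: "(\<lambda>s. X s \<omega>) \<in> borel_measurable borel" and ym[measurable]: "(\<lambda>s. Y s \<omega>) \<in> borel_measurable borel"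
      using measurable_process_path[OF moving_averageD(1)[OF X] elim(9)] measurable_process_path[OF moving_averageD(1)[OF Y] elim(9)] by auto
    define x where "x = sconv \<eta> (\<lambda>s. X s \<omega>)"
    define y where "y = sconv \<eta> (\<lambda>s. Y s \<omega>)"
    have x[measurable]: "x \<in> borel_measurable borel" and y[measurable]: "y \<in> borel_measurable borel"
      unfolding x_def y_def
      using measurable_process_path[OF moving_averageD(1)[OF SX] elim(9)] measurable_process_path[OF moving_averageD(1)[OF SY] elim(9)]
      by simp_all
    have dx: "delay \<eta> (\<lambda>r. X r \<omega>) = x" unfolding x_def by (rule ext) (rule delay_eq_sconv[OF xm])
    have dy: "delay \<eta> (\<lambda>r. Y r \<omega>) = y" unfolding y_def by (rule ext) (rule delay_eq_sconv[OF ym])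
    have ip: "integrable lborel (\<lambda>v. ?wp v *\<^sub>R x (t - v))"
      using elim(2) unfolding x_def[symmetric] by (subst (asm) integrable_dens[OF wi(1) wn(1)]) simp_all
    have im: "integrable lborel (\<lambda>v. ?wn v *\<^sub>R x (t - v))"
      using elim(3) unfolding x_def[symmetric] by (subst (asm) integrable_dens[OF wi(2) wn(2)]) simp_all
    have iy: "integrable lborel (\<lambda>v. indicator {0..a} v *\<^sub>R y (t - v))"
      using elim(4) unfolding y_def[symmetric] ind_dens_def
      by (subst (asm) integrable_dens[OF integrable_indicator_Icc]) simp_all
    have split: "?wp v *\<^sub>R x (t - v) - ?wn v *\<^sub>R x (t - v) = ?c v * x (t - v)" for v
      by (simp add: max_def)
    have ic: "integrable lborel (\<lambda>v. ?c v * x (t - v))"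
      using Bochner_Integration.integrable_diff[OF ip im] unfolding split .
    have cc: "(\<integral>v. ?c v * x (t - v) \<partial>lborel) = conv (dens ?wp) x t - conv (dens ?wn) x t"
      unfolding conv_dens[OF wi(1) wn(1) x] conv_dens[OF wi(2) wn(2) x] Bochner_Integration.integral_diff[OF ip im, symmetric] split ..
    have ker: "indicator {..t} u *\<^sub>R (frac_kernel \<beta> s t u * x u) = ?c (t + -1 * u) * x (t - (t + -1 * u))" for u
      using st by (cases "u \<le> t") (simp_all add: frac_kernel_def frac_step_def a_def max_def)
    have I1: "integrable lborel (\<lambda>u. indicator {..t} u *\<^sub>R (frac_kernel \<beta> s t u * x u))"
      unfolding ker by (rule lborel_integrable_real_affine[OF ic]) simp
    have V1: "(\<integral>u. indicator {..t} u *\<^sub>R (frac_kernel \<beta> s t u * x u) \<partial>lborel) = conv (dens ?wp) x t - conv (dens ?wn) x t"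
      unfolding ker cc[symmetric] by (subst (2) lborel_integral_real_affine[of "-1" _ t]) simp_all
    have ind: "indicator {s..t} u *\<^sub>R y u = indicator {0..a} (t + -1 * u) *\<^sub>R y (t - (t + -1 * u))" for u
      by (auto simp: indicator_def a_def)
    have I2: "integrable lborel (\<lambda>u. indicator {s..t} u *\<^sub>R y u)"
      unfolding ind by (rule lborel_integrable_real_affine[OF iy]) simp
    have V2: "(\<integral>u. indicator {s..t} u *\<^sub>R y u \<partial>lborel) = conv (ind_dens a) y t"
      unfolding ind ind_dens_def
      by (subst conv_dens[OF integrable_indicator_Icc], simp, simp, subst (2) lborel_integral_real_affine[of "-1" _ t]) simp_all
    have G: "Gamma (1 - \<beta>) \<noteq> 0"
    proof -
      have "0 < Gamma (1 - \<beta>)" by (rule Gamma_real_pos) (use \<beta>1 in simp)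
      then show ?thesis by linarith
    qed
    have val: "1 / Gamma (1 - \<beta>) * (conv (dens ?wp) x t - conv (dens ?wn) x t) = conv (ind_dens a) y t"
    proof -
      have "1 / c * (c * z) = z" if "c \<noteq> 0" for c z :: real using that by simp
      from this[OF G] show ?thesis using elim(1) unfolding x_def[symmetric] y_def[symmetric] by simp
    qed
    have sx: "(\<lambda>v. X (u - v) \<omega>) \<in> borel_measurable borel" "(\<lambda>v. Y (u - v) \<omega>) \<in> borel_measurable borel" for u
      by measurable
    have A1: "AE u in lborel. signed_integrable half_line \<eta> (\<lambda>v. X (u - v) \<omega>)"
      using elim(5,6) by eventually_elim (simp add: signed_integrable_jordan[OF sx(1)])
    have A2: "AE u in lborel. signed_integrable half_line \<eta> (\<lambda>v. Y (u - v) \<omega>)"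
      using elim(7,8) by eventually_elim (simp add: signed_integrable_jordan[OF sx(2)])
    show ?case
      unfolding dx dy set_integrable_def set_lebesgue_integral_def V1 V2
      using A1 A2 I1 I2 val by blast
  qed
qed

end

text \<open>The integrability clauses prevent an identity between default values 0 of Bochner
  integrals, and the first conjunct prevents \<open>marchaud_derivative\<close> from being its
  default value on a set of positive times with positive measure. All jointly measurable versions of
  the derivative are covered, and the existence clause shows that there are some.\<close>

theorem proposition3p6:
  fixes M :: "'w measure" and L X :: "real \<Rightarrow> 'w \<Rightarrow> real"
    and \<beta> :: real and \<eta> :: "real set \<Rightarrow> real" and g :: "real \<Rightarrow> real"
  assumes "prob_space M"
    and "0 < \<beta>" and "\<beta> < 1 / 2"
    and "two_sided_levy_process M L"
    and "integrable M (L 1)" and "(\<integral>\<omega>. L 1 \<omega> \<partial>M) = 0"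
    and "integrable M (\<lambda>\<omega>. (L 1 \<omega>)\<^sup>2)" and "(\<integral>\<omega>. (L 1 \<omega>)\<^sup>2 \<partial>M) = 1"
    and "finite_signed_measure half_line \<eta>"
    and "(\<integral>\<^sup>+u. ennreal u \<partial>variation half_line \<eta>) < \<infinity>"
    and "\<And>z. Re z \<le> 0 \<Longrightarrow> sfdde_h \<beta> \<eta> z \<noteq> 0"
    and "square_integrable lborel g"
    and "\<And>t. t < 0 \<Longrightarrow> g t = 0"
    and "has_fourier_L2 (\<lambda>t. complex_of_real (g t))
           (\<lambda>y. (- (\<i> * of_real y)) powr of_real (- \<beta>) / sfdde_h \<beta> \<eta> (\<i> * of_real y))"
    and "measurable_process M X"
    and "\<And>t. has_levy_integral M L (\<lambda>u. indicator {..t} u * g (t - u)) (X t)"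
  shows "(AE t in lborel. 0 < t \<longrightarrow> (\<exists>D. has_marchaud_derivative \<beta> g t D)) \<and>
    (\<exists>DX. is_marchaud_process M \<beta> X DX) \<and>
    (\<forall>DX. is_marchaud_process M \<beta> X DX \<longrightarrow>
      (\<forall>t. has_levy_integral M L
             (\<lambda>u. indicator {..t} u * marchaud_derivative \<beta> g (t - u)) (DX t)) \<and>
      (\<forall>s t. s < t \<longrightarrow>
        (AE \<omega> in M.
          (AE u in lborel. signed_integrable half_line \<eta> (\<lambda>v. X (u - v) \<omega>)) \<and>
          (AE u in lborel. signed_integrable half_line \<eta> (\<lambda>v. DX (u - v) \<omega>)) \<and>
          set_integrable lborel {..t} (\<lambda>u. frac_kernel \<beta> s t u * delay \<eta> (\<lambda>r. X r \<omega>) u) \<and>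
          set_integrable lborel {s..t} (delay \<eta> (\<lambda>r. DX r \<omega>)) \<and>
          1 / Gamma (1 - \<beta>) *
            (LINT u:{..t}|lborel. frac_kernel \<beta> s t u * delay \<eta> (\<lambda>r. X r \<omega>) u)
          = (LINT u:{s..t}|lborel. delay \<eta> (\<lambda>r. DX r \<omega>) u))))"
  proof -
  interpret orthogonal_increments M L
    by (rule two_sided_levy_orthogonal_increments) (rule assms)+
  interpret sfdde_filter \<beta> \<eta> g
    by unfold_locales (rule assms; assumption?)+
  have cut_g: "(\<lambda>u. indicator {..t} u * g (t - u)) = (\<lambda>u. g (t - u))" for t
    using g_neg by (auto simp: fun_eq_iff indicator_def)
  have cut_mderiv: "(\<lambda>u. indicator {..t} u * mderiv (t - u)) = (\<lambda>u. mderiv (t - u))" for t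
    by (auto simp: fun_eq_iff indicator_def marchaud_derivative_def)
  have "moving_average g X"
    using assms(15) assms(16)[unfolded cut_g] g by (simp add: moving_average_def)
  then interpret sfdde_solution M L \<beta> \<eta> g X
    by unfold_locales
  show ?thesis
  proof (intro conjI allI impI)
    show "AE t in lborel. 0 < t \<longrightarrow> (\<exists>D. has_marchaud_derivative \<beta> g t D)"
      by (rule marchaud_g_exists)
    show "\<exists>DX. is_marchaud_process M \<beta> X DX"
      by (rule marchaud_process_exists)
  next
    fix DX assume DX: "is_marchaud_process M \<beta> X DX"
    then have m: "measurable_process M DX" by (simp add: is_marchaud_process_def)
    have Y: "moving_average mderiv DX" using DX marchaud_process_iff[OF m] by blast
    show "has_levy_integral M L (\<lambda>u. indicator {..t} u * mderiv (t - u)) (DX t)" for t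
      unfolding cut_mderiv by (rule moving_averageD(3)[OF Y])
    show "AE \<omega> in M.
          (AE u in lborel. signed_integrable half_line \<eta> (\<lambda>v. X (u - v) \<omega>)) \<and>
          (AE u in lborel. signed_integrable half_line \<eta> (\<lambda>v. DX (u - v) \<omega>)) \<and>
          set_integrable lborel {..t} (\<lambda>u. frac_kernel \<beta> s t u * delay \<eta> (\<lambda>r. X r \<omega>) u) \<and>
          set_integrable lborel {s..t} (delay \<eta> (\<lambda>r. DX r \<omega>)) \<and>
          1 / Gamma (1 - \<beta>) *
            (LINT u:{..t}|lborel. frac_kernel \<beta> s t u * delay \<eta> (\<lambda>r. X r \<omega>) u)
          = (LINT u:{s..t}|lborel. delay \<eta> (\<lambda>r. DX r \<omega>) u)" if "s < t" for s t
      by (rule marchaud_process_identity[OF Y that])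
  qed
qed

end
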